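(* Let $x,y,z,w,k\in\mathbb{Z}_{\geq0}$, $a_1,\dots,a_{2k}\in\mathbb{Z}_{>0}$, $a_{2k+1}\in\mathbb{Z}_{\geq 0}$, with $z\geq w$; put $a_o=\sum_{i=0}^k a_{2i+1}$, $a_e=\sum_{i=1}^k a_{2i}$, $a=a_o+a_e$. Then: (1) With $X=[z-y]-\frac{2a+2x+2z+1}{2}$ if $y\le z$ and $X=[y-z]-\frac{2a+2x+2y+1}{2}$ if $z<y$; and $Y=[2a+2x+z+w]\setminus[2a+2x+y+z]-\frac{2a+2x+2z+1}{2}$ if $y<w$, $Y=[2a+2x+y+z]\setminus[2a+2x+z+w]-\frac{2a+2x+2z+1}{2}$ if $w\le y\le z$, $Y=[2a+2x+2y]\setminus[2a+2x+y+w]-\frac{2a+2x+2y+1}{2}$ if $z<y$: \[\frac{\operatorname{M}_{q}(A(x,y,z,w;a_1,\ldots,a_{2k+1}))}{\operatorname{M}_{q}(A(x,y,z,w;a))}\cdot \frac{\operatorname{wt}(F_{sym}(2a_{1},a_{2},\ldots,a_{2k+1}))}{\operatorname{wt}(F_{sym}(2a))}\] equals $\frac{\operatorname{M}_q(H'_{0,a_{e},a_{o}+y-1,z+w,x-y+z}(Q_{o},Q_{e}\cup X\cup Y))}{\operatorname{M}_q(H'_{a_{e},0,a_{o}+y-1,z+w,x-y+z}(Q_{o}\cup Q_{e},X\cup Y))}$ if $y<w$; $\frac{\operatorname{M}_q(H'_{0,a_{e},a_{o}+y-1,z+w,x-y+z}(Q_{o}\cup Y,Q_{e}\cup X))}{\operatorname{M}_q(H'_{a_{e},0,a_{o}+y-1,z+w,x-y+z}(Q_{o}\cup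 Q_{e}\cup Y,X))}$ if $w\le y\le z$; and $\frac{\operatorname{M}_q(H'_{0,a_{e},a_{o}+y-1,z+w,x}(Q_{o}\cup X\cup Y,Q_{e}))}{\operatorname{M}_q(H'_{a_{e},0,a_{o}+y-1,z+w,x}(Q_{o}\cup Q_{e}\cup X\cup Y,\varnothing))}$ if $z<y$. (2) With $X=[z-y]-(a+x+z)$ if $y\le z$, $X=[y-z]-(a+x+y)$ if $z<y$; and $Y=[2a+2x+z+w-1]\setminus[2a+2x+y+z-1]-(a+x+z)$ if $y<w$, $Y=[2a+2x+y+z-1]\setminus[2a+2x+z+w-1]-(a+x+z)$ if $w\le y\le z$, $Y=[2a+2x+2y-1]\setminus[2a+2x+y+w-1]-(a+x+y)$ if $z<y$: \[\frac{\operatorname{M}_{q}(B(x,y,z,w;a_1,\ldots,a_{2k+1}))}{\operatorname{M}_{q}(B(x,y,z,w;a))}\cdot\frac{\operatorname{wt}(F_{sym}(2a_{1}-1,a_{2},\ldots,a_{2k+1}))}{\operatorname{wt}(F_{sym}(2a-1))}\] equals $\frac{\operatorname{M}_q(H_{0,a_{e},a_{o}+y-1,z+w,x-y+z}(Q_{o},Q_{e}\cup X\cup Y))}{\operatorname{M}_q(H_{a_{e},0,a_{o}+y-1,z+w,x-y+z}(Q_{o}\cup Q_{e},X\cup Y))}$ if $y<w$; $\frac{\operatorname{M}_q(H_{0,a_{e},a_{o}+y-1,z+w,x-y+z}(Q_{o}\cup Y,Q_{e}\cup X))}{\operatorname{M}_q(H_{a_{e},0,a_{o}+y-1,z+w,x-y+z}(Q_{o}\cup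 Q_{e}\cup Y,X))}$ if $w\le y\le z$; and $\frac{\operatorname{M}_q(H_{0,a_{e},a_{o}+y-1,z+w,x}(Q_{o}\cup X\cup Y,Q_{e}))}{\operatorname{M}_q(H_{a_{e},0,a_{o}+y-1,z+w,x}(Q_{o}\cup Q_{e}\cup X\cup Y,\varnothing))}$ if $z<y$. (3) With $X,Y$ as in (2): \[\frac{\operatorname{M}_{q}(C(x,y,z,w;a_1,\ldots,a_{2k+1}))}{\operatorname{M}_{q}(C(x,y,z,w;a))}\cdot\frac{\operatorname{wt}(F_{sym}(2a_{1}-1,a_{2},\ldots,a_{2k+1}))}{\operatorname{wt}(F_{sym}(2a-1))}\] equals $\frac{\operatorname{M}_q(H_{0,a_{e},a_{o}+y-1,z+w+1,x-y+z}(Q_{o},Q_{e}\cup X\cup Y\cup\{0\}))}{\operatorname{M}_q(H_{a_{e},0,a_{o}+y-1,z+w+1,x-y+z}(Q_{o}\cup Q_{e},X\cup Y\cup\{0\}))}$ if $y<w$; $\frac{\operatorname{M}_q(H_{0,a_{e},a_{o}+y-1,z+w+1,x-y+z}(Q_{o}\cup Y,Q_{e}\cup X\cup\{0\}))}{\operatorname{M}_q(H_{a_{e},0,a_{o}+y-1,z+w+1,x-y+z}(Q_{o}\cup Q_{e}\cup Y, X\cup\{0\}))}$ if $w\le y\le z$; and $\frac{\operatorname{M}_q(H_{0,a_{e},a_{o}+y-1,z+w+1,x}(Q_{o}\cup X\cup Y,Q_{e}\cup\{0\}))}{\operatorname{M}_q(H_{a_{e},0,a_{o}+y-1,z+w+1,x}(Q_{o}\cup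 Q_{e}\cup X\cup Y,\{0\}))}$ if $z<y$. (4) With $X$ as in (1), and $Y=[2a+2x+z+w]\setminus[2a+2x+y+z]-\frac{2a+2x+2z+1}{2}$ if $y<w$, $Y=[2a+2x+y+z]\setminus[2a+2x+z+w]-\frac{2a+2x+2z+1}{2}$ if $w\le y\le z$, $Y=[2a+2x+2y]\setminus[2a+2x+y+w]-\frac{2a+2x+2y+1}{2}$ if $z<y$: \[\frac{\operatorname{M}_{q}(D(x,y,z,w;a_1,\ldots,a_{2k+1}))}{\operatorname{M}_{q}(A(x,y,z,w;a))}\cdot \frac{\operatorname{wt}(F_{sym}(2a_{1},a_{2},\ldots,a_{2k+1}))}{\operatorname{wt}(F_{sym}(2a))}\] equals $\frac{\operatorname{M}_q(H'_{0,a_{o},a_{e}+y-1,z+w,x-y+z}(Q_{e},Q_{o}\cup X\cup Y))}{\operatorname{M}_q(H'_{a_{o},0,a_{e}+y-1,z+w,x-y+z}(Q_{o}\cup Q_{e},X\cup Y))}$ if $y<w$; $\frac{\operatorname{M}_q(H'_{0,a_{o},a_{e}+y-1,z+w,x-y+z}(Q_{e}\cup Y,Q_{o}\cup X))}{\operatorname{M}_q(H'_{a_{o},0,a_{e}+y-1,z+w,x-y+z}(Q_{o}\cup Q_{e}\cup Y, X))}$ if $w\le y\le z$; and $\frac{\operatorname{M}_q(H'_{0,a_{o},a_{e}+y-1,z+w,x}(Q_{e}\cup X\cup Y,Q_{o}))}{\operatorname{M}_q(H'_{a_{o},0,a_{e}+y-1,z+w,x}(Q_{o}\cup Q_{e}\cup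 X\cup Y,\varnothing))}$ if $z<y$. (5) With $X,Y$ as in (2): \[\frac{\operatorname{M}_{q}(E(x,y,z,w;a_1,\ldots,a_{2k+1}))}{\operatorname{M}_{q}(C(x,y,z,w;a))}\cdot \frac{\operatorname{wt}(F_{sym}(2a_{1}-1,a_{2},\ldots,a_{2k+1}))}{\operatorname{wt}(F_{sym}(2a-1))}\] equals $\frac{\operatorname{M}_q(H_{0,a_{o}-1,a_{e}+y,z+w+1,x-y+z}(Q_{e},Q_{o}\cup X\cup Y))}{\operatorname{M}_q(H_{a_{o}-1,0,a_{e}+y,z+w+1,x-y+z}((Q_{o}\setminus\{0\})\cup Q_{e},X\cup Y\cup\{0\}))}$ if $y<w$; $\frac{\operatorname{M}_q(H_{0,a_{o}-1,a_{e}+y,z+w+1,x-y+z}(Q_{e}\cup Y,Q_{o}\cup X))}{\operatorname{M}_q(H_{a_{o}-1,0,a_{e}+y,z+w+1,x-y+z}((Q_{o}\setminus\{0\})\cup Q_{e}\cup Y, X\cup\{0\}))}$ if $w\le y\le z$; and $\frac{\operatorname{M}_q(H_{0,a_{o}-1,a_{e}+y,z+w+1,x}(Q_{e}\cup X\cup Y,Q_{o}))}{\operatorname{M}_q(H_{a_{o}-1,0,a_{e}+y,z+w+1,x}((Q_{o}\setminus\{0\})\cup Q_{e}\cup X\cup Y,\{0\}))}$ if $z<y$. In each part, $Q_o,Q_e$ are the sets attached to the fern removed in that part: to $F_{sym}(2a_1,a_2,\dots,a_{2k+1})$ in (1), (4), and to $F_{sym}(2a_1-1,a_2,\dots,a_{2k+1})$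 in (2), (3), (5).
   Context: Lattice and weights. Triangular lattice of unit triangles (side $1$) with one family of lattice lines vertical; left-pointing (resp. right-pointing) unit triangles have a vertical side on the right (resp. left). A lozenge is the union of two unit triangles sharing an edge; it is horizontal if the shared edge is vertical. For a region with distinguished horizontal line $\ell$ (always the perpendicular bisector of the left side of its boundary hexagon), the $i$-coordinate of a point is twice its signed vertical distance above $\ell$; a horizontal lozenge with center at $i$-coordinate $n$ has weight $\frac{q^n+q^{-n}}{2}$, other lozenges weight $1$; $\operatorname{M}_q(R)$ is the sum over lozenge tilings of $R$ of the product of lozenge weights. Hexagon side lengths are listed clockwise starting from the (vertical) left side. An intrusion of length $n$ is the union of the $n$ unit triangles crossed by $\ell$ nearest to the left side (the first is left-pointing with left vertex at the midpoint of the left side, orientations alternate; so for even $n$ the last is right-pointing with its right vertex on a vertical lattice line, for odd $n$ it is left-pointing). Notation: $[n]=\{1,\dots,n\}$, $[0]=\varnothing$, $A+r=\{s+r:s\in A\}$, $A-r=A+(-r)$. Ferns. For $b_1,\dots,b_{2k}\in\mathbb{Z}_{>0}$, $b_{2k+1}\in\mathbb{Z}_{\ge0}$, the symmetric fern $F_{sym}(b_1,\dots,b_{2k+1})$ is a vertical string of lattice triangles of sizes $b_{2k+1},\dots,b_2,b_1,b_2,\dots,b_{2k+1}$ (bottom to top), each having its vertical side on a common vertical lattice line (the fern axis), consecutive ones touching at corners on the axis and alternating orientation, the central one (the core, size $b_1$) left-pointing. The flipped fern $\overline F_{sym}(b_1,\dots)$ is its mirror image in a vertical line. Place the fern symmetric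 about the line $i=0$. For each triangle of size $s$ in it, removing its $s$ unit triangles having a side on the axis leaves a region with a unique lozenge tiling, consisting of horizontal lozenges; $\operatorname{wt}(F_{sym}(b_1,\dots,b_{2k+1}))$ ($=\operatorname{wt}(\overline F_{sym}(\cdots))$) is the product of the weights of all these horizontal lozenges. $Q_o$ (resp. $Q_e$) is the set of signed heights above the symmetry line (in side-length units, i.e. half the $i$-coordinates) of midpoints of the unit segments of the fern axis lying in sides of the triangles of sizes $b_1,b_3,\dots,b_{2k+1}$ (resp. $b_2,\dots,b_{2k}$). Regions (with $a_o,a_e,a$ as in the claim; the region with argument list consisting of the single number $a$ means $k=0$, $a_1=a$): $A(x,y,z,w;a_1,\dots,a_{2k+1})$: hexagon with sides $2a_e+2x$, $2a_o+y+w$, $2a_e+y+z$, $2a_o+2x$, $2a_e+y+w$, $2a_o+y+z$; remove an intrusion of length $2(a_o-a_1)+2y$ and the fern $F_{sym}(2a_1,a_2,\dots,a_{2k+1})$ placed so that the vertex of its core not on the fern axis is the rightmost vertex of the intrusion. $B(\cdot)$: hexagon with sides $2a_e+2x$, $2a_o+y+w-1$, $2a_e+y+z$, $2a_o+2x-1$, $2a_e+y+w$, $2a_o+y+z-1$; remove an intrusion of length $2(a_o-a_1)+2y$ and $F_{sym}(2a_1-1,a_2,\dots,a_{2k+1})$ attached in the same way. $C(\cdot)$: hexagon with sides $2a_e+2x$, $2a_o+y+w-1$, $2a_e+y+z+1$, $2a_o+2x-2$, $2a_e+y+w+1$, $2a_o+y+z-1$; remove the same intrusion and fern as for $B$, and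 additionally the right-pointing unit triangle on $\ell$ sharing an edge with the core. $D(\cdot)$: hexagon with sides $2a_o+2x$, $2a_e+y+w$, $2a_o+y+z$, $2a_e+2x$, $2a_o+y+w$, $2a_e+y+z$; remove an intrusion of length $2a_e+2y$ and $\overline F_{sym}(2a_1,a_2,\dots,a_{2k+1})$ placed so that the rightmost vertex of the intrusion is the midpoint of the side of the core lying on the fern axis. $E(\cdot)$: hexagon with sides $2a_o+2x-2$, $2a_e+y+w+1$, $2a_o+y+z-1$, $2a_e+2x$, $2a_o+y+w-1$, $2a_e+y+z+1$; remove an intrusion of length $2a_e+2y+1$ and $\overline F_{sym}(2a_1-1,a_2,\dots,a_{2k+1})$ placed so that the midpoint of the rightmost vertical side of the intrusion is the midpoint of the core's side on the fern axis. $H_{m,n,\alpha,\beta,\gamma}(L,R)$: hexagon with sides $2n+2\gamma$, $2m+2\alpha+1$, $2n+\beta$, $2m+2\alpha+2\gamma-\beta+1$, $2n+\beta$, $2m+2\alpha+1$, minus an intrusion of length $2m+2\alpha+1$; the vertical diagonal through the top and bottom vertices has unit segments labeled $-(m+n+\alpha+\gamma),\dots,m+n+\alpha+\gamma$ bottom to top (label $=$ signed height of midpoint above $\ell$); remove the left-pointing unit triangles whose right side is a diagonal segment with label in $L$ and the right-pointing ones whose left side is a diagonal segment with label in $R$. $H'_{m,n,\alpha,\beta,\gamma}(L,R)$: the same with hexagon sides $2n+2\gamma$, $2m+2\alpha+2$, $2n+\beta$, $2m+2\alpha+2\gamma-\beta+2$, $2n+\beta$, $2m+2\alpha+2$, intrusion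 length $2m+2\alpha+2$, diagonal labels $-(m+n+\alpha+\gamma)-\frac12,\dots,m+n+\alpha+\gamma+\frac12$. *)

theory Defs
  imports Complex_Main "HOL-Library.Disjoint_Sets"
begin

text \<open>
  Points are pairs \<open>(c, h)\<close>: \<open>c\<close> numbers the vertical lattice lines from left to right, the left side
  of the hexagon lying on \<open>c = 0\<close>, and \<open>h\<close> is the i-coordinate, i.e. twice the signed height above
  the line \<open>\<ell>\<close>. Every hexagon below has a left side of even length, centred at \<open>(0, 0)\<close>, so
  \<open>(c, h)\<close> is a lattice point iff \<open>c + h\<close> is even.

  The unit triangle \<open>(c, j)\<close> lies between the vertical lines \<open>c\<close> and \<open>c + 1\<close>, and \<open>j\<close> is the
  i-coordinate of its horizontal symmetry axis. Each pair of integers is exactly one unit triangle;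
  its orientation is forced by the parity of \<open>c + j\<close>.
\<close>

type_synonym cell = "int \<times> int"

definition left_pointing :: "cell \<Rightarrow> bool" where
  "left_pointing t \<longleftrightarrow> even (fst t + snd t)"

definition vertices :: "cell \<Rightarrow> (int \<times> int) set" where
  "vertices t = (case t of (c, j) \<Rightarrow>
     if left_pointing t then {(c, j), (c + 1, j - 1), (c + 1, j + 1)}
     else {(c + 1, j), (c, j - 1), (c, j + 1)})"

text \<open>The vertical lattice line that contains the vertical side of a unit triangle.\<close>

definition side_line :: "cell \<Rightarrow> int" where
  "side_line t = (if left_pointing t then fst t + 1 else fst t)"

definition lozenges :: "cell set set" where
  "lozenges = {{t, t'} | t t'. t \<noteq> t' \<and> card (vertices t \<inter> vertices t') = 2}"

definition tilings :: "cell set \<Rightarrow> cell set set set" where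
  "tilings R = {T. T \<subseteq> lozenges \<and> partition_on R T}"

definition lozenge_weight :: "'a::field \<Rightarrow> int \<Rightarrow> 'a" where
  "lozenge_weight q n = (q powi n + q powi (- n)) / 2"

text \<open>
  A lozenge is horizontal iff it has the form \<open>{(c, n), (c + 1, n)}\<close>; its centre then has
  i-coordinate \<open>n\<close>. All other lozenges have weight 1.
\<close>

definition tiling_weight :: "'a::field \<Rightarrow> cell set set \<Rightarrow> 'a" where
  "tiling_weight q T = (\<Prod>(c, n) \<in> {(c, n). {(c, n), (c + 1, n)} \<in> T}. lozenge_weight q n)"

definition Mq :: "'a::field \<Rightarrow> cell set \<Rightarrow> 'a" where
  "Mq q R = (\<Sum>T \<in> tilings R. tiling_weight q T)"

text \<open>
  The sides are listed clockwise from the left side, which runs from \<open>(0, - s1)\<close> to \<open>(0, s1)\<close>.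
  The inequalities are the six half-planes bounded by the side lines met when walking clockwise from
  \<open>(0, - s1)\<close>; the two equations say that this walk closes up.
\<close>

definition hexagon :: "int \<Rightarrow> int \<Rightarrow> int \<Rightarrow> int \<Rightarrow> int \<Rightarrow> int \<Rightarrow> cell set" where
  "hexagon s1 s2 s3 s4 s5 s6 =
     {t. s2 + s3 = s5 + s6 \<and> s1 + s2 = s4 + s5 \<and>
         (\<forall>(c, h) \<in> vertices t.
            0 \<le> c \<and> h - c \<le> s1 \<and> h + c \<le> s1 + 2 * s2 \<and>
            c \<le> s2 + s3 \<and> s1 - 2 * s3 - 2 * s4 \<le> h - c \<and> - s1 \<le> h + c)}"

definition intrusion :: "int \<Rightarrow> cell set" where
  "intrusion n = {0..<n} \<times> {0}"

text \<open>
  The lattice triangle of size \<open>s\<close>, left-pointing iff \<open>left\<close>, whose vertical side lies on the line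
  \<open>p\<close> and has its midpoint at i-coordinate \<open>m\<close>.
\<close>

definition triangle :: "bool \<Rightarrow> int \<Rightarrow> int \<Rightarrow> int \<Rightarrow> cell set" where
  "triangle left p m s =
     {t. \<forall>(c, h) \<in> vertices t.
           if left then c \<le> p \<and> \<bar>h - m\<bar> \<le> c - (p - s) else p \<le> c \<and> \<bar>h - m\<bar> \<le> (p + s) - c}"

text \<open>
  A fern is given by \<open>k\<close> and sizes \<open>b 1, \<dots>, b (2 * k + 1)\<close>. A lobe \<open>(odd_index, m, s)\<close> is one of
  its triangles: the parity of its index, the i-coordinate \<open>m\<close> of the midpoint of its side on the
  axis (the fern being symmetric about \<open>\<ell>\<close>), and its size \<open>s\<close>.
\<close>

definition lobe_midpoint :: "(nat \<Rightarrow> int) \<Rightarrow> nat \<Rightarrow> int" where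
  "lobe_midpoint b i = (if i = 1 then 0 else b 1 + 2 * (\<Sum>j = 2..<i. b j) + b i)"

definition lobes :: "nat \<Rightarrow> (nat \<Rightarrow> int) \<Rightarrow> (bool \<times> int \<times> int) set" where
  "lobes k b =
     {(odd i, m, b i) | i m. i \<in> {1..2 * k + 1} \<and> m \<in> {lobe_midpoint b i, - lobe_midpoint b i}}"

definition fern :: "int \<Rightarrow> nat \<Rightarrow> (nat \<Rightarrow> int) \<Rightarrow> cell set" where
  "fern p k b = (\<Union>(odd_index, m, s) \<in> lobes k b. triangle odd_index p m s)"

definition flipped_fern :: "int \<Rightarrow> nat \<Rightarrow> (nat \<Rightarrow> int) \<Rightarrow> cell set" where
  "flipped_fern p k b = (\<Union>(odd_index, m, s) \<in> lobes k b. triangle (\<not> odd_index) p m s)"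

text \<open>
  The axis is put on the line \<open>b 1\<close>, so that the core points to \<open>(0, 0)\<close>. Each of the regions below
  has exactly one tiling, so \<open>Mq\<close> is the product of the weights of its lozenges.
\<close>

definition fern_weight :: "'a::field \<Rightarrow> nat \<Rightarrow> (nat \<Rightarrow> int) \<Rightarrow> 'a" where
  "fern_weight q k b =
     (\<Prod>(odd_index, m, s) \<in> lobes k b.
        Mq q {t \<in> triangle odd_index (b 1) m s. side_line t \<noteq> b 1})"

text \<open>Signed heights (half the i-coordinates) of midpoints of unit segments of the fern axis.\<close>

definition axis_heights :: "bool \<Rightarrow> nat \<Rightarrow> (nat \<Rightarrow> int) \<Rightarrow> real set" where
  "axis_heights odd_index k b =
     {real_of_int (m - s + 2 * r - 1) / 2 | m s r. (odd_index, m, s) \<in> lobes k b \<and> r \<in> {1..s}}"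

abbreviation Q_odd :: "nat \<Rightarrow> (nat \<Rightarrow> int) \<Rightarrow> real set" where
  "Q_odd \<equiv> axis_heights True"

abbreviation Q_even :: "nat \<Rightarrow> (nat \<Rightarrow> int) \<Rightarrow> real set" where
  "Q_even \<equiv> axis_heights False"

definition odd_sum :: "nat \<Rightarrow> (nat \<Rightarrow> int) \<Rightarrow> int" where
  "odd_sum k a = (\<Sum>i = 0..k. a (2 * i + 1))"

definition even_sum :: "nat \<Rightarrow> (nat \<Rightarrow> int) \<Rightarrow> int" where
  "even_sum k a = (\<Sum>i = 1..k. a (2 * i))"

definition region_A :: "nat \<Rightarrow> (nat \<Rightarrow> int) \<Rightarrow> int \<Rightarrow> int \<Rightarrow> int \<Rightarrow> int \<Rightarrow> cell set" where
  "region_A k a x y z w =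
     (let ao = odd_sum k a; ae = even_sum k a; n = 2 * (ao - a 1) + 2 * y in
      hexagon (2*ae + 2*x) (2*ao + y + w) (2*ae + y + z) (2*ao + 2*x) (2*ae + y + w) (2*ao + y + z)
      - intrusion n - fern (n + 2 * a 1) k (a(1 := 2 * a 1)))"

definition region_B :: "nat \<Rightarrow> (nat \<Rightarrow> int) \<Rightarrow> int \<Rightarrow> int \<Rightarrow> int \<Rightarrow> int \<Rightarrow> cell set" where
  "region_B k a x y z w =
     (let ao = odd_sum k a; ae = even_sum k a; n = 2 * (ao - a 1) + 2 * y in
      hexagon (2*ae + 2*x) (2*ao + y + w - 1) (2*ae + y + z)
              (2*ao + 2*x - 1) (2*ae + y + w) (2*ao + y + z - 1)
      - intrusion n - fern (n + (2 * a 1 - 1)) k (a(1 := 2 * a 1 - 1)))"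

definition region_C :: "nat \<Rightarrow> (nat \<Rightarrow> int) \<Rightarrow> int \<Rightarrow> int \<Rightarrow> int \<Rightarrow> int \<Rightarrow> cell set" where
  "region_C k a x y z w =
     (let ao = odd_sum k a; ae = even_sum k a; n = 2 * (ao - a 1) + 2 * y in
      hexagon (2*ae + 2*x) (2*ao + y + w - 1) (2*ae + y + z + 1)
              (2*ao + 2*x - 2) (2*ae + y + w + 1) (2*ao + y + z - 1)
      - intrusion n - fern (n + (2 * a 1 - 1)) k (a(1 := 2 * a 1 - 1))
      - {(n + (2 * a 1 - 1), 0)})"

definition region_D :: "nat \<Rightarrow> (nat \<Rightarrow> int) \<Rightarrow> int \<Rightarrow> int \<Rightarrow> int \<Rightarrow> int \<Rightarrow> cell set" where
  "region_D k a x y z w =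
     (let ao = odd_sum k a; ae = even_sum k a; n = 2 * ae + 2 * y in
      hexagon (2*ao + 2*x) (2*ae + y + w) (2*ao + y + z) (2*ae + 2*x) (2*ao + y + w) (2*ae + y + z)
      - intrusion n - flipped_fern n k (a(1 := 2 * a 1)))"

definition region_E :: "nat \<Rightarrow> (nat \<Rightarrow> int) \<Rightarrow> int \<Rightarrow> int \<Rightarrow> int \<Rightarrow> int \<Rightarrow> cell set" where
  "region_E k a x y z w =
     (let ao = odd_sum k a; ae = even_sum k a; n = 2 * ae + 2 * y + 1 in
      hexagon (2*ao + 2*x - 2) (2*ae + y + w + 1) (2*ao + y + z - 1)
              (2*ae + 2*x) (2*ao + y + w - 1) (2*ae + y + z + 1)
      - intrusion n - flipped_fern n k (a(1 := 2 * a 1 - 1)))"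

text \<open>
  The left-pointing (\<open>left\<close>) or right-pointing unit triangles with a vertical side on the line \<open>p\<close>
  at a height belonging to \<open>S\<close>.
\<close>

definition dents :: "bool \<Rightarrow> int \<Rightarrow> real set \<Rightarrow> cell set" where
  "dents left p S =
     {t. left_pointing t = left \<and> side_line t = p \<and> real_of_int (snd t) / 2 \<in> S}"

text \<open>The vertical diagonal through the top vertex lies on the line numbered by the second side.\<close>

definition region_H :: "int \<Rightarrow> int \<Rightarrow> int \<Rightarrow> int \<Rightarrow> int \<Rightarrow> real set \<Rightarrow> real set \<Rightarrow> cell set" where
  "region_H m n \<alpha> \<beta> \<gamma> L R =
     (let p = 2*m + 2*\<alpha> + 1 in
      hexagon (2*n + 2*\<gamma>) p (2*n + \<beta>) (2*m + 2*\<alpha> + 2*\<gamma> - \<beta> + 1) (2*n + \<beta>) p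
      - intrusion p - dents True p L - dents False p R)"

definition region_H' :: "int \<Rightarrow> int \<Rightarrow> int \<Rightarrow> int \<Rightarrow> int \<Rightarrow> real set \<Rightarrow> real set \<Rightarrow> cell set" where
  "region_H' m n \<alpha> \<beta> \<gamma> L R =
     (let p = 2*m + 2*\<alpha> + 2 in
      hexagon (2*n + 2*\<gamma>) p (2*n + \<beta>) (2*m + 2*\<alpha> + 2*\<gamma> - \<beta> + 2) (2*n + \<beta>) p
      - intrusion p - dents True p L - dents False p R)"

definition shift_down :: "int set \<Rightarrow> real \<Rightarrow> real set" where
  "shift_down S r = (\<lambda>s. real_of_int s - r) ` S"

end

(*
  Both sides of each identity compare two regions that are cut by the same vertical axis into two
  trapezoids, the left one bisected by an intrusion. After filling the removed fern and two corner
  triangles back in (their tilings are forced), a tiling is determined by the set S of axis segments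
  crossed by horizontal lozenges together with tilings of the halves. With
  x(t) = (q^t - q^-t) / (q - q^-1), the weighted number of tilings of the right half with dents W is a constant
  times the Vandermonde product of x over W, and each quarter on the left gives a Vandermonde product
  of x^2 (times the product of the x(t) if the number of columns is odd); both follow column by column,
  summing determinants over interlacing sets. Moving a symmetric set Q of dents from the right to the
  left of the axis multiplies the summand of S by the product of x(t) - x(e) over e in Q on one side
  and by the product of x(t)^2 - x(e)^2 over e in the positive part of Q on the other. As Q = -Q these
  agree up to signs, so the ratio depends neither on S nor on the outer boundary: it is the same for
  the original pair of regions and for the pair H, whose axis passes through the top and bottom vertices.
*)
theory Submission
  imports Defs "HOL-Library.FuncSet" "Jordan_Normal_Form.Determinant"
begin

section \<open>Lozenge tilings column by column\<close>

text \<open>Why the column sums close up: the weight of a horizontal lozenge is half a central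
  difference, \<open>qint q (t + 1) - qint q (t - 1) = 2 * lozenge_weight q t\<close>. So weight
  times a power of \<open>qint\<close> has a polynomial antiderivative, the sum over one gap between
  dents telescopes, and a sum of determinants over interlacing sets is again a determinant of
  Vandermonde type. On the left, the missing row 0 acts in every second column as one more dent at
  0, where odd antiderivatives vanish; this is how the linear factor comes and goes. The height 0
  has no mirror image to be paired with, so it is never moved: it is kept out of Q and carried along
  as a fixed dent on the right (\<open>E0\<close>, \<open>E1\<close>). The sets {0} in the
  identities for C and E come from there. Cancelling a ratio needs a denominator that does not
  vanish, so one admissible set S is exhibited. The three cases for y, w, z record on which side of
  the axis each of the two corner triangles lies.\<close>

lemma vertices_left: "even (c + j) \<Longrightarrow> vertices (c, j) = {(c, j), (c + 1, j - 1), (c + 1, j + 1)}"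
  and vertices_right: "odd (c + j) \<Longrightarrow> vertices (c, j) = {(c + 1, j), (c, j - 1), (c, j + 1)}"
  unfolding vertices_def left_pointing_def by simp_all

text \<open>Triangles of equal orientation are translates of one another and share at most one
  vertex unless they coincide; triangles of opposite orientation share an edge in three relative
  positions. The common vertices are given by coordinates so that the case split leaves only linear
  equations.\<close>

lemma two_common_vertices:
  assumes uv: "(u\<^sub>1, u\<^sub>2) \<noteq> (v\<^sub>1, v\<^sub>2)"
    "(u\<^sub>1, u\<^sub>2) \<in> vertices (c, j)" "(u\<^sub>1, u\<^sub>2) \<in> vertices (c', j')"
    "(v\<^sub>1, v\<^sub>2) \<in> vertices (c, j)" "(v\<^sub>1, v\<^sub>2) \<in> vertices (c', j')"
  shows "even (c + j) \<Longrightarrow> odd (c' + j') \<Longrightarrow> c' = c \<and> (j' = j + 1 \<or> j = j' + 1) \<or> c' = c + 1 \<and> j' = j"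
    and "even (c + j) \<Longrightarrow> even (c' + j') \<Longrightarrow> (c, j) = (c', j')"
    and "odd (c + j) \<Longrightarrow> odd (c' + j') \<Longrightarrow> (c, j) = (c', j')"
proof -
  assume e: "even (c + j)" "odd (c' + j')"
  show "c' = c \<and> (j' = j + 1 \<or> j = j' + 1) \<or> c' = c + 1 \<and> j' = j"
    using uv unfolding vertices_left[OF e(1)] vertices_right[OF e(2)] insert_iff prod.inject empty_iff
    by (elim disjE conjE FalseE; simp)
next
  assume e: "even (c + j)" "even (c' + j')"
  show "(c, j) = (c', j')"
    using uv unfolding vertices_left[OF e(1)] vertices_left[OF e(2)] insert_iff prod.inject empty_iff
    by (elim disjE conjE FalseE; simp)
next
  assume e: "odd (c + j)" "odd (c' + j')"
  show "(c, j) = (c', j')"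
    using uv unfolding vertices_right[OF e(1)] vertices_right[OF e(2)] insert_iff prod.inject empty_iff
    by (elim disjE conjE FalseE; simp)
qed

text \<open>A lozenge that is not horizontal stays inside one column, so only horizontal lozenges
  cross a vertical lattice line. This is what makes it possible to proceed column by column.\<close>

lemma lozenge_cases:
  assumes "l \<in> lozenges"
  obtains (horizontal) c n where "even (c + n)" "l = {(c, n), (c + 1, n)}"
  | (vertical) c n where "l = {(c, n), (c, n + 1)}"
proof -
  from assms obtain c j c' j' where l: "l = {(c, j), (c', j')}" and ne: "(c, j) \<noteq> (c', j')"
    and two: "card (vertices (c, j) \<inter> vertices (c', j')) = 2"
    unfolding lozenges_def by auto
  obtain u v where "u \<noteq> v" and uv': "vertices (c, j) \<inter> vertices (c', j') = {u, v}"
    using two unfolding card_2_iff by blast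
  moreover obtain u\<^sub>1 u\<^sub>2 v\<^sub>1 v\<^sub>2 where "u = (u\<^sub>1, u\<^sub>2)" "v = (v\<^sub>1, v\<^sub>2)"
    by (metis surj_pair)
  ultimately have uv: "(u\<^sub>1, u\<^sub>2) \<noteq> (v\<^sub>1, v\<^sub>2)"
    "(u\<^sub>1, u\<^sub>2) \<in> vertices (c, j)" "(u\<^sub>1, u\<^sub>2) \<in> vertices (c', j')"
    "(v\<^sub>1, v\<^sub>2) \<in> vertices (c, j)" "(v\<^sub>1, v\<^sub>2) \<in> vertices (c', j')"
    by blast+
  have "(c' = c \<and> (j' = j + 1 \<or> j = j' + 1)) \<or> (c' = c + 1 \<and> j' = j \<and> even (c + j)) \<or> (c = c' + 1 \<and> j' = j \<and> even (c' + j))"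
    using two_common_vertices[OF uv] two_common_vertices(1)[OF uv(1) uv(3) uv(2) uv(5) uv(4)] ne
    by (cases "even (c + j)"; cases "even (c' + j')") auto
  then show thesis
    using l vertical[of c j] vertical[of c j'] horizontal[of c j] horizontal[of c' j]
    by (elim disjE conjE) (auto simp: insert_commute)
qed

lemma horizontal_lozenge_iff: "{(c, n), (c + 1, n)} \<in> lozenges \<longleftrightarrow> even (c + n)"
proof
  assume "{(c, n), (c + 1, n)} \<in> lozenges"
  then show "even (c + n)"
    by (cases rule: lozenge_cases) (auto simp: doubleton_eq_iff)
next
  assume "even (c + n)"
  then have "vertices (c, n) \<inter> vertices (c + 1, n) = {(c + 1, n - 1), (c + 1, n + 1)}"
    unfolding vertices_def left_pointing_def by auto
  then have "card (vertices (c, n) \<inter> vertices (c + 1, n)) = 2" by simp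
  moreover have "(c, n) \<noteq> (c + 1, n)" by simp
  ultimately show "{(c, n), (c + 1, n)} \<in> lozenges" unfolding lozenges_def by blast
qed

lemma vertical_lozenge: "{(c, n), (c, n + 1)} \<in> lozenges"
proof -
  have "vertices (c, n) \<inter> vertices (c, n + 1) = (if even (c + n) then {(c, n), (c + 1, n + 1)} else {(c + 1, n), (c, n + 1)})"
    unfolding vertices_def left_pointing_def by auto
  then have "card (vertices (c, n) \<inter> vertices (c, n + 1)) = 2" by simp
  moreover have "(c, n) \<noteq> (c, n + 1)" by simp
  ultimately show ?thesis unfolding lozenges_def by blast
qed

text \<open>A weight attached to each single piece turns \<open>tiling_weight\<close> into a product
  over the whole tiling, which is multiplicative when tilings of disjoint regions are joined. For a
  horizontal pair, \<open>the_elem\<close> picks the common height of its two cells.\<close>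

definition cell_pair_weight :: "'a::field \<Rightarrow> cell set \<Rightarrow> 'a" where
  "cell_pair_weight q l = (if \<exists>c n. l = {(c, n), (c + 1, n)} then lozenge_weight q (the_elem (snd ` l)) else 1)"

lemma cell_pair_weight_horizontal [simp]:
  "cell_pair_weight q {(c, n), (c + 1, n)} = lozenge_weight q n"
  unfolding cell_pair_weight_def by auto

lemma cell_pair_weight_vertical [simp]:
  "cell_pair_weight q {(c, n), (c, n + 1)} = 1"
  unfolding cell_pair_weight_def by (auto simp: doubleton_eq_iff)

lemma tiling_weight_altdef:
  assumes "finite T"
  shows "tiling_weight q T = (\<Prod>l\<in>T. cell_pair_weight q l)"
proof -
  let ?h = "\<lambda>(c, n). {(c, n), (c + 1, n)} :: cell set"
  let ?A = "{(c, n). {(c, n), (c + 1, n)} \<in> T}"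
  have inj: "inj_on ?h ?A" by (auto simp: inj_on_def doubleton_eq_iff)
  have "(\<Prod>l\<in>T. cell_pair_weight q l) = (\<Prod>l\<in>?h ` ?A. cell_pair_weight q l)"
    by (rule prod.mono_neutral_right) (use assms in \<open>auto simp: cell_pair_weight_def image_iff\<close>)
  also have "\<dots> = (\<Prod>t\<in>?A. cell_pair_weight q (?h t))"
    by (simp add: prod.reindex[OF inj])
  also have "\<dots> = tiling_weight q T" unfolding tiling_weight_def
    by (rule prod.cong) auto
  finally show ?thesis by simp
qed

lemma tiling_finite:
  assumes "finite R" "T \<in> tilings R"
  shows "finite T"
  using assms unfolding tilings_def partition_on_def
  by (auto intro: finite_UnionD)

lemma finite_tilings:
  assumes "finite R" shows "finite (tilings R)"
proof -
  have "tilings R \<subseteq> Pow (Pow R)" unfolding tilings_def partition_on_def by auto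
  then show ?thesis using assms by (meson finite_Pow_iff finite_subset)
qed

lemma Mq_altdef:
  assumes "finite R"
  shows "Mq q R = (\<Sum>T\<in>tilings R. \<Prod>l\<in>T. cell_pair_weight q l)"
  unfolding Mq_def by (rule sum.cong) (auto simp: tiling_weight_altdef tiling_finite[OF assms])

lemma Mq_empty [simp]: "Mq q {} = 1"
proof -
  have "tilings {} = {{}}" unfolding tilings_def by (auto simp: partition_on_empty)
  then show ?thesis unfolding Mq_altdef[OF finite.emptyI] by simp
qed

lemma tilings_iff:
  "T \<in> tilings R \<longleftrightarrow> T \<subseteq> lozenges \<and> \<Union>T = R \<and> disjoint T"
  unfolding tilings_def partition_on_def lozenges_def by auto

lemma bij_betw_remove_lozenges:
  assumes F: "F \<subseteq> lozenges" "disjoint F" "\<Union>F \<subseteq> R"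
  shows "bij_betw (\<lambda>T. F \<union> T) (tilings (R - \<Union>F)) {T \<in> tilings R. F \<subseteq> T}"
    and "T \<in> tilings (R - \<Union>F) \<Longrightarrow> F \<inter> T = {}"
proof -
  have nonempty: "l \<noteq> {}" if "l \<in> lozenges" for l using that unfolding lozenges_def by auto
  have disj: "F \<inter> T = {}" if "T \<in> tilings (R - \<Union>F)" for T
    using that F nonempty unfolding tilings_iff by fastforce
  then show "T \<in> tilings (R - \<Union>F) \<Longrightarrow> F \<inter> T = {}" .
  show "bij_betw (\<lambda>T. F \<union> T) (tilings (R - \<Union>F)) {T \<in> tilings R. F \<subseteq> T}"
  proof (rule bij_betw_byWitness[where f' = "\<lambda>T. T - F"])
    show "\<forall>T\<in>tilings (R - \<Union>F). F \<union> T - F = T" using disj by blast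
    show "\<forall>T\<in>{T \<in> tilings R. F \<subseteq> T}. F \<union> (T - F) = T" by blast
    show "(\<lambda>T. F \<union> T) ` tilings (R - \<Union>F) \<subseteq> {T \<in> tilings R. F \<subseteq> T}"
    proof safe
      fix T assume T: "T \<in> tilings (R - \<Union>F)"
      have "disjoint (F \<union> T)"
        by (rule disjoint_union) (use T F in \<open>auto simp: tilings_iff\<close>)
      then show "F \<union> T \<in> tilings R" using T F unfolding tilings_iff by auto
    qed
    show "(\<lambda>T. T - F) ` {T \<in> tilings R. F \<subseteq> T} \<subseteq> tilings (R - \<Union>F)"
    proof safe
      fix T assume T: "T \<in> tilings R" "F \<subseteq> T"
      have d: "disjoint T" using T(1) by (auto simp: tilings_iff)
      have "\<Union>(T - F) = R - \<Union>F"
      proof -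
        have "l \<inter> l' = {}" if "l \<in> T - F" "l' \<in> F" for l l'
          using that T(2) by (intro disjointD[OF d]) auto
        then have "\<Union>(T - F) \<inter> \<Union>F = {}" by blast
        moreover have "\<Union>T = R" using T(1) by (simp add: tilings_iff)
        ultimately show ?thesis using T(2) by blast
      qed
      moreover have "disjoint (T - F)" using d by (rule pairwise_subset) auto
      ultimately show "T - F \<in> tilings (R - \<Union>F)" using T(1) unfolding tilings_iff by blast
    qed
  qed
qed

lemma prod_weight_union_tiling:
  assumes "finite R" "finite F" "F \<subseteq> lozenges" "disjoint F" "\<Union>F \<subseteq> R" "T \<in> tilings (R - \<Union>F)"
  shows "(\<Prod>l\<in>F \<union> T. cell_pair_weight q l) = (\<Prod>l\<in>F. cell_pair_weight q l) * (\<Prod>l\<in>T. cell_pair_weight q l)"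
  by (rule prod.union_disjoint)
    (use assms bij_betw_remove_lozenges(2)[of F R T] tiling_finite[of "R - \<Union>F" T] in auto)

lemma Mq_forced:
  assumes R: "finite R" and F: "F \<subseteq> lozenges" "disjoint F" "\<Union>F \<subseteq> R"
    and forced: "\<And>T. T \<in> tilings R \<Longrightarrow> F \<subseteq> T"
  shows "Mq q R = (\<Prod>l\<in>F. cell_pair_weight q l) * Mq q (R - \<Union>F)"
proof -
  have finF: "finite F" using F R by (meson finite_UnionD finite_subset)
  have eq: "{T \<in> tilings R. F \<subseteq> T} = tilings R" using forced by auto
  have "Mq q R = (\<Sum>T\<in>tilings (R - \<Union>F). \<Prod>l\<in>F \<union> T. cell_pair_weight q l)"
    unfolding Mq_altdef[OF R]
    using sum.reindex_bij_betw[OF bij_betw_remove_lozenges(1)[OF F], of "\<lambda>T. prod (cell_pair_weight q) T"]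
    unfolding eq by simp
  also have "\<dots> = (\<Sum>T\<in>tilings (R - \<Union>F). (\<Prod>l\<in>F. cell_pair_weight q l) * (\<Prod>l\<in>T. cell_pair_weight q l))"
    by (rule sum.cong[OF refl]) (rule prod_weight_union_tiling[OF R finF F])
  also have "\<dots> = (\<Prod>l\<in>F. cell_pair_weight q l) * Mq q (R - \<Union>F)"
    using R by (simp add: Mq_altdef sum_distrib_left)
  finally show ?thesis .
qed

text \<open>The restriction to tilings without a piece across A and B serves two purposes: regions
  that no lozenge can connect (\<open>Mq_disconnected\<close>), and what remains of a tiling once
  all crossing lozenges have been taken out (\<open>Mq_split\<close>).\<close>

lemma sum_uncut_tilings:
  assumes fin: "finite A" "finite B" and disj: "A \<inter> B = {}"
  shows "(\<Sum>T\<in>{T \<in> tilings (A \<union> B). \<forall>l\<in>T. l \<subseteq> A \<or> l \<subseteq> B}. \<Prod>l\<in>T. cell_pair_weight q l) = Mq q A * Mq q B"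
proof -
  let ?Z = "\<lambda>T. \<Prod>l\<in>T. cell_pair_weight q l"
  have nonempty: "l \<noteq> {}" if "l \<in> lozenges" for l using that unfolding lozenges_def by auto
  have sub: "l \<subseteq> R" if "l \<in> T" "T \<in> tilings R" for l T R using that by (auto simp: tilings_iff)
  have "Mq q A * Mq q B = (\<Sum>(T1, T2)\<in>tilings A \<times> tilings B. ?Z T1 * ?Z T2)"
    using fin by (simp add: Mq_altdef sum_product sum.cartesian_product)
  also have "\<dots> = (\<Sum>T\<in>{T \<in> tilings (A \<union> B). \<forall>l\<in>T. l \<subseteq> A \<or> l \<subseteq> B}. ?Z T)"
  proof (rule sum.reindex_bij_witness[where j = "\<lambda>(T1, T2). T1 \<union> T2" and i = "\<lambda>T. ({l\<in>T. l \<subseteq> A}, {l\<in>T. l \<subseteq> B})"]; clarsimp)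
    fix T1 T2 assume T: "T1 \<in> tilings A" "T2 \<in> tilings B"
    have n1: "\<not> l \<subseteq> B" if "l \<in> T1" for l
      using that T nonempty[of l] sub[OF that T(1)] disj unfolding tilings_iff by blast
    have n2: "\<not> l \<subseteq> A" if "l \<in> T2" for l
      using that T nonempty[of l] sub[OF that T(2)] disj unfolding tilings_iff by blast
    show "{l. (l \<in> T1 \<or> l \<in> T2) \<and> l \<subseteq> A} = T1 \<and> {l. (l \<in> T1 \<or> l \<in> T2) \<and> l \<subseteq> B} = T2"
      using n1 n2 sub T by blast
    have "disjoint (T1 \<union> T2)"
      by (rule disjoint_union) (use T disj in \<open>auto simp: tilings_iff\<close>)
    then show "T1 \<union> T2 \<in> tilings (A \<union> B) \<and> (\<forall>l\<in>T1 \<union> T2. l \<subseteq> A \<or> l \<subseteq> B)"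
      using T sub unfolding tilings_iff by auto
    have "T1 \<inter> T2 = {}" using n1 sub[OF _ T(2)] by auto
    then show "?Z (T1 \<union> T2) = ?Z T1 * ?Z T2"
      using tiling_finite[OF fin(1) T(1)] tiling_finite[OF fin(2) T(2)] by (intro prod.union_disjoint)
  next
    fix T assume T: "T \<in> tilings (A \<union> B)" "\<forall>l\<in>T. l \<subseteq> A \<or> l \<subseteq> B"
    show "{l \<in> T. l \<subseteq> A} \<union> {l \<in> T. l \<subseteq> B} = T" using T by blast
    have u: "\<Union>T = A \<union> B" and d: "disjoint T" and loz: "T \<subseteq> lozenges" using T by (auto simp: tilings_iff)
    have part: "\<Union>{l \<in> T. l \<subseteq> C} = C" if "\<Union>T = C \<union> D" "C \<inter> D = {}" "\<forall>l\<in>T. l \<subseteq> C \<or> l \<subseteq> D" for C D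
    proof (intro equalityI subsetI)
      fix x assume "x \<in> C"
      then have "x \<in> \<Union>T" using that(1) by simp
      then obtain l where "l \<in> T" "x \<in> l" by blast
      then show "x \<in> \<Union>{l \<in> T. l \<subseteq> C}" using that(2,3) \<open>x \<in> C\<close> by auto
    qed auto
    have "\<Union>{l \<in> T. l \<subseteq> A} = A" using part[of A B] u disj T(2) by auto
    moreover have "\<Union>{l \<in> T. l \<subseteq> B} = B"
    proof (rule part[of B A])
      show "\<Union>T = B \<union> A" "B \<inter> A = {}" using u disj by auto
      show "\<forall>l\<in>T. l \<subseteq> B \<or> l \<subseteq> A" using T(2) by blast
    qed
    moreover have "disjoint {l \<in> T. l \<subseteq> A}" "disjoint {l \<in> T. l \<subseteq> B}"
      using d by (rule pairwise_subset, blast)+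
    ultimately show "{l \<in> T. l \<subseteq> A} \<in> tilings A \<and> {l \<in> T. l \<subseteq> B} \<in> tilings B"
      using loz unfolding tilings_iff by blast
  qed
  finally show ?thesis by simp
qed

lemma Mq_disconnected:
  assumes fin: "finite A" "finite B" and disj: "A \<inter> B = {}"
    and sep: "\<And>l. l \<in> lozenges \<Longrightarrow> l \<subseteq> A \<union> B \<Longrightarrow> l \<subseteq> A \<or> l \<subseteq> B"
  shows "Mq q (A \<union> B) = Mq q A * Mq q B"
proof -
  have "{T \<in> tilings (A \<union> B). \<forall>l\<in>T. l \<subseteq> A \<or> l \<subseteq> B} = tilings (A \<union> B)"
  proof -
    have "l \<subseteq> A \<or> l \<subseteq> B" if "T \<in> tilings (A \<union> B)" "l \<in> T" for T l
      using that sep[of l] by (auto simp: tilings_iff)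
    then show ?thesis by blast
  qed
  then show ?thesis using sum_uncut_tilings[OF fin disj, of q] fin by (simp add: Mq_altdef)
qed

text \<open>Sort the tilings by the set S of heights at which horizontal lozenges cross the line p;
  for fixed S the two sides are tiled independently. The parity in V says that the cell left of the
  line is left-pointing, without which the pair would not be a lozenge.\<close>

lemma Mq_split:
  fixes p :: int
  assumes fin: "finite A" "finite B"
    and A: "\<And>c j. (c, j) \<in> A \<Longrightarrow> c < p" and B: "\<And>c j. (c, j) \<in> B \<Longrightarrow> p \<le> c"
  defines "V \<equiv> {j. (p - 1, j) \<in> A \<and> (p, j) \<in> B \<and> odd (p + j)}"
  shows "Mq q (A \<union> B) = (\<Sum>S\<in>Pow V. (\<Prod>s\<in>S. lozenge_weight q s) * (Mq q (A - {p - 1} \<times> S) * Mq q (B - {p} \<times> S)))"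
proof -
  let ?Z = "\<lambda>T. \<Prod>l\<in>T. cell_pair_weight q l"
  let ?h = "\<lambda>j. {(p - 1, j), (p, j)} :: cell set"
  define cut where "cut T = {j. ?h j \<in> T}" for T
  have disj: "A \<inter> B = {}" using A B by force
  have finV: "finite V"
    by (rule finite_subset[of _ "snd ` A"]) (use fin in \<open>force simp: V_def\<close>)+
  have h_loz: "?h j \<in> lozenges" if "odd (p + j)" for j
    using horizontal_lozenge_iff[of "p - 1" j] that by auto
  have h_odd: "odd (p + j)" if "?h j \<in> lozenges" for j
    using horizontal_lozenge_iff[of "p - 1" j] that by auto
  have inj: "inj_on ?h X" for X by (auto simp: inj_on_def doubleton_eq_iff)
  have cross: "l \<subseteq> A \<or> l \<subseteq> B \<or> l \<in> range ?h" if "l \<in> lozenges" "l \<subseteq> A \<union> B" for l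
    using that(1)
  proof (cases rule: lozenge_cases)
    case (horizontal c n)
    show ?thesis
    proof (cases "c = p - 1")
      case True then show ?thesis using horizontal by auto
    next
      case False then show ?thesis using horizontal that(2) A[of c n] B[of c n] A[of "c+1" n] B[of "c+1" n] by auto
    qed
  next
    case (vertical c n)
    then show ?thesis using that(2) A[of c n] B[of c n] A[of c "n+1"] B[of c "n+1"] by auto
  qed
  have cutV: "cut T \<in> Pow V" if "T \<in> tilings (A \<union> B)" for T
  proof -
    have "j \<in> V" if j: "?h j \<in> T" for j
    proof -
      have "?h j \<in> lozenges" "?h j \<subseteq> A \<union> B" using j \<open>T \<in> tilings (A \<union> B)\<close> by (auto simp: tilings_iff)
      then show ?thesis using h_odd A[of p j] B[of "p-1" j] unfolding V_def by auto
    qed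
    then show ?thesis unfolding cut_def by auto
  qed
  have "Mq q (A \<union> B) = (\<Sum>T\<in>tilings (A \<union> B). ?Z T)" using fin by (simp add: Mq_altdef)
  also have "\<dots> = (\<Sum>S\<in>Pow V. \<Sum>T\<in>{T\<in>tilings (A \<union> B). cut T = S}. ?Z T)"
    by (rule sum.group[symmetric]) (use fin finV finite_tilings cutV in auto)
  also have "\<dots> = (\<Sum>S\<in>Pow V. (\<Prod>s\<in>S. lozenge_weight q s) * (Mq q (A - {p - 1} \<times> S) * Mq q (B - {p} \<times> S)))"
  proof (rule sum.cong[OF refl])
    fix S assume "S \<in> Pow V"
    then have S: "S \<subseteq> V" by auto
    let ?F = "?h ` S"
    let ?A = "A - {p - 1} \<times> S" and ?B = "B - {p} \<times> S"
    have F: "?F \<subseteq> lozenges" using S h_loz unfolding V_def by blast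
    have Fd: "disjoint ?F" unfolding disjoint_def by auto
    have FU: "\<Union>?F = {p - 1} \<times> S \<union> {p} \<times> S" by auto
    have FR: "\<Union>?F \<subseteq> A \<union> B" using S unfolding V_def FU by auto
    have rest: "A \<union> B - \<Union>?F = ?A \<union> ?B" unfolding FU using A B by fastforce
    have finF: "finite ?F" using S finV by (meson finite_imageI finite_subset)
    note bij = bij_betw_remove_lozenges[OF F Fd FR, unfolded rest]
    \<comment> \<open>The rest has to be uncut: a further lozenge across the line would enlarge the
      crossing set beyond S.\<close>
    have "bij_betw (\<lambda>T. ?F \<union> T) {T \<in> tilings (?A \<union> ?B). \<forall>l\<in>T. l \<subseteq> ?A \<or> l \<subseteq> ?B} {T\<in>tilings (A \<union> B). cut T = S}"
    proof (rule bij_betw_subset[OF bij(1)])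
      show "(\<lambda>T. ?F \<union> T) ` {T \<in> tilings (?A \<union> ?B). \<forall>l\<in>T. l \<subseteq> ?A \<or> l \<subseteq> ?B} = {T\<in>tilings (A \<union> B). cut T = S}"
      proof (intro equalityI subsetI)
        fix T' assume "T' \<in> (\<lambda>T. ?F \<union> T) ` {T \<in> tilings (?A \<union> ?B). \<forall>l\<in>T. l \<subseteq> ?A \<or> l \<subseteq> ?B}"
        then obtain T where T': "T' = ?F \<union> T" and T: "T \<in> tilings (?A \<union> ?B)"
          and un: "\<forall>l\<in>T. l \<subseteq> ?A \<or> l \<subseteq> ?B" by blast
        have "?F \<union> T \<in> tilings (A \<union> B)" using bij_betw_apply[OF bij(1) T] by blast
        moreover have "j \<in> S" if "j \<in> cut (?F \<union> T)" for j
        proof (rule ccontr)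
          assume "j \<notin> S"
          then have "?h j \<notin> ?F" by (auto simp: doubleton_eq_iff)
          then have "?h j \<in> T" using that unfolding cut_def by auto
          then show False using un A[of p j] B[of "p-1" j] by fastforce
        qed
        moreover have "j \<in> cut (?F \<union> T)" if "j \<in> S" for j using that unfolding cut_def by blast
        ultimately show "T' \<in> {T\<in>tilings (A \<union> B). cut T = S}" unfolding T' by blast
      next
        fix T assume "T \<in> {T\<in>tilings (A \<union> B). cut T = S}"
        then have T: "T \<in> tilings (A \<union> B)" and ST: "S = cut T" by auto
        have FT: "?F \<subseteq> T" unfolding ST cut_def by auto
        then obtain T' where T': "T' \<in> tilings (?A \<union> ?B)" "T = ?F \<union> T'"
          using T bij(1) unfolding bij_betw_def by blast
        have "l \<subseteq> ?A \<or> l \<subseteq> ?B" if l: "l \<in> T'" for l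
        proof -
          have l': "l \<in> lozenges" "l \<subseteq> ?A \<union> ?B" using l T'(1) by (auto simp: tilings_iff)
          have "l \<notin> range ?h"
          proof
            assume "l \<in> range ?h"
            then obtain j where j: "l = ?h j" by auto
            then have "j \<in> S" using l T'(2) unfolding ST cut_def by auto
            then show False using l'(2) j A[of p j] B[of "p - 1" j] by auto
          qed
          then have "l \<subseteq> A \<or> l \<subseteq> B" using cross[of l] l' by auto
          then show ?thesis using l'(2) disj by auto
        qed
        then show "T \<in> (\<lambda>T. ?F \<union> T) ` {T \<in> tilings (?A \<union> ?B). \<forall>l\<in>T. l \<subseteq> ?A \<or> l \<subseteq> ?B}" using T' by auto
      qed
    qed auto
    then have "(\<Sum>T\<in>{T\<in>tilings (A \<union> B). cut T = S}. ?Z T)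
      = (\<Sum>T\<in>{T \<in> tilings (?A \<union> ?B). \<forall>l\<in>T. l \<subseteq> ?A \<or> l \<subseteq> ?B}. ?Z (?F \<union> T))"
      by (rule sum.reindex_bij_betw[symmetric])
    also have "\<dots> = (\<Sum>T\<in>{T \<in> tilings (?A \<union> ?B). \<forall>l\<in>T. l \<subseteq> ?A \<or> l \<subseteq> ?B}. ?Z ?F * ?Z T)"
      by (rule sum.cong[OF refl], rule prod_weight_union_tiling[of "A \<union> B"])
        (use fin finF F Fd FR rest in auto)
    also have "\<dots> = ?Z ?F * (Mq q ?A * Mq q ?B)"
      using sum_uncut_tilings[of ?A ?B q] fin disj
      by (subst sum_distrib_left[symmetric]) auto
    also have "?Z ?F = (\<Prod>s\<in>S. lozenge_weight q s)"
    proof -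
      have "?Z ?F = (\<Prod>s\<in>S. cell_pair_weight q (?h s))" by (simp add: prod.reindex[OF inj])
      also have "\<dots> = (\<Prod>s\<in>S. lozenge_weight q s)"
        using cell_pair_weight_horizontal[of q "p - 1"] by (intro prod.cong) auto
      finally show ?thesis .
    qed
    finally show "(\<Sum>T\<in>{T\<in>tilings (A \<union> B). cut T = S}. ?Z T) = (\<Prod>s\<in>S. lozenge_weight q s) * (Mq q ?A * Mq q ?B)" .
  qed
  finally show ?thesis .
qed

section \<open>Reflections of a region\<close>

lemma Mq_image_involution:
  assumes inv: "\<And>t. f (f t) = t"
    and loz: "\<And>l. l \<in> lozenges \<Longrightarrow> f ` l \<in> lozenges \<and> cell_pair_weight q (f ` l) = cell_pair_weight q l"
    and R: "finite R"
  shows "Mq q (f ` R) = Mq q R"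
proof -
  have inv_im: "f ` f ` X = X" for X using inv by (simp add: image_image)
  have inj: "inj f" using inv by (metis injI)
  have til: "(`) f ` T \<in> tilings (f ` X)" if "T \<in> tilings X" for T X
  proof -
    have "disjoint ((`) f ` T)" unfolding disjoint_def
    proof (intro ballI impI)
      fix a b assume "a \<in> (`) f ` T" "b \<in> (`) f ` T" "a \<noteq> b"
      then obtain a' b' where "a = f ` a'" "b = f ` b'" "a' \<in> T" "b' \<in> T" "a' \<noteq> b'" by blast
      moreover from this have "a' \<inter> b' = {}" using that by (auto simp: tilings_iff disjoint_def)
      ultimately show "a \<inter> b = {}" by (simp add: image_Int[OF inj, symmetric])
    qed
    moreover have "\<Union>((`) f ` T) = f ` X" using that unfolding tilings_iff by blast
    ultimately show ?thesis using that loz unfolding tilings_iff by blast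
  qed
  have inj2: "inj_on ((`) f) T" for T using inj by (simp add: inj_on_image inj_on_def inj_image_eq_iff)
  have "(\<Sum>T\<in>tilings R. \<Prod>l\<in>T. cell_pair_weight q l) = (\<Sum>T\<in>tilings (f ` R). \<Prod>l\<in>T. cell_pair_weight q l)"
  proof (rule sum.reindex_bij_witness[where i = "(`) ((`) f)" and j = "(`) ((`) f)"])
    fix T assume T: "T \<in> tilings R"
    show "(`) f ` (`) f ` T = T" by (simp add: image_image inv)
    show "(`) f ` T \<in> tilings (f ` R)" using til[OF T] .
    have "(\<Prod>l\<in>(`) f ` T. cell_pair_weight q l) = (\<Prod>l\<in>T. cell_pair_weight q (f ` l))"
      by (simp add: prod.reindex[OF inj2])
    also have "\<dots> = (\<Prod>l\<in>T. cell_pair_weight q l)"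
      by (rule prod.cong) (use T loz in \<open>auto simp: tilings_iff\<close>)
    finally show "(\<Prod>l\<in>(`) f ` T. cell_pair_weight q l) = (\<Prod>l\<in>T. cell_pair_weight q l)" .
  next
    fix T assume T: "T \<in> tilings (f ` R)"
    show "(`) f ` (`) f ` T = T" by (simp add: image_image inv)
    show "(`) f ` T \<in> tilings R" using til[OF T] by (simp add: inv_im)
  qed
  then show ?thesis using R by (simp add: Mq_altdef)
qed

lemma lozenge_weight_minus [simp]: "lozenge_weight q (- n) = lozenge_weight q n"
  unfolding lozenge_weight_def by (simp add: add.commute)

lemma Mq_flip_vertical:
  assumes "finite R" shows "Mq q ((\<lambda>(c, j). (c, - j)) ` R) = Mq q R"
proof (rule Mq_image_involution[OF _ _ assms])
  fix l :: "cell set" assume "l \<in> lozenges"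
  then show "(\<lambda>(c, j). (c, - j)) ` l \<in> lozenges \<and> cell_pair_weight q ((\<lambda>(c, j). (c, - j)) ` l) = cell_pair_weight q l"
  proof (cases rule: lozenge_cases)
    case (horizontal c n)
    then show ?thesis using horizontal_lozenge_iff[of c "-n"] by simp
  next
    case (vertical c n)
    have "(\<lambda>(c, j). (c, - j)) ` l = {(c, - n - 1), (c, (- n - 1) + 1)}" unfolding vertical by auto
    then show ?thesis using vertical_lozenge[of c "-n - 1"] cell_pair_weight_vertical[of q c "-n-1"] vertical
      by simp
  qed
qed auto

text \<open>Column c lies between the lines c and c + 1, so reflection in the line p sends it to
  column \<open>2 * p - 1 - c\<close>. Heights, and with them the weights, are unchanged; the two
  orientations are exchanged.\<close>

lemma Mq_flip_horizontal:
  assumes "finite R" shows "Mq q ((\<lambda>(c, j). (2 * p - 1 - c, j)) ` R) = Mq q R"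
proof (rule Mq_image_involution[OF _ _ assms])
  fix l :: "cell set" assume "l \<in> lozenges"
  then show "(\<lambda>(c, j). (2 * p - 1 - c, j)) ` l \<in> lozenges \<and> cell_pair_weight q ((\<lambda>(c, j). (2 * p - 1 - c, j)) ` l) = cell_pair_weight q l"
  proof (cases rule: lozenge_cases)
    case (horizontal c n)
    have "(\<lambda>(c, j). (2 * p - 1 - c, j)) ` l = {(2 * p - 2 - c, n), ((2 * p - 2 - c) + 1, n)}"
      unfolding horizontal by auto
    moreover have "even (2 * p - 2 - c + n)" using horizontal(1) by simp
    ultimately show ?thesis using horizontal_lozenge_iff[of "2 * p - 2 - c" n] cell_pair_weight_horizontal[of q "2 * p - 2 - c" n] horizontal
      by simp
  next
    case (vertical c n)
    then show ?thesis using vertical_lozenge[of "2 * p - 1 - c" n] by simp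
  qed
qed auto

section \<open>Tilings of a single column\<close>

lemma column_lozenge:
  assumes "T \<in> tilings ({c} \<times> D)" "j \<in> D"
  shows "\<exists>i \<in> {j - 1, j + 1} \<inter> D. {(c, j), (c, i)} \<in> T"
proof -
  from assms obtain l where l: "l \<in> T" "(c, j) \<in> l" "l \<in> lozenges" "l \<subseteq> {c} \<times> D"
    unfolding tilings_iff by blast
  from l(3) show ?thesis
  proof (cases rule: lozenge_cases)
    case (horizontal c' n)
    then have "(c', n) \<in> {c} \<times> D" "(c' + 1, n) \<in> {c} \<times> D" using l(4) by auto
    then show ?thesis by auto
  next
    case (vertical c' n)
    then have n: "c' = c" "n \<in> D" "n + 1 \<in> D" using l(4) by auto
    then consider "j = n" | "j = n + 1" using l(2) vertical by auto
    then show ?thesis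
    proof cases
      case 1
      have "{(c, j), (c, n + 1)} \<in> T" using l(1) unfolding vertical n(1) 1 .
      then show ?thesis using n 1 by auto
    next
      case 2
      have "{(c, j), (c, n)} \<in> T" using l(1) unfolding vertical n(1) 2 by (simp add: insert_commute)
      then show ?thesis using n 2 by auto
    qed
  qed
qed

lemma Mq_column_stuck:
  assumes "finite D" "j \<in> D" "j - 1 \<notin> D" "j + 1 \<notin> D"
  shows "Mq q ({c} \<times> D) = 0"
proof -
  have "tilings ({c} \<times> D) = {}" using column_lozenge[of _ c D j] assms by fastforce
  then show ?thesis using assms by (simp add: Mq_altdef)
qed

text \<open>The lowest cell of the column lacks its lower neighbour and must be joined to the cell
  above it, at weight 1. Columns are peeled from below in this way.\<close>

lemma Mq_column_pair:
  assumes D: "finite D" and low: "\<And>i. i \<in> D \<Longrightarrow> k < i" and k: "k = j + 1"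
  shows "Mq q ({c} \<times> (D \<union> {j, k})) = Mq q ({c} \<times> D)"
proof -
  let ?l = "{(c, j), (c, j + 1)} :: cell set"
  have "{?l} \<subseteq> T" if T: "T \<in> tilings ({c} \<times> (D \<union> {j, j + 1}))" for T
  proof -
    have "j - 1 \<notin> D" using low k by force
    then show ?thesis using column_lozenge[OF T, of j] by auto
  qed
  moreover have "?l \<in> lozenges" by (rule vertical_lozenge)
  ultimately have "Mq q ({c} \<times> (D \<union> {j, j + 1}))
      = (\<Prod>l\<in>{?l}. cell_pair_weight q l) * Mq q ({c} \<times> (D \<union> {j, j + 1}) - \<Union>{?l})"
    using D by (intro Mq_forced) auto
  also have "{c} \<times> (D \<union> {j, j + 1}) - \<Union>{?l} = {c} \<times> D" using low k by force
  finally show ?thesis unfolding k by simp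
qed

text \<open>Strict interlacing, as in two consecutive rows of a Gelfand-Tsetlin pattern. The longer
  list stands first, and the last equation rejects all other lengths.\<close>

fun interlaced :: "int list \<Rightarrow> int list \<Rightarrow> bool" where
  "interlaced [t] [] = True"
| "interlaced (t # t' # ts) (s # ss) = (t < s \<and> s < t' \<and> interlaced (t' # ts) ss)"
| "interlaced _ _ = False"

lemma interlaced_iff_nth:
  "interlaced ts ss \<longleftrightarrow> length ts = Suc (length ss) \<and> (\<forall>i<length ss. ts ! i < ss ! i \<and> ss ! i < ts ! Suc i)"
proof (induction ts ss rule: interlaced.induct)
  case (2 t t' ts s ss)
  have "(\<forall>i<length (s # ss). (t # t' # ts) ! i < (s # ss) ! i \<and> (s # ss) ! i < (t # t' # ts) ! Suc i)
    \<longleftrightarrow> (t < s \<and> s < t') \<and> (\<forall>i<length ss. (t' # ts) ! i < ss ! i \<and> ss ! i < (t' # ts) ! Suc i)"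
    by (simp add: All_less_Suc2)
  then show ?case using 2 by auto
qed auto

lemma even_gap: "even (t - lo) \<Longrightarrow> lo \<le> t \<Longrightarrow> t \<noteq> lo \<Longrightarrow> lo + 2 \<le> t" for t lo :: int
  by presburger

lemma odd_gap: "odd (t - lo) \<Longrightarrow> lo \<le> t \<Longrightarrow> t \<noteq> lo + 1 \<Longrightarrow> lo + 3 \<le> t" for t lo :: int
  by presburger

text \<open>Scan the column from below. Free cells are joined in pairs by force until a gap appears;
  it must be at a cell with the parity of \<open>lo\<close>, which shifts the pairing by one, and
  the next gap must then have the other parity. So gaps of the two kinds alternate, and as
  \<open>hi\<close> has the parity of \<open>lo\<close> the last one is again in \<open>ts\<close>.
  All lozenges inside a column have weight 1.\<close>

lemma Mq_column_interlaced:
  assumes "sorted_wrt (<) ts" "sorted_wrt (<) ss" "lo \<le> hi" "even (hi - lo)"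
    and "\<And>t. t \<in> set ts \<Longrightarrow> lo \<le> t \<and> t \<le> hi \<and> even (t - lo)"
    and "\<And>s. s \<in> set ss \<Longrightarrow> lo \<le> s \<and> s \<le> hi \<and> odd (s - lo)"
  shows "Mq q ({c} \<times> ({lo..hi} - set ts - set ss)) = (if interlaced ts ss then 1 else 0)"
  using assms
proof (induction "nat (hi - lo)" arbitrary: lo ts ss rule: less_induct)
  case less
  note T = less.prems(5) and S = less.prems(6)
  let ?D = "{lo..hi} - set ts - set ss"
  have IH: "Mq q ({c} \<times> ({lo + 2..hi} - set ts' - set ss')) = (if interlaced ts' ss' then 1 else 0)"
    if "lo + 2 \<le> hi" "sorted_wrt (<) ts'" "sorted_wrt (<) ss'"
      "\<And>t. t \<in> set ts' \<Longrightarrow> lo + 2 \<le> t \<and> t \<le> hi \<and> even (t - lo)"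
      "\<And>s. s \<in> set ss' \<Longrightarrow> lo + 2 \<le> s \<and> s \<le> hi \<and> odd (s - lo)" for ts' ss'
    by (rule less.hyps) (use that less.prems(4) in auto)
  have lo_ss: "lo \<notin> set ss" using S by force
  have lo1_ts: "lo + 1 \<notin> set ts" using T[of "lo + 1"] by auto
  have S2: "lo + 2 \<le> s \<and> s \<le> hi \<and> odd (s - lo)" if "s \<in> set ss" "s \<noteq> lo + 1" for s
    using S[OF that(1)] odd_gap[of s lo] that(2) by auto
  have step: "lo + 2 \<le> hi" if "lo \<noteq> hi" using that less.prems(3,4) by presburger
  show ?case
  proof (cases "lo \<in> set ts")
    case False
    have T2: "lo + 2 \<le> t \<and> t \<le> hi \<and> even (t - lo)" if "t \<in> set ts" for t
      using T[OF that] even_gap[of t lo] that False by (cases "t = lo") auto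
    show ?thesis
    proof (cases "lo = hi \<or> lo + 1 \<in> set ss")
      case True
      then have "Mq q ({c} \<times> ?D) = 0"
        using False lo_ss less.prems(3) by (intro Mq_column_stuck[of _ lo]) auto
      moreover have "\<not> interlaced ts ss"
      proof
        assume il: "interlaced ts ss"
        then obtain t ts' where ts: "ts = t # ts'" by (cases ts) auto
        then have t: "lo + 2 \<le> t" "t \<le> hi" using T2[of t] by auto
        then obtain s ss' where ss: "ss = s # ss'" using True by (cases ss) auto
        then have "t < s" using il ts by (cases ts') auto
        moreover have "s \<le> lo + 1" using True ss less.prems(2) t by auto
        ultimately show False using t by simp
      qed
      ultimately show ?thesis by simp
    next
      case False': False
      then have hi: "lo + 2 \<le> hi" using step by auto
      have "?D = ({lo + 2..hi} - set ts - set ss) \<union> {lo, lo + 1}"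
        using False False' lo_ss lo1_ts hi by auto
      then have "Mq q ({c} \<times> ?D) = Mq q ({c} \<times> ({lo + 2..hi} - set ts - set ss))"
        by (simp only:) (rule Mq_column_pair, auto)
      also have "\<dots> = (if interlaced ts ss then 1 else 0)"
        using False' S2 T2 less.prems hi by (intro IH) auto
      finally show ?thesis .
    qed
  next
    case True
    then obtain t ts' where ts: "ts = t # ts'" by (cases ts) auto
    have "t = lo" using True T[of t] less.prems(1) ts by force
    with ts have ts: "ts = lo # ts'" by simp
    have sts': "sorted_wrt (<) ts'" and gt: "\<And>t. t \<in> set ts' \<Longrightarrow> lo < t" using less.prems(1) ts by auto
    have T2: "lo + 2 \<le> t \<and> t \<le> hi \<and> even (t - lo)" if "t \<in> set ts'" for t
      using T[of t] gt[OF that] that ts even_gap[of t lo] by auto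
    show ?thesis
    proof (cases "lo = hi")
      case True
      have "t \<notin> set ts'" for t using T2[of t] True by auto
      then have "ts' = []" by (cases ts') auto
      have "s \<notin> set ss" for s using S[of s] True by auto
      then have "ss = []" by (cases ss) auto
      show ?thesis using ts True \<open>ts' = []\<close> \<open>ss = []\<close> by simp
    next
      case False
      then have hi: "lo + 2 \<le> hi" using step by auto
      show ?thesis
      proof (cases "lo + 1 \<in> set ss")
        case True
        then obtain s ss' where ss: "ss = s # ss'" by (cases ss) auto
        have "lo + 1 \<le> s" using S[of s] ss by (cases "s = lo") auto
        then have "s = lo + 1" using True ss less.prems(2) by force
        with ss have ss: "ss = (lo + 1) # ss'" by simp
        have "sorted_wrt (<) ss'" and gts: "\<And>s. s \<in> set ss' \<Longrightarrow> lo + 1 < s" using less.prems(2) ss by auto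
        have "?D = {lo + 2..hi} - set ts' - set ss'" unfolding ts ss by auto
        then have "Mq q ({c} \<times> ?D) = (if interlaced ts' ss' then 1 else 0)"
          using hi sts' \<open>sorted_wrt (<) ss'\<close> T2 S2 gts ss
          by (simp only:) (rule IH, auto)
        also have "interlaced ts' ss' = interlaced ts ss"
          unfolding ts ss using T2[of "hd ts'"] by (cases ts') auto
        finally show ?thesis .
      next
        case lo1: False
        show ?thesis
        proof (cases "lo + 2 \<in> set ts'")
          case True
          then obtain t ts'' where ts': "ts' = t # ts''" by (cases ts') auto
          then have t: "t = lo + 2" using True T2[of t] sts' by force
          have "Mq q ({c} \<times> ?D) = 0"
            using ts ts' t hi lo1 lo1_ts by (intro Mq_column_stuck[of _ "lo + 1"]) auto
          moreover have "\<not> interlaced ts ss"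
          proof
            assume "interlaced ts ss"
            then obtain s where "s \<in> set ss" "lo < s" "s < lo + 2" unfolding ts ts' t by (cases ss) auto
            then show False using S2[of s] lo1 by (cases "s = lo + 1") auto
          qed
          ultimately show ?thesis by simp
        next
          case False
          have "lo + 2 \<notin> set ss" using S[of "lo + 2"] by auto
          \<comment> \<open>Here the gap travels upwards: \<open>lo + 1\<close> is joined to
            \<open>lo + 2\<close>, and what remains looks as though \<open>lo + 2\<close> had been
            removed in place of \<open>lo\<close>.\<close>
          then have "?D = ({lo + 2..hi} - set ((lo + 2) # ts') - set ss) \<union> {lo + 1, lo + 2}"
            using False lo1 lo1_ts hi ts lo_ss by auto
          then have "Mq q ({c} \<times> ?D) = Mq q ({c} \<times> ({lo + 2..hi} - set ((lo + 2) # ts') - set ss))"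
            by (simp only:) (rule Mq_column_pair, auto)
          also have "\<dots> = (if interlaced ((lo + 2) # ts') ss then 1 else 0)"
          proof (rule IH[OF hi])
            have "lo + 2 < t" if "t \<in> set ts'" for t using T2[OF that] False that by (cases "t = lo + 2") auto
            then show "sorted_wrt (<) ((lo + 2) # ts')" using sts' by auto
            show "sorted_wrt (<) ss" by fact
            show "lo + 2 \<le> t \<and> t \<le> hi \<and> even (t - lo)" if "t \<in> set ((lo + 2) # ts')" for t
              using that T2 hi by auto
            show "lo + 2 \<le> s \<and> s \<le> hi \<and> odd (s - lo)" if "s \<in> set ss" for s
              using S2[OF that] lo1 that by auto
          qed
          also have "interlaced ((lo + 2) # ts') ss = interlaced ts ss"
          proof -
            have "lo + 2 < s" "lo < s" if "s \<in> set ss" for s using S2[OF that] lo1 that by (cases "s = lo + 1"; cases "s = lo + 2"; auto)+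
            then show ?thesis unfolding ts by (cases ss; cases ts') auto
          qed
          finally show ?thesis .
        qed
      qed
    qed
  qed
qed

section \<open>Determinants summed over interlacing sets\<close>

text \<open>T and S live on neighbouring vertical lines, where the possible heights have opposite
  parity; interlacing alone would also admit heights of the wrong parity.\<close>

definition interlacing_sets :: "int set \<Rightarrow> int set set" where
  "interlacing_sets T = {S. finite S \<and> (\<forall>s\<in>S. \<forall>t\<in>T. odd (s - t)) \<and>
     interlaced (sorted_list_of_set T) (sorted_list_of_set S)}"

lemma sorted_list_of_set_image:
  fixes f :: "nat \<Rightarrow> int"
  assumes "\<And>i. Suc i < m \<Longrightarrow> f i < f (Suc i)"
  shows "sorted_list_of_set (f ` {..<m}) = map f [0..<m]"
proof -
  have mono: "f i < f j" if "i < j" "j < m" for i j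
    using that assms by (induction j) (auto simp: less_Suc_eq, force)
  have "sorted_wrt (<) (map f [0..<m])"
    unfolding sorted_wrt_iff_nth_less using mono by auto
  then have "sorted (map f [0..<m])" "distinct (map f [0..<m])"
    by (auto simp: strict_sorted_iff)
  then have "sorted_list_of_set (set (map f [0..<m])) = map f [0..<m]"
    by (rule sorted_list_of_set.idem_if_sorted_distinct)
  then show ?thesis by (simp add: atLeast0LessThan)
qed

lemma finite_odd_gap: "finite {s :: int. a < s \<and> s < b \<and> odd (s - a)}"
  by (rule finite_subset[of _ "{a..b}"]) auto

lemma det_mat:
  fixes A :: "nat \<Rightarrow> nat \<Rightarrow> 'a::comm_ring_1"
  shows "det (mat m m (\<lambda>(i, j). A i j)) = (\<Sum>p\<in>{p. p permutes {0..<m}}. signof p * (\<Prod>i<m. A i (p i)))"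
proof -
  have "(\<Prod>i = 0..<m. mat m m (\<lambda>(i, j). A i j) $$ (i, p i)) = (\<Prod>i<m. A i (p i))"
    if p: "p permutes {0..<m}" for p
  proof (rule prod.cong)
    fix i assume "i \<in> {..<m}"
    then have "i < m" "p i < m" using permutes_in_image[OF p, of i] by auto
    then show "mat m m (\<lambda>(i, j). A i j) $$ (i, p i) = A i (p i)" by simp
  qed auto
  then show ?thesis by (simp add: det_def'[of _ m])
qed

text \<open>An interlacing set is one free choice in each gap of T, and the i-th choice enters only
  the i-th row. By multilinearity the sum may therefore be carried out inside each row. Since T has
  a single parity, the parity condition on S can be stated relative to the left end of each
  gap.\<close>

lemma sum_interlacing_sets_det:
  fixes h :: "nat \<Rightarrow> int \<Rightarrow> 'a::comm_ring_1"
  assumes T: "finite T" "card T = Suc m" and par: "\<And>t t'. t \<in> T \<Longrightarrow> t' \<in> T \<Longrightarrow> even (t - t')"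
  defines "ts \<equiv> sorted_list_of_set T"
  shows "(\<Sum>S\<in>interlacing_sets T. (\<Prod>s\<in>S. v s) * det (mat m m (\<lambda>(i, j). h j (sorted_list_of_set S ! i))))
    = det (mat m m (\<lambda>(i, j). \<Sum>s\<in>{s. ts ! i < s \<and> s < ts ! Suc i \<and> odd (s - ts ! i)}. v s * h j s))"
proof -
  let ?I = "\<lambda>i. {s. ts ! i < s \<and> s < ts ! Suc i \<and> odd (s - ts ! i)}"
  let ?G = "\<lambda>f. \<Sum>p\<in>{p. p permutes {0..<m}}. signof p * (\<Prod>i\<in>{..<m}. v (f i) * h (p i) (f i))"
  have len: "length ts = Suc m" using T unfolding ts_def by simp
  have tsT: "ts ! i \<in> T" if "i \<le> m" for i
    using nth_mem[of i ts] that len T(1) unfolding ts_def by simp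
  have sorted_map: "sorted_list_of_set (f ` {..<m}) = map f [0..<m]" if f: "f \<in> PiE {..<m} ?I" for f
  proof (rule sorted_list_of_set_image)
    fix i assume "Suc i < m"
    then have "f i < ts ! Suc i" "ts ! Suc i < f (Suc i)" using f by (auto simp: PiE_iff)
    then show "f i < f (Suc i)" by simp
  qed
  have "(\<Sum>S\<in>interlacing_sets T. (\<Prod>s\<in>S. v s) * det (mat m m (\<lambda>(i, j). h j (sorted_list_of_set S ! i))))
    = (\<Sum>f\<in>PiE {..<m} ?I. ?G f)"
  proof (rule sum.reindex_bij_witness[where j = "\<lambda>S. \<lambda>i\<in>{..<m}. sorted_list_of_set S ! i" and i = "\<lambda>f. f ` {..<m}"])
    fix S assume "S \<in> interlacing_sets T"
    then have S: "finite S" "\<And>s t. s \<in> S \<Longrightarrow> t \<in> T \<Longrightarrow> odd (s - t)"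
      and il: "interlaced ts (sorted_list_of_set S)"
      unfolding interlacing_sets_def ts_def by auto
    let ?ss = "sorted_list_of_set S" and ?f = "\<lambda>i\<in>{..<m}. sorted_list_of_set S ! i"
    have card: "card S = m" and gap: "\<And>i. i < m \<Longrightarrow> ts ! i < ?ss ! i \<and> ?ss ! i < ts ! Suc i"
      using il len unfolding interlaced_iff_nth by auto
    have mem: "?ss ! i \<in> S" if "i < m" for i using nth_mem[of i ?ss] that card S(1) by simp
    have im: "?f ` {..<m} = S"
    proof -
      have "?f ` {..<m} = (!) ?ss ` {..<length ?ss}" using card by auto
      also have "\<dots> = set ?ss" by (auto simp: set_conv_nth)
      finally show ?thesis using S(1) by simp
    qed
    show "?f ` {..<m} = S" by (rule im)
    show "?f \<in> PiE {..<m} ?I" using gap mem S(2) tsT by auto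
    have inj: "inj_on ((!) ?ss) {..<m}" using card by (auto simp: inj_on_def nth_eq_iff_index_eq)
    have "(\<Prod>s\<in>S. v s) = (\<Prod>i<m. v (?ss ! i))"
    proof -
      have "S = (!) ?ss ` {..<m}" using im by auto
      then show ?thesis using prod.reindex[OF inj, of v] by simp
    qed
    then show "?G ?f = (\<Prod>s\<in>S. v s) * det (mat m m (\<lambda>(i, j). h j (?ss ! i)))"
      by (simp add: det_mat sum_distrib_left prod.distrib mult.left_commute)
  next
    fix f assume f: "f \<in> PiE {..<m} ?I"
    note sm = sorted_map[OF f]
    show "(\<lambda>i\<in>{..<m}. sorted_list_of_set (f ` {..<m}) ! i) = f"
      unfolding sm using f by (auto simp: PiE_iff extensional_def restrict_def fun_eq_iff)
    have "odd (f i - t)" if "i < m" "t \<in> T" for i t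
    proof -
      have "odd (f i - ts ! i)" using f that by (auto simp: PiE_iff)
      moreover have "even (ts ! i - t)" using par[OF tsT that(2)] that by simp
      ultimately show ?thesis by (metis diff_add_cancel diff_diff_eq2 even_diff odd_add dvd_diff_commute add_diff_eq)
    qed
    moreover have "interlaced ts (map f [0..<m])" unfolding interlaced_iff_nth using len f by (auto simp: PiE_iff)
    ultimately show "f ` {..<m} \<in> interlacing_sets T"
      unfolding interlacing_sets_def using sm unfolding ts_def by auto
  qed
  also have "\<dots> = (\<Sum>p\<in>{p. p permutes {0..<m}}. signof p * (\<Sum>f\<in>PiE {..<m} ?I. \<Prod>i\<in>{..<m}. v (f i) * h (p i) (f i)))"
    by (subst sum.swap) (simp add: sum_distrib_left)
  also have "\<dots> = (\<Sum>p\<in>{p. p permutes {0..<m}}. signof p * (\<Prod>i\<in>{..<m}. \<Sum>s\<in>?I i. v s * h (p i) s))"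
    using finite_odd_gap by (subst prod_sum_PiE) simp_all
  also have "\<dots> = det (mat m m (\<lambda>(i, j). \<Sum>s\<in>?I i. v s * h j s))"
    by (simp add: det_mat)
  finally show ?thesis .
qed

section \<open>Telescoping sums and determinants with polynomial rows\<close>

lemma sum_telescope_odd:
  fixes F :: "int \<Rightarrow> 'a::comm_ring_1"
  assumes "a \<le> b" "even (b - a)"
  shows "(\<Sum>s\<in>{s. a < s \<and> s < b \<and> odd (s - a)}. F (s + 1) - F (s - 1)) = F b - F a"
proof -
  obtain k where k: "b - a = 2 * k" using assms(2) by (rule evenE)
  define n where "n = nat k"
  have b: "b = a + 2 * int n" using k assms(1) unfolding n_def by simp
  have "{s. a < s \<and> s < b \<and> odd (s - a)} = (\<lambda>i. a + 2 * int i + 1) ` {..<n}"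
  proof (intro equalityI subsetI)
    fix s assume s: "s \<in> {s. a < s \<and> s < b \<and> odd (s - a)}"
    then have "odd (s - a)" by blast
    then obtain k where k: "s - a = 2 * k + 1" by (rule oddE)
    then have "s = a + 2 * int (nat k) + 1" "nat k < n" using s b by auto
    then show "s \<in> (\<lambda>i. a + 2 * int i + 1) ` {..<n}" by blast
  qed (use b in auto)
  moreover have "inj_on (\<lambda>i. a + 2 * int i + 1) {..<n}" by (auto simp: inj_on_def)
  ultimately have "(\<Sum>s\<in>{s. a < s \<and> s < b \<and> odd (s - a)}. F (s + 1) - F (s - 1))
    = (\<Sum>i<n. F (a + 2 * int i + 1 + 1) - F (a + 2 * int i + 1 - 1))"
    by (simp add: sum.reindex)
  also have "\<dots> = (\<Sum>i<n. F (a + 2 * int (Suc i)) - F (a + 2 * int i))"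
    by (rule sum.cong) (auto simp: algebra_simps)
  also have "\<dots> = F b - F a" unfolding b by (subst sum_lessThan_telescope) simp
  finally show ?thesis .
qed

text \<open>Multiplication from the left by the lower triangular matrix of ones adds consecutive
  differences up to differences from row 0, and that matrix has determinant 1.\<close>

lemma det_row_differences:
  fixes M :: "nat \<Rightarrow> nat \<Rightarrow> 'a::idom"
  shows "det (mat m m (\<lambda>(i, j). M (Suc i) j - M i j)) = det (mat m m (\<lambda>(i, j). M (Suc i) j - M 0 j))"
proof -
  let ?L = "mat m m (\<lambda>(i, k). if k \<le> i then 1 else 0) :: 'a mat"
  let ?A = "mat m m (\<lambda>(i, j). M (Suc i) j - M i j)"
  have "?L * ?A = mat m m (\<lambda>(i, j). M (Suc i) j - M 0 j)"
  proof (rule eq_matI)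
    fix i j assume "i < dim_row (mat m m (\<lambda>(i, j). M (Suc i) j - M 0 j))" "j < dim_col (mat m m (\<lambda>(i, j). M (Suc i) j - M 0 j))"
    then have ij: "i < m" "j < m" by auto
    have "(?L * ?A) $$ (i, j) = (\<Sum>k = 0..<m. (if k \<le> i then 1 else 0) * (M (Suc k) j - M k j))"
      using ij by (simp add: scalar_prod_def)
    also have "\<dots> = (\<Sum>k<Suc i. M (Suc k) j - M k j)"
      using ij by (intro sum.mono_neutral_cong_right) auto
    also have "\<dots> = M (Suc i) j - M 0 j" by (rule sum_lessThan_telescope)
    finally show "(?L * ?A) $$ (i, j) = mat m m (\<lambda>(i, j). M (Suc i) j - M 0 j) $$ (i, j)" using ij by simp
  qed auto
  moreover have "det ?L = 1"
    by (subst det_lower_triangular[of m]) (auto simp: diag_mat_def prod.list_conv_set_nth)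
  ultimately show ?thesis using det_mult[of ?L m ?A] by simp
qed

text \<open>The matrix factors into the scaled Vandermonde matrix V and the triangular matrix of
  coefficients. The same factorization, read backwards for a basis in which the value matrix is
  itself triangular, evaluates V.\<close>

lemma det_poly_scaled:
  fixes y u :: "nat \<Rightarrow> 'a::idom"
  assumes deg: "\<And>j. j < m \<Longrightarrow> degree (P j) = j"
  shows "det (mat m m (\<lambda>(i, j). u i * poly (P j) (y i)))
     = (\<Prod>i<m. u i) * (\<Prod>j<m. lead_coeff (P j)) * (\<Prod>i<m. \<Prod>l<i. y i - y l)"
proof -
  define V where "V = mat m m (\<lambda>(i, k). u i * y i ^ k)"
  have V: "V \<in> carrier_mat m m" unfolding V_def by simp
  have main: "det (mat m m (\<lambda>(i, j). u i * poly (P j) (y i))) = det V * (\<Prod>j<m. lead_coeff (P j))"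
    if deg: "\<And>j. j < m \<Longrightarrow> degree (P j) = j" for P
  proof -
    let ?U = "mat m m (\<lambda>(k, j). coeff (P j) k)"
    have "V * ?U = mat m m (\<lambda>(i, j). u i * poly (P j) (y i))"
    proof (rule eq_matI)
      fix i j assume "i < dim_row (mat m m (\<lambda>(i, j). u i * poly (P j) (y i)))" "j < dim_col (mat m m (\<lambda>(i, j). u i * poly (P j) (y i)))"
      then have ij: "i < m" "j < m" by auto
      have "(V * ?U) $$ (i, j) = (\<Sum>k = 0..<m. u i * y i ^ k * coeff (P j) k)"
        using ij by (simp add: scalar_prod_def V_def)
      also have "\<dots> = (\<Sum>k\<le>j. u i * y i ^ k * coeff (P j) k)"
        using ij deg[OF ij(2)] by (intro sum.mono_neutral_right) (auto simp: coeff_eq_0)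
      also have "\<dots> = u i * poly (P j) (y i)"
        using deg[OF ij(2)] by (simp add: poly_altdef sum_distrib_left algebra_simps)
      finally show "(V * ?U) $$ (i, j) = mat m m (\<lambda>(i, j). u i * poly (P j) (y i)) $$ (i, j)" using ij by simp
    qed (auto simp: V_def)
    moreover have "det ?U = (\<Prod>j<m. lead_coeff (P j))"
    proof -
      have "det ?U = prod_list (diag_mat ?U)"
        by (rule det_upper_triangular[of _ m]) (use deg in \<open>auto intro!: upper_triangularI coeff_eq_0\<close>)
      also have "\<dots> = (\<Prod>j<m. coeff (P j) j)"
        by (simp add: diag_mat_def prod.list_conv_set_nth atLeast0LessThan)
      finally show ?thesis using deg by simp
    qed
    ultimately show ?thesis using det_mult[OF V, of ?U] by simp
  qed
  \<comment> \<open>Newton basis: \<open>N j\<close> vanishes at \<open>y i\<close> for i < j, so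
    its value matrix is lower triangular; it is monic, so \<open>main\<close> identifies that
    determinant with \<open>det V\<close>.\<close>
  define N where "N j = (\<Prod>l<j. [:- y l, 1:])" for j
  have Ndeg: "degree (N j) = j" for j
    unfolding N_def by (simp add: degree_prod_eq_sum_degree)
  have Nlead: "lead_coeff (N j) = 1" for j
    unfolding N_def by (simp only: lead_coeff_prod) simp
  have "det V = det (mat m m (\<lambda>(i, j). u i * poly (N j) (y i)))"
    using main[of N] Ndeg Nlead by simp
  also have "\<dots> = prod_list (diag_mat (mat m m (\<lambda>(i, j). u i * poly (N j) (y i))))"
    by (rule det_lower_triangular[of m]) (auto simp: N_def poly_prod intro!: bexI)
  also have "\<dots> = (\<Prod>i<m. u i * (\<Prod>l<i. y i - y l))"
    by (simp add: diag_mat_def prod.list_conv_set_nth atLeast0LessThan N_def poly_prod)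
  finally show ?thesis using main[OF deg] by (simp add: prod.distrib algebra_simps)
qed

section \<open>Symmetric q-integers\<close>

text \<open>The value at \<open>q = 1\<close> is the limit; the quotient would be the junk value 0 there.\<close>

definition qint :: "'a::field \<Rightarrow> int \<Rightarrow> 'a" where
  "qint q t = (if q = 1 then of_int t else (q powi t - q powi (- t)) / (q - inverse q))"

lemma qint_0 [simp]: "qint q 0 = 0"
  by (simp add: qint_def)

lemma qint_minus: "qint q (- t) = - qint q t"
proof (cases "q = 1")
  case False
  have "(q powi (- t) - q powi t) = - (q powi t - q powi (- t))" by simp
  then show ?thesis using False by (simp only: qint_def minus_minus if_False minus_divide_left)
qed (simp add: qint_def)

context
  fixes q :: "'a::linordered_field"
  assumes q: "q > 0"
begin

lemma q_diff_nonzero: "q \<noteq> 1 \<Longrightarrow> q - inverse q \<noteq> 0"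
proof
  assume "q \<noteq> 1" "q - inverse q = 0"
  then have "q * q = 1" using q by (simp add: field_simps)
  then have "(q - 1) * (q + 1) = 0" by (simp add: algebra_simps)
  then show False using \<open>q \<noteq> 1\<close> q by auto
qed

lemma qint_1 [simp]: "qint q 1 = 1"
  using q_diff_nonzero by (auto simp: qint_def power_int_minus)

lemma lozenge_weight_pos: "lozenge_weight q t > 0"
  unfolding lozenge_weight_def using q by (simp add: add_pos_pos zero_less_power_int)

lemma powi_shift: "q powi (t + 1) = q powi t * q" "q powi (t - 1) = q powi t * inverse q"
  "q powi (- (t + 1)) = inverse (q powi t) * inverse q" "q powi (- (t - 1)) = inverse (q powi t) * q"
  "q powi (- t) = inverse (q powi t)" "q powi t \<noteq> 0"
proof -
  show p: "q powi (t + 1) = q powi t * q" and m: "q powi (t - 1) = q powi t * inverse q"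
    and "q powi (- t) = inverse (q powi t)" "q powi t \<noteq> 0"
    using q power_int_diff[of q t 1] by (auto simp: power_int_add power_int_minus divide_inverse)
  show "q powi (- (t + 1)) = inverse (q powi t) * inverse q"
    unfolding power_int_minus p using q by simp
  show "q powi (- (t - 1)) = inverse (q powi t) * q"
    unfolding power_int_minus m using q by simp
qed

text \<open>The source of all telescoping: up to the factor 2, the lozenge weight is the central
  difference of \<open>qint\<close>.\<close>

lemma qint_diff: "qint q (t + 1) - qint q (t - 1) = 2 * lozenge_weight q t"
proof (cases "q = 1")
  case True then show ?thesis by (simp add: qint_def lozenge_weight_def)
next
  case False
  define a where "a = q powi t"
  have a: "a \<noteq> 0" and q0: "q \<noteq> 0" using powi_shift(6)[of t] q unfolding a_def by auto
  have "(a * q - inverse a * inverse q) - (a * inverse q - inverse a * q) = (a + inverse a) * (q - inverse q)"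
    by (simp add: algebra_simps)
  then have "(a * q - inverse a * inverse q) / (q - inverse q) - (a * inverse q - inverse a * q) / (q - inverse q) = a + inverse a"
    using q_diff_nonzero[OF False] by (simp add: diff_divide_distrib[symmetric])
  then show ?thesis using False unfolding qint_def lozenge_weight_def powi_shift a_def[symmetric] by simp
qed

text \<open>Together with \<open>qint_prod\<close> this says that the two neighbours
  \<open>qint q (t + 1)\<close> and \<open>qint q (t - 1)\<close> are the roots of a quadratic whose
  coefficients depend on \<open>qint q t\<close> alone. Their powers therefore obey a recursion in
  \<open>qint q t\<close>.\<close>

lemma qint_sum: "qint q (t + 1) + qint q (t - 1) = (q + inverse q) * qint q t"
proof (cases "q = 1")
  case True then show ?thesis by (simp add: qint_def)
next
  case False
  define a where "a = q powi t"
  have "(a * q - inverse a * inverse q) + (a * inverse q - inverse a * q) = (q + inverse q) * (a - inverse a)"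
    by (simp add: algebra_simps)
  then have "(a * q - inverse a * inverse q) / (q - inverse q) + (a * inverse q - inverse a * q) / (q - inverse q) = (q + inverse q) * ((a - inverse a) / (q - inverse q))"
    by (simp add: add_divide_distrib[symmetric])
  then show ?thesis using False unfolding qint_def powi_shift a_def[symmetric] by simp
qed

lemma qint_prod: "qint q (t + 1) * qint q (t - 1) = (qint q t)\<^sup>2 - 1"
proof (cases "q = 1")
  case True then show ?thesis by (simp add: qint_def power2_eq_square algebra_simps)
next
  case False
  define a d where "a = q powi t" and "d = q - inverse q"
  have a: "a \<noteq> 0" and q0: "q \<noteq> 0" using powi_shift(6)[of t] q unfolding a_def by auto
  have d: "d \<noteq> 0" using q_diff_nonzero[OF False] d_def by simp
  have "(a * q - inverse a * inverse q) * (a * inverse q - inverse a * q) = (a - inverse a)\<^sup>2 - d\<^sup>2"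
    unfolding d_def using a q0 by (simp add: power2_eq_square field_simps)
  then have "(a * q - inverse a * inverse q) / d * ((a * inverse q - inverse a * q) / d) = ((a - inverse a) / d)\<^sup>2 - 1"
    unfolding times_divide_times_eq power_divide power2_eq_square using d by (simp only: diff_divide_distrib) simp
  then show ?thesis using False unfolding qint_def powi_shift a_def[symmetric] d_def[symmetric] by simp
qed

text \<open>Each step of two adds twice a positive lozenge weight. The heights compared later lie on
  one vertical line and so have equal parity.\<close>

lemma qint_less:
  assumes "s < t" "even (t - s)" shows "qint q s < qint q t"
proof -
  have step: "qint q s < qint q (s + 2 * int (Suc n))" for n
  proof (induction n)
    case 0
    then show ?case using qint_diff[of "s + 1"] lozenge_weight_pos[of "s + 1"] by (simp add: algebra_simps)
  next
    case (Suc n)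
    have "qint q (s + 2 * int (Suc n)) < qint q (s + 2 * int (Suc (Suc n)))"
      using qint_diff[of "s + 2 * int (Suc n) + 1"] lozenge_weight_pos[of "s + 2 * int (Suc n) + 1"] by (simp add: algebra_simps)
    then show ?case using Suc by simp
  qed
  obtain k where k: "t - s = 2 * k" using assms(2) by (rule evenE)
  moreover have "k > 0" using k assms(1) by simp
  ultimately have t: "t = s + 2 * int (Suc (nat (k - 1)))" by simp
  show ?thesis by (subst t) (rule step)
qed

lemma qint_pos: "t > 0 \<Longrightarrow> qint q t > 0"
proof -
  assume t: "t > 0"
  show ?thesis
  proof (cases "even t")
    case True then show ?thesis using qint_less[of 0 t] t by simp
  next
    case False
    then have "t = 1 \<or> (1 < t \<and> even (t - 1))" using t by presburger
    then show ?thesis using qint_less[of 1 t] by (auto intro: less_trans)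
  qed
qed

text \<open>Write u, v for the two neighbours of x = \<open>qint q t\<close>. Then u^(n+2) - v^(n+2)
  = (u + v) (u^(n+1) - v^(n+1)) - u v (u^n - v^n), where u + v = (q + 1/q) x and u v = x^2 - 1. So
  the differences of odd powers are the weight times a polynomial in x^2, those of even powers carry
  one more factor x. The top coefficients obey the recursion of \<open>qint\<close> itself, which
  makes them positive.\<close>

lemma odd_even_power_polys:
  "\<exists>A B. degree A \<le> i \<and> coeff A i = qint q (2 * int i + 1) \<and> degree B \<le> i \<and> coeff B i = qint q (2 * int i + 2) \<and>
    (\<forall>t. 2 * lozenge_weight q t * poly A ((qint q t)\<^sup>2) = qint q (t + 1) ^ (2 * i + 1) - qint q (t - 1) ^ (2 * i + 1)) \<and>
    (\<forall>t. 2 * lozenge_weight q t * qint q t * poly B ((qint q t)\<^sup>2) = qint q (t + 1) ^ (2 * i + 2) - qint q (t - 1) ^ (2 * i + 2))"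
proof (induction i)
  case 0
  have "2 * lozenge_weight q t * qint q t * (q + inverse q) = qint q (t + 1) ^ 2 - qint q (t - 1) ^ 2" for t
  proof -
    have "qint q (t + 1) ^ 2 - qint q (t - 1) ^ 2 = (qint q (t + 1) - qint q (t - 1)) * (qint q (t + 1) + qint q (t - 1))"
      by (simp add: power2_eq_square algebra_simps)
    then show ?thesis unfolding qint_diff qint_sum by (simp add: mult_ac)
  qed
  moreover have "qint q 2 = q + inverse q" using qint_sum[of 1] by simp
  ultimately show ?case
    by (rule_tac exI[of _ 1], rule_tac exI[of _ "[:q + inverse q:]"]) (simp add: qint_diff power2_eq_square)
next
  case (Suc i)
  define d where "d = q + inverse q"
  from Suc obtain A B where A: "degree A \<le> i" "coeff A i = qint q (2 * int i + 1)"
    and B: "degree B \<le> i" "coeff B i = qint q (2 * int i + 2)"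
    and A_eq: "\<And>t. 2 * lozenge_weight q t * poly A ((qint q t)\<^sup>2) = qint q (t + 1) ^ (2 * i + 1) - qint q (t - 1) ^ (2 * i + 1)"
    and B_eq: "\<And>t. 2 * lozenge_weight q t * qint q t * poly B ((qint q t)\<^sup>2) = qint q (t + 1) ^ (2 * i + 2) - qint q (t - 1) ^ (2 * i + 2)"
    by blast
  \<comment> \<open>The polynomial variable stands for \<open>(qint q t)^2\<close>, and
    \<open>pCons 0\<close> multiplies by it; \<open>pCons 0 A - A\<close> is thus the product u v
    times A.\<close>
  define A' where "A' = smult d (pCons 0 B) - (pCons 0 A - A)"
  define B' where "B' = smult d A' - (pCons 0 B - B)"
  have rec: "qint q (n + 2) = d * qint q (n + 1) - qint q n" for n
    using qint_sum[of "n + 1"] unfolding d_def by (simp add: algebra_simps)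
  have A': "degree A' \<le> Suc i" unfolding A'_def using A B
    by (intro degree_diff_le degree_smult_le[THEN order_trans]) (auto intro: order_trans[OF degree_pCons_le])
  moreover have "degree B' \<le> Suc i" unfolding B'_def using A' B
    by (intro degree_diff_le degree_smult_le[THEN order_trans]) (auto intro: order_trans[OF degree_pCons_le])
  moreover have cA: "coeff A' (Suc i) = qint q (2 * int (Suc i) + 1)"
    unfolding A'_def using A B rec[of "2 * int i + 1"] by (simp add: coeff_eq_0 algebra_simps)
  moreover have "coeff B' (Suc i) = qint q (2 * int (Suc i) + 2)"
    unfolding B'_def using cA B rec[of "2 * int i + 2"] by (simp add: coeff_eq_0 algebra_simps)
  moreover have A'_eq: "2 * lozenge_weight q t * poly A' ((qint q t)\<^sup>2) = qint q (t + 1) ^ (2 * Suc i + 1) - qint q (t - 1) ^ (2 * Suc i + 1)" for t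
  proof -
    let ?u = "qint q (t + 1)" and ?v = "qint q (t - 1)" and ?x = "qint q t"
    have "2 * lozenge_weight q t * poly A' (?x\<^sup>2)
      = d * ?x * (2 * lozenge_weight q t * ?x * poly B (?x\<^sup>2)) - (?x\<^sup>2 - 1) * (2 * lozenge_weight q t * poly A (?x\<^sup>2))"
      unfolding A'_def by (simp add: algebra_simps power2_eq_square)
    also have "\<dots> = (?u + ?v) * (?u ^ (2 * i + 2) - ?v ^ (2 * i + 2)) - ?u * ?v * (?u ^ (2 * i + 1) - ?v ^ (2 * i + 1))"
      unfolding A_eq B_eq qint_sum qint_prod d_def by simp
    also have "\<dots> = ?u ^ (2 * Suc i + 1) - ?v ^ (2 * Suc i + 1)" by (simp add: algebra_simps)
    finally show ?thesis .
  qed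
  moreover have "2 * lozenge_weight q t * qint q t * poly B' ((qint q t)\<^sup>2) = qint q (t + 1) ^ (2 * Suc i + 2) - qint q (t - 1) ^ (2 * Suc i + 2)" for t
  proof -
    let ?u = "qint q (t + 1)" and ?v = "qint q (t - 1)" and ?x = "qint q t"
    have "2 * lozenge_weight q t * ?x * poly B' (?x\<^sup>2)
      = d * ?x * (2 * lozenge_weight q t * poly A' (?x\<^sup>2)) - (?x\<^sup>2 - 1) * (2 * lozenge_weight q t * ?x * poly B (?x\<^sup>2))"
      unfolding B'_def by (simp add: algebra_simps)
    also have "\<dots> = (?u + ?v) * (?u ^ (2 * Suc i + 1) - ?v ^ (2 * Suc i + 1)) - ?u * ?v * (?u ^ (2 * i + 2) - ?v ^ (2 * i + 2))"
      unfolding A'_eq B_eq qint_sum qint_prod d_def by simp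
    also have "\<dots> = ?u ^ (2 * Suc i + 2) - ?v ^ (2 * Suc i + 2)" by (simp add: algebra_simps)
    finally show ?thesis .
  qed
  ultimately show ?case by blast
qed

text \<open>E is a discrete derivative. Its values on the \<open>r i\<close> are g times polynomials
  of degree i with positive top coefficient, so triangular elimination yields an antiderivative of
  every g times y^i. The offset e separates the two uses: 0 for antiderivatives that are odd in
  \<open>qint\<close>, 1 for even ones. Positive leading coefficients are kept because their
  products become the constants of the tiling counts.\<close>

lemma triangular_poly_inverse:
  fixes E :: "'a poly \<Rightarrow> int \<Rightarrow> 'a"
  assumes lin: "\<And>p p' t. E (p - p') t = E p t - E p' t" "\<And>c p t. E (smult c p) t = c * E p t"
      "\<And>f (n::nat) t. E (\<Sum>k<n. f k) t = (\<Sum>k<n. E (f k) t)"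
    and A: "\<And>i. degree (A i) \<le> i" "\<And>i. coeff (A i) i > 0"
    and r: "\<And>i. degree (r i) \<le> i + e" "\<And>i. coeff (r i) (i + e) > 0"
    and eq: "\<And>i t. E (r i) t = g t * poly (A i) (y t)"
  shows "\<exists>p. degree p = i + e \<and> lead_coeff p > 0 \<and> (\<forall>t. E p t = g t * y t ^ i)"
proof (induction i rule: less_induct)
  case (less i)
  then obtain Q where Q: "\<And>k. k < i \<Longrightarrow> degree (Q k) = k + e" "\<And>k t. k < i \<Longrightarrow> E (Q k) t = g t * y t ^ k"
    by metis
  define p where "p = smult (inverse (coeff (A i) i)) (r i - (\<Sum>k<i. smult (coeff (A i) k) (Q k)))"
  have Qdeg: "degree (\<Sum>k<i. smult (coeff (A i) k) (Q k)) \<le> i + e - 1" if "i > 0"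
  proof (rule degree_sum_le)
    fix k assume "k \<in> {..<i}"
    then show "degree (smult (coeff (A i) k) (Q k)) \<le> i + e - 1"
      using Q(1)[of k] degree_smult_le[of "coeff (A i) k" "Q k"] by simp
  qed simp
  have top: "coeff p (i + e) = inverse (coeff (A i) i) * coeff (r i) (i + e)"
    unfolding p_def using Qdeg by (cases "i = 0") (auto simp: coeff_eq_0)
  then have pos: "coeff p (i + e) > 0" using A(2) r(2) by simp
  have "degree p \<le> i + e"
  proof -
    have "degree (\<Sum>k<i. smult (coeff (A i) k) (Q k)) \<le> i + e" using Qdeg by (cases "i = 0") auto
    then show ?thesis unfolding p_def using r(1) by (intro degree_smult_le[THEN order_trans] degree_diff_le)
  qed
  then have "degree p = i + e" using pos le_degree[of p "i + e"] by simp
  moreover have "E p t = g t * y t ^ i" for t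
  proof -
    have "poly (A i) (y t) = (\<Sum>k\<le>i. coeff (A i) k * y t ^ k)"
      unfolding poly_altdef using A(1)[of i] by (intro sum.mono_neutral_left) (auto simp: coeff_eq_0)
    also have "\<dots> = coeff (A i) i * y t ^ i + (\<Sum>k<i. coeff (A i) k * y t ^ k)"
      by (simp add: lessThan_Suc_atMost[symmetric])
    finally have Ai: "poly (A i) (y t) - (\<Sum>k<i. coeff (A i) k * y t ^ k) = coeff (A i) i * y t ^ i" by simp
    have "E p t = inverse (coeff (A i) i) * (g t * poly (A i) (y t) - (\<Sum>k<i. coeff (A i) k * (g t * y t ^ k)))"
      unfolding p_def by (simp add: lin eq Q(2))
    also have "\<dots> = inverse (coeff (A i) i) * g t * (poly (A i) (y t) - (\<Sum>k<i. coeff (A i) k * y t ^ k))"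
      by (simp add: sum_distrib_left algebra_simps)
    also have "\<dots> = g t * y t ^ i" unfolding Ai using A(2)[of i] by simp
    finally show ?thesis .
  qed
  ultimately show ?case using pos by (intro exI[of _ p]) simp
qed

text \<open>Even powers of \<open>qint\<close> have antiderivatives x p(x^2), odd in x and hence
  zero at t = 0. This is what suits columns with the dent at height 0.\<close>

lemma telescoping_even:
  "\<exists>p. degree p = i \<and> lead_coeff p > 0 \<and> (\<forall>t. qint q (t + 1) * poly p ((qint q (t + 1))\<^sup>2) - qint q (t - 1) * poly p ((qint q (t - 1))\<^sup>2)
      = lozenge_weight q t * ((qint q t)\<^sup>2) ^ i)"
proof -
  define E where "E p t = qint q (t + 1) * poly p ((qint q (t + 1))\<^sup>2) - qint q (t - 1) * poly p ((qint q (t - 1))\<^sup>2)" for p t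
  obtain A where A: "\<And>i. degree (A i) \<le> i" "\<And>i. coeff (A i) i = qint q (2 * int i + 1)"
     "\<And>i t. 2 * lozenge_weight q t * poly (A i) ((qint q t)\<^sup>2) = qint q (t + 1) ^ (2 * i + 1) - qint q (t - 1) ^ (2 * i + 1)"
    using odd_even_power_polys by metis
  have "\<exists>p. degree p = i + 0 \<and> lead_coeff p > 0 \<and> (\<forall>t. E p t = lozenge_weight q t * ((qint q t)\<^sup>2) ^ i)"
  \<comment> \<open>The 1/2 cancels the factor 2 that \<open>odd_even_power_polys\<close> carries in
    front of the weight.\<close>
  proof (rule triangular_poly_inverse[where A = A and r = "\<lambda>i. monom (1/2) i"])
    show "E (monom (1/2) i) t = lozenge_weight q t * poly (A i) ((qint q t)\<^sup>2)" for i t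
      using A(3)[of t i] unfolding E_def by (simp add: poly_monom power_mult[symmetric] algebra_simps)
  qed (auto simp: E_def A qint_pos algebra_simps poly_sum sum_subtractf sum_distrib_left intro: degree_monom_le)
  then show ?thesis unfolding E_def by simp
qed

text \<open>Odd powers of \<open>qint\<close> have even antiderivatives p(x^2), at the price of one
  degree more.\<close>

lemma telescoping_odd:
  "\<exists>p. degree p = Suc i \<and> lead_coeff p > 0 \<and> (\<forall>t. poly p ((qint q (t + 1))\<^sup>2) - poly p ((qint q (t - 1))\<^sup>2)
      = lozenge_weight q t * qint q t * ((qint q t)\<^sup>2) ^ i)"
proof -
  define E where "E p t = poly p ((qint q (t + 1))\<^sup>2) - poly p ((qint q (t - 1))\<^sup>2)" for p t
  obtain B where B: "\<And>i. degree (B i) \<le> i" "\<And>i. coeff (B i) i = qint q (2 * int i + 2)"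
     "\<And>i t. 2 * lozenge_weight q t * qint q t * poly (B i) ((qint q t)\<^sup>2) = qint q (t + 1) ^ (2 * i + 2) - qint q (t - 1) ^ (2 * i + 2)"
    using odd_even_power_polys by metis
  have "\<exists>p. degree p = i + 1 \<and> lead_coeff p > 0 \<and> (\<forall>t. E p t = (lozenge_weight q t * qint q t) * ((qint q t)\<^sup>2) ^ i)"
  proof (rule triangular_poly_inverse[where A = B and r = "\<lambda>i. monom (1/2) (i + 1)"])
    show "E (monom (1/2) (i + 1)) t = lozenge_weight q t * qint q t * poly (B i) ((qint q t)\<^sup>2)" for i t
    proof -
      have "a ^ (2 * i + 2) = (a\<^sup>2) ^ (i + 1)" for a :: 'a by (simp only: power_mult[symmetric]) simp
      then show ?thesis using B(3)[of t i] unfolding E_def poly_monom by (simp add: algebra_simps)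
    qed
  qed (auto simp: E_def B qint_pos algebra_simps poly_sum sum_subtractf sum_distrib_left intro: degree_monom_le)
  then show ?thesis unfolding E_def by simp
qed

text \<open>Even and odd j are covered by the two preceding families; composing with
  \<open>[:0, 0, 1:]\<close> replaces the variable by its square.\<close>

lemma telescoping_full:
  "\<exists>p. degree p = Suc j \<and> lead_coeff p > 0 \<and> (\<forall>t. poly p (qint q (t + 1)) - poly p (qint q (t - 1))
      = lozenge_weight q t * qint q t ^ j)"
proof (cases "even j")
  case True
  then obtain i where j: "j = 2 * i" by (rule evenE)
  obtain p where p: "degree p = i" "lead_coeff p > 0" "\<And>t. qint q (t + 1) * poly p ((qint q (t + 1))\<^sup>2) - qint q (t - 1) * poly p ((qint q (t - 1))\<^sup>2)
      = lozenge_weight q t * ((qint q t)\<^sup>2) ^ i" using telescoping_even by blast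
  define r where "r = pCons 0 (pcompose p [:0, 0, 1:])"
  have "p \<noteq> 0" using p(2) by auto
  then have "pcompose p [:0, 0, 1:] \<noteq> 0" by (simp add: pcompose_eq_0_iff)
  then have "degree r = Suc j" "lead_coeff r > 0"
    using p lead_coeff_comp[of "[:0, 0, 1:]" p] unfolding r_def j by (simp_all add: degree_pcompose)
  moreover have "poly r (qint q (t + 1)) - poly r (qint q (t - 1)) = lozenge_weight q t * qint q t ^ j" for t
    using p(3)[of t] unfolding r_def j by (simp add: poly_pcompose power_mult power2_eq_square)
  ultimately show ?thesis by blast
next
  case False
  then obtain i where j: "j = 2 * i + 1" by (rule oddE)
  obtain p where p: "degree p = Suc i" "lead_coeff p > 0" "\<And>t. poly p ((qint q (t + 1))\<^sup>2) - poly p ((qint q (t - 1))\<^sup>2)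
      = lozenge_weight q t * qint q t * ((qint q t)\<^sup>2) ^ i" using telescoping_odd by blast
  define r where "r = pcompose p [:0, 0, 1:]"
  have "degree r = Suc j" "lead_coeff r > 0"
    using p lead_coeff_comp[of "[:0, 0, 1:]" p] unfolding r_def j by (simp_all add: degree_pcompose)
  moreover have "poly r (qint q (t + 1)) - poly r (qint q (t - 1)) = lozenge_weight q t * qint q t ^ j" for t
  proof -
    have sq: "poly [:0, 0, 1:] a = a\<^sup>2" for a :: 'a by (simp add: power2_eq_square)
    show ?thesis using p(3)[of t] unfolding r_def j poly_pcompose sq by (simp add: power_mult mult.assoc)
  qed
  ultimately show ?thesis by blast
qed

end

section \<open>Vandermonde products\<close>

text \<open>Factors are oriented by the order of the indices, not of the values, so the product is
  positive as soon as y increases on T.\<close>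

definition vand :: "(int \<Rightarrow> 'a::comm_ring_1) \<Rightarrow> int set \<Rightarrow> 'a" where
  "vand y T = (\<Prod>t\<in>T. \<Prod>s\<in>{s\<in>T. s < t}. y t - y s)"

lemma vand_nth:
  assumes "finite T"
  shows "vand y T = (\<Prod>i<card T. \<Prod>l<i. y (sorted_list_of_set T ! i) - y (sorted_list_of_set T ! l))"
proof -
  let ?ts = "sorted_list_of_set T"
  have len: "length ?ts = card T" by simp
  have bij: "bij_betw ((!) ?ts) {..<card T} T"
    using bij_betw_nth[of ?ts "{..<card T}" T] assms by simp
  have less: "?ts ! l < ?ts ! i \<longleftrightarrow> l < i" if "i < card T" "l < card T" for i l
    using strict_sorted_list_of_set[of T] that len
    by (metis linorder_neqE_nat not_less_iff_gr_or_eq sorted_wrt_nth_less)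
  have "vand y T = (\<Prod>i<card T. \<Prod>s\<in>{s\<in>T. s < ?ts ! i}. y (?ts ! i) - y s)"
    unfolding vand_def by (rule prod.reindex_bij_betw[OF bij, symmetric])
  also have "\<dots> = (\<Prod>i<card T. \<Prod>l<i. y (?ts ! i) - y (?ts ! l))"
  proof (rule prod.cong[OF refl])
    fix i assume i: "i \<in> {..<card T}"
    have "bij_betw ((!) ?ts) {..<i} {s\<in>T. s < ?ts ! i}"
    proof (rule bij_betw_subset[OF bij])
      show "(!) ?ts ` {..<i} = {s \<in> T. s < ?ts ! i}"
      proof (intro equalityI subsetI)
        fix s assume "s \<in> (!) ?ts ` {..<i}"
        then show "s \<in> {s \<in> T. s < ?ts ! i}" using i less bij_betw_apply[OF bij] by auto
      next
        fix s assume s: "s \<in> {s \<in> T. s < ?ts ! i}"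
        then obtain l where "l < card T" "s = ?ts ! l" using bij unfolding bij_betw_def by blast
        then show "s \<in> (!) ?ts ` {..<i}" using s less[of i l] i by auto
      qed
    qed (use i in auto)
    then show "(\<Prod>s\<in>{s\<in>T. s < ?ts ! i}. y (?ts ! i) - y s) = (\<Prod>l<i. y (?ts ! i) - y (?ts ! l))"
      by (rule prod.reindex_bij_betw[symmetric])
  qed
  finally show ?thesis .
qed

lemma vand_insert_min:
  assumes "finite T" "\<And>t. t \<in> T \<Longrightarrow> t0 < t"
  shows "vand y (insert t0 T) = (\<Prod>t\<in>T. y t - y t0) * vand y T"
proof -
  have t0: "t0 \<notin> T" using assms(2) by force
  have e: "{s \<in> insert t0 T. s < t0} = {}" using assms(2) by force
  have "(\<Prod>s\<in>{s \<in> insert t0 T. s < t}. y t - y s) = (y t - y t0) * (\<Prod>s\<in>{s \<in> T. s < t}. y t - y s)" if "t \<in> T" for t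
  proof -
    have "{s \<in> insert t0 T. s < t} = insert t0 {s \<in> T. s < t}" using assms(2)[OF that] by auto
    then show ?thesis using t0 assms(1) by simp
  qed
  then have "(\<Prod>t\<in>T. \<Prod>s\<in>{s \<in> insert t0 T. s < t}. y t - y s) = (\<Prod>t\<in>T. (y t - y t0) * (\<Prod>s\<in>{s \<in> T. s < t}. y t - y s))"
    by (intro prod.cong) auto
  moreover have "vand y (insert t0 T) = (\<Prod>s\<in>{s \<in> insert t0 T. s < t0}. y t0 - y s) * (\<Prod>t\<in>T. \<Prod>s\<in>{s \<in> insert t0 T. s < t}. y t - y s)"
    unfolding vand_def using assms(1) t0 by (rule prod.insert)
  ultimately show ?thesis unfolding e by (simp add: vand_def prod.distrib)
qed

section \<open>Sums of Vandermonde products over interlacing sets\<close>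

lemma card_interlacing:
  assumes "S \<in> interlacing_sets T"
  shows "card T = Suc (card S)" "finite S"
  using assms unfolding interlacing_sets_def interlaced_iff_nth by auto

text \<open>The common core of the three summation formulas below. The entries v y^j have
  antiderivatives \<open>\<Psi> j\<close>; summing each gap and taking differences from the smallest
  dent t0 leaves rows that are a factor u times a polynomial in z. For general dents u is
  \<open>z t - z t0\<close>; for t0 = 0 in the left half it is \<open>qint q t\<close>.\<close>

lemma sum_interlacing_vand:
  fixes y u z v :: "int \<Rightarrow> 'a::idom"
  assumes T: "finite T" "\<And>t. t \<in> T \<Longrightarrow> t0 < t" and par: "\<And>t. t \<in> T \<Longrightarrow> even (t - t0)"
    and tele: "\<And>j s. j < card T \<Longrightarrow> \<Psi> j (s + 1) - \<Psi> j (s - 1) = v s * y s ^ j"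
    and \<Psi>: "\<And>j t. j < card T \<Longrightarrow> \<Psi> j t - \<Psi> j t0 = u t * poly (P j) (z t)"
    and deg: "\<And>j. j < card T \<Longrightarrow> degree (P j) = j"
  shows "(\<Sum>S\<in>interlacing_sets (insert t0 T). (\<Prod>s\<in>S. v s) * vand y S)
    = (\<Prod>t\<in>T. u t) * (\<Prod>j<card T. lead_coeff (P j)) * vand z T"
proof -
  define m where "m = card T"
  define ts where "ts = sorted_list_of_set (insert t0 T)"
  define ts' where "ts' = sorted_list_of_set T"
  have t0: "t0 \<notin> T" using T(2) by force
  have par': "even (t - t')" if "t \<in> insert t0 T" "t' \<in> insert t0 T" for t t'
  proof -
    have "even (t - t0)" "even (t' - t0)" using par that by auto
    then show ?thesis by presburger
  qed
  have ts: "ts = t0 # ts'"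
  proof -
    have "sorted (t0 # ts')" "distinct (t0 # ts')" using T t0 unfolding ts'_def by (auto simp: less_imp_le)
    then have "sorted_list_of_set (set (t0 # ts')) = t0 # ts'"
      by (rule sorted_list_of_set.idem_if_sorted_distinct)
    then show ?thesis using T(1) unfolding ts_def ts'_def by simp
  qed
  have len: "length ts' = m" unfolding ts'_def m_def by simp
  have mem: "ts' ! i \<in> T" if "i < m" for i using nth_mem[of i ts'] that len T(1) unfolding ts'_def by simp
  have mem0: "ts ! i \<in> insert t0 T" if "i \<le> m" for i using mem that unfolding ts by (cases i) auto
  have lt: "ts ! i < ts ! Suc i" if "i < m" for i
    using strict_sorted_list_of_set[of "insert t0 T"] that len ts unfolding ts_def[symmetric]
    by (intro sorted_wrt_nth_less[of "(<)" ts]) auto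
  have "(\<Sum>S\<in>interlacing_sets (insert t0 T). (\<Prod>s\<in>S. v s) * vand y S)
    = (\<Sum>S\<in>interlacing_sets (insert t0 T). (\<Prod>s\<in>S. v s) * det (mat m m (\<lambda>(i, j). y (sorted_list_of_set S ! i) ^ j)))"
  proof (rule sum.cong[OF refl])
    fix S assume "S \<in> interlacing_sets (insert t0 T)"
    then have S: "card S = m" "finite S" using card_interlacing[of S "insert t0 T"] T(1) t0 unfolding m_def by auto
    have "det (mat m m (\<lambda>(i, j). y (sorted_list_of_set S ! i) ^ j)) = vand y S"
      using det_poly_scaled[of m "\<lambda>j. monom 1 j" "\<lambda>_. 1" "\<lambda>i. y (sorted_list_of_set S ! i)"] S vand_nth[OF S(2), of y]
      by (simp add: poly_monom degree_monom_eq)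
    then show "(\<Prod>s\<in>S. v s) * vand y S = (\<Prod>s\<in>S. v s) * det (mat m m (\<lambda>(i, j). y (sorted_list_of_set S ! i) ^ j))" by simp
  qed
  also have "\<dots> = det (mat m m (\<lambda>(i, j). \<Sum>s\<in>{s. ts ! i < s \<and> s < ts ! Suc i \<and> odd (s - ts ! i)}. v s * y s ^ j))"
    unfolding ts_def
  proof (rule sum_interlacing_sets_det[where h = "\<lambda>j s. y s ^ j"])
    show "card (insert t0 T) = Suc m" using T(1) t0 by (simp add: m_def)
  qed (use T(1) par' in blast)+
  also have "\<dots> = det (mat m m (\<lambda>(i, j). \<Psi> j (ts ! Suc i) - \<Psi> j (ts ! i)))"
  proof (rule arg_cong[where f = det], rule cong_mat, simp, simp, clarsimp)
    fix i j assume ij: "i < m" "j < m"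
    have "(\<Sum>s\<in>{s. ts ! i < s \<and> s < ts ! Suc i \<and> odd (s - ts ! i)}. v s * y s ^ j) = \<Psi> j (ts ! Suc i) - \<Psi> j (ts ! i)"
      using tele[of j] ij sum_telescope_odd[of "ts ! i" "ts ! Suc i" "\<Psi> j"] lt[OF ij(1)] par'[OF mem0 mem0, of "Suc i" i]
      unfolding m_def by simp
    then show "(\<Sum>s | ts ! i < s \<and> s < ts ! Suc i \<and> even s = odd (ts ! i). v s * y s ^ j) = \<Psi> j (ts ! Suc i) - \<Psi> j (ts ! i)" by simp
  qed
  also have "\<dots> = det (mat m m (\<lambda>(i, j). \<Psi> j (ts ! Suc i) - \<Psi> j (ts ! 0)))"
    by (rule det_row_differences[of m "\<lambda>i j. \<Psi> j (ts ! i)"])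
  also have "\<dots> = det (mat m m (\<lambda>(i, j). u (ts' ! i) * poly (P j) (z (ts' ! i))))"
    by (rule arg_cong[where f = det], rule cong_mat) (use \<Psi> in \<open>auto simp: ts m_def\<close>)
  also have "\<dots> = (\<Prod>i<m. u (ts' ! i)) * (\<Prod>j<m. lead_coeff (P j)) * vand z T"
    using deg vand_nth[OF T(1), of z] unfolding m_def ts'_def by (subst det_poly_scaled) auto
  also have "(\<Prod>i<m. u (ts' ! i)) = (\<Prod>t\<in>T. u t)"
    using bij_betw_nth[of ts' "{..<m}" T] T(1) len unfolding ts'_def by (intro prod.reindex_bij_betw) simp
  finally show ?thesis unfolding m_def .
qed

context
  fixes q :: "'a::linordered_field"
  assumes q: "q > 0"
begin

text \<open>Each \<open>p j\<close> at \<open>z t\<close> minus its value at \<open>z t0\<close> is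
  divisible by \<open>z t - z t0\<close>. The quotients have the right degrees and the same leading
  coefficients, and the split-off factors are precisely what completes the Vandermonde product of
  the other dents to that of T.\<close>

lemma sum_interlacing_with_polys:
  fixes z v y :: "int \<Rightarrow> 'a"
  assumes p: "\<And>j. degree (p j) = Suc j" "\<And>j t. poly (p j) (z (t + 1)) - poly (p j) (z (t - 1)) = v t * y t ^ j"
    and T: "finite T" "T \<noteq> {}" "\<And>t t'. t \<in> T \<Longrightarrow> t' \<in> T \<Longrightarrow> even (t - t')"
  shows "(\<Sum>S\<in>interlacing_sets T. (\<Prod>s\<in>S. v s) * vand y S) = (\<Prod>j<card T - 1. lead_coeff (p j)) * vand z T"
proof -
  define t0 where "t0 = Min T"
  define T' where "T' = T - {t0}"
  have T': "T = insert t0 T'" "finite T'" "t0 \<notin> T'" "\<And>t. t \<in> T' \<Longrightarrow> t0 < t"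
    using Min_in[OF T(1,2)] Min_le[OF T(1)] T(1) unfolding T'_def t0_def by (auto simp: less_le)
  define Q where "Q j = synthetic_div (p j) (z t0)" for j
  have Q: "poly (p j) (z t) - poly (p j) (z t0) = (z t - z t0) * poly (Q j) (z t)" for j t
  proof -
    have "p j + smult (z t0) (Q j) = pCons (poly (p j) (z t0)) (Q j)"
      unfolding Q_def by (rule synthetic_div_correct)
    then have "poly (p j + smult (z t0) (Q j)) (z t) = poly (pCons (poly (p j) (z t0)) (Q j)) (z t)" by simp
    then show ?thesis by (simp add: algebra_simps)
  qed
  have degQ: "degree (Q j) = j" for j unfolding Q_def using p(1) by (simp add: degree_synthetic_div)
  have leadQ: "lead_coeff (Q j) = lead_coeff (p j)" for j
  proof -
    have "p j + smult (z t0) (Q j) = pCons (poly (p j) (z t0)) (Q j)"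
      unfolding Q_def by (rule synthetic_div_correct)
    then have "coeff (p j + smult (z t0) (Q j)) (Suc j) = coeff (pCons (poly (p j) (z t0)) (Q j)) (Suc j)" by simp
    then show ?thesis using p(1) degQ by (simp add: coeff_eq_0)
  qed
  have "(\<Sum>S\<in>interlacing_sets (insert t0 T'). (\<Prod>s\<in>S. v s) * vand y S)
    = (\<Prod>t\<in>T'. z t - z t0) * (\<Prod>j<card T'. lead_coeff (Q j)) * vand z T'"
    by (rule sum_interlacing_vand[where \<Psi> = "\<lambda>j t. poly (p j) (z t)"]) (use T' T(3) p Q degQ in auto)
  also have "\<dots> = (\<Prod>j<card T - 1. lead_coeff (p j)) * vand z T"
    using T' by (simp add: leadQ vand_insert_min)
  finally show ?thesis using T'(1) by simp
qed

text \<open>C is chosen before T, so it depends on the number of dents only. This allows constants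
  to be carried along without ever being computed.\<close>

lemma sum_interlacing_full:
  "\<exists>C>0. \<forall>T. finite T \<longrightarrow> card T = Suc m \<longrightarrow> (\<forall>t\<in>T. \<forall>t'\<in>T. even (t - t')) \<longrightarrow>
     (\<Sum>S\<in>interlacing_sets T. (\<Prod>s\<in>S. lozenge_weight q s) * vand (qint q) S) = C * vand (qint q) T"
proof -
  obtain p where p: "\<And>j. degree (p j) = Suc j" "\<And>j. lead_coeff (p j) > 0"
    "\<And>j t. poly (p j) (qint q (t + 1)) - poly (p j) (qint q (t - 1)) = lozenge_weight q t * qint q t ^ j"
    using telescoping_full[OF q] by metis
  have "(\<Prod>j<m. lead_coeff (p j)) > 0" using p(2) by (intro prod_pos) auto
  moreover have "(\<Sum>S\<in>interlacing_sets T. (\<Prod>s\<in>S. lozenge_weight q s) * vand (qint q) S) = (\<Prod>j<m. lead_coeff (p j)) * vand (qint q) T"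
    if "finite T" "card T = Suc m" "\<forall>t\<in>T. \<forall>t'\<in>T. even (t - t')" for T
  proof -
    have "T \<noteq> {}" using that by auto
    have "(\<Sum>S\<in>interlacing_sets T. (\<Prod>s\<in>S. lozenge_weight q s) * vand (qint q) S)
      = (\<Prod>j<card T - 1. lead_coeff (p j)) * vand (qint q) T"
      by (rule sum_interlacing_with_polys[OF p(1,3)]) (use that \<open>T \<noteq> {}\<close> in blast)+
    then show ?thesis using that(2) by (simp only: diff_Suc_1)
  qed
  ultimately show ?thesis by blast
qed

lemma sum_interlacing_odd:
  "\<exists>C>0. \<forall>T. finite T \<longrightarrow> card T = Suc m \<longrightarrow> (\<forall>t\<in>T. \<forall>t'\<in>T. even (t - t')) \<longrightarrow>
     (\<Sum>S\<in>interlacing_sets T. (\<Prod>s\<in>S. lozenge_weight q s) * ((\<Prod>s\<in>S. qint q s) * vand (\<lambda>s. (qint q s)\<^sup>2) S)) = C * vand (\<lambda>s. (qint q s)\<^sup>2) T"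
proof -
  obtain p where p: "\<And>j. degree (p j) = Suc j" "\<And>j. lead_coeff (p j) > 0"
    "\<And>j t. poly (p j) ((qint q (t + 1))\<^sup>2) - poly (p j) ((qint q (t - 1))\<^sup>2) = lozenge_weight q t * qint q t * ((qint q t)\<^sup>2) ^ j"
    using telescoping_odd[OF q] by metis
  have "(\<Prod>j<m. lead_coeff (p j)) > 0" using p(2) by (intro prod_pos) auto
  moreover have "(\<Sum>S\<in>interlacing_sets T. (\<Prod>s\<in>S. lozenge_weight q s) * ((\<Prod>s\<in>S. qint q s) * vand (\<lambda>s. (qint q s)\<^sup>2) S)) = (\<Prod>j<m. lead_coeff (p j)) * vand (\<lambda>s. (qint q s)\<^sup>2) T"
    if "finite T" "card T = Suc m" "\<forall>t\<in>T. \<forall>t'\<in>T. even (t - t')" for T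
  proof -
    have "T \<noteq> {}" using that by auto
    have "(\<Sum>S\<in>interlacing_sets T. (\<Prod>s\<in>S. lozenge_weight q s * qint q s) * vand (\<lambda>s. (qint q s)\<^sup>2) S)
      = (\<Prod>j<card T - 1. lead_coeff (p j)) * vand (\<lambda>s. (qint q s)\<^sup>2) T"
      by (rule sum_interlacing_with_polys[OF p(1,3)]) (use that \<open>T \<noteq> {}\<close> in blast)+
    then show ?thesis using that(2) by (simp only: prod.distrib mult.assoc diff_Suc_1)
  qed
  ultimately show ?thesis by blast
qed

text \<open>The smallest dent is 0, where the antiderivatives x p(x^2) vanish. No subtraction is
  left to factor out, and each row keeps its linear factor \<open>qint q t\<close>.\<close>

lemma sum_interlacing_even:
  "\<exists>C>0. \<forall>T. finite T \<longrightarrow> card T = m \<longrightarrow> (\<forall>t\<in>T. even t \<and> 0 < t) \<longrightarrow>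
     (\<Sum>S\<in>interlacing_sets (insert 0 T). (\<Prod>s\<in>S. lozenge_weight q s) * vand (\<lambda>s. (qint q s)\<^sup>2) S) = C * ((\<Prod>t\<in>T. qint q t) * vand (\<lambda>s. (qint q s)\<^sup>2) T)"
proof -
  obtain p where p: "\<And>j. degree (p j) = j" "\<And>j. lead_coeff (p j) > 0"
    "\<And>j t. qint q (t + 1) * poly (p j) ((qint q (t + 1))\<^sup>2) - qint q (t - 1) * poly (p j) ((qint q (t - 1))\<^sup>2) = lozenge_weight q t * ((qint q t)\<^sup>2) ^ j"
    using telescoping_even[OF q] by metis
  have "(\<Prod>j<m. lead_coeff (p j)) > 0" using p(2) by (intro prod_pos) auto
  moreover have "(\<Sum>S\<in>interlacing_sets (insert 0 T). (\<Prod>s\<in>S. lozenge_weight q s) * vand (\<lambda>s. (qint q s)\<^sup>2) S) = (\<Prod>j<m. lead_coeff (p j)) * ((\<Prod>t\<in>T. qint q t) * vand (\<lambda>s. (qint q s)\<^sup>2) T)"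
    if "finite T" "card T = m" "\<forall>t\<in>T. even t \<and> 0 < t" for T
  proof -
    have "(\<Sum>S\<in>interlacing_sets (insert 0 T). (\<Prod>s\<in>S. lozenge_weight q s) * vand (\<lambda>s. (qint q s)\<^sup>2) S)
      = (\<Prod>t\<in>T. qint q t) * (\<Prod>j<card T. lead_coeff (p j)) * vand (\<lambda>s. (qint q s)\<^sup>2) T"
    proof (rule sum_interlacing_vand)
      fix j s
      show "qint q (s + 1) * poly (p j) ((qint q (s + 1))\<^sup>2) - qint q (s - 1) * poly (p j) ((qint q (s - 1))\<^sup>2) = lozenge_weight q s * ((qint q s)\<^sup>2) ^ j"
        by (rule p(3))
      show "qint q s * poly (p j) ((qint q s)\<^sup>2) - qint q 0 * poly (p j) ((qint q 0)\<^sup>2) = qint q s * poly (p j) ((qint q s)\<^sup>2)"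
        by simp
    qed (use that p in auto)
    then show ?thesis using that(2) by (simp only: mult_ac)
  qed
  ultimately show ?thesis by blast
qed

end

section \<open>Tilings of trapezoids with dents\<close>

lemma interlacing_bounds:
  assumes T: "finite T" and S: "S \<in> interlacing_sets T" and s: "s \<in> S"
  obtains t t' where "t \<in> T" "t' \<in> T" "t < s" "s < t'"
proof -
  let ?ts = "sorted_list_of_set T" and ?ss = "sorted_list_of_set S"
  have il: "interlaced ?ts ?ss" and fin: "finite S" using S unfolding interlacing_sets_def by auto
  obtain i where i: "i < length ?ss" "s = ?ss ! i" using s fin by (metis in_set_conv_nth set_sorted_list_of_set)
  have len: "length ?ts = Suc (length ?ss)" and lt: "?ts ! i < s" "s < ?ts ! Suc i"
    using il i unfolding interlaced_iff_nth by auto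
  have "?ts ! i \<in> set ?ts" "?ts ! Suc i \<in> set ?ts" using i(1) len by (auto intro!: nth_mem simp del: set_sorted_list_of_set)
  then show thesis using that lt T by simp
qed

lemma Mq_column:
  assumes "finite T" "finite S" "lo \<le> hi" "even (hi - lo)"
    and T: "\<And>t. t \<in> T \<Longrightarrow> lo \<le> t \<and> t \<le> hi \<and> even (t - lo)"
    and S: "\<And>s. s \<in> S \<Longrightarrow> lo \<le> s \<and> s \<le> hi \<and> odd (s - lo)"
  shows "Mq q ({c} \<times> ({lo..hi} - T - S)) = (if S \<in> interlacing_sets T then 1 else 0)"
proof -
  have "odd (s - t)" if "s \<in> S" "t \<in> T" for s t
  proof -
    have "odd (s - lo)" "even (t - lo)" using that S T by auto
    then show ?thesis by presburger
  qed
  then have "S \<in> interlacing_sets T \<longleftrightarrow> interlaced (sorted_list_of_set T) (sorted_list_of_set S)"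
    using assms(2) unfolding interlacing_sets_def by auto
  then show ?thesis
    using Mq_column_interlaced[of "sorted_list_of_set T" "sorted_list_of_set S" lo hi q c] assms by simp
qed

text \<open>The long side lies on the line p from i-coordinate - b to t; the upper and lower
  boundaries approach each other by one unit each per column.\<close>

definition right_trapezoid :: "int \<Rightarrow> nat \<Rightarrow> int \<Rightarrow> int \<Rightarrow> cell set" where
  "right_trapezoid p n b t = {(c, j). p \<le> c \<and> c < p + int n \<and> - b + (c - p) < j \<and> j < t - (c - p)}"

lemma finite_right_trapezoid [simp]: "finite (right_trapezoid p n b t)"
  by (rule finite_subset[of _ "{p..p + int n} \<times> {- b..t}"]) (auto simp: right_trapezoid_def)

lemma finite_int_interval_subset: "(\<And>x. x \<in> X \<Longrightarrow> a \<le> x \<and> x \<le> b) \<Longrightarrow> finite X" for X :: "int set"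
  by (rule finite_subset[of _ "{a..b}"]) auto

text \<open>The part of the left trapezoid above row 0, which the intrusion occupies. It widens to
  the right, so its columns are peeled off from the right.\<close>

definition upper_trapezoid :: "nat \<Rightarrow> int \<Rightarrow> cell set" where
  "upper_trapezoid p s = {(c, j). 0 \<le> c \<and> c < int p \<and> 1 \<le> j \<and> j \<le> s + c}"

lemma finite_upper_trapezoid [simp]: "finite (upper_trapezoid p s)"
  by (rule finite_subset[of _ "{0..int p} \<times> {0..s + int p}"]) (auto simp: upper_trapezoid_def)

text \<open>The symplectic analogue of \<open>vand\<close>; it counts tilings of the part of the left trapezoid above the intrusion.\<close>

definition sp_vand :: "'a::linordered_field \<Rightarrow> nat \<Rightarrow> int set \<Rightarrow> 'a" where
  "sp_vand q p T = (if odd p then \<Prod>t\<in>T. qint q t else 1) * vand (\<lambda>s. (qint q s)\<^sup>2) T"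

context
  fixes q :: "'a::linordered_field"
  assumes q: "q > 0"
begin

text \<open>Peel off the leftmost column: its dents W interlace with the set S crossed on the next
  line, and \<open>sum_interlacing_full\<close> sums the Vandermonde products of S. Every column
  uses up one dent, so any other number of dents gives 0. The bound on b + t keeps all columns
  nonempty.\<close>

lemma Mq_right_trapezoid:
  "\<exists>C>0. \<forall>p b t W. even (p - b) \<longrightarrow> even (p - t) \<longrightarrow> 2 * int n \<le> b + t \<longrightarrow>
     W \<subseteq> {j. (p, j) \<in> right_trapezoid p n b t \<and> odd (p + j)} \<longrightarrow>
     Mq q (right_trapezoid p n b t - {p} \<times> W) = (if card W = n then C * vand (qint q) W else 0)"
proof (induction n)
  case 0
  have "right_trapezoid p 0 b t = {}" for p b t unfolding right_trapezoid_def by auto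
  then show ?case by (intro exI[of _ 1]) (auto simp: vand_def)
next
  case (Suc n)
  then obtain C where C: "C > 0" and IH: "\<And>p b t W. even (p - b) \<Longrightarrow> even (p - t) \<Longrightarrow> 2 * int n \<le> b + t \<Longrightarrow>
     W \<subseteq> {j. (p, j) \<in> right_trapezoid p n b t \<and> odd (p + j)} \<Longrightarrow>
     Mq q (right_trapezoid p n b t - {p} \<times> W) = (if card W = n then C * vand (qint q) W else 0)" by auto
  obtain D where D: "D > 0" and sum: "\<And>T. finite T \<Longrightarrow> card T = Suc n \<Longrightarrow> \<forall>t\<in>T. \<forall>t'\<in>T. even (t - t') \<Longrightarrow>
     (\<Sum>S\<in>interlacing_sets T. (\<Prod>s\<in>S. lozenge_weight q s) * vand (qint q) S) = D * vand (qint q) T"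
    using sum_interlacing_full[OF q, of n] by blast
  have "Mq q (right_trapezoid p (Suc n) b t - {p} \<times> W) = (if card W = Suc n then C * D * vand (qint q) W else 0)"
    if par: "even (p - b)" "even (p - t)" and wide: "2 * int (Suc n) \<le> b + t"
      and W: "W \<subseteq> {j. (p, j) \<in> right_trapezoid p (Suc n) b t \<and> odd (p + j)}" for p b t W
  proof -
    let ?lo = "- b + 1" and ?hi = "t - 1"
    let ?A = "{p} \<times> ({?lo..?hi} - W)" and ?B = "right_trapezoid (p + 1) n (b - 1) (t - 1)"
    let ?V = "{j. (p + 1 - 1, j) \<in> ?A \<and> (p + 1, j) \<in> ?B \<and> odd (p + 1 + j)}"
    have Wb: "?lo \<le> w \<and> w \<le> ?hi \<and> odd (p + w)" if "w \<in> W" for w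
      using W that by (auto simp: right_trapezoid_def)
    have finW: "finite W" using Wb by (intro finite_int_interval_subset[of W ?lo ?hi]) auto
    have eq: "right_trapezoid p (Suc n) b t - {p} \<times> W = ?A \<union> ?B"
      unfolding right_trapezoid_def by auto
    have finV: "finite ?V" by (intro finite_int_interval_subset[of _ ?lo ?hi]) auto
    \<comment> \<open>Interlacing sets lie strictly between dents of W, hence inside the next
      column. So the sum over subsets of V becomes the full sum over
      \<open>interlacing_sets W\<close>.\<close>
    have IL: "interlacing_sets W \<subseteq> Pow ?V" if "card W = Suc n"
    proof
      fix S assume S: "S \<in> interlacing_sets W"
      show "S \<in> Pow ?V"
      proof (rule PowI, rule subsetI)
        fix s assume s: "s \<in> S"
        obtain t1 t2 where t: "t1 \<in> W" "t2 \<in> W" "t1 < s" "s < t2" using interlacing_bounds[OF finW S s] .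
        have "card S = n" "finite S" using card_interlacing[OF S] that by auto
        then have "n > 0" using s by (auto simp: card_gt_0_iff)
        have "odd (s - t1)" "odd (p + t1)" using S s t Wb unfolding interlacing_sets_def by auto
        then have ev: "even (p + s)" by presburger
        then have "s \<notin> W" using Wb by auto
        then show "s \<in> ?V" using t Wb[OF t(1)] Wb[OF t(2)] \<open>n > 0\<close> ev unfolding right_trapezoid_def by auto
      qed
    qed
    have "Mq q (right_trapezoid p (Suc n) b t - {p} \<times> W)
      = (\<Sum>S\<in>Pow ?V. (\<Prod>s\<in>S. lozenge_weight q s) * (Mq q (?A - {p + 1 - 1} \<times> S) * Mq q (?B - {p + 1} \<times> S)))"
      unfolding eq
    proof (rule Mq_split)
      show "p + 1 \<le> c" if "(c, j) \<in> ?B" for c j using that unfolding right_trapezoid_def by simp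
    qed auto
    also have "\<dots> = (\<Sum>S\<in>Pow ?V. if S \<in> interlacing_sets W \<and> card S = n then (\<Prod>s\<in>S. lozenge_weight q s) * (C * vand (qint q) S) else 0)"
    proof (rule sum.cong[OF refl])
      fix S assume S: "S \<in> Pow ?V"
      then have Sb: "?lo \<le> s \<and> s \<le> ?hi \<and> odd (p + 1 + s)" if "s \<in> S" for s using that by auto
      have finS: "finite S" using S finV by (meson PowD finite_subset)
      have "Mq q ({p} \<times> ({?lo..?hi} - W - S)) = (if S \<in> interlacing_sets W then 1 else 0)"
      proof (rule Mq_column[OF finW finS])
        show "?lo \<le> ?hi" using wide by simp
        show "even (?hi - ?lo)" using par by presburger
        show "?lo \<le> w \<and> w \<le> ?hi \<and> even (w - ?lo)" if "w \<in> W" for w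
        proof -
          have "even (w - ?lo)" using Wb[OF that] par by presburger
          then show ?thesis using Wb[OF that] by simp
        qed
        show "?lo \<le> s \<and> s \<le> ?hi \<and> odd (s - ?lo)" if "s \<in> S" for s
        proof -
          have "odd (s - ?lo)" using Sb[OF that] par by presburger
          then show ?thesis using Sb[OF that] by simp
        qed
      qed
      moreover have "?A - {p + 1 - 1} \<times> S = {p} \<times> ({?lo..?hi} - W - S)" by auto
      moreover have "Mq q (?B - {p + 1} \<times> S) = (if card S = n then C * vand (qint q) S else 0)"
        by (rule IH) (use par wide S in auto)
      ultimately show "(\<Prod>s\<in>S. lozenge_weight q s) * (Mq q (?A - {p + 1 - 1} \<times> S) * Mq q (?B - {p + 1} \<times> S))
         = (if S \<in> interlacing_sets W \<and> card S = n then (\<Prod>s\<in>S. lozenge_weight q s) * (C * vand (qint q) S) else 0)"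
        by simp
    qed
    also have "\<dots> = (if card W = Suc n then C * D * vand (qint q) W else 0)"
    proof (cases "card W = Suc n")
      case True
      have "(\<Sum>S\<in>Pow ?V. if S \<in> interlacing_sets W \<and> card S = n then (\<Prod>s\<in>S. lozenge_weight q s) * (C * vand (qint q) S) else 0)
        = (\<Sum>S\<in>interlacing_sets W. (\<Prod>s\<in>S. lozenge_weight q s) * (C * vand (qint q) S))"
        by (rule sum.mono_neutral_cong_right) (use finV IL[OF True] card_interlacing True in auto)
      also have "\<dots> = C * (\<Sum>S\<in>interlacing_sets W. (\<Prod>s\<in>S. lozenge_weight q s) * vand (qint q) S)"
        by (simp add: sum_distrib_left mult_ac)
      also have "\<dots> = C * (D * vand (qint q) W)"
      proof (subst sum[OF finW True])
        show "\<forall>t\<in>W. \<forall>t'\<in>W. even (t - t')"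
        proof (intro ballI)
          fix t t' assume "t \<in> W" "t' \<in> W"
          then have "odd (p + t)" "odd (p + t')" using Wb by auto
          then show "even (t - t')" by presburger
        qed
      qed simp
      finally show ?thesis using True by (simp add: mult.assoc)
    next
      case False
      then have "\<not> (S \<in> interlacing_sets W \<and> card S = n)" for S using card_interlacing[of S W] by auto
      then show ?thesis using False by (intro trans[OF sum.neutral]) auto
    qed
    finally show ?thesis .
  qed
  moreover have "C * D > 0" using C D by simp
  ultimately show ?case by blast
qed

text \<open>As on the right, one column is peeled at a time, but now the number of dents grows only
  with every second column, because in the others the missing cell of row 0 plays the part of a
  dent.\<close>

lemma Mq_upper_trapezoid:
  "\<exists>C>0. \<forall>s T. 0 \<le> s \<longrightarrow> even s \<longrightarrow> T \<subseteq> {j. (int p - 1, j) \<in> upper_trapezoid p s \<and> odd (int p + j)} \<longrightarrow>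
     Mq q (upper_trapezoid p s - {int p - 1} \<times> T) = (if card T = p div 2 then C * sp_vand q p T else 0)"
proof (induction p)
  case 0
  have "upper_trapezoid 0 s = {}" for s unfolding upper_trapezoid_def by auto
  then show ?case by (intro exI[of _ 1]) (auto simp: vand_def sp_vand_def)
next
  case (Suc p)
  then obtain C where C: "C > 0" and IH: "\<And>s T. 0 \<le> s \<Longrightarrow> even s \<Longrightarrow> T \<subseteq> {j. (int p - 1, j) \<in> upper_trapezoid p s \<and> odd (int p + j)} \<Longrightarrow>
     Mq q (upper_trapezoid p s - {int p - 1} \<times> T) = (if card T = p div 2 then C * sp_vand q p T else 0)" by auto
  \<comment> \<open>\<open>Mq_column\<close> wants both ends of the column to have the parity of the
    dents. For odd p the interval from 1 to s + p has this form; for even p it is prolonged to 0,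
    and the cell there, absent from the region, is entered as a dent.\<close>
  define G where "G T = (if odd p then T else insert 0 T)" for T :: "int set"
  have "\<exists>D>0. \<forall>T. finite T \<longrightarrow> card T = Suc p div 2 \<longrightarrow> (\<forall>t\<in>T. even (int p + t) \<and> 0 < t) \<longrightarrow>
     (\<Sum>S\<in>interlacing_sets (G T). (\<Prod>s\<in>S. lozenge_weight q s) * sp_vand q p S) = D * sp_vand q (Suc p) T"
  proof (cases "odd p")
    case True
    then have m: "Suc p div 2 = Suc (p div 2)" by presburger
    have "even (t - t')" if "even (int p + t)" "even (int p + t')" for t t' using that by presburger
    then show ?thesis
      using sum_interlacing_odd[OF q, of "p div 2"] True unfolding G_def m sp_vand_def
      by simp meson
  next
    case False
    then have m: "Suc p div 2 = p div 2" by presburger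
    have "even (int p + t) \<longleftrightarrow> even t" for t using False by simp
    then show ?thesis
      using sum_interlacing_even[OF q, of "p div 2"] False unfolding G_def m sp_vand_def by simp
  qed
  then obtain D where D: "D > 0" and sum: "\<And>T. finite T \<Longrightarrow> card T = Suc p div 2 \<Longrightarrow> (\<forall>t\<in>T. even (int p + t) \<and> 0 < t) \<Longrightarrow>
     (\<Sum>S\<in>interlacing_sets (G T). (\<Prod>s\<in>S. lozenge_weight q s) * sp_vand q p S) = D * sp_vand q (Suc p) T"
    by blast
  have "Mq q (upper_trapezoid (Suc p) s - {int (Suc p) - 1} \<times> T) = (if card T = Suc p div 2 then C * D * sp_vand q (Suc p) T else 0)"
    if s: "0 \<le> s" "even s" and T: "T \<subseteq> {j. (int (Suc p) - 1, j) \<in> upper_trapezoid (Suc p) s \<and> odd (int (Suc p) + j)}" for s T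
  proof -
    let ?lo = "if odd p then 1 else 0 :: int" and ?hi = "s + int p"
    let ?A = "upper_trapezoid p s" and ?B = "{int p} \<times> ({1..?hi} - T)"
    let ?V = "{j. (int p - 1, j) \<in> ?A \<and> (int p, j) \<in> ?B \<and> odd (int p + j)}"
    have Tb: "1 \<le> w \<and> w \<le> ?hi \<and> even (int p + w)" if "w \<in> T" for w
      using T that by (auto simp: upper_trapezoid_def)
    have finT: "finite T" using Tb by (intro finite_int_interval_subset[of T 1 ?hi]) auto
    have finG: "finite (G T)" using finT unfolding G_def by auto
    have "0 \<notin> T" using Tb by force
    then have cardG: "card (G T) = Suc (p div 2) \<longleftrightarrow> card T = Suc p div 2"
      using finT unfolding G_def by (cases "odd p") (auto elim!: oddE evenE)
    have Gb: "?lo \<le> w \<and> w \<le> ?hi \<and> even (w - ?lo)" if "w \<in> G T" for w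
    proof (cases "w \<in> T")
      case True
      have "even (w - ?lo)" using Tb[OF True] by (cases "odd p") auto
      then show ?thesis using Tb[OF True] by auto
    next
      case False
      then have "w = 0" "even p" using that unfolding G_def by (auto split: if_splits)
      then show ?thesis using s by simp
    qed
    have eq: "upper_trapezoid (Suc p) s - {int (Suc p) - 1} \<times> T = ?A \<union> ?B"
      unfolding upper_trapezoid_def by auto
    have finV: "finite ?V" by (intro finite_int_interval_subset[of _ 1 ?hi]) auto
    have IL: "interlacing_sets (G T) \<subseteq> Pow ?V" if "card T = Suc p div 2"
    proof
      fix S assume S: "S \<in> interlacing_sets (G T)"
      show "S \<in> Pow ?V"
      proof (rule PowI, rule subsetI)
        fix r assume r: "r \<in> S"
        obtain t1 t2 where t: "t1 \<in> G T" "t2 \<in> G T" "t1 < r" "r < t2" using interlacing_bounds[OF finG S r] .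
        have "card S = p div 2" "finite S" using card_interlacing[OF S] that cardG by auto
        then have "p > 0" using r by (auto simp: card_gt_0_iff intro: Nat.gr0I)
        have "odd (r - t1)" using S r t unfolding interlacing_sets_def by auto
        then have od: "odd (int p + r)" using Gb[OF t(1)] by (cases "odd p") auto
        then have "r \<notin> T" using Tb by auto
        then show "r \<in> ?V" using t Gb[OF t(1)] Gb[OF t(2)] \<open>p > 0\<close> od unfolding upper_trapezoid_def by (auto split: if_splits)
      qed
    qed
    have "Mq q (upper_trapezoid (Suc p) s - {int (Suc p) - 1} \<times> T)
      = (\<Sum>S\<in>Pow ?V. (\<Prod>s\<in>S. lozenge_weight q s) * (Mq q (?A - {int p - 1} \<times> S) * Mq q (?B - {int p} \<times> S)))"
      unfolding eq
    proof (rule Mq_split)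
      show "c < int p" if "(c, j) \<in> ?A" for c j using that unfolding upper_trapezoid_def by simp
    qed auto
    also have "\<dots> = (\<Sum>S\<in>Pow ?V. if S \<in> interlacing_sets (G T) \<and> card S = p div 2 then (\<Prod>s\<in>S. lozenge_weight q s) * (C * sp_vand q p S) else 0)"
    proof (rule sum.cong[OF refl])
      fix S assume S: "S \<in> Pow ?V"
      then have Sb: "1 \<le> r \<and> r \<le> ?hi \<and> odd (int p + r)" if "r \<in> S" for r using that by auto
      have finS: "finite S" using S finV by (meson PowD finite_subset)
      have "Mq q ({int p} \<times> ({?lo..?hi} - G T - S)) = (if S \<in> interlacing_sets (G T) then 1 else 0)"
      proof (rule Mq_column[OF finG finS _ _ Gb])
        show "?lo \<le> ?hi" using s by (auto elim!: oddE)
        show "even (?hi - ?lo)" using s by auto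
        show "?lo \<le> r \<and> r \<le> ?hi \<and> odd (r - ?lo)" if "r \<in> S" for r
          using Sb[OF that] by (cases "odd p") auto
      qed
      moreover have "?B - {int p} \<times> S = {int p} \<times> ({?lo..?hi} - G T - S)"
      proof -
        have "{1..?hi} - T - S = {?lo..?hi} - G T - S" unfolding G_def by auto
        moreover have "?B - {int p} \<times> S = {int p} \<times> ({1..?hi} - T - S)" by auto
        ultimately show ?thesis by (simp only:)
      qed
      moreover have "Mq q (?A - {int p - 1} \<times> S) = (if card S = p div 2 then C * sp_vand q p S else 0)"
        by (rule IH[OF s]) (use S in auto)
      ultimately show "(\<Prod>s\<in>S. lozenge_weight q s) * (Mq q (?A - {int p - 1} \<times> S) * Mq q (?B - {int p} \<times> S))
         = (if S \<in> interlacing_sets (G T) \<and> card S = p div 2 then (\<Prod>s\<in>S. lozenge_weight q s) * (C * sp_vand q p S) else 0)"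
        by simp
    qed
    also have "\<dots> = (if card T = Suc p div 2 then C * D * sp_vand q (Suc p) T else 0)"
    proof (cases "card T = Suc p div 2")
      case True
      have cS: "card S = p div 2" if "S \<in> interlacing_sets (G T)" for S
        using card_interlacing[OF that] True cardG by auto
      have "(\<Sum>S\<in>Pow ?V. if S \<in> interlacing_sets (G T) \<and> card S = p div 2 then (\<Prod>s\<in>S. lozenge_weight q s) * (C * sp_vand q p S) else 0)
        = (\<Sum>S\<in>interlacing_sets (G T). (\<Prod>s\<in>S. lozenge_weight q s) * (C * sp_vand q p S))"
        by (rule sum.mono_neutral_cong_right) (use finV IL[OF True] cS in auto)
      also have "\<dots> = C * (\<Sum>S\<in>interlacing_sets (G T). (\<Prod>s\<in>S. lozenge_weight q s) * sp_vand q p S)"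
        by (simp add: sum_distrib_left mult_ac)
      also have "\<dots> = C * (D * sp_vand q (Suc p) T)"
        by (subst sum[OF finT True]) (use Tb in \<open>force+\<close>)
      finally show ?thesis using True by (simp add: mult.assoc)
    next
      case False
      then have "\<not> (S \<in> interlacing_sets (G T) \<and> card S = p div 2)" for S using card_interlacing[of S "G T"] cardG by auto
      then show ?thesis using False by (intro trans[OF sum.neutral]) auto
    qed
    finally show ?thesis .
  qed
  moreover have "C * D > 0" using C D by simp
  ultimately show ?case by blast
qed

end

section \<open>The left half, cut in two by the intrusion\<close>

definition left_trapezoid :: "nat \<Rightarrow> int \<Rightarrow> cell set" where
  "left_trapezoid p s = {(c, j). 0 \<le> c \<and> c < int p \<and> \<bar>j\<bar> \<le> s + c \<and> j \<noteq> 0}"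

lemma finite_left_trapezoid [simp]: "finite (left_trapezoid p s)"
  by (rule finite_subset[of _ "{0..int p} \<times> {- (s + int p)..s + int p}"]) (auto simp: left_trapezoid_def)

abbreviation positives :: "int set \<Rightarrow> int set" where
  "positives T \<equiv> {t \<in> T. 0 < t}"

abbreviation negatives :: "int set \<Rightarrow> int set" where
  "negatives T \<equiv> {t. 0 < t \<and> - t \<in> T}"

text \<open>No lozenge reaches across the missing row 0, and reflection in that row turns the lower
  part into a second upper trapezoid.\<close>

lemma Mq_left_trapezoid_halves:
  "Mq q (left_trapezoid p s - {int p - 1} \<times> T)
    = Mq q (upper_trapezoid p s - {int p - 1} \<times> positives T) * Mq q (upper_trapezoid p s - {int p - 1} \<times> negatives T)"
proof -
  let ?U = "upper_trapezoid p s - {int p - 1} \<times> positives T"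
  let ?L = "upper_trapezoid p s - {int p - 1} \<times> negatives T"
  let ?L' = "(\<lambda>(c, j). (c, - j)) ` ?L"
  have "left_trapezoid p s - {int p - 1} \<times> T = ?U \<union> ?L'"
  proof (intro equalityI subsetI)
    fix x assume x: "x \<in> left_trapezoid p s - {int p - 1} \<times> T"
    obtain c j where cj: "x = (c, j)" by (cases x)
    show "x \<in> ?U \<union> ?L'"
    proof (cases "j > 0")
      case True
      then have "x \<in> ?U" using x unfolding cj left_trapezoid_def upper_trapezoid_def by auto
      then show ?thesis by blast
    next
      case False
      then have "(c, - j) \<in> ?L" using x unfolding cj left_trapezoid_def upper_trapezoid_def by auto
      then have "x \<in> ?L'" unfolding cj by (intro image_eqI[of _ _ "(c, - j)"]) auto
      then show ?thesis by blast
    qed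
  next
    fix x assume "x \<in> ?U \<union> ?L'"
    then show "x \<in> left_trapezoid p s - {int p - 1} \<times> T"
      unfolding left_trapezoid_def upper_trapezoid_def by auto
  qed
  moreover have "Mq q (?U \<union> ?L') = Mq q ?U * Mq q ?L'"
  proof -
    define U where "U = ?U"
    define L where "L = ?L'"
    have fin: "finite U" "finite L" unfolding U_def L_def by auto
    have U: "0 < j" if "(c, j) \<in> U" for c j using that by (auto simp: U_def upper_trapezoid_def)
    have L: "j < 0" if "(c, j) \<in> L" for c j using that by (auto simp: L_def upper_trapezoid_def)
    have "Mq q (U \<union> L) = Mq q U * Mq q L"
    proof (rule Mq_disconnected[OF fin])
      show "U \<inter> L = {}" using U L by fastforce
      fix l assume "l \<in> lozenges" and sub: "l \<subseteq> U \<union> L"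
      then show "l \<subseteq> U \<or> l \<subseteq> L"
      proof (cases rule: lozenge_cases)
        case (horizontal c n)
        then show ?thesis using sub U[of c n] L[of "c + 1" n] U[of "c + 1" n] L[of c n] by auto
      next
        case (vertical c n)
        then show ?thesis using sub U[of c n] L[of c "n + 1"] U[of c "n + 1"] L[of c n] by auto
      qed
    qed
    then show ?thesis unfolding U_def L_def .
  qed
  ultimately show ?thesis by (simp add: Mq_flip_vertical)
qed

section \<open>Vandermonde products of unions\<close>

lemma vand_insert_mono:
  fixes y :: "int \<Rightarrow> 'a::linordered_field"
  assumes T: "finite T" "t0 \<notin> T" and mono: "\<And>s t. s \<in> insert t0 T \<Longrightarrow> t \<in> insert t0 T \<Longrightarrow> s < t \<Longrightarrow> y s < y t"
  shows "vand y (insert t0 T) = vand y T * (\<Prod>t\<in>T. \<bar>y t0 - y t\<bar>)"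
proof -
  have A: "(\<Prod>s\<in>{s \<in> insert t0 T. s < t0}. y t0 - y s) = (\<Prod>t\<in>T. if t < t0 then y t0 - y t else 1)"
  proof -
    have "{s \<in> insert t0 T. s < t0} = {s \<in> T. s < t0}" by auto
    then show ?thesis using T(1) by (simp add: prod.If_cases Int_def)
  qed
  have B: "(\<Prod>s\<in>{s \<in> insert t0 T. s < t}. y t - y s) = (if t0 < t then y t - y t0 else 1) * (\<Prod>s\<in>{s \<in> T. s < t}. y t - y s)" if "t \<in> T" for t
  proof (cases "t0 < t")
    case True
    then have "{s \<in> insert t0 T. s < t} = insert t0 {s \<in> T. s < t}" by auto
    then show ?thesis using T True by simp
  next
    case False
    then have "{s \<in> insert t0 T. s < t} = {s \<in> T. s < t}" by auto
    then show ?thesis using False by simp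
  qed
  have C: "(if t < t0 then y t0 - y t else 1) * (if t0 < t then y t - y t0 else 1) = \<bar>y t0 - y t\<bar>" if "t \<in> T" for t
    using mono[of t t0] mono[of t0 t] that T(2) by (cases t t0 rule: linorder_cases) auto
  have "vand y (insert t0 T) = (\<Prod>s\<in>{s \<in> insert t0 T. s < t0}. y t0 - y s) * (\<Prod>t\<in>T. \<Prod>s\<in>{s \<in> insert t0 T. s < t}. y t - y s)"
    unfolding vand_def using T by (rule prod.insert)
  also have "(\<Prod>t\<in>T. \<Prod>s\<in>{s \<in> insert t0 T. s < t}. y t - y s) = (\<Prod>t\<in>T. (if t0 < t then y t - y t0 else 1) * (\<Prod>s\<in>{s \<in> T. s < t}. y t - y s))"
    by (rule prod.cong[OF refl B])
  also have "\<dots> = (\<Prod>t\<in>T. if t0 < t then y t - y t0 else 1) * vand y T" by (simp add: prod.distrib vand_def)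
  finally have "vand y (insert t0 T) = vand y T * (\<Prod>t\<in>T. (if t < t0 then y t0 - y t else 1) * (if t0 < t then y t - y t0 else 1))"
    unfolding A by (simp add: prod.distrib mult_ac)
  also have "(\<Prod>t\<in>T. (if t < t0 then y t0 - y t else 1) * (if t0 < t then y t - y t0 else 1)) = (\<Prod>t\<in>T. \<bar>y t0 - y t\<bar>)"
    by (rule prod.cong[OF refl C])
  finally show ?thesis .
qed

text \<open>As y increases, each mixed factor is positive in the orientation used by
  \<open>vand\<close>. Absolute values therefore describe it without regard to how T and Q are
  interspersed, and no signs have to be tracked.\<close>

lemma vand_union:
  fixes y :: "int \<Rightarrow> 'a::linordered_field"
  assumes "finite T" "finite Q" "T \<inter> Q = {}"
    and mono: "\<And>s t. s \<in> T \<union> Q \<Longrightarrow> t \<in> T \<union> Q \<Longrightarrow> s < t \<Longrightarrow> y s < y t"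
  shows "vand y (T \<union> Q) = vand y T * vand y Q * (\<Prod>t\<in>T. \<Prod>e\<in>Q. \<bar>y t - y e\<bar>)"
  using assms(1,3,4)
proof (induction T rule: finite_induct)
  case empty
  then show ?case by (simp add: vand_def)
next
  case (insert t T)
  have "vand y (insert t T \<union> Q) = vand y (T \<union> Q) * (\<Prod>s\<in>T \<union> Q. \<bar>y t - y s\<bar>)"
    using vand_insert_mono[of "T \<union> Q" t y] insert assms(2) by auto
  also have "(\<Prod>s\<in>T \<union> Q. \<bar>y t - y s\<bar>) = (\<Prod>s\<in>T. \<bar>y t - y s\<bar>) * (\<Prod>s\<in>Q. \<bar>y t - y s\<bar>)"
    using insert assms(2) by (intro prod.union_disjoint) auto
  also have "vand y (T \<union> Q) = vand y T * vand y Q * (\<Prod>t\<in>T. \<Prod>e\<in>Q. \<bar>y t - y e\<bar>)"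
    using insert by (intro insert.IH) auto
  finally have "vand y (insert t T \<union> Q) = vand y T * vand y Q * (\<Prod>t\<in>T. \<Prod>e\<in>Q. \<bar>y t - y e\<bar>)
      * ((\<Prod>s\<in>T. \<bar>y t - y s\<bar>) * (\<Prod>s\<in>Q. \<bar>y t - y s\<bar>))" .
  moreover have "vand y (insert t T) = vand y T * (\<Prod>s\<in>T. \<bar>y t - y s\<bar>)"
    using insert by (intro vand_insert_mono) auto
  ultimately show ?case using insert.hyps by (simp add: mult_ac)
qed

lemma vand_pos:
  fixes y :: "int \<Rightarrow> 'a::linordered_field"
  assumes mono: "\<And>s t. s \<in> T \<Longrightarrow> t \<in> T \<Longrightarrow> s < t \<Longrightarrow> y s < y t"
  shows "vand y T > 0"
  unfolding vand_def using mono by (intro prod_pos ballI) auto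

section \<open>Two trapezoids glued along an axis\<close>

text \<open>
  The constants depend on the number of columns only; they are never computed, as they cancel in
  all ratios.
\<close>

definition right_const :: "'a::linordered_field \<Rightarrow> nat \<Rightarrow> 'a" where
  "right_const q n = (SOME C. C > 0 \<and> (\<forall>p b t W. even (p - b) \<longrightarrow> even (p - t) \<longrightarrow> 2 * int n \<le> b + t \<longrightarrow>
     W \<subseteq> {j. (p, j) \<in> right_trapezoid p n b t \<and> odd (p + j)} \<longrightarrow>
     Mq q (right_trapezoid p n b t - {p} \<times> W) = (if card W = n then C * vand (qint q) W else 0)))"

definition upper_const :: "'a::linordered_field \<Rightarrow> nat \<Rightarrow> 'a" where
  "upper_const q p = (SOME C. C > 0 \<and> (\<forall>s T. 0 \<le> s \<longrightarrow> even s \<longrightarrow> T \<subseteq> {j. (int p - 1, j) \<in> upper_trapezoid p s \<and> odd (int p + j)} \<longrightarrow>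
     Mq q (upper_trapezoid p s - {int p - 1} \<times> T) = (if card T = p div 2 then C * sp_vand q p T else 0)))"

definition right_count :: "'a::linordered_field \<Rightarrow> nat \<Rightarrow> int set \<Rightarrow> 'a" where
  "right_count q n W = (if card W = n then right_const q n * vand (qint q) W else 0)"

definition left_count :: "'a::linordered_field \<Rightarrow> nat \<Rightarrow> int set \<Rightarrow> 'a" where
  "left_count q p T = (if card (positives T) = p div 2 \<and> card (negatives T) = p div 2
     then (upper_const q p)\<^sup>2 * sp_vand q p (positives T) * sp_vand q p (negatives T) else 0)"

definition two_sided :: "nat \<Rightarrow> nat \<Rightarrow> int \<Rightarrow> int \<Rightarrow> int \<Rightarrow> int set \<Rightarrow> int set \<Rightarrow> cell set" where
  "two_sided p n s b t L R =
     (left_trapezoid p s - {int p - 1} \<times> L) \<union> (right_trapezoid (int p) n b t - {int p} \<times> R)"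

definition left_axis :: "nat \<Rightarrow> int \<Rightarrow> int set" where
  "left_axis p s = {j. odd (int p + j) \<and> j \<noteq> 0 \<and> \<bar>j\<bar> < s + int p}"

definition right_axis :: "nat \<Rightarrow> int \<Rightarrow> int \<Rightarrow> int set" where
  "right_axis p b t = {j. odd (int p + j) \<and> - b < j \<and> j < t}"

lemma finite_axis [simp]: "finite (left_axis p s)" "finite (right_axis p b t)"
  by (rule finite_int_interval_subset[of _ "- (s + int p)" "s + int p"], auto simp: left_axis_def,
      rule finite_int_interval_subset[of _ "- b" t], auto simp: right_axis_def)

lemma finite_halves: "finite T \<Longrightarrow> finite (positives T)" "finite T \<Longrightarrow> finite (negatives T)"
  by (simp, rule finite_subset[of _ "uminus ` T"], auto simp: image_iff) (metis minus_minus)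

lemma card_halves_eq_0:
  assumes "finite T" "0 \<notin> T" "card (positives T) = 0" "card (negatives T) = 0"
  shows "T = {}"
proof -
  have "positives T = {}" "negatives T = {}" using assms finite_halves[of T] by auto
  then have "t \<notin> T" for t
    using assms(2) by (cases t "0::int" rule: linorder_cases) (auto dest: spec[of _ t] spec[of _ "- t"])
  then show ?thesis by auto
qed

lemma nonzero_halves:
  assumes "0 \<notin> T" shows "T = positives T \<union> uminus ` negatives T"
proof (intro equalityI subsetI)
  fix e assume e: "e \<in> T"
  then have "e \<noteq> 0" using assms by auto
  then show "e \<in> positives T \<union> uminus ` negatives T"
    using e by (cases "0 < e") (auto intro: image_eqI[of _ _ "- e"])
qed auto

lemma symmetric_minus_mem: "uminus ` Q = Q \<Longrightarrow> - e \<in> Q \<longleftrightarrow> e \<in> Q" for e :: int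
  by (metis image_iff minus_minus)

lemma card_symmetric:
  assumes "finite Q" "0 \<notin> Q" "uminus ` Q = Q"
  shows "card Q = 2 * card (positives Q)"
proof -
  have neg: "negatives Q = positives Q" using symmetric_minus_mem[OF assms(3)] by auto
  have "card Q = card (positives Q \<union> uminus ` positives Q)" using nonzero_halves[OF assms(2)] neg by simp
  also have "\<dots> = card (positives Q) + card (uminus ` positives Q)"
    by (rule card_Un_disjoint) (use assms(1) in auto)
  also have "card (uminus ` positives Q) = card (positives Q)" by (rule card_image) simp
  finally show ?thesis by simp
qed

context
  fixes q :: "'a::linordered_field"
  assumes q: "q > 0"
begin

lemma right_const: "right_const q n > 0"
  and Mq_right: "even (p - b) \<Longrightarrow> even (p - t) \<Longrightarrow> 2 * int n \<le> b + t \<Longrightarrow>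
     W \<subseteq> {j. (p, j) \<in> right_trapezoid p n b t \<and> odd (p + j)} \<Longrightarrow>
     Mq q (right_trapezoid p n b t - {p} \<times> W) = right_count q n W"
  using someI_ex[OF Mq_right_trapezoid[OF q, of n]] unfolding right_const_def[symmetric] right_count_def by blast+

lemma upper_const: "upper_const q p > 0"
  and Mq_upper: "0 \<le> s \<Longrightarrow> even s \<Longrightarrow> T \<subseteq> {j. (int p - 1, j) \<in> upper_trapezoid p s \<and> odd (int p + j)} \<Longrightarrow>
     Mq q (upper_trapezoid p s - {int p - 1} \<times> T) = (if card T = p div 2 then upper_const q p * sp_vand q p T else 0)"
  using someI_ex[OF Mq_upper_trapezoid[OF q, of p]] unfolding upper_const_def[symmetric] by blast+

lemma Mq_left:
  assumes "0 \<le> s" "even s" "T \<subseteq> {j. (int p - 1, j) \<in> left_trapezoid p s \<and> odd (int p + j)}"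
  shows "Mq q (left_trapezoid p s - {int p - 1} \<times> T) = left_count q p T"
proof -
  have "positives T \<subseteq> {j. (int p - 1, j) \<in> upper_trapezoid p s \<and> odd (int p + j)}"
    using assms(3) unfolding upper_trapezoid_def left_trapezoid_def by auto
  moreover have "negatives T \<subseteq> {j. (int p - 1, j) \<in> upper_trapezoid p s \<and> odd (int p + j)}"
    using assms(3) unfolding upper_trapezoid_def left_trapezoid_def by fastforce
  ultimately show ?thesis unfolding Mq_left_trapezoid_halves left_count_def
    using Mq_upper[OF assms(1,2)] by (simp add: power2_eq_square mult_ac)
qed

text \<open>\<open>left_axis\<close> and \<open>right_axis\<close> describe the axis by height
  alone, also when one half has no columns at all; this gives numerator and denominator the same
  index set for S later on.\<close>

lemma Mq_two_sided:
  assumes s: "0 \<le> s" "even s" and bt: "even (int p - b)" "even (int p - t)" "2 * int n \<le> b + t"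
    and L: "L \<subseteq> left_axis p s" "p = 0 \<Longrightarrow> L = {}" and R: "R \<subseteq> right_axis p b t" "n = 0 \<Longrightarrow> R = {}"
  shows "Mq q (two_sided p n s b t L R) = (\<Sum>S\<in>Pow (left_axis p s \<inter> right_axis p b t - L - R).
     (\<Prod>j\<in>S. lozenge_weight q j) * (left_count q p (L \<union> S) * right_count q n (R \<union> S)))"
proof -
  let ?A = "left_trapezoid p s - {int p - 1} \<times> L" and ?B = "right_trapezoid (int p) n b t - {int p} \<times> R"
  let ?V = "{j. (int p - 1, j) \<in> ?A \<and> (int p, j) \<in> ?B \<and> odd (int p + j)}"
  let ?W = "left_axis p s \<inter> right_axis p b t - L - R"
  have VW: "?V \<subseteq> ?W" unfolding left_axis_def right_axis_def left_trapezoid_def right_trapezoid_def by auto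
  have WV: "?W \<subseteq> ?V" if "p > 0" "n > 0"
    using that unfolding left_axis_def right_axis_def left_trapezoid_def right_trapezoid_def by auto
  have "Mq q (two_sided p n s b t L R)
      = (\<Sum>S\<in>Pow ?V. (\<Prod>j\<in>S. lozenge_weight q j) * (Mq q (?A - {int p - 1} \<times> S) * Mq q (?B - {int p} \<times> S)))"
    unfolding two_sided_def
  proof (rule Mq_split)
    show "c < int p" if "(c, j) \<in> ?A" for c j using that unfolding left_trapezoid_def by simp
    show "int p \<le> c" if "(c, j) \<in> ?B" for c j using that unfolding right_trapezoid_def by simp
  qed simp_all
  also have "\<dots> = (\<Sum>S\<in>Pow ?V. (\<Prod>j\<in>S. lozenge_weight q j) * (left_count q p (L \<union> S) * right_count q n (R \<union> S)))"
  proof (rule sum.cong[OF refl])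
    fix S assume "S \<in> Pow ?V"
    then have S: "S \<subseteq> ?V" by auto
    have Lp: "L \<subseteq> {j. (int p - 1, j) \<in> left_trapezoid p s \<and> odd (int p + j)}"
    proof (cases "p = 0")
      case False
      then show ?thesis using L(1) unfolding left_axis_def left_trapezoid_def by auto
    qed (use L in auto)
    have Rp: "R \<subseteq> {j. (int p, j) \<in> right_trapezoid (int p) n b t \<and> odd (int p + j)}"
    proof (cases "n = 0")
      case False
      then show ?thesis using R(1) unfolding right_axis_def right_trapezoid_def by auto
    qed (use R in auto)
    have "?A - {int p - 1} \<times> S = left_trapezoid p s - {int p - 1} \<times> (L \<union> S)" by auto
    then have "Mq q (?A - {int p - 1} \<times> S) = left_count q p (L \<union> S)"
      using Mq_left[OF s, of "L \<union> S" p] Lp S by auto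
    moreover have "?B - {int p} \<times> S = right_trapezoid (int p) n b t - {int p} \<times> (R \<union> S)" by auto
    then have "Mq q (?B - {int p} \<times> S) = right_count q n (R \<union> S)"
      using Mq_right[OF bt, of "R \<union> S"] Rp S by auto
    ultimately show "(\<Prod>j\<in>S. lozenge_weight q j) * (Mq q (?A - {int p - 1} \<times> S) * Mq q (?B - {int p} \<times> S))
       = (\<Prod>j\<in>S. lozenge_weight q j) * (left_count q p (L \<union> S) * right_count q n (R \<union> S))" by simp
  qed
  \<comment> \<open>If p or n is 0, there are no cells to be crossed although the axis set may be
    nonempty. The additional sets S then fail the cardinality tests and contribute 0.\<close>
  also have "\<dots> = (\<Sum>S\<in>Pow ?W. (\<Prod>j\<in>S. lozenge_weight q j) * (left_count q p (L \<union> S) * right_count q n (R \<union> S)))"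
  proof (rule sum.mono_neutral_left)
    show "\<forall>S\<in>Pow ?W - Pow ?V. (\<Prod>j\<in>S. lozenge_weight q j) * (left_count q p (L \<union> S) * right_count q n (R \<union> S)) = 0"
    proof
      fix S assume S: "S \<in> Pow ?W - Pow ?V"
      then have "S \<noteq> {}" by auto
      have fin: "finite S" using S by (auto intro: finite_subset[of S "left_axis p s"])
      have "p = 0 \<or> n = 0" using S WV by (cases "p = 0"; cases "n = 0") auto
      then show "(\<Prod>j\<in>S. lozenge_weight q j) * (left_count q p (L \<union> S) * right_count q n (R \<union> S)) = 0"
      proof
        assume p: "p = 0"
        then have "L = {}" using L by simp
        moreover have "0 \<notin> S" using S unfolding left_axis_def by auto
        ultimately have "\<not> (card (positives (L \<union> S)) = 0 \<and> card (negatives (L \<union> S)) = 0)"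
          using card_halves_eq_0[OF fin] \<open>S \<noteq> {}\<close> by auto
        then show ?thesis unfolding left_count_def p by auto
      next
        assume n: "n = 0"
        then have "card (R \<union> S) \<noteq> n" using R fin \<open>S \<noteq> {}\<close> by auto
        then show ?thesis unfolding right_count_def by simp
      qed
    qed
  qed (use VW in auto)
  finally show ?thesis .
qed

section \<open>Positivity of the counts\<close>

lemma qint_abs_diff_pos: "s \<noteq> t \<Longrightarrow> even (t - s) \<Longrightarrow> \<bar>qint q s - qint q t\<bar> > 0"
  using qint_less[OF q, of s t] qint_less[OF q, of t s] by (cases s t rule: linorder_cases) auto

lemma qint_sq_less: "0 < s \<Longrightarrow> s < t \<Longrightarrow> even (t - s) \<Longrightarrow> (qint q s)\<^sup>2 < (qint q t)\<^sup>2"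
  using qint_less[OF q, of s t] qint_pos[OF q, of s] by (intro power_strict_mono) auto

lemma right_count_nonneg: "(\<And>s t. s \<in> W \<Longrightarrow> t \<in> W \<Longrightarrow> even (t - s)) \<Longrightarrow> right_count q n W \<ge> 0"
  and right_count_pos: "(\<And>s t. s \<in> W \<Longrightarrow> t \<in> W \<Longrightarrow> even (t - s)) \<Longrightarrow> card W = n \<Longrightarrow> right_count q n W > 0"
proof -
  assume par: "\<And>s t. s \<in> W \<Longrightarrow> t \<in> W \<Longrightarrow> even (t - s)"
  have "vand (qint q) W > 0" by (rule vand_pos) (use par in \<open>blast intro: qint_less[OF q]\<close>)
  then have "right_const q n * vand (qint q) W > 0" using right_const[of n] by simp
  then show "right_count q n W \<ge> 0" "card W = n \<Longrightarrow> right_count q n W > 0"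
    unfolding right_count_def by auto
qed

lemma sp_vand_pos:
  assumes "\<And>s t. s \<in> T \<Longrightarrow> t \<in> T \<Longrightarrow> even (t - s)" "\<And>t. t \<in> T \<Longrightarrow> 0 < t"
  shows "sp_vand q p T > 0"
proof -
  have "(\<Prod>t\<in>T. qint q t) > 0" using qint_pos[OF q] assms(2) by (intro prod_pos) auto
  moreover have "vand (\<lambda>s. (qint q s)\<^sup>2) T > 0"
    by (rule vand_pos) (use assms in \<open>blast intro: qint_sq_less\<close>)
  ultimately show ?thesis unfolding sp_vand_def by auto
qed

lemma left_count_nonneg: "(\<And>s t. s \<in> T \<Longrightarrow> t \<in> T \<Longrightarrow> even (t - s)) \<Longrightarrow> left_count q p T \<ge> 0"
  and left_count_pos: "(\<And>s t. s \<in> T \<Longrightarrow> t \<in> T \<Longrightarrow> even (t - s)) \<Longrightarrow> card (positives T) = p div 2 \<Longrightarrow>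
    card (negatives T) = p div 2 \<Longrightarrow> left_count q p T > 0"
proof -
  assume par: "\<And>s t. s \<in> T \<Longrightarrow> t \<in> T \<Longrightarrow> even (t - s)"
  have par': "even (t - s)" if "s \<in> negatives T" "t \<in> negatives T" for s t
    using par[of "- s" "- t"] that by simp
  have "sp_vand q p (positives T) > 0" by (rule sp_vand_pos) (use par in auto)
  moreover have "sp_vand q p (negatives T) > 0" by (rule sp_vand_pos[OF par']) auto
  ultimately have pos: "(upper_const q p)\<^sup>2 * sp_vand q p (positives T) * sp_vand q p (negatives T) > 0"
    using upper_const[of p] by simp
  then show "left_count q p T \<ge> 0" unfolding left_count_def by simp
  show "left_count q p T > 0" if "card (positives T) = p div 2" "card (negatives T) = p div 2"
    using pos that unfolding left_count_def by simp
qed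

text \<open>All summands are nonnegative, so a single S with the right numbers of dents above, below
  and to the right suffices.\<close>

lemma two_sided_pos:
  assumes s: "0 \<le> s" "even s" and bt: "even (int p - b)" "even (int p - t)" "2 * int n \<le> b + t"
    and L: "L \<subseteq> left_axis p s" "p = 0 \<Longrightarrow> L = {}" and R: "R \<subseteq> right_axis p b t" "n = 0 \<Longrightarrow> R = {}"
    and S: "S \<subseteq> left_axis p s \<inter> right_axis p b t - L - R"
    and cards: "card (positives (L \<union> S)) = p div 2" "card (negatives (L \<union> S)) = p div 2" "card (R \<union> S) = n"
  shows "Mq q (two_sided p n s b t L R) > 0"
proof -
  let ?W = "left_axis p s \<inter> right_axis p b t - L - R"
  have par: "even (y - x)" if "odd (int p + x)" "odd (int p + y)" for x y using that by presburger
  have oddL: "odd (int p + x)" if "x \<in> L" for x using that L unfolding left_axis_def by auto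
  have oddR: "odd (int p + x)" if "x \<in> R" for x using that R unfolding right_axis_def by auto
  have oddW: "odd (int p + x)" if "x \<in> S'" "S' \<subseteq> ?W" for x S' using that unfolding left_axis_def by auto
  have parL: "even (y - x)" if "S' \<subseteq> ?W" "x \<in> L \<union> S'" "y \<in> L \<union> S'" for x y S'
    using that oddL oddW[OF _ that(1)] by (intro par) blast+
  have parR: "even (y - x)" if "S' \<subseteq> ?W" "x \<in> R \<union> S'" "y \<in> R \<union> S'" for x y S'
    using that oddR oddW[OF _ that(1)] by (intro par) blast+
  have w: "(\<Prod>j\<in>S. lozenge_weight q j) > 0" for S using lozenge_weight_pos[OF q] by (intro prod_pos) auto
  have "left_count q p (L \<union> S) > 0" by (rule left_count_pos[OF parL[OF S] cards(1,2)])
  moreover have "right_count q n (R \<union> S) > 0" by (rule right_count_pos[OF parR[OF S] cards(3)])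
  ultimately have "(\<Prod>j\<in>S. lozenge_weight q j) * (left_count q p (L \<union> S) * right_count q n (R \<union> S)) > 0"
    using w by (intro mult_pos_pos)
  moreover have "(\<Prod>j\<in>S. lozenge_weight q j) * (left_count q p (L \<union> S) * right_count q n (R \<union> S)) \<ge> 0" if "S \<in> Pow ?W" for S
  proof -
    have S: "S \<subseteq> ?W" using that by simp
    have "left_count q p (L \<union> S) \<ge> 0" by (rule left_count_nonneg[OF parL[OF S]])
    moreover have "right_count q n (R \<union> S) \<ge> 0" by (rule right_count_nonneg[OF parR[OF S]])
    ultimately show ?thesis using w[of S] by (intro mult_nonneg_nonneg) auto
  qed
  moreover have "Mq q (two_sided p n s b t L R) = (\<Sum>S\<in>Pow ?W. (\<Prod>j\<in>S. lozenge_weight q j) * (left_count q p (L \<union> S) * right_count q n (R \<union> S)))"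
    by (rule Mq_two_sided) (use s bt L R in auto)
  ultimately show ?thesis using S by (simp only:) (intro sum_pos2[of _ S], auto)
qed

text \<open>Pair e with -e: since \<open>qint\<close> is odd, the two factors multiply to a
  difference of squares. This identity is the bridge between the two halves, whose counts are built
  from \<open>qint\<close> and from its square.\<close>

lemma prod_symmetric_differences:
  assumes "finite Q" "0 \<notin> Q" "uminus ` Q = Q"
  shows "(\<Prod>e\<in>Q. \<bar>qint q t - qint q e\<bar>) = (\<Prod>e\<in>positives Q. \<bar>(qint q t)\<^sup>2 - (qint q e)\<^sup>2\<bar>)"
proof -
  have "negatives Q = positives Q" using symmetric_minus_mem[OF assms(3)] by auto
  then have Q: "Q = positives Q \<union> uminus ` positives Q" using nonzero_halves[OF assms(2)] by simp
  have "(\<Prod>e\<in>Q. \<bar>qint q t - qint q e\<bar>) = (\<Prod>e\<in>positives Q. \<bar>qint q t - qint q e\<bar>) * (\<Prod>e\<in>uminus ` positives Q. \<bar>qint q t - qint q e\<bar>)"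
    by (subst Q, rule prod.union_disjoint) (use assms(1) in auto)
  also have "(\<Prod>e\<in>uminus ` positives Q. \<bar>qint q t - qint q e\<bar>) = (\<Prod>e\<in>positives Q. \<bar>qint q t + qint q e\<bar>)"
    by (subst prod.reindex) (auto simp: qint_minus)
  also have "(\<Prod>e\<in>positives Q. \<bar>qint q t - qint q e\<bar>) * (\<Prod>e\<in>positives Q. \<bar>qint q t + qint q e\<bar>)
      = (\<Prod>e\<in>positives Q. \<bar>(qint q t)\<^sup>2 - (qint q e)\<^sup>2\<bar>)"
    by (subst prod.distrib[symmetric]) (simp add: abs_mult[symmetric] power2_eq_square algebra_simps)
  finally show ?thesis .
qed

text \<open>The parity of the number of columns decides whether the linear factor is present, and an
  even k leaves it unchanged.\<close>

lemma sp_vand_union: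
  assumes "finite T" "finite Q" "T \<inter> Q = {}"
    and par: "\<And>s t. s \<in> T \<union> Q \<Longrightarrow> t \<in> T \<union> Q \<Longrightarrow> even (t - s)" "\<And>t. t \<in> T \<union> Q \<Longrightarrow> 0 < t"
    and k: "even k"
  shows "sp_vand q (p + k) (T \<union> Q) = sp_vand q p T * sp_vand q p Q * (\<Prod>t\<in>T. \<Prod>e\<in>Q. \<bar>(qint q t)\<^sup>2 - (qint q e)\<^sup>2\<bar>)"
proof -
  have "vand (\<lambda>s. (qint q s)\<^sup>2) (T \<union> Q) = vand (\<lambda>s. (qint q s)\<^sup>2) T * vand (\<lambda>s. (qint q s)\<^sup>2) Q
      * (\<Prod>t\<in>T. \<Prod>e\<in>Q. \<bar>(qint q t)\<^sup>2 - (qint q e)\<^sup>2\<bar>)"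
    by (rule vand_union[OF assms(1-3)]) (use par in \<open>blast intro: qint_sq_less\<close>)
  then show ?thesis unfolding sp_vand_def using k assms(1-3) by (simp add: prod.union_disjoint mult_ac)
qed

text \<open>A symmetric Q adds the same set \<open>positives Q\<close> above and below the
  intrusion, and card Q more columns ask for exactly that many more dents in each part; so both
  sides vanish together. The mixed factors above and below recombine to one product over T because
  they are even in t. The constant is multiplied across to avoid a quotient.\<close>

lemma left_count_union:
  assumes T: "finite T" "0 \<notin> T" and Q: "finite Q" "0 \<notin> Q" "uminus ` Q = Q" and disj: "T \<inter> Q = {}"
    and par: "\<And>s t. s \<in> T \<union> Q \<Longrightarrow> t \<in> T \<union> Q \<Longrightarrow> even (t - s)"
  shows "left_count q (p + card Q) (T \<union> Q) * (upper_const q p)\<^sup>2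
    = (upper_const q (p + card Q))\<^sup>2 * (sp_vand q p (positives Q))\<^sup>2 * left_count q p T * (\<Prod>t\<in>T. \<Prod>e\<in>Q. \<bar>qint q t - qint q e\<bar>)"
proof -
  note mem = symmetric_minus_mem[OF Q(3)]
  define P where "P t = (\<Prod>e\<in>positives Q. \<bar>(qint q t)\<^sup>2 - (qint q e)\<^sup>2\<bar>)" for t
  have P_minus: "P (- t) = P t" for t unfolding P_def by (simp add: qint_minus)
  have posU: "positives (T \<union> Q) = positives T \<union> positives Q" by auto
  have negU: "negatives (T \<union> Q) = negatives T \<union> positives Q" by (auto simp: mem)
  have d1: "positives T \<inter> positives Q = {}" and d2: "negatives T \<inter> positives Q = {}"
    using disj mem by auto
  note fin = finite_halves[OF T(1)] finite_halves(1)[OF Q(1)]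
  have cardQ: "card Q = 2 * card (positives Q)" by (rule card_symmetric[OF Q])
  have half: "(p + card Q) div 2 = p div 2 + card (positives Q)" unfolding cardQ by simp
  have c1: "card (positives (T \<union> Q)) = card (positives T) + card (positives Q)"
    unfolding posU by (rule card_Un_disjoint) (use fin d1 in auto)
  have c2: "card (negatives (T \<union> Q)) = card (negatives T) + card (positives Q)"
    unfolding negU by (rule card_Un_disjoint) (use fin d2 in auto)
  have s1: "sp_vand q (p + card Q) (positives (T \<union> Q)) = sp_vand q p (positives T) * sp_vand q p (positives Q) * (\<Prod>t\<in>positives T. P t)"
    unfolding posU P_def by (rule sp_vand_union) (use fin d1 par cardQ in auto)
  have s2: "sp_vand q (p + card Q) (negatives (T \<union> Q)) = sp_vand q p (negatives T) * sp_vand q p (positives Q) * (\<Prod>t\<in>negatives T. P t)"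
    unfolding negU P_def
  proof (rule sp_vand_union)
    fix a b assume ab: "a \<in> negatives T \<union> positives Q" "b \<in> negatives T \<union> positives Q"
    then have "- a \<in> T \<union> Q" "- b \<in> T \<union> Q" by (auto simp: mem)
    then have "even (- b - (- a))" using par by blast
    then show "even (b - a)" by presburger
  qed (use fin d2 cardQ in auto)
  have "(\<Prod>t\<in>T. P t) = (\<Prod>t\<in>positives T. P t) * (\<Prod>t\<in>negatives T. P t)"
  proof -
    have "T = positives T \<union> uminus ` negatives T" by (rule nonzero_halves[OF T(2)])
    then have "(\<Prod>t\<in>T. P t) = (\<Prod>t\<in>positives T \<union> uminus ` negatives T. P t)" by simp
    also have "\<dots> = (\<Prod>t\<in>positives T. P t) * (\<Prod>t\<in>uminus ` negatives T. P t)"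
      by (rule prod.union_disjoint) (use fin in auto)
    also have "(\<Prod>t\<in>uminus ` negatives T. P t) = (\<Prod>t\<in>negatives T. P t)"
      by (subst prod.reindex) (auto simp: P_minus)
    finally show ?thesis .
  qed
  moreover have "(\<Prod>t\<in>T. \<Prod>e\<in>Q. \<bar>qint q t - qint q e\<bar>) = (\<Prod>t\<in>T. P t)"
    unfolding P_def prod_symmetric_differences[OF Q] ..
  ultimately show ?thesis
    unfolding left_count_def c1 c2 half s1 s2 by (simp add: power2_eq_square mult_ac)
qed

lemma right_count_union:
  assumes W: "finite W" and Q: "finite Q" and disj: "W \<inter> Q = {}"
    and par: "\<And>s t. s \<in> W \<union> Q \<Longrightarrow> t \<in> W \<union> Q \<Longrightarrow> even (t - s)"
  shows "right_count q (n + card Q) (W \<union> Q) * right_const q n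
    = right_const q (n + card Q) * vand (qint q) Q * right_count q n W * (\<Prod>t\<in>W. \<Prod>e\<in>Q. \<bar>qint q t - qint q e\<bar>)"
proof -
  have "card (W \<union> Q) = card W + card Q" using assms by (simp add: card_Un_disjoint)
  moreover have "vand (qint q) (W \<union> Q) = vand (qint q) W * vand (qint q) Q * (\<Prod>t\<in>W. \<Prod>e\<in>Q. \<bar>qint q t - qint q e\<bar>)"
    by (rule vand_union[OF W Q disj]) (use par in \<open>blast intro: qint_less[OF q]\<close>)
  ultimately show ?thesis unfolding right_count_def by (simp add: mult_ac)
qed

text \<open>The constant \<open>K\<close> does not depend on the outer boundary \<open>s, b, t\<close>.\<close>

lemma two_sided_move_dents:
  assumes Q: "finite Q" "0 \<notin> Q" "uminus ` Q = Q" and fin: "finite L" "finite R"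
    and disj: "L \<inter> Q = {}" "R \<inter> Q = {}" and par: "\<And>j. j \<in> L \<union> R \<union> Q \<Longrightarrow> odd (int p + j)"
    and triv: "p = 0 \<Longrightarrow> L = {}" "n = 0 \<Longrightarrow> R = {}"
  shows "\<exists>K. K \<noteq> 0 \<and> (\<forall>s b t. even s \<longrightarrow> int (card Q) \<le> s \<longrightarrow> even (int p - b) \<longrightarrow> even (int p - t) \<longrightarrow>
     2 * int (n + card Q) \<le> b + t \<longrightarrow> L \<union> Q \<subseteq> left_axis p s \<longrightarrow> R \<union> Q \<subseteq> right_axis p b t \<longrightarrow>
     Mq q (two_sided p (n + card Q) s b t L (R \<union> Q))
       = K * Mq q (two_sided (p + card Q) n (s - int (card Q)) b t (L \<union> Q) R))"
proof -
  define P where "P t = (\<Prod>e\<in>Q. \<bar>qint q t - qint q e\<bar>)" for t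
  define k where "k = (upper_const q (p + card Q))\<^sup>2 * (sp_vand q p (positives Q))\<^sup>2 / (upper_const q p)\<^sup>2"
  define k' where "k' = right_const q (n + card Q) * vand (qint q) Q / right_const q n"
  have even_diff: "even (t - s)" if "odd (int p + s)" "odd (int p + t)" for s t using that by presburger
  have parQ: "even (t - s)" if "s \<in> Q" "t \<in> Q" for s t using that par even_diff by blast
  have Ppos: "P t > 0" if "t \<notin> Q" "odd (int p + t)" for t
    unfolding P_def
  proof (intro prod_pos ballI qint_abs_diff_pos)
    fix e assume e: "e \<in> Q"
    show "t \<noteq> e" using e that(1) by auto
    show "even (e - t)" using even_diff[OF that(2)] par e by blast
  qed
  have "sp_vand q p (positives Q) > 0" by (rule sp_vand_pos) (use parQ in auto)
  then have k: "k > 0" unfolding k_def using upper_const[of p] upper_const[of "p + card Q"] by simp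
  have "vand (qint q) Q > 0" by (rule vand_pos) (use parQ in \<open>blast intro: qint_less[OF q]\<close>)
  then have k': "k' > 0" unfolding k'_def using right_const[of n] right_const[of "n + card Q"] by simp
  have PL: "(\<Prod>t\<in>L. P t) > 0" using Ppos disj(1) par by (intro prod_pos) blast
  have PR: "(\<Prod>t\<in>R. P t) > 0" using Ppos disj(2) par by (intro prod_pos) blast
  \<comment> \<open>Moving Q produces the mixed factors over R and S on one side and over L and S on
    the other. The part over S is common and cancels, so K retains only the products over R and
    L.\<close>
  define K where "K = k' * (\<Prod>t\<in>R. P t) / (k * (\<Prod>t\<in>L. P t))"
  have "K \<noteq> 0" unfolding K_def using k k' PL PR by simp
  moreover have "Mq q (two_sided p (n + card Q) s b t L (R \<union> Q)) = K * Mq q (two_sided (p + card Q) n (s - int (card Q)) b t (L \<union> Q) R)"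
    if s: "even s" "int (card Q) \<le> s" and bt: "even (int p - b)" "even (int p - t)" "2 * int (n + card Q) \<le> b + t"
      and LR: "L \<union> Q \<subseteq> left_axis p s" "R \<union> Q \<subseteq> right_axis p b t" for s b t
  proof -
    have cardQ: "even (card Q)" using card_symmetric[OF Q] by simp
    \<comment> \<open>The axis depends on s + p only: card Q further columns are balanced by a left
      side that is shorter by the same amount at each end. Evenness of card Q keeps the parity of
      the heights.\<close>
    have la: "left_axis (p + card Q) (s - int (card Q)) = left_axis p s" and ra: "right_axis (p + card Q) b t = right_axis p b t"
      unfolding left_axis_def right_axis_def using cardQ by auto
    let ?W = "left_axis p s \<inter> right_axis p b t - L - (R \<union> Q)"
    have N: "Mq q (two_sided p (n + card Q) s b t L (R \<union> Q)) = (\<Sum>S\<in>Pow ?W.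
        (\<Prod>j\<in>S. lozenge_weight q j) * (left_count q p (L \<union> S) * right_count q (n + card Q) (R \<union> Q \<union> S)))"
      using s bt LR triv Q by (intro Mq_two_sided) auto
    have Q0: "Q = {}" if "card Q = 0" using that Q by simp
    have D: "Mq q (two_sided (p + card Q) n (s - int (card Q)) b t (L \<union> Q) R) = (\<Sum>S\<in>Pow ?W.
        (\<Prod>j\<in>S. lozenge_weight q j) * (left_count q (p + card Q) (L \<union> Q \<union> S) * right_count q n (R \<union> S)))"
    proof -
      have "left_axis p s \<inter> right_axis p b t - (L \<union> Q) - R = ?W" by auto
      then show ?thesis using s bt LR triv cardQ Q0
        by (subst Mq_two_sided) (auto simp: la ra)
    qed
    show ?thesis unfolding N D sum_distrib_left
    proof (rule sum.cong[OF refl])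
      fix S assume "S \<in> Pow ?W"
      then have S: "S \<subseteq> ?W" by auto
      have finS: "finite S" using S by (auto intro: finite_subset[of S "left_axis p s"])
      have parS: "odd (int p + j)" if "j \<in> S" for j using S that unfolding left_axis_def by auto
      have parU: "even (j' - j)" if "j \<in> L \<union> R \<union> S \<union> Q" "j' \<in> L \<union> R \<union> S \<union> Q" for j j'
        using that par parS by (intro even_diff) blast+
      have dS: "L \<inter> S = {}" "R \<inter> S = {}" "(L \<union> S) \<inter> Q = {}" "(R \<union> S) \<inter> Q = {}" using S disj by blast+
      have zero: "0 \<notin> L \<union> S" using LR S unfolding left_axis_def by auto
      have nz: "upper_const q p \<noteq> 0" "right_const q n \<noteq> 0" using upper_const[of p] right_const[of n] by auto
      have "left_count q (p + card Q) (L \<union> S \<union> Q) * (upper_const q p)\<^sup>2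
         = (upper_const q (p + card Q))\<^sup>2 * (sp_vand q p (positives Q))\<^sup>2 * left_count q p (L \<union> S) * (\<Prod>t\<in>L \<union> S. P t)"
        unfolding P_def by (rule left_count_union[OF _ zero Q dS(3)]) (use fin finS parU in blast)+
      then have l: "left_count q (p + card Q) (L \<union> Q \<union> S) = k * left_count q p (L \<union> S) * ((\<Prod>t\<in>L. P t) * (\<Prod>t\<in>S. P t))"
        using nz(1) prod.union_disjoint[OF fin(1) finS dS(1), of P] unfolding k_def by (simp add: field_simps Un_ac)
      have "right_count q (n + card Q) (R \<union> S \<union> Q) * right_const q n
         = right_const q (n + card Q) * vand (qint q) Q * right_count q n (R \<union> S) * (\<Prod>t\<in>R \<union> S. P t)"
        unfolding P_def by (rule right_count_union[OF _ Q(1) dS(4)]) (use fin finS parU in blast)+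
      then have r: "right_count q (n + card Q) (R \<union> Q \<union> S) = k' * right_count q n (R \<union> S) * ((\<Prod>t\<in>R. P t) * (\<Prod>t\<in>S. P t))"
        using nz(2) prod.union_disjoint[OF fin(2) finS dS(2), of P] unfolding k'_def by (simp add: field_simps Un_ac)
      have "K * (k * (\<Prod>t\<in>L. P t)) = k' * (\<Prod>t\<in>R. P t)" unfolding K_def using k PL by simp
      then have "k' * (\<Prod>t\<in>R. P t) = K * (k * (\<Prod>t\<in>L. P t))" by simp
      have "left_count q p (L \<union> S) * right_count q (n + card Q) (R \<union> Q \<union> S)
        = (k' * (\<Prod>t\<in>R. P t)) * (left_count q p (L \<union> S) * right_count q n (R \<union> S) * (\<Prod>t\<in>S. P t))"
        unfolding r by (simp only: mult_ac)
      also have "\<dots> = K * (left_count q (p + card Q) (L \<union> Q \<union> S) * right_count q n (R \<union> S))"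
        unfolding l \<open>k' * (\<Prod>t\<in>R. P t) = K * (k * (\<Prod>t\<in>L. P t))\<close> by (simp only: mult_ac)
      finally show "(\<Prod>j\<in>S. lozenge_weight q j) * (left_count q p (L \<union> S) * right_count q (n + card Q) (R \<union> Q \<union> S))
        = K * ((\<Prod>j\<in>S. lozenge_weight q j) * (left_count q (p + card Q) (L \<union> Q \<union> S) * right_count q n (R \<union> S)))"
        by (simp only: mult_ac)
    qed
  qed
  ultimately show ?thesis by blast
qed

end

section \<open>Forced tilings of lattice triangles\<close>

text \<open>For a right-pointing cell the vertex conditions are stricter by one unit than the bound
  stated here, but parity excludes exactly the borderline value, so one bound serves both
  orientations.\<close>

lemma triangle_left_iff:
  assumes "even (p - s + m)"
  shows "(c, j) \<in> triangle True p m s \<longleftrightarrow> p - s \<le> c \<and> c < p \<and> \<bar>j - m\<bar> \<le> c - (p - s)"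
proof (cases "even (c + j)")
  case True
  then show ?thesis unfolding triangle_def by (auto simp: vertices_left)
next
  case False
  have "\<bar>j - m\<bar> \<noteq> c - (p - s)" using False assms by presburger
  then show ?thesis using False unfolding triangle_def by (auto simp: vertices_right)
qed

lemma triangle_right_iff:
  assumes "even (p + s + m)"
  shows "(c, j) \<in> triangle False p m s \<longleftrightarrow> p \<le> c \<and> c < p + s \<and> \<bar>j - m\<bar> \<le> p + s - 1 - c"
proof (cases "even (c + j)")
  case True
  have "\<bar>j - m\<bar> \<noteq> p + s - 1 - c" using True assms by presburger
  then show ?thesis using True unfolding triangle_def by (auto simp: vertices_left)
next
  case False
  then show ?thesis unfolding triangle_def by (auto simp: vertices_right)
qed

text \<open>For a left-pointing lobe, i is the column counted from its tip and (i, j) runs over the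
  right-pointing cells, one for each forced horizontal lozenge. A right-pointing lobe is the mirror
  image and has the same weight.\<close>

definition lobe_weight :: "'a::field \<Rightarrow> int \<Rightarrow> int \<Rightarrow> 'a" where
  "lobe_weight q m s = (\<Prod>(i, j)\<in>{(i, j). 0 < i \<and> i < s \<and> \<bar>j - m\<bar> < i \<and> odd (i + j - m)}. lozenge_weight q j)"

lemma lobe_weight_pos: "q > 0 \<Longrightarrow> lobe_weight (q :: 'a::linordered_field) m s > 0"
  unfolding lobe_weight_def using lozenge_weight_pos[of q] by (intro prod_pos) auto

lemma side_line_iff: "side_line (c, j) = (if even (c + j) then c + 1 else c)"
  unfolding side_line_def left_pointing_def by simp

text \<open>
  Next to the axis the vertical neighbours of a right-pointing cell of the lobe are missing, which
  forces the cell into a horizontal lozenge; this propagates away from the axis.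
\<close>

lemma Mq_left_lobe:
  fixes q :: "'a::field_char_0"
  assumes R: "finite R" and par: "even (p - s + m)"
    and mem: "\<And>c j. (c, j) \<in> triangle True p m s \<Longrightarrow> (c, j) \<in> R \<longleftrightarrow> side_line (c, j) \<noteq> p \<and> \<not> (z \<and> j = 0)"
  shows "Mq q R = lobe_weight q m s * Mq q (R - triangle True p m s)"
proof -
  let ?T = "triangle True p m s"
  \<comment> \<open>K lists the right-pointing cells of the lobe. The flag z covers lobes whose row
    0 has already been deleted together with the intrusion.\<close>
  define K where "K = {(c, j). (c, j) \<in> ?T \<and> odd (c + j) \<and> \<not> (z \<and> j = 0)}"
  let ?h = "\<lambda>(c, j). {(c - 1, j), (c, j)} :: cell set"
  note tri = triangle_left_iff[OF par]
  have inR: "(c, j) \<in> R \<longleftrightarrow> \<not> (even (c + j) \<and> c = p - 1) \<and> \<not> (z \<and> j = 0)" if "(c, j) \<in> ?T" for c j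
    using mem[OF that] that unfolding side_line_iff tri by auto
  have K_iff: "(c, j) \<in> K \<longleftrightarrow> c < p \<and> \<bar>j - m\<bar> < c - (p - s) \<and> odd (c + j) \<and> \<not> (z \<and> j = 0)" for c j
  proof -
    have "\<bar>j - m\<bar> \<noteq> c - (p - s)" if "odd (c + j)" using that par by presburger
    then show ?thesis unfolding K_def tri by auto
  qed
  have KR: "?h t \<subseteq> R \<inter> ?T" if "t \<in> K" for t
  proof -
    obtain c j where t: "t = (c, j)" by (cases t)
    have k: "c < p" "\<bar>j - m\<bar> < c - (p - s)" "odd (c + j)" "\<not> (z \<and> j = 0)" using that unfolding t K_iff by auto
    then have "(c - 1, j) \<in> ?T" "(c, j) \<in> ?T" unfolding tri by auto
    then show ?thesis using k inR[of c j] inR[of "c - 1" j] unfolding t by auto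
  qed
  have loz: "?h ` K \<subseteq> lozenges"
  proof
    fix l assume "l \<in> ?h ` K"
    then obtain c j where "l = {(c - 1, j), (c - 1 + 1, j)}" "even (c - 1 + j)" using K_iff by auto
    then show "l \<in> lozenges" using horizontal_lozenge_iff by metis
  qed
  have disj: "disjoint (?h ` K)"
    unfolding disjoint_def
  proof (intro ballI impI)
    fix a b assume "a \<in> ?h ` K" "b \<in> ?h ` K" "a \<noteq> b"
    then obtain c j c' j' where ab: "a = {(c - 1, j), (c, j)}" "b = {(c' - 1, j'), (c', j')}" "(c, j) \<in> K" "(c', j') \<in> K" by auto
    have "odd (c + j)" "odd (c' + j')" using ab(3,4) K_iff by auto
    have "c' \<noteq> c - 1" if "j' = j"
    proof
      assume "c' = c - 1"
      then show False using \<open>odd (c + j)\<close> \<open>odd (c' + j')\<close> that by simp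
    qed
    moreover have "c \<noteq> c' - 1" if "j' = j"
    proof
      assume "c = c' - 1"
      then show False using \<open>odd (c + j)\<close> \<open>odd (c' + j')\<close> that by simp
    qed
    moreover have "(c, j) \<noteq> (c', j')" using \<open>a \<noteq> b\<close> ab by auto
    ultimately show "a \<inter> b = {}" unfolding ab by auto
  qed
  have union: "\<Union>(?h ` K) = R \<inter> ?T"
  proof (intro equalityI subsetI)
    fix t assume "t \<in> \<Union>(?h ` K)"
    then show "t \<in> R \<inter> ?T" using KR by blast
  next
    fix t assume t: "t \<in> R \<inter> ?T"
    obtain c j where cj: "t = (c, j)" by (cases t)
    have T: "(c, j) \<in> ?T" and r: "\<not> (even (c + j) \<and> c = p - 1)" "\<not> (z \<and> j = 0)" using t inR unfolding cj by auto
    show "t \<in> \<Union>(?h ` K)"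
    proof (cases "odd (c + j)")
      case True
      then have "(c, j) \<in> K" using T r unfolding K_def by auto
      then show ?thesis unfolding cj by blast
    next
      case False
      then have "(c + 1, j) \<in> K" using T r unfolding K_iff tri by auto
      moreover have "(c, j) \<in> ?h (c + 1, j)" by simp
      ultimately show ?thesis unfolding cj by blast
    qed
  qed
  have forced: "?h ` K \<subseteq> T" if T: "T \<in> tilings R" for T
  proof -
    have d: "disjoint T" and U: "\<Union>T = R" and L: "T \<subseteq> lozenges" using T by (auto simp: tilings_iff)
    have "{(c - 1, j), (c, j)} \<in> T" if "(c, j) \<in> K" for c j
      using that
    proof (induction "nat (p - c)" arbitrary: c j rule: less_induct)
      case less
      have k: "c < p" "\<bar>j - m\<bar> < c - (p - s)" "odd (c + j)" "\<not> (z \<and> j = 0)" using less.prems unfolding K_iff by auto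
      have next_l: "{(c, j'), (c + 1, j')} \<in> T" if "j' = j + 1 \<or> j' = j - 1" "(c, j') \<in> R" for j'
      proof -
        have "(c, j') \<in> ?T" "even (c + j')" using k that(1) unfolding tri by auto
        then have "(c + 1, j') \<in> K" using inR[of c j'] that(2) k(1) unfolding K_iff tri by auto
        then show ?thesis using less.hyps[of "c + 1" j'] k(1) by simp
      qed
      have "(c, j) \<in> R" using KR[OF less.prems] by simp
      then obtain l where l: "l \<in> T" "(c, j) \<in> l" using U by blast
      have "l \<in> lozenges" "l \<subseteq> R" using l(1) L U by auto
      from this(1) show ?case
      proof (cases rule: lozenge_cases)
        case (horizontal c' n)
        then have "n = j" "c' = c - 1" using l(2) k(3) by auto
        then show ?thesis using l(1) horizontal by simp
      next
        case (vertical c' n)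
        \<comment> \<open>A vertical lozenge at (c, j) would occupy a left-pointing neighbour in
          column c, which by the induction hypothesis already belongs to a horizontal lozenge with
          column c + 1.\<close>
        define j' where "j' = (if j = n then n + 1 else n)"
        have j': "j' = j + 1 \<or> j' = j - 1" "(c, j') \<in> l" using l(2) vertical unfolding j'_def by auto
        let ?l = "{(c, j'), (c + 1, j')}"
        have "?l \<in> T" using next_l[OF j'(1)] j'(2) \<open>l \<subseteq> R\<close> by auto
        moreover have "l \<noteq> ?l" using vertical l(2) j'(1) by (auto simp: doubleton_eq_iff)
        ultimately have "l \<inter> ?l = {}" using d l(1) by (meson disjointD)
        then show ?thesis using j'(2) by auto
      qed
    qed
    then show ?thesis by auto
  qed
  have inj: "inj_on ?h K"
  proof (rule inj_onI)
    fix x y assume xy: "x \<in> K" "y \<in> K" "?h x = ?h y"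
    obtain c j c' j' where x: "x = (c, j)" "y = (c', j')" by (metis surj_pair)
    have "odd (c + j)" "odd (c' + j')" using xy K_iff unfolding x by auto
    then show "x = y" using xy(3) unfolding x by (auto simp: doubleton_eq_iff)
  qed
  have "(\<Prod>l\<in>?h ` K. cell_pair_weight q l) = (\<Prod>(c, j)\<in>K. lozenge_weight q j)"
  proof -
    have "cell_pair_weight q (?h t) = (\<lambda>(c, j). lozenge_weight q j) t" for t
      using cell_pair_weight_horizontal[of q "fst t - 1" "snd t"] by (simp add: case_prod_unfold)
    then show ?thesis by (simp add: prod.reindex[OF inj])
  qed
  also have "\<dots> = lobe_weight q m s"
  proof -
    let ?I = "{(i, j). 0 < i \<and> i < s \<and> \<bar>j - m\<bar> < i \<and> odd (i + j - m)}"
    have finI: "finite ?I" by (rule finite_subset[of _ "{0..s} \<times> {m - s..m + s}"]) auto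
    \<comment> \<open>A lozenge on row 0 has weight 1, so the weight of the lobe is the same with
      and without that row.\<close>
    have zero: "lozenge_weight q 0 = 1" by (simp add: lozenge_weight_def)
    have "lobe_weight q m s = (\<Prod>(i, j)\<in>{(i, j) \<in> ?I. \<not> (z \<and> j = 0)}. lozenge_weight q j)"
      unfolding lobe_weight_def by (rule prod.mono_neutral_right[OF finI]) (auto simp: zero)
    also have "\<dots> = (\<Prod>(c, j)\<in>K. lozenge_weight q j)"
    proof (rule prod.reindex_bij_witness[where i = "\<lambda>(c, j). (c - (p - s), j)" and j = "\<lambda>(i, j). (i + (p - s), j)"])
      fix t assume t: "t \<in> {(i, j) \<in> ?I. \<not> (z \<and> j = 0)}"
      obtain i j where ij: "t = (i, j)" by (cases t)
      have "odd (i + j - m)" using t ij by auto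
      then have "odd (i + (p - s) + j)" using par by presburger
      then show "(\<lambda>(i, j). (i + (p - s), j)) t \<in> K" using t unfolding ij by (auto simp: K_iff)
    next
      fix t assume t: "t \<in> K"
      obtain c j where cj: "t = (c, j)" by (cases t)
      have "odd (c + j)" using t cj K_iff by auto
      then have "odd (c - (p - s) + j - m)" using par by presburger
      then show "(\<lambda>(c, j). (c - (p - s), j)) t \<in> {(i, j) \<in> ?I. \<not> (z \<and> j = 0)}" using t unfolding cj by (auto simp: K_iff)
    qed auto
    finally show ?thesis by simp
  qed
  finally have w: "(\<Prod>l\<in>?h ` K. cell_pair_weight q l) = lobe_weight q m s" .
  have "Mq q R = (\<Prod>l\<in>?h ` K. cell_pair_weight q l) * Mq q (R - \<Union>(?h ` K))"
    by (rule Mq_forced[OF R loz disj _ forced]) (use union in auto)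
  moreover have "R - \<Union>(?h ` K) = R - ?T" unfolding union by blast
  ultimately show ?thesis unfolding w by simp
qed

lemma Mq_right_lobe:
  fixes q :: "'a::field_char_0"
  assumes R: "finite R" and par: "even (p + s + m)"
    and mem: "\<And>c j. (c, j) \<in> triangle False p m s \<Longrightarrow> (c, j) \<in> R \<longleftrightarrow> side_line (c, j) \<noteq> p"
  shows "Mq q R = lobe_weight q m s * Mq q (R - triangle False p m s)"
proof -
  let ?f = "\<lambda>(c, j). (2 * p - 1 - c, j) :: cell"
  have ff: "?f (?f t) = t" for t by (cases t) simp
  have f_mem: "(c, j) \<in> ?f ` X \<longleftrightarrow> ?f (c, j) \<in> X" for c j X
    using ff by (metis (no_types, lifting) image_iff)
  have par': "even (p - s + m)" using par by presburger
  have tri: "?f ` triangle False p m s = triangle True p m s"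
  proof (rule Set.set_eqI)
    fix t :: cell
    obtain c j where t: "t = (c, j)" by (cases t)
    show "t \<in> ?f ` triangle False p m s \<longleftrightarrow> t \<in> triangle True p m s"
      unfolding t f_mem using triangle_left_iff[OF par'] triangle_right_iff[OF par] by auto
  qed
  have "Mq q (?f ` R) = lobe_weight q m s * Mq q (?f ` R - triangle True p m s)"
  proof (rule Mq_left_lobe[where z = False, OF _ par'])
    fix c j assume "(c, j) \<in> triangle True p m s"
    then have "?f (c, j) \<in> triangle False p m s" using tri f_mem by blast
    then have "(c, j) \<in> ?f ` R \<longleftrightarrow> side_line (2 * p - 1 - c, j) \<noteq> p"
      unfolding f_mem using mem[of "2 * p - 1 - c" j] by simp
    then show "(c, j) \<in> ?f ` R \<longleftrightarrow> side_line (c, j) \<noteq> p \<and> \<not> (False \<and> j = 0)"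
      unfolding side_line_iff by auto
  qed (use R in simp)
  moreover have "?f ` R - triangle True p m s = ?f ` (R - triangle False p m s)"
    unfolding tri[symmetric] by (rule image_set_diff[symmetric]) (metis ff injI)
  ultimately show ?thesis using R by (simp add: Mq_flip_horizontal)
qed

lemma finite_triangle [simp]: "finite (triangle b p m s)"
proof (rule finite_subset)
  show "triangle b p m s \<subseteq> {p - \<bar>s\<bar> - 2..p + \<bar>s\<bar> + 2} \<times> {m - 2 * \<bar>s\<bar> - 2..m + 2 * \<bar>s\<bar> + 2}"
    unfolding triangle_def vertices_def by (auto split: if_splits)
qed simp

lemma Mq_triangle_off_axis:
  fixes q :: "'a::field_char_0"
  assumes "even (p + s + m)"
  shows "Mq q {t \<in> triangle b p m s. side_line t \<noteq> p} = lobe_weight q m s"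
proof -
  let ?R = "{t \<in> triangle b p m s. side_line t \<noteq> p}"
  show ?thesis
  proof (cases b)
    case True
    have "even (p - s + m)" using assms by presburger
    then have "Mq q ?R = lobe_weight q m s * Mq q (?R - triangle True p m s)"
      by (intro Mq_left_lobe[where z = False]) (auto simp: True)
    moreover have "?R - triangle True p m s = {}" using True by auto
    ultimately show ?thesis by simp
  next
    case False
    have "Mq q ?R = lobe_weight q m s * Mq q (?R - triangle False p m s)"
      using assms by (intro Mq_right_lobe) (auto simp: False)
    moreover have "?R - triangle False p m s = {}" using False by auto
    ultimately show ?thesis by simp
  qed
qed

text \<open>The lobes are indexed, because lobes of size 0 may coincide as sets of cells.
  Left-pointing lobes may cross the missing row 0, which is why row 0 is exempted for them
  alone.\<close>

lemma Mq_remove_lobes: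
  fixes q :: "'a::field_char_0"
  assumes "finite I" and R: "finite R" and par: "\<And>i. i \<in> I \<Longrightarrow> even (p + s i + m i)"
    and mem: "\<And>i c j. i \<in> I \<Longrightarrow> (c, j) \<in> triangle (b i) p (m i) (s i) \<Longrightarrow>
        (c, j) \<in> R \<longleftrightarrow> side_line (c, j) \<noteq> p \<and> \<not> (b i \<and> j = 0)"
    and disj: "\<And>i i'. i \<in> I \<Longrightarrow> i' \<in> I \<Longrightarrow> i \<noteq> i' \<Longrightarrow>
        triangle (b i) p (m i) (s i) \<inter> triangle (b i') p (m i') (s i') = {}"
  shows "Mq q R = (\<Prod>i\<in>I. lobe_weight q (m i) (s i)) * Mq q (R - (\<Union>i\<in>I. triangle (b i) p (m i) (s i)))"
  using assms(1,3-)
proof (induction I rule: finite_induct)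
  case (insert i I)
  let ?R = "R - (\<Union>i\<in>I. triangle (b i) p (m i) (s i))"
  have IH: "Mq q R = (\<Prod>i\<in>I. lobe_weight q (m i) (s i)) * Mq q ?R"
    by (rule insert.IH) (use insert.prems in blast)+
  have mem': "(c, j) \<in> ?R \<longleftrightarrow> side_line (c, j) \<noteq> p \<and> \<not> (b i \<and> j = 0)" if t: "(c, j) \<in> triangle (b i) p (m i) (s i)" for c j
  proof -
    have "(c, j) \<notin> triangle (b i') p (m i') (s i')" if i': "i' \<in> I" for i'
    proof -
      have "triangle (b i) p (m i) (s i) \<inter> triangle (b i') p (m i') (s i') = {}"
        by (rule insert.prems(3)) (use i' insert.hyps(2) in auto)
      then show ?thesis using t by auto
    qed
    then show ?thesis using insert.prems(2)[OF _ t] by auto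
  qed
  have par: "even (p + s i + m i)" using insert.prems(1)[of i] by simp
  have "Mq q ?R = lobe_weight q (m i) (s i) * Mq q (?R - triangle (b i) p (m i) (s i))"
  proof (cases "b i")
    case True
    have "even (p - s i + m i)" using par by presburger
    then have "Mq q ?R = lobe_weight q (m i) (s i) * Mq q (?R - triangle True p (m i) (s i))"
      using R mem' True by (intro Mq_left_lobe[where z = True]) auto
    then show ?thesis using True by simp
  next
    case False
    have "Mq q ?R = lobe_weight q (m i) (s i) * Mq q (?R - triangle False p (m i) (s i))"
      using R mem' False par by (intro Mq_right_lobe) auto
    then show ?thesis using False by simp
  qed
  moreover have "?R - triangle (b i) p (m i) (s i) = R - (\<Union>i\<in>insert i I. triangle (b i) p (m i) (s i))"
    by auto
  ultimately show ?case using IH insert.hyps by (simp add: mult_ac)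
qed simp

lemma triangle_disjoint:
  assumes "even (p + s + m)" "even (p + s' + m')" "s + s' \<le> \<bar>m - m'\<bar>"
  shows "triangle b p m s \<inter> triangle b' p m' s' = {}"
proof -
  have near: "\<bar>j - m\<bar> < s" if "(c, j) \<in> triangle b p m s" "even (p + s + m)" for b c j m s
  proof -
    have "even (p - s + m)" using that(2) by presburger
    then show ?thesis using that triangle_left_iff[of p s m c j] triangle_right_iff[of p s m c j] by (cases b) auto
  qed
  have False if "(c, j) \<in> triangle b p m s" "(c, j) \<in> triangle b' p m' s'" for c j
    using near[OF that(1) assms(1)] near[OF that(2) assms(2)] assms(3) by linarith
  then show ?thesis by fastforce
qed

text \<open>The six conditions on vertices become conditions on the cell. An even first side fixes
  the parity of all slanted sides, so that the borderline cases occur for one orientation only and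
  can be absorbed into strict or weak inequalities.\<close>

lemma hexagon_iff:
  assumes "even s1" "s2 + s3 = s5 + s6" "s1 + s2 = s4 + s5"
  shows "(c, j) \<in> hexagon s1 s2 s3 s4 s5 s6 \<longleftrightarrow> 0 \<le> c \<and> c < s2 + s3 \<and> j - c \<le> s1 \<and> j + c < s1 + 2 * s2
     \<and> s1 - 2 * s3 - 2 * s4 < j - c \<and> - s1 \<le> j + c"
proof (cases "even (c + j)")
  case True
  have "j + c + 1 \<noteq> s1 + 2 * s2" "j - c - 1 \<noteq> s1 - 2 * s3 - 2 * s4" using True assms(1) by presburger+
  then show ?thesis using assms(2,3) unfolding hexagon_def by (auto simp: vertices_left[OF True])
next
  case False
  have "j - c \<noteq> s1" "j + c \<noteq> - s1" using False assms(1) by presburger+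
  then show ?thesis using assms(2,3) unfolding hexagon_def by (auto simp: vertices_right[OF False])
qed

lemma card_odd_gap:
  assumes "lo \<le> hi"
  shows "card {j :: int. lo < j \<and> j < hi \<and> odd (j - lo)} = nat ((hi - lo) div 2)"
proof -
  have "{j :: int. lo < j \<and> j < hi \<and> odd (j - lo)} = (\<lambda>i. lo + 1 + 2 * i) ` {0..<(hi - lo) div 2}"
  proof (intro equalityI subsetI)
    fix j assume j: "j \<in> {j :: int. lo < j \<and> j < hi \<and> odd (j - lo)}"
    then have "odd (j - lo)" by blast
    then obtain i where i: "j - lo = 2 * i + 1" by (rule oddE)
    then have "i \<in> {0..<(hi - lo) div 2}" "j = lo + 1 + 2 * i" using j by auto
    then show "j \<in> (\<lambda>i. lo + 1 + 2 * i) ` {0..<(hi - lo) div 2}" by blast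
  qed (use assms in auto)
  moreover have "card ((\<lambda>i. lo + 1 + 2 * i) ` {0..<(hi - lo) div 2}) = card {0..<(hi - lo) div 2}"
    by (rule card_image) (auto simp: inj_on_def)
  ultimately show ?thesis by simp
qed

section \<open>Axis segments of a fern\<close>

text \<open>The i-coordinate of the upper end of the axis segment covered by the lobes up to index
  i; by symmetry its negative is the lower end.\<close>

definition lobe_edge :: "(nat \<Rightarrow> int) \<Rightarrow> nat \<Rightarrow> int" where
  "lobe_edge b i = b 1 + 2 * (\<Sum>j = 2..i. b j)"

text \<open>The heights of \<open>axis_heights\<close> doubled to i-coordinates, so that parity is
  available.\<close>

definition axis_set :: "bool \<Rightarrow> nat \<Rightarrow> (nat \<Rightarrow> int) \<Rightarrow> int set" where
  "axis_set odd_index k b = {j. \<exists>m s. (odd_index, m, s) \<in> lobes k b \<and> \<bar>j - m\<bar> < s \<and> odd (j - m + s)}"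

lemma axis_heights_eq: "axis_heights o' k b = (\<lambda>j. real_of_int j / 2) ` axis_set o' k b"
proof (intro equalityI subsetI)
  fix h assume "h \<in> axis_heights o' k b"
  then obtain m s r where h: "h = real_of_int (m - s + 2 * r - 1) / 2" "(o', m, s) \<in> lobes k b" "r \<in> {1..s}"
    unfolding axis_heights_def by blast
  then have "\<bar>m - s + 2 * r - 1 - m\<bar> < s" "odd (m - s + 2 * r - 1 - m + s)" by auto
  then have "m - s + 2 * r - 1 \<in> axis_set o' k b" unfolding axis_set_def using h(2) by blast
  then show "h \<in> (\<lambda>j. real_of_int j / 2) ` axis_set o' k b" using h(1) by blast
next
  fix h assume "h \<in> (\<lambda>j. real_of_int j / 2) ` axis_set o' k b"
  then obtain j m s where h: "h = real_of_int j / 2" "(o', m, s) \<in> lobes k b" "\<bar>j - m\<bar> < s" "odd (j - m + s)"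
    unfolding axis_set_def by blast
  obtain r where r: "j - m + s = 2 * r + 1" using h(4) by (rule oddE)
  then have "j = m - s + 2 * (r + 1) - 1" "r + 1 \<in> {1..s}" using h(3) by auto
  then show "h \<in> axis_heights o' k b" unfolding axis_heights_def h(1) using h(2) by blast
qed

lemma lobe_edge_Suc: "1 \<le> i \<Longrightarrow> lobe_edge b (Suc i) = lobe_edge b i + 2 * b (Suc i)"
  unfolding lobe_edge_def by simp

lemma lobe_edge_1: "lobe_edge b 1 = b 1"
  unfolding lobe_edge_def by simp

lemma lobe_midpoint_edge: "2 \<le> i \<Longrightarrow> lobe_midpoint b i = lobe_edge b (i - 1) + b i \<and> lobe_edge b i = lobe_edge b (i - 1) + 2 * b i"
proof -
  assume i: "2 \<le> i"
  then obtain n where n: "i = Suc n" "1 \<le> n" by (cases i) auto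
  have "{2..<i} = {2..n}" unfolding n by auto
  then show ?thesis using n lobe_edge_Suc[OF n(2), of b] i unfolding lobe_midpoint_def lobe_edge_def by simp
qed

context
  fixes k :: nat and b :: "nat \<Rightarrow> int"
  assumes b_nonneg: "\<And>i. i \<in> {1..2 * k + 1} \<Longrightarrow> 0 \<le> b i"
begin

lemma lobe_edge_mono: "1 \<le> i \<Longrightarrow> i \<le> i' \<Longrightarrow> i' \<le> 2 * k + 1 \<Longrightarrow> lobe_edge b i \<le> lobe_edge b i'"
proof (induction i')
  case (Suc n)
  then show ?case using lobe_edge_Suc[of n b] b_nonneg[of "Suc n"] by (cases "i = Suc n") auto
qed simp

lemma lobe_edge_pos: "1 \<le> i \<Longrightarrow> i \<le> 2 * k + 1 \<Longrightarrow> b 1 \<le> lobe_edge b i"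
  using lobe_edge_mono[of 1 i] lobe_edge_1 by simp

lemma lobe_even: "even (lobe_edge b i - b 1)"
  unfolding lobe_edge_def by simp

lemma lobes_cases:
  assumes "(o', m, s) \<in> lobes k b"
  obtains (core) "o'" "m = 0" "s = b 1"
  | (outer) i \<epsilon> where "i \<in> {2..2 * k + 1}" "o' = odd i" "s = b i" "\<epsilon> = 1 \<or> \<epsilon> = - 1"
     "m = \<epsilon> * (lobe_edge b (i - 1) + b i)" "lobe_edge b i = lobe_edge b (i - 1) + 2 * b i" "b 1 \<le> lobe_edge b (i - 1)" "0 \<le> b i"
     "lobe_edge b i \<le> lobe_edge b (2 * k + 1)"
proof -
  from assms obtain i where i: "o' = odd i" "s = b i" "i \<in> {1..2 * k + 1}" "m = lobe_midpoint b i \<or> m = - lobe_midpoint b i"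
    unfolding lobes_def by auto
  show thesis
  proof (cases "i = 1")
    case True
    then show thesis using i core by (auto simp: lobe_midpoint_def)
  next
    case False
    then have i2: "i \<in> {2..2 * k + 1}" using i(3) by auto
    then have bounds: "b 1 \<le> lobe_edge b (i - 1)" "0 \<le> b i" "lobe_edge b i \<le> lobe_edge b (2 * k + 1)"
      using lobe_edge_pos[of "i - 1"] b_nonneg[of i] lobe_edge_mono[of i "2 * k + 1"] by auto
    have e: "lobe_midpoint b i = lobe_edge b (i - 1) + b i" "lobe_edge b i = lobe_edge b (i - 1) + 2 * b i"
      using lobe_midpoint_edge[of i b] i2 by auto
    from i(4) show thesis
    proof
      assume "m = lobe_midpoint b i"
      then have "m = 1 * (lobe_edge b (i - 1) + b i)" using e(1) by simp
      then show thesis by (rule outer[OF i2 i(1,2) disjI1[OF refl] _ e(2) bounds(1,2,3)])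
    next
      assume "m = - lobe_midpoint b i"
      then have "m = - 1 * (lobe_edge b (i - 1) + b i)" using e(1) by simp
      then show thesis by (rule outer[OF i2 i(1,2) disjI2[OF refl] _ e(2) bounds(1,2,3)])
    qed
  qed
qed

lemma core_lobe: "(True, 0, b 1) \<in> lobes k b"
  unfolding lobes_def lobe_midpoint_def by force

lemma outer_lobe:
  assumes "i \<in> {2..2 * k + 1}"
  shows "(odd i, lobe_edge b (i - 1) + b i, b i) \<in> lobes k b" "(odd i, - (lobe_edge b (i - 1) + b i), b i) \<in> lobes k b"
proof -
  have e: "lobe_midpoint b i = lobe_edge b (i - 1) + b i" using assms lobe_midpoint_edge[of i b] by auto
  have "i \<in> {1..2 * k + 1}" using assms by auto
  then show "(odd i, lobe_edge b (i - 1) + b i, b i) \<in> lobes k b" "(odd i, - (lobe_edge b (i - 1) + b i), b i) \<in> lobes k b"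
    unfolding lobes_def e[symmetric] by blast+
qed

lemma lobe_bounds:
  assumes "(o', m, s) \<in> lobes k b"
  shows "0 \<le> s" "\<bar>m\<bar> + s \<le> lobe_edge b (2 * k + 1)" "even (m + s + b 1)" "o' \<and> m = 0 \<and> s = b 1 \<or> b 1 \<le> \<bar>m\<bar> - s"
proof -
  have b1: "0 \<le> b 1" using b_nonneg by simp
  have "0 \<le> s \<and> \<bar>m\<bar> + s \<le> lobe_edge b (2 * k + 1) \<and> even (m + s + b 1) \<and> (o' \<and> m = 0 \<and> s = b 1 \<or> b 1 \<le> \<bar>m\<bar> - s)"
    using assms
  proof (cases rule: lobes_cases)
    case core
    then show "0 \<le> s \<and> \<bar>m\<bar> + s \<le> lobe_edge b (2 * k + 1) \<and> even (m + s + b 1) \<and> (o' \<and> m = 0 \<and> s = b 1 \<or> b 1 \<le> \<bar>m\<bar> - s)"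
      using b1 lobe_edge_pos[of "2 * k + 1"] by simp
  next
    case (outer i \<epsilon>)
    have "even (lobe_edge b (i - 1) - b 1)" by (rule lobe_even)
    then have "even (m + s + b 1)" using outer by auto
    then show "0 \<le> s \<and> \<bar>m\<bar> + s \<le> lobe_edge b (2 * k + 1) \<and> even (m + s + b 1) \<and> (o' \<and> m = 0 \<and> s = b 1 \<or> b 1 \<le> \<bar>m\<bar> - s)"
      using outer b1 by auto
  qed
  then show "0 \<le> s" "\<bar>m\<bar> + s \<le> lobe_edge b (2 * k + 1)" "even (m + s + b 1)" "o' \<and> m = 0 \<and> s = b 1 \<or> b 1 \<le> \<bar>m\<bar> - s"
    by blast+
qed

lemma lobe_separated:
  assumes "(o1, m1, s1) \<in> lobes k b" "(o2, m2, s2) \<in> lobes k b" "(o1, m1, s1) \<noteq> (o2, m2, s2)"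
  shows "s1 + s2 \<le> \<bar>m1 - m2\<bar>"
proof -
  have b1: "0 \<le> b 1" using b_nonneg by simp
  have outer_outer: "s1 + s2 \<le> \<bar>m1 - m2\<bar>"
    if "i \<in> {2..2 * k + 1}" "i' \<in> {2..2 * k + 1}" "i < i'"
      "s1 = b i" "\<epsilon> = 1 \<or> \<epsilon> = - 1" "m1 = \<epsilon> * (lobe_edge b (i - 1) + b i)" "lobe_edge b i = lobe_edge b (i - 1) + 2 * b i" "b 1 \<le> lobe_edge b (i - 1)" "0 \<le> b i"
      "s2 = b i'" "\<epsilon>' = 1 \<or> \<epsilon>' = - 1" "m2 = \<epsilon>' * (lobe_edge b (i' - 1) + b i')" "0 \<le> b i'" for i i' :: nat and \<epsilon> \<epsilon>' m1 m2 s1 s2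
  proof -
    have "lobe_edge b i \<le> lobe_edge b (i' - 1)" using that(1-3) by (intro lobe_edge_mono) auto
    then show ?thesis using that b1 by auto
  qed
  from assms(1) show ?thesis
  proof (cases rule: lobes_cases)
    case core1: core
    from assms(2) show ?thesis
    proof (cases rule: lobes_cases)
      case core
      then show ?thesis using core1 assms(3) by simp
    next
      case outer
      then show ?thesis using core1 b1 by auto
    qed
  next
    case outer1: (outer i \<epsilon>)
    from assms(2) show ?thesis
    proof (cases rule: lobes_cases)
      case core
      then show ?thesis using outer1 b1 by auto
    next
      case outer2: (outer i' \<epsilon>')
      consider "i < i'" | "i' < i" | "i = i'" by linarith
      then show ?thesis
      proof cases
        case 1
        then show ?thesis using outer_outer[of i i' s1 \<epsilon> m1 s2 \<epsilon>' m2] outer1 outer2 by blast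
      next
        case 2
        then show ?thesis using outer_outer[of i' i s2 \<epsilon>' m2 s1 \<epsilon> m1] outer1 outer2 by (simp add: abs_minus_commute add.commute)
      next
        case 3
        then have "\<epsilon> \<noteq> \<epsilon>'" using assms(3) outer1 outer2 by auto
        then show ?thesis using 3 outer1 outer2 b1 by auto
      qed
    qed
  qed
qed

lemma finite_lobes: "finite (lobes k b)"
proof -
  have "lobes k b \<subseteq> (\<lambda>i. (odd i, lobe_midpoint b i, b i)) ` {1..2 * k + 1} \<union> (\<lambda>i. (odd i, - lobe_midpoint b i, b i)) ` {1..2 * k + 1}"
    unfolding lobes_def by auto
  then show ?thesis by (rule finite_subset) simp
qed

lemma lobe_minus:
  assumes "(o', m, s) \<in> lobes k b" shows "(o', - m, s) \<in> lobes k b"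
proof -
  obtain i where i: "o' = odd i" "s = b i" "i \<in> {1..2 * k + 1}" "m \<in> {lobe_midpoint b i, - lobe_midpoint b i}"
    using assms unfolding lobes_def by blast
  then have "- m \<in> {lobe_midpoint b i, - lobe_midpoint b i}" by auto
  then show ?thesis using i(1-3) unfolding lobes_def by blast
qed

lemma axis_set_minus: "uminus ` axis_set o' k b = axis_set o' k b"
proof -
  have "- j \<in> axis_set o' k b" if j: "j \<in> axis_set o' k b" for j
  proof -
    obtain m s where "(o', m, s) \<in> lobes k b" "\<bar>j - m\<bar> < s" "odd (j - m + s)" using j unfolding axis_set_def by blast
    then have "(o', - m, s) \<in> lobes k b" "\<bar>- j - (- m)\<bar> < s" "odd (- j - (- m) + s)" using lobe_minus by auto
    then show ?thesis unfolding axis_set_def by blast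
  qed
  note minus = this
  show ?thesis
  proof (intro equalityI subsetI)
    fix j assume "j \<in> axis_set o' k b"
    then show "j \<in> uminus ` axis_set o' k b" using minus by (intro image_eqI[of j uminus "- j"]) auto
  qed (use minus in auto)
qed

lemma axis_set_bounds: "j \<in> axis_set o' k b \<Longrightarrow> \<bar>j\<bar> < lobe_edge b (2 * k + 1) \<and> odd (j + b 1)"
proof -
  assume "j \<in> axis_set o' k b"
  then obtain m s where l: "(o', m, s) \<in> lobes k b" "\<bar>j - m\<bar> < s" "odd (j - m + s)" unfolding axis_set_def by blast
  have "odd (j + b 1)" using l(3) lobe_bounds(3)[OF l(1)] by presburger
  then show ?thesis using lobe_bounds(2)[OF l(1)] l(2) by auto
qed

lemma axis_set_disjoint: "axis_set True k b \<inter> axis_set False k b = {}"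
proof -
  have False if l: "(True, m, s) \<in> lobes k b" "\<bar>j - m\<bar> < s" and l': "(False, m', s') \<in> lobes k b" "\<bar>j - m'\<bar> < s'" for j m s m' s'
    using lobe_separated[OF l(1) l'(1)] l(2) l'(2) by simp
  then show ?thesis unfolding axis_set_def by blast
qed

text \<open>Consecutive lobes touch, so the lobes up to index n fill the axis without gaps up to
  \<open>lobe_edge b n\<close> in both directions; induction on n.\<close>

lemma axis_set_Un: "axis_set True k b \<union> axis_set False k b = {j. \<bar>j\<bar> < lobe_edge b (2 * k + 1) \<and> odd (j + b 1)}"
proof (intro equalityI subsetI)
  fix j assume "j \<in> {j. \<bar>j\<bar> < lobe_edge b (2 * k + 1) \<and> odd (j + b 1)}"
  then have j: "\<bar>j\<bar> < lobe_edge b (2 * k + 1)" "odd (j + b 1)" by auto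
  have *: "\<exists>o'. j \<in> axis_set o' k b" if "1 \<le> n" "n \<le> 2 * k + 1" "\<bar>j\<bar> < lobe_edge b n" for n
    using that
  proof (induction n)
    case (Suc n)
    show ?case
    proof (cases "n = 0")
      case True
      then have "\<bar>j - 0\<bar> < b 1" using Suc.prems lobe_edge_1[of b] by simp
      moreover have "odd (j - 0 + b 1)" using j(2) by simp
      ultimately show ?thesis using core_lobe unfolding axis_set_def by blast
    next
      case n: False
      show ?thesis
      proof (cases "\<bar>j\<bar> < lobe_edge b n")
        case True
        then show ?thesis using Suc n by auto
      next
        case False
        have e: "lobe_edge b (Suc n) = lobe_edge b n + 2 * b (Suc n)" using n by (intro lobe_edge_Suc) auto
        have ev: "even (lobe_edge b n - b 1)" by (rule lobe_even)
        have i: "Suc n \<in> {2..2 * k + 1}" using n Suc.prems by auto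
        have "\<bar>j\<bar> \<noteq> lobe_edge b n" using j(2) ev by presburger
        then have lt: "lobe_edge b n < \<bar>j\<bar>" using False by simp
        let ?m = "lobe_edge b n + b (Suc n)"
        show ?thesis
        proof (cases "0 \<le> j")
          case True
          have "\<bar>j - ?m\<bar> < b (Suc n)" using lt True Suc.prems(3) unfolding e by auto
          moreover have "odd (j - ?m + b (Suc n))" using ev j(2) by auto
          moreover have "(odd (Suc n), ?m, b (Suc n)) \<in> lobes k b" using outer_lobe(1)[OF i] by simp
          ultimately show ?thesis unfolding axis_set_def by blast
        next
          case False
          have "\<bar>j - (- ?m)\<bar> < b (Suc n)" using lt False Suc.prems(3) unfolding e by auto
          moreover have "odd (j - (- ?m) + b (Suc n))" using ev j(2) by auto
          moreover have "(odd (Suc n), - ?m, b (Suc n)) \<in> lobes k b" using outer_lobe(2)[OF i] by simp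
          ultimately show ?thesis unfolding axis_set_def by blast
        qed
      qed
    qed
  qed simp
  then obtain o' where "j \<in> axis_set o' k b" using j(1) *[of "2 * k + 1"] by auto
  then show "j \<in> axis_set True k b \<union> axis_set False k b" by (cases o') auto
qed (use axis_set_bounds in auto)

lemma finite_axis_set: "finite (axis_set o' k b)"
  using axis_set_bounds by (intro finite_int_interval_subset[of _ "- lobe_edge b (2 * k + 1)" "lobe_edge b (2 * k + 1)"]) force

lemma zero_axis_set:
  assumes "0 < b 1" "odd (b 1)" shows "0 \<in> axis_set True k b"
proof -
  have "\<bar>0 - 0\<bar> < b 1" "odd (0 - 0 + b 1)" using assms by auto
  then show ?thesis using core_lobe unfolding axis_set_def by blast
qed

lemma zero_notin_axis_set: "0 \<notin> axis_set False k b"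
proof
  assume "0 \<in> axis_set False k b"
  then obtain m s where l: "(False, m, s) \<in> lobes k b" "\<bar>m\<bar> < s" unfolding axis_set_def by auto
  have "0 \<le> b 1" using b_nonneg by simp
  then show False using lobe_bounds(4)[OF l(1)] l(2) by auto
qed

lemma card_positives_False: "int (card (positives (axis_set False k b))) = (\<Sum>i = 1..k. b (2 * i))"
proof -
  let ?J = "\<lambda>i. {j. lobe_edge b (2 * i - 1) < j \<and> j < lobe_edge b (2 * i) \<and> odd (j - lobe_edge b (2 * i - 1))}"
  have b1: "0 \<le> b 1" using b_nonneg by simp
  have e: "lobe_edge b (2 * i) = lobe_edge b (2 * i - 1) + 2 * b (2 * i)" "0 \<le> b (2 * i)" "0 \<le> lobe_edge b (2 * i - 1)" if "i \<in> {1..k}" for i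
  proof -
    have i: "2 \<le> 2 * i" "1 \<le> 2 * i - 1" "2 * i - 1 \<le> 2 * k + 1" using that by auto
    show "lobe_edge b (2 * i) = lobe_edge b (2 * i - 1) + 2 * b (2 * i)" using lobe_midpoint_edge[OF i(1), of b] by simp
    show "0 \<le> b (2 * i)" using that by (intro b_nonneg) auto
    show "0 \<le> lobe_edge b (2 * i - 1)" using lobe_edge_pos[OF i(2,3)] b1 by linarith
  qed
  have "positives (axis_set False k b) = (\<Union>i\<in>{1..k}. ?J i)"
  proof (intro equalityI subsetI)
    fix j assume "j \<in> positives (axis_set False k b)"
    then obtain m s where l: "(False, m, s) \<in> lobes k b" "\<bar>j - m\<bar> < s" "odd (j - m + s)" and j: "0 < j"
      unfolding axis_set_def by blast
    from l(1) show "j \<in> (\<Union>i\<in>{1..k}. ?J i)"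
    proof (cases rule: lobes_cases)
      case (outer i \<epsilon>)
      then obtain i' where i': "i = 2 * i'" by (auto elim: evenE)
      have "\<epsilon> = 1" using outer l(2) j b1 by auto
      then have "j \<in> ?J i'" using outer l(2,3) unfolding i' by auto
      moreover have "i' \<in> {1..k}" using outer(1) i' by auto
      ultimately show ?thesis by blast
    qed simp
  next
    fix j assume "j \<in> (\<Union>i\<in>{1..k}. ?J i)"
    then obtain i where i: "i \<in> {1..k}" "j \<in> ?J i" by blast
    have "2 * i \<in> {2..2 * k + 1}" using i(1) by auto
    from outer_lobe(1)[OF this] have "(False, lobe_edge b (2 * i - 1) + b (2 * i), b (2 * i)) \<in> lobes k b" by simp
    moreover have "\<bar>j - (lobe_edge b (2 * i - 1) + b (2 * i))\<bar> < b (2 * i)" "odd (j - (lobe_edge b (2 * i - 1) + b (2 * i)) + b (2 * i))"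
      using i(2) e[OF i(1)] by auto
    ultimately have "j \<in> axis_set False k b" unfolding axis_set_def by blast
    then show "j \<in> positives (axis_set False k b)" using i e[OF i(1)] by auto
  qed
  moreover have "card (\<Union>i\<in>{1..k}. ?J i) = (\<Sum>i = 1..k. card (?J i))"
  proof (rule card_UN_disjoint)
    show "\<forall>i\<in>{1..k}. finite (?J i)" using finite_odd_gap by blast
    show "\<forall>i\<in>{1..k}. \<forall>i'\<in>{1..k}. i \<noteq> i' \<longrightarrow> ?J i \<inter> ?J i' = {}"
    proof (intro ballI impI)
      have *: "?J i \<inter> ?J i' = {}" if "i < i'" "i \<in> {1..k}" "i' \<in> {1..k}" for i i'
      proof -
        have "lobe_edge b (2 * i) \<le> lobe_edge b (2 * i' - 1)" using that by (intro lobe_edge_mono) auto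
        then show ?thesis by auto
      qed
      fix i i' assume "i \<in> {1..k}" "i' \<in> {1..k}" "i \<noteq> i'"
      then show "?J i \<inter> ?J i' = {}" using *[of i i'] *[of i' i] by (cases i i' rule: linorder_cases) auto
    qed
  qed simp
  moreover have "int (card (?J i)) = b (2 * i)" if "i \<in> {1..k}" for i
    using e[OF that] by (subst card_odd_gap) auto
  ultimately show ?thesis by simp
qed

text \<open>Even-indexed lobes are counted directly; the odd-indexed ones follow by complement in
  the whole fern. The height 0, present when the core has odd size, is its own mirror image and must
  be left out for the count to be twice that of the positive half.\<close>

lemma card_axis_sets:
  "int (card (axis_set False k b)) = 2 * (\<Sum>i = 1..k. b (2 * i))"
  "int (card (axis_set True k b - {0})) = 2 * (lobe_edge b (2 * k + 1) div 2 - (\<Sum>i = 1..k. b (2 * i)))"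
proof -
  let ?O = "axis_set True k b" and ?E = "axis_set False k b" and ?e = "lobe_edge b (2 * k + 1)"
  have E: "card ?E = 2 * card (positives ?E)"
    by (rule card_symmetric[OF finite_axis_set zero_notin_axis_set axis_set_minus])
  then show "int (card ?E) = 2 * (\<Sum>i = 1..k. b (2 * i))" using card_positives_False by simp
  have sym: "uminus ` (?O - {0}) = ?O - {0}"
    using axis_set_minus[of True] by (subst image_set_diff) auto
  have O: "card (?O - {0}) = 2 * card (positives (?O - {0}))"
    by (rule card_symmetric[OF _ _ sym]) (use finite_axis_set in auto)
  have "positives (?O - {0}) \<union> positives ?E = {j. 0 < j \<and> j < ?e \<and> odd (j + b 1)}"
  proof -
    have "positives (?O - {0}) \<union> positives ?E = {j. 0 < j \<and> j \<in> ?O \<union> ?E}" by auto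
    also have "\<dots> = {j. 0 < j \<and> j < ?e \<and> odd (j + b 1)}" unfolding axis_set_Un by auto
    finally show ?thesis .
  qed
  moreover have "card (positives (?O - {0}) \<union> positives ?E) = card (positives (?O - {0})) + card (positives ?E)"
  proof (rule card_Un_disjoint)
    show "positives (?O - {0}) \<inter> positives ?E = {}" using axis_set_disjoint by blast
    show "finite (positives (?O - {0}))" "finite (positives ?E)"
      using finite_axis_set[of True] finite_axis_set[of False] by simp_all
  qed
  moreover have "int (card {j. 0 < j \<and> j < ?e \<and> odd (j + b 1)}) = ?e div 2"
  proof (cases "even (b 1)")
    case True
    have "0 \<le> ?e" using lobe_edge_pos[of "2 * k + 1"] b_nonneg[of 1] by simp
    moreover have "{j. 0 < j \<and> j < ?e \<and> odd (j + b 1)} = {j. 0 < j \<and> j < ?e \<and> odd (j - 0)}" using True by auto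
    ultimately show ?thesis using card_odd_gap[of 0 ?e] by simp
  next
    case False
    have "odd ?e" using lobe_even[of "2 * k + 1"] False by presburger
    have "0 \<le> ?e" using lobe_edge_pos[of "2 * k + 1"] b_nonneg[of 1] by simp
    then have "1 \<le> ?e" using \<open>odd ?e\<close> by presburger
    moreover have "{j. 0 < j \<and> j < ?e \<and> odd (j + b 1)} = {j. 1 < j \<and> j < ?e \<and> odd (j - 1)}"
    proof (rule Collect_cong)
      fix j
      have "odd (j + b 1) \<longleftrightarrow> even j" "odd (j - 1) \<longleftrightarrow> even j" using False by simp_all
      moreover have "even j \<Longrightarrow> 0 < j \<longleftrightarrow> 1 < j" by presburger
      ultimately show "0 < j \<and> j < ?e \<and> odd (j + b 1) \<longleftrightarrow> 1 < j \<and> j < ?e \<and> odd (j - 1)" by blast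
    qed
    ultimately have "int (card {j. 0 < j \<and> j < ?e \<and> odd (j + b 1)}) = (?e - 1) div 2" using card_odd_gap[of 1 ?e] by simp
    then show ?thesis using \<open>odd ?e\<close> by presburger
  qed
  ultimately have "int (card (positives (?O - {0}))) = ?e div 2 - (\<Sum>i = 1..k. b (2 * i))"
    using card_positives_False by simp
  then show "int (card (?O - {0})) = 2 * (?e div 2 - (\<Sum>i = 1..k. b (2 * i)))" using O by simp
qed

lemma fern_weight_eq:
  fixes q :: "'a::field_char_0"
  shows "fern_weight q k b = (\<Prod>(o', m, s)\<in>lobes k b. lobe_weight q m s)"
  unfolding fern_weight_def
proof (rule prod.cong[OF refl])
  fix l assume l: "l \<in> lobes k b"
  obtain o' m s where oms: "l = (o', m, s)" by (cases l)
  have "even (b 1 + s + m)" using lobe_bounds(3)[of o' m s] l oms by (simp add: ac_simps)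
  then show "(case l of (o', m, s) \<Rightarrow> Mq q {t \<in> triangle o' (b 1) m s. side_line t \<noteq> b 1}) = (case l of (o', m, s) \<Rightarrow> lobe_weight q m s)"
    unfolding oms by (simp add: Mq_triangle_off_axis)
qed

end

section \<open>Moving the dents of a fern across the axis\<close>

text \<open>
  The axis of a fern meets the boundary at heights \<open>N + 2 min(y, w)\<close> and \<open>- N - 2 min(y, z)\<close>.
  Prolonging, at either end, the boundary side that stops short of the axis completes both halves to
  trapezoids and adds a corner triangle, whose dents on the axis are the sets \<open>X\<close> and \<open>Y\<close> of the theorem.
\<close>

definition left_corner :: "int \<Rightarrow> int \<Rightarrow> int \<Rightarrow> int \<Rightarrow> int set" where
  "left_corner N y z w = {j. odd (N + j) \<and> (N + 2 * w < j \<and> j < N + 2 * y \<or> - (N + 2 * y) < j \<and> j < - (N + 2 * z))}"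

definition right_corner :: "int \<Rightarrow> int \<Rightarrow> int \<Rightarrow> int \<Rightarrow> int set" where
  "right_corner N y z w = {j. odd (N + j) \<and> (N + 2 * y < j \<and> j < N + 2 * w \<or> - (N + 2 * z) < j \<and> j < - (N + 2 * y))}"

text \<open>The axis heights of a single core of size e, apart from 0.\<close>

definition central :: "int \<Rightarrow> int set" where
  "central e = {j. odd (e + j) \<and> \<bar>j\<bar> < e \<and> j \<noteq> 0}"

lemma card_axis_gap:
  fixes lo hi e :: int
  assumes "even (lo - e)" "even (hi - e)"
  shows "finite {j. odd (e + j) \<and> lo < j \<and> j < hi}" "int (card {j. odd (e + j) \<and> lo < j \<and> j < hi}) = max 0 ((hi - lo) div 2)"
proof -
  have eq: "{j. odd (e + j) \<and> lo < j \<and> j < hi} = {j. lo < j \<and> j < hi \<and> odd (j - lo)}"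
  proof (rule Collect_cong)
    fix j have "odd (e + j) \<longleftrightarrow> odd (j - lo)" using assms by presburger
    then show "odd (e + j) \<and> lo < j \<and> j < hi \<longleftrightarrow> lo < j \<and> j < hi \<and> odd (j - lo)" by blast
  qed
  show "finite {j. odd (e + j) \<and> lo < j \<and> j < hi}"
    by (rule finite_int_interval_subset[of _ lo hi]) auto
  show "int (card {j. odd (e + j) \<and> lo < j \<and> j < hi}) = max 0 ((hi - lo) div 2)"
  proof (cases "lo \<le> hi")
    case True
    then show ?thesis unfolding eq card_odd_gap[OF True] by simp
  next
    case False
    then have "{j. odd (e + j) \<and> lo < j \<and> j < hi} = {}" by auto
    then show ?thesis using False by simp
  qed
qed

lemma card_Un_three:
  assumes "finite A" "finite B" "finite C" "A \<inter> B = {}" "(A \<union> B) \<inter> C = {}"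
  shows "int (card (A \<union> B \<union> C)) = int (card A) + int (card B) + int (card C)"
  using assms by (simp add: card_Un_disjoint)

lemma card_central:
  fixes e :: int
  assumes "0 \<le> e"
  shows "finite {j. odd (e + j) \<and> 0 < j \<and> j < e}" "int (card {j. odd (e + j) \<and> 0 < j \<and> j < e}) = e div 2"
proof -
  show "finite {j. odd (e + j) \<and> 0 < j \<and> j < e}" by (rule finite_int_interval_subset[of _ 0 e]) auto
  show "int (card {j. odd (e + j) \<and> 0 < j \<and> j < e}) = e div 2"
  proof (cases "even e")
    case True
    then show ?thesis using card_axis_gap(2)[of 0 e e] assms by simp
  next
    case False
    then have "1 \<le> e" using assms by presburger
    have "{j. odd (e + j) \<and> 0 < j \<and> j < e} = {j. odd (e + j) \<and> 1 < j \<and> j < e}"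
    proof (rule Collect_cong)
      fix j have "odd (e + j) \<Longrightarrow> 0 < j \<longleftrightarrow> 1 < j" using False by presburger
      then show "odd (e + j) \<and> 0 < j \<and> j < e \<longleftrightarrow> odd (e + j) \<and> 1 < j \<and> j < e" by blast
    qed
    then have "int (card {j. odd (e + j) \<and> 0 < j \<and> j < e}) = (e - 1) div 2"
      using card_axis_gap(2)[of 1 e e] False \<open>1 \<le> e\<close> by simp
    moreover have "(e - 1) div 2 = e div 2" using False by presburger
    ultimately show ?thesis by simp
  qed
qed

context
  fixes q :: "'a::linordered_field"
    and e N y z w :: int and Q E1 :: "int set"
  assumes q: "q > 0" and yzw: "0 \<le> y" "0 \<le> z" "0 \<le> w" and e: "0 \<le> e" "e \<le> N" "even (N - e)"
    and Q: "Q \<subseteq> {j. odd (e + j) \<and> \<bar>j\<bar> < e \<and> j \<noteq> 0}" "uminus ` Q = Q"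
    and E1: "E1 \<subseteq> {0}" "E1 \<noteq> {} \<Longrightarrow> odd e"
begin

section \<open>Nonvanishing denominators and comparison of two outer boundaries\<close>

lemma finite_sets: "finite (central e)" "finite Q" "finite E1" "finite (left_corner N y z w)" "finite (right_corner N y z w)"
proof -
  show c: "finite (central e)" unfolding central_def by (rule finite_int_interval_subset[of _ "- e" e]) auto
  show "finite Q" using Q(1) c unfolding central_def by (rule finite_subset)
  show "finite E1" using E1(1) by (rule finite_subset) simp
  show "finite (left_corner N y z w)" unfolding left_corner_def
    using yzw e by (intro finite_int_interval_subset[of _ "- (N + 2 * y)" "N + 2 * y"]) auto
  show "finite (right_corner N y z w)" unfolding right_corner_def
    using yzw e by (intro finite_int_interval_subset[of _ "- (N + 2 * z)" "N + 2 * w"]) auto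
qed

lemma card_central_full: "int (card (central e)) = 2 * (e div 2)"
proof -
  have "uminus ` (central e) = (central e)"
  proof (intro equalityI subsetI)
    fix j assume "j \<in> (central e)"
    then have "- j \<in> (central e)" unfolding central_def by simp
    then show "j \<in> uminus ` (central e)" by (intro image_eqI[of j uminus "- j"]) auto
  qed (auto simp: central_def)
  then have "card (central e) = 2 * card (positives (central e))"
    by (intro card_symmetric finite_sets) (auto simp: central_def)
  moreover have "positives (central e) = {j. odd (e + j) \<and> 0 < j \<and> j < e}" unfolding central_def by auto
  ultimately show ?thesis using card_central[OF e(1)] by simp
qed

text \<open>The witness S fills the axis next to the core: min(y, w) segments above and min(y, z)
  below. Above the intrusion, the core gives e div 2 dents and S with the left corner gives min(y,
  w) + max(0, y - w) = y more, as p div 2 requires; likewise below. On the right, S and both corners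
  give w + z, and E1 accounts for the rest of n.\<close>

lemma two_sided_denominator_pos:
  assumes p: "int p = e + 2 * y" and n: "int n = w + z + int (card E1)"
    and s: "0 \<le> s" "even s" and b: "N + 2 * y \<le> s + int p" "N + 2 * z \<le> b" "N + 2 * w \<le> t" "2 * int n \<le> b + t"
       "even (int p - b)" "even (int p - t)"
  shows "Mq q (two_sided p n s b t ((central e) \<union> left_corner N y z w) (right_corner N y z w \<union> E1)) > 0"
proof -
  define Sp where "Sp = {j. odd (e + j) \<and> e < j \<and> j < e + 2 * min y w}"
  define Sn where "Sn = {j. odd (e + j) \<and> e < j \<and> j < e + 2 * min y z}"
  define ZLt where "ZLt = {j. odd (e + j) \<and> N + 2 * w < j \<and> j < N + 2 * y}"
  define ZLb where "ZLb = {j. odd (e + j) \<and> N + 2 * z < j \<and> j < N + 2 * y}"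
  define ZRt where "ZRt = {j. odd (e + j) \<and> N + 2 * y < j \<and> j < N + 2 * w}"
  define ZRb where "ZRb = {j. odd (e + j) \<and> N + 2 * y < j \<and> j < N + 2 * z}"
  define C where "C = {j. odd (e + j) \<and> 0 < j \<and> j < e}"
  define LL where "LL = (central e) \<union> left_corner N y z w"
  define RR where "RR = right_corner N y z w \<union> E1"
  define S where "S = Sp \<union> uminus ` Sn"
  have Nodd: "odd (N + j) \<longleftrightarrow> odd (e + j)" for j using e(3) by presburger
  have podd: "odd (int p + j) \<longleftrightarrow> odd (e + j)" for j unfolding p by simp
  have minus_iff: "j \<in> uminus ` X \<longleftrightarrow> - j \<in> X" for j :: int and X by (auto simp: image_iff) (metis minus_minus)
  have mem: "j \<in> S \<longleftrightarrow> odd (e + j) \<and> (e < j \<and> j < e + 2 * min y w \<or> e < - j \<and> - j < e + 2 * min y z)" for j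
    unfolding S_def Un_iff minus_iff Sp_def Sn_def by auto
  have L: "j \<in> LL \<longleftrightarrow> odd (e + j) \<and> (\<bar>j\<bar> < e \<and> j \<noteq> 0 \<or> N + 2 * w < j \<and> j < N + 2 * y \<or> - (N + 2 * y) < j \<and> j < - (N + 2 * z))" for j
    unfolding LL_def central_def left_corner_def Nodd by auto
  have Req: "j \<in> right_corner N y z w \<longleftrightarrow> odd (e + j) \<and> (N + 2 * y < j \<and> j < N + 2 * w \<or> - (N + 2 * z) < j \<and> j < - (N + 2 * y))" for j
    unfolding right_corner_def Nodd by auto
  have E1': "odd (e + j)" "j = 0" "1 \<le> e" if "j \<in> E1" for j
  proof -
    show "j = 0" using that E1(1) by auto
    have "odd e" using that E1(2) by auto
    then show "odd (e + j)" using \<open>j = 0\<close> by simp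
    have "e \<noteq> 0" using \<open>odd e\<close> by auto
    then show "1 \<le> e" using e(1) by simp
  qed
  have cSp: "finite Sp" "int (card Sp) = min y w" unfolding Sp_def using card_axis_gap[of e e "e + 2 * min y w"] yzw by auto
  have cSn: "finite Sn" "int (card Sn) = min y z" unfolding Sn_def using card_axis_gap[of e e "e + 2 * min y z"] yzw by auto
  have cZLt: "finite ZLt" "int (card ZLt) = max 0 (y - w)" unfolding ZLt_def using card_axis_gap[of "N + 2 * w" e "N + 2 * y"] e(3) by auto
  have cZLb: "finite ZLb" "int (card ZLb) = max 0 (y - z)" unfolding ZLb_def using card_axis_gap[of "N + 2 * z" e "N + 2 * y"] e(3) by auto
  have cZRt: "finite ZRt" "int (card ZRt) = max 0 (w - y)" unfolding ZRt_def using card_axis_gap[of "N + 2 * y" e "N + 2 * w"] e(3) by auto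
  have cZRb: "finite ZRb" "int (card ZRb) = max 0 (z - y)" unfolding ZRb_def using card_axis_gap[of "N + 2 * y" e "N + 2 * z"] e(3) by auto
  have cC: "finite C" "int (card C) = e div 2" unfolding C_def using card_central[OF e(1)] by auto
  have phalf: "int (p div 2) = e div 2 + y"
  proof -
    have "int (p div 2) = (e + 2 * y) div 2" using p by (simp add: zdiv_int)
    then show ?thesis by simp
  qed
  have "positives (LL \<union> S) = C \<union> Sp \<union> ZLt"
  proof (intro equalityI subsetI)
    fix j assume "j \<in> positives (LL \<union> S)"
    then have "0 < j" "j \<in> LL \<or> j \<in> S" by auto
    then show "j \<in> C \<union> Sp \<union> ZLt" unfolding L mem C_def Sp_def ZLt_def using yzw e by auto
  next
    fix j assume j: "j \<in> C \<union> Sp \<union> ZLt"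
    then have "0 < j" unfolding C_def Sp_def ZLt_def using yzw e by auto
    moreover have "j \<in> LL \<or> j \<in> S" using j unfolding L mem C_def Sp_def ZLt_def using yzw e by auto
    ultimately show "j \<in> positives (LL \<union> S)" by blast
  qed
  moreover have "int (card (C \<union> Sp \<union> ZLt)) = int (card C) + int (card Sp) + int (card ZLt)"
    by (rule card_Un_three[OF cC(1) cSp(1) cZLt(1)]) (use e yzw in \<open>auto simp: C_def Sp_def ZLt_def\<close>)
  ultimately have c1: "card (positives (LL \<union> S)) = p div 2" using cC cSp cZLt phalf by (simp add: max_def min_def split: if_splits)
  have "negatives (LL \<union> S) = C \<union> Sn \<union> ZLb"
  proof (intro equalityI subsetI)
    fix j assume "j \<in> negatives (LL \<union> S)"
    then have "0 < j" "- j \<in> LL \<or> - j \<in> S" by auto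
    then show "j \<in> C \<union> Sn \<union> ZLb" unfolding L mem C_def Sn_def ZLb_def using yzw e by auto
  next
    fix j assume j: "j \<in> C \<union> Sn \<union> ZLb"
    then have "0 < j" unfolding C_def Sn_def ZLb_def using yzw e by auto
    moreover have "- j \<in> LL \<or> - j \<in> S" using j unfolding L mem C_def Sn_def ZLb_def using yzw e by auto
    ultimately show "j \<in> negatives (LL \<union> S)" by blast
  qed
  moreover have "int (card (C \<union> Sn \<union> ZLb)) = int (card C) + int (card Sn) + int (card ZLb)"
    by (rule card_Un_three[OF cC(1) cSn(1) cZLb(1)]) (use e yzw in \<open>auto simp: C_def Sn_def ZLb_def\<close>)
  ultimately have c2: "card (negatives (LL \<union> S)) = p div 2" using cC cSn cZLb phalf by (simp add: max_def min_def split: if_splits)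
  have "right_corner N y z w = ZRt \<union> uminus ` ZRb"
    by (rule Set.set_eqI) (unfold Req Un_iff minus_iff ZRt_def ZRb_def, auto)
  moreover have "card (ZRt \<union> uminus ` ZRb) = card ZRt + card (uminus ` ZRb)"
    using cZRt cZRb yzw e by (intro card_Un_disjoint) (auto simp: ZRt_def ZRb_def)
  moreover have "card (uminus ` ZRb) = card ZRb" "card (uminus ` Sn) = card Sn" by (rule card_image, simp)+
  moreover have "card S = card Sp + card (uminus ` Sn)"
    unfolding S_def using cSp cSn e by (intro card_Un_disjoint) (auto simp: Sp_def Sn_def)
  moreover have "int (card (right_corner N y z w \<union> E1 \<union> S)) = int (card (right_corner N y z w)) + int (card E1) + int (card S)"
  proof (rule card_Un_three)
    show "right_corner N y z w \<inter> E1 = {}"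
    proof -
      have "j \<notin> right_corner N y z w" if "j \<in> E1" for j unfolding Req using E1'[OF that] yzw e by auto
      then show ?thesis by auto
    qed
    have "j \<notin> right_corner N y z w \<union> E1" if "j \<in> S" for j
    proof -
      have "j \<noteq> 0" using that e unfolding mem by auto
      moreover have "j \<notin> right_corner N y z w" using that e yzw unfolding mem Req by (auto simp: min_def split: if_splits)
      ultimately show ?thesis using E1' by auto
    qed
    then show "(right_corner N y z w \<union> E1) \<inter> S = {}" by blast
  qed (use finite_sets cSp cSn in \<open>auto simp: S_def\<close>)
  ultimately have c3: "card (RR \<union> S) = n" unfolding RR_def
    using n cSp cSn cZRt cZRb by (simp add: max_def min_def split: if_splits)
  have S: "S \<subseteq> left_axis p s \<inter> right_axis p b t - LL - RR"
  proof
    fix j assume "j \<in> S"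
    then have j: "odd (e + j)" "e < j \<and> j < e + 2 * min y w \<or> e < - j \<and> - j < e + 2 * min y z" unfolding mem by auto
    have "j \<in> left_axis p s" "j \<in> right_axis p b t" unfolding left_axis_def right_axis_def podd using j e yzw b by auto
    moreover have "j \<notin> LL" unfolding L using j e yzw by (auto simp: min_def split: if_splits)
    moreover have "j \<noteq> 0" using j e by auto
    then have "j \<notin> RR" using j e yzw E1' unfolding RR_def Un_iff Req by (auto simp: min_def split: if_splits)
    ultimately show "j \<in> left_axis p s \<inter> right_axis p b t - LL - RR" by blast
  qed
  show ?thesis unfolding LL_def[symmetric] RR_def[symmetric]
  proof (rule two_sided_pos[OF q s b(5,6,4) _ _ _ _ S c1 c2 c3])
    show "LL \<subseteq> left_axis p s"
    proof
      fix j assume "j \<in> LL"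
      then show "j \<in> left_axis p s" unfolding L left_axis_def podd using yzw e b by auto
    qed
    show "RR \<subseteq> right_axis p b t"
    proof
      fix j assume "j \<in> RR"
      then consider "j \<in> right_corner N y z w" | "j \<in> E1" unfolding RR_def by blast
      then show "j \<in> right_axis p b t"
      proof cases
        case 1
        then show ?thesis unfolding Req right_axis_def podd using yzw e b by auto
      next
        case 2
        then show ?thesis unfolding right_axis_def podd using E1'[OF 2] yzw e b by auto
      qed
    qed
    show "LL = {}" if "p = 0"
    proof -
      have "e = 0" "y = 0" using that p e(1) yzw by auto
      then have "j \<notin> LL" for j unfolding L using yzw e by auto
      then show ?thesis by blast
    qed
    show "RR = {}" if "n = 0"
    proof -
      have "w = 0" "z = 0" "card E1 = 0" using that n yzw by auto
      then have "E1 = {}" "j \<notin> right_corner N y z w" for j unfolding Req using yzw e finite_sets by auto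
      then show ?thesis unfolding RR_def by blast
    qed
  qed
qed

text \<open>\<open>two_sided_move_dents\<close> is applied twice with the same K: once to the
  original boundary, whose halves end at N + 2 y on the left and at N + 2 w, - N - 2 z on the right,
  and once to the hexagon H, where all these ends are moved out to T. Because w is at most z, T is
  large enough for all of them.\<close>

lemma two_sided_ratio:
  assumes p: "int p + int (card Q) = e + 2 * y" and n: "int n = w + z + int (card E1)"
    and zw: "w \<le> z" and T: "T = N + 2 * max y z"
  defines "L \<equiv> ((central e) - Q) \<union> left_corner N y z w" and "R \<equiv> right_corner N y z w \<union> E1"
    and "L' \<equiv> (central e) \<union> left_corner N y z w"
  shows "Mq q (two_sided p (n + card Q) (N + 2 * y - int p) (N + 2 * z) (N + 2 * w) L (R \<union> Q))
      / Mq q (two_sided (p + card Q) n (N + 2 * y - int (p + card Q)) (N + 2 * z) (N + 2 * w) L' R)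
    = Mq q (two_sided p (n + card Q) (T - int p) T T L (R \<union> Q))
      / Mq q (two_sided (p + card Q) n (T - int (p + card Q)) T T L' R)"
proof -
  have Nodd: "odd (N + j) \<longleftrightarrow> odd (e + j)" for j using e(3) by presburger
  have Q0: "0 \<notin> Q" using Q(1) by auto
  have QC: "Q \<subseteq> (central e)" using Q(1) unfolding central_def .
  have evQ: "even (card Q)" using card_symmetric[OF finite_sets(2) Q0 Q(2)] by simp
  then have podd: "odd (int p + j) \<longleftrightarrow> odd (e + j)" for j using p by presburger
  have evp: "even (int p - e)" using p evQ by presburger
  have E1': "odd (e + j)" "j = 0" "1 \<le> e" if "j \<in> E1" for j
  proof -
    show "j = 0" using that E1(1) by auto
    have "odd e" using that E1(2) by auto
    then show "odd (e + j)" using \<open>j = 0\<close> by simp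
    have "e \<noteq> 0" using \<open>odd e\<close> by auto
    then show "1 \<le> e" using e(1) by simp
  qed
  \<comment> \<open>Q lies in \<open>central e\<close>, which for odd e misses one of the e axis
    segments of the core, the one at height 0; this leaves room for E1. The bound makes the right
    trapezoid wide enough.\<close>
  have cardE: "int (card E1) + int (card Q) \<le> e"
  proof -
    have "card Q \<le> card (central e)" using QC finite_sets by (intro card_mono)
    then have "int (card Q) \<le> 2 * (e div 2)" using card_central_full by simp
    moreover have "card E1 \<le> 1" using card_mono[OF _ E1(1)] by simp
    moreover have "odd e" if "card E1 > 0" using that E1(2) by (cases "E1 = {}") auto
    ultimately show ?thesis by (cases "card E1 > 0") (simp_all, presburger+)
  qed
  have LQ: "L \<union> Q = L'" unfolding L_def L'_def using QC by blast
  have Lmem: "odd (e + j) \<and> j \<noteq> 0 \<and> \<bar>j\<bar> < N + 2 * y" if "j \<in> L'" for j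
    using that yzw e unfolding L'_def central_def left_corner_def Un_iff mem_Collect_eq Nodd by auto
  have Rmem: "odd (e + j) \<and> - (N + 2 * z) < j \<and> j < N + 2 * w" if "j \<in> R \<union> Q" for j
  proof -
    consider "j \<in> right_corner N y z w" | "j \<in> E1" | "j \<in> Q" using \<open>j \<in> R \<union> Q\<close> unfolding R_def by blast
    then show ?thesis
    proof cases
      case 1
      then show ?thesis using yzw e unfolding right_corner_def mem_Collect_eq Nodd by auto
    next
      case 2
      then show ?thesis using E1'[OF 2] yzw e by auto
    next
      case 3
      then have "odd (e + j)" "\<bar>j\<bar> < e" using Q(1) by auto
      then show ?thesis using yzw e by auto
    qed
  qed
  have disj: "L \<inter> Q = {}" "R \<inter> Q = {}"
  proof -
    have Qb: "\<bar>j\<bar> < e \<and> j \<noteq> 0" if "j \<in> Q" for j using Q(1) that by auto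
    then have "j \<notin> left_corner N y z w" "j \<notin> right_corner N y z w" "j \<notin> E1" if "j \<in> Q" for j
      using Qb[OF that] yzw e E1'[of j] unfolding left_corner_def right_corner_def by auto
    then show "L \<inter> Q = {}" "R \<inter> Q = {}" unfolding L_def R_def by blast+
  qed
  \<comment> \<open>Without columns on the left, y is 0 and Q already exhausts
    \<open>central e\<close>.\<close>
  have trivp: "L = {}" if "p = 0"
  proof -
    have c: "card ((central e) - Q) = card (central e) - card Q" using QC finite_sets by (intro card_Diff_subset)
    have "e + 2 * y \<le> 2 * (e div 2)" using that p card_mono[OF finite_sets(1) QC] card_central_full by simp
    then have "y = 0" "int (card Q) = 2 * (e div 2)" using yzw that p by linarith+
    then have "(central e) - Q = {}" using c card_central_full finite_sets(1) by auto
    moreover have "left_corner N y z w = {}" unfolding left_corner_def using \<open>y = 0\<close> yzw e by auto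
    ultimately show ?thesis unfolding L_def by blast
  qed
  have trivn: "R = {}" if "n = 0"
  proof -
    have wz: "w = 0" "z = 0" "card E1 = 0" using that n yzw by auto
    then have "E1 = {}" using finite_sets by auto
    moreover have "right_corner N y z w = {}" unfolding right_corner_def using wz yzw e by auto
    ultimately show ?thesis unfolding R_def by blast
  qed
  have finLR: "finite L" "finite R" unfolding L_def R_def using finite_sets by auto
  have par: "odd (int p + j)" if "j \<in> L \<union> R \<union> Q" for j
    using that Lmem[of j] Rmem[of j] LQ unfolding podd by blast
  obtain K where "K \<noteq> 0" and K: "\<And>s b t. even s \<Longrightarrow> int (card Q) \<le> s \<Longrightarrow> even (int p - b) \<Longrightarrow> even (int p - t) \<Longrightarrow>
     2 * int (n + card Q) \<le> b + t \<Longrightarrow> L \<union> Q \<subseteq> left_axis p s \<Longrightarrow> R \<union> Q \<subseteq> right_axis p b t \<Longrightarrow>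
     Mq q (two_sided p (n + card Q) s b t L (R \<union> Q)) = K * Mq q (two_sided (p + card Q) n (s - int (card Q)) b t (L \<union> Q) R)"
    using two_sided_move_dents[OF q finite_sets(2) Q0 Q(2) finLR disj par trivp trivn] by blast
  have gen: "Mq q (two_sided p (n + card Q) s b t L (R \<union> Q)) / Mq q (two_sided (p + card Q) n (s - int (card Q)) b t L' R) = K"
    if s: "s + int p = B" "N + 2 * y \<le> B" "N + 2 * z \<le> b" "N + 2 * w \<le> t" "even (B - e)" "even (b - e)" "even (t - e)"
      and bt: "2 * int (n + card Q) \<le> b + t" for s b t B
  proof -
    have ev: "even s" "even (int p - b)" "even (int p - t)" using s evp by presburger+
    have sQ: "int (card Q) \<le> s" using s p e by linarith
    have eq: "Mq q (two_sided p (n + card Q) s b t L (R \<union> Q)) = K * Mq q (two_sided (p + card Q) n (s - int (card Q)) b t (L \<union> Q) R)"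
    proof (rule K[OF ev(1) sQ ev(2,3) bt])
      show "L \<union> Q \<subseteq> left_axis p s"
      proof
        fix j assume "j \<in> L \<union> Q"
        then show "j \<in> left_axis p s" using Lmem[of j] s unfolding LQ left_axis_def podd by auto
      qed
      show "R \<union> Q \<subseteq> right_axis p b t"
      proof
        fix j assume "j \<in> R \<union> Q"
        then show "j \<in> right_axis p b t" using Rmem[of j] s unfolding right_axis_def podd by auto
      qed
    qed
    have "Mq q (two_sided (p + card Q) n (s - int (card Q)) b t L' R) > 0"
      unfolding L'_def R_def
    proof (rule two_sided_denominator_pos)
      show "int (p + card Q) = e + 2 * y" using p by simp
      show "even (int (p + card Q) - b)" "even (int (p + card Q) - t)" using ev evQ by simp_all
    qed (use n s sQ ev evQ bt in auto)
    then show ?thesis unfolding eq LQ by simp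
  qed
  have "Mq q (two_sided p (n + card Q) (N + 2 * y - int p) (N + 2 * z) (N + 2 * w) L (R \<union> Q))
      / Mq q (two_sided (p + card Q) n (N + 2 * y - int p - int (card Q)) (N + 2 * z) (N + 2 * w) L' R) = K"
    by (rule gen[of _ "N + 2 * y"]) (use e n cardE yzw in auto)
  moreover have "Mq q (two_sided p (n + card Q) (T - int p) T T L (R \<union> Q))
      / Mq q (two_sided (p + card Q) n (T - int p - int (card Q)) T T L' R) = K"
    by (rule gen[of _ T]) (use e n cardE yzw zw T in auto)
  moreover have "X - int p - int (card Q) = X - int (p + card Q)" for X by simp
  ultimately show ?thesis by (simp only:)
qed

end

section \<open>Filling in the fern and the corners\<close>

lemma two_sided_left_iff:
  assumes "c < int p"
  shows "(c, j) \<in> two_sided p n s b t L R \<longleftrightarrow> 0 \<le> c \<and> \<bar>j\<bar> \<le> s + c \<and> j \<noteq> 0 \<and> \<not> (c = int p - 1 \<and> j \<in> L)"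
  using assms unfolding two_sided_def left_trapezoid_def right_trapezoid_def by auto

lemma two_sided_right_iff:
  assumes "int p \<le> c"
  shows "(c, j) \<in> two_sided p n s b t L R \<longleftrightarrow> c < int p + int n \<and> - b + (c - int p) < j \<and> j < t - (c - int p) \<and> \<not> (c = int p \<and> j \<in> R)"
  using assms unfolding two_sided_def left_trapezoid_def right_trapezoid_def by auto

lemma finite_two_sided [simp]: "finite (two_sided p n s b t L R)"
  unfolding two_sided_def by simp

text \<open>Since the dents of L cover the axis side of the lobe, the region lacks exactly the axis
  cells and row 0 there. This is the situation in which \<open>Mq_remove_lobes\<close> peels a lobe
  off.\<close>

lemma two_sided_left_lobe:
  assumes par: "even (int p + l + m)" and l: "l \<le> int p" "\<bar>m\<bar> + l \<le> s + int p"
    and L: "\<And>j. \<bar>j - m\<bar> < l \<Longrightarrow> odd (j - m + l) \<Longrightarrow> j \<noteq> 0 \<Longrightarrow> j \<in> L" "\<And>j. j \<in> L \<Longrightarrow> odd (int p + j)"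
    and mem: "(c, j) \<in> triangle True (int p) m l"
  shows "(c, j) \<in> two_sided p n s b t L R \<longleftrightarrow> side_line (c, j) \<noteq> int p \<and> j \<noteq> 0"
proof -
  have "even (int p - l + m)" using par by presburger
  then have c: "int p - l \<le> c" "c < int p" "\<bar>j - m\<bar> \<le> c - (int p - l)" using mem triangle_left_iff by auto
  have dent: "j \<in> L \<longleftrightarrow> even (c + j)" if "c = int p - 1" "j \<noteq> 0"
  proof
    assume "even (c + j)"
    then have "odd (j - m + l)" using that par by presburger
    moreover have "\<bar>j - m\<bar> < l" using c that by simp
    ultimately show "j \<in> L" using L(1) that by blast
  next
    assume "j \<in> L"
    then show "even (c + j)" using L(2)[of j] that by simp
  qed
  have "0 \<le> c" "\<bar>j\<bar> \<le> s + c" using c l by auto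
  moreover have "side_line (c, j) = int p \<longleftrightarrow> c = int p - 1 \<and> even (c + j)" unfolding side_line_iff using c(2) by auto
  ultimately show ?thesis using dent unfolding two_sided_left_iff[OF c(2)] by blast
qed

lemma two_sided_right_lobe:
  assumes par: "even (int p + l + m)" and l: "l \<le> int n" "m + l \<le> t" "- b \<le> m - l"
    and R: "\<And>j. \<bar>j - m\<bar> < l \<Longrightarrow> odd (j - m + l) \<Longrightarrow> j \<in> R" "\<And>j. j \<in> R \<Longrightarrow> odd (int p + j)"
    and mem: "(c, j) \<in> triangle False (int p) m l"
  shows "(c, j) \<in> two_sided p n s b t L R \<longleftrightarrow> side_line (c, j) \<noteq> int p"
proof -
  have c: "int p \<le> c" "c < int p + l" "\<bar>j - m\<bar> \<le> int p + l - 1 - c" using mem triangle_right_iff[OF par] by auto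
  have dent: "j \<in> R \<longleftrightarrow> odd (c + j)" if "c = int p"
  proof
    assume "odd (c + j)"
    then have "odd (j - m + l)" using that par by presburger
    moreover have "\<bar>j - m\<bar> < l" using c that by simp
    ultimately show "j \<in> R" using R(1) that by blast
  next
    assume "j \<in> R"
    then show "odd (c + j)" using R(2)[of j] that by simp
  qed
  have "c < int p + int n" "- b + (c - int p) < j" "j < t - (c - int p)" using c l by auto
  moreover have "side_line (c, j) = int p \<longleftrightarrow> c = int p \<and> odd (c + j)" unfolding side_line_iff using c(1) by auto
  ultimately show ?thesis using dent unfolding two_sided_right_iff[OF c(1)] by blast
qed

text \<open>The flag f marks the flipped fern, whose odd-indexed triangles point right. Accordingly
  \<open>axis_set (\<not> f)\<close> gives the dents left of the axis and \<open>axis_set f\<close>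
  those right of it.\<close>

definition fern_cells :: "nat \<Rightarrow> (nat \<Rightarrow> int) \<Rightarrow> nat \<Rightarrow> bool \<Rightarrow> cell set" where
  "fern_cells k b p f = (\<Union>(o', m, s)\<in>lobes k b. triangle (o' \<noteq> f) (int p) m s)"

definition left_dents :: "nat \<Rightarrow> (nat \<Rightarrow> int) \<Rightarrow> int \<Rightarrow> int \<Rightarrow> int \<Rightarrow> int \<Rightarrow> bool \<Rightarrow> int set" where
  "left_dents k b N y z w f = (axis_set (\<not> f) k b - {0}) \<union> left_corner N y z w"

text \<open>E0 is empty or {0}; the latter records a right-pointing unit triangle removed next to
  the core, as in region C.\<close>

definition right_dents :: "nat \<Rightarrow> (nat \<Rightarrow> int) \<Rightarrow> int \<Rightarrow> int \<Rightarrow> int \<Rightarrow> int \<Rightarrow> bool \<Rightarrow> int set \<Rightarrow> int set" where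
  "right_dents k b N y z w f E0 = axis_set f k b \<union> right_corner N y z w \<union> E0"

text \<open>The region with fern and corners filled back in except for their cells on the axis, so
  that it consists of two complete trapezoids with dents.\<close>

definition full_region :: "nat \<Rightarrow> (nat \<Rightarrow> int) \<Rightarrow> nat \<Rightarrow> nat \<Rightarrow> int \<Rightarrow> int \<Rightarrow> int \<Rightarrow> int \<Rightarrow> bool \<Rightarrow> int set \<Rightarrow> cell set" where
  "full_region k b p n N y z w f E0 = two_sided p n (N + 2 * y - int p) (N + 2 * z) (N + 2 * w)
     (left_dents k b N y z w f) (right_dents k b N y z w f E0)"

text \<open>The completed left half ends at N + 2 y and the completed right half at N + 2 w; the
  triangle spans the difference, on the side that reaches further.\<close>

definition top_cells :: "nat \<Rightarrow> int \<Rightarrow> int \<Rightarrow> int \<Rightarrow> cell set" where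
  "top_cells p N y w = triangle (w \<le> y) (int p) (N + y + w) \<bar>y - w\<bar>"

definition bottom_cells :: "nat \<Rightarrow> int \<Rightarrow> int \<Rightarrow> int \<Rightarrow> cell set" where
  "bottom_cells p N y z = triangle (z \<le> y) (int p) (- (N + y + z)) \<bar>y - z\<bar>"

context
  fixes q :: "'a::linordered_field" and k :: nat and b :: "nat \<Rightarrow> int" and p n :: nat and N y z w :: int and f :: bool
    and E0 :: "int set"
  assumes b_nonneg: "\<And>i. i \<in> {1..2 * k + 1} \<Longrightarrow> 0 \<le> b i"
    and yzw: "0 \<le> y" "0 \<le> z" "0 \<le> w" and edge: "lobe_edge b (2 * k + 1) \<le> N" "even (N + b 1)" "even (int p + b 1)"
    and left_size: "\<And>m s. (\<not> f, m, s) \<in> lobes k b \<Longrightarrow> s \<le> int p" "y - w \<le> int p" "y - z \<le> int p"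
    and right_size: "\<And>m s. (f, m, s) \<in> lobes k b \<Longrightarrow> s \<le> int n" "w - y \<le> int n" "z - y \<le> int n"
    and E0: "E0 \<subseteq> {0}" "E0 \<noteq> {} \<Longrightarrow> \<not> f \<and> odd (b 1)"
begin

lemma fern_N_nonneg: "0 \<le> N"
  using lobe_edge_pos[of k b "2 * k + 1", OF b_nonneg] b_nonneg[of 1] edge(1) by simp

lemma dents_odd: "j \<in> (left_dents k b N y z w f) \<Longrightarrow> odd (int p + j)" "j \<in> (right_dents k b N y z w f E0) \<Longrightarrow> odd (int p + j)"
proof -
  have ax: "odd (int p + j)" if "j \<in> axis_set o' k b" for o'
  proof -
    have "odd (j + b 1)" using axis_set_bounds[OF b_nonneg that] by blast
    then show ?thesis using edge(3) by presburger
  qed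
  have co: "odd (int p + j)" if "odd (N + j)" using that edge(2,3) by presburger
  show "j \<in> (left_dents k b N y z w f) \<Longrightarrow> odd (int p + j)" unfolding left_dents_def left_corner_def using ax co by blast
  have "odd (int p + j)" if "j \<in> E0"
  proof -
    have "odd (b 1)" "j = 0" using that E0 by auto
    then show ?thesis using edge(3) by simp
  qed
  then show "j \<in> (right_dents k b N y z w f E0) \<Longrightarrow> odd (int p + j)" unfolding right_dents_def right_corner_def using ax co by blast
qed

lemma fern_lobe_par:
  assumes "(o', m, s) \<in> lobes k b" shows "even (int p + s + m)"
proof -
  have "even (m + s + b 1)" by (rule lobe_bounds(3)[OF b_nonneg assms])
  then show ?thesis using edge(3) by presburger
qed

lemma corner_par: "even (int p + \<bar>y - w\<bar> + (N + y + w))" "even (int p + \<bar>y - z\<bar> + - (N + y + z))"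
  using edge(2,3) by presburger+

lemma fern_lobe_mem:
  assumes l: "(o', m, s) \<in> lobes k b" and mem: "(c, j) \<in> triangle (o' \<noteq> f) (int p) m s"
  shows "(c, j) \<in> (full_region k b p n N y z w f E0) \<longleftrightarrow> side_line (c, j) \<noteq> int p \<and> \<not> (o' \<noteq> f \<and> j = 0)"
proof -
  note lb = lobe_bounds[OF b_nonneg l]
  show ?thesis
  proof (cases "o' = f")
    case True
    have "(c, j) \<in> (full_region k b p n N y z w f E0) \<longleftrightarrow> side_line (c, j) \<noteq> int p"
    unfolding full_region_def
    proof (rule two_sided_right_lobe[OF fern_lobe_par[OF l]])
      show "j' \<in> (right_dents k b N y z w f E0)" if "\<bar>j' - m\<bar> < s" "odd (j' - m + s)" for j'
        using that l True unfolding right_dents_def axis_set_def by blast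
      show "(c, j) \<in> triangle False (int p) m s" using mem True by simp
      show "s \<le> int n" using right_size(1) l True by blast
    qed (use lb edge yzw dents_odd in auto)
    then show ?thesis using True by simp
  next
    case False
    then have o': "o' = (\<not> f)" by auto
    have "(c, j) \<in> (full_region k b p n N y z w f E0) \<longleftrightarrow> side_line (c, j) \<noteq> int p \<and> j \<noteq> 0"
    unfolding full_region_def
    proof (rule two_sided_left_lobe[OF fern_lobe_par[OF l]])
      show "j' \<in> (left_dents k b N y z w f)" if "\<bar>j' - m\<bar> < s" "odd (j' - m + s)" "j' \<noteq> 0" for j'
        using that l o' unfolding left_dents_def axis_set_def by blast
      show "(c, j) \<in> triangle True (int p) m s" using mem False by simp
      show "s \<le> int p" using left_size(1) l o' by blast
    qed (use lb edge yzw dents_odd in auto)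
    then show ?thesis using False by simp
  qed
qed

lemma corner_odd: "odd (j - (N + y + w) + \<bar>y - w\<bar>) \<longleftrightarrow> odd (N + j)" "odd (j - - (N + y + z) + \<bar>y - z\<bar>) \<longleftrightarrow> odd (N + j)"
  by presburger+

lemma top_corner_mem:
  assumes mem: "(c, j) \<in> triangle (w \<le> y) (int p) (N + y + w) \<bar>y - w\<bar>"
  shows "(c, j) \<in> (full_region k b p n N y z w f E0) \<longleftrightarrow> side_line (c, j) \<noteq> int p \<and> \<not> (w \<le> y \<and> j = 0)"
proof (cases "w \<le> y")
  case False
  have "(c, j) \<in> (full_region k b p n N y z w f E0) \<longleftrightarrow> side_line (c, j) \<noteq> int p"
  unfolding full_region_def
  proof (rule two_sided_right_lobe[OF corner_par(1)])
    show "j' \<in> (right_dents k b N y z w f E0)" if "\<bar>j' - (N + y + w)\<bar> < \<bar>y - w\<bar>" "odd (j' - (N + y + w) + \<bar>y - w\<bar>)" for j'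
      using that False unfolding right_dents_def right_corner_def corner_odd by auto
    show "(c, j) \<in> triangle False (int p) (N + y + w) \<bar>y - w\<bar>" using mem False by simp
  qed (use False right_size fern_N_nonneg yzw dents_odd in auto)
  then show ?thesis using False by simp
next
  case True
  have "(c, j) \<in> (full_region k b p n N y z w f E0) \<longleftrightarrow> side_line (c, j) \<noteq> int p \<and> j \<noteq> 0"
  unfolding full_region_def
  proof (rule two_sided_left_lobe[OF corner_par(1)])
    show "j' \<in> (left_dents k b N y z w f)" if "\<bar>j' - (N + y + w)\<bar> < \<bar>y - w\<bar>" "odd (j' - (N + y + w) + \<bar>y - w\<bar>)" for j'
      using that True unfolding left_dents_def left_corner_def corner_odd by auto
    show "(c, j) \<in> triangle True (int p) (N + y + w) \<bar>y - w\<bar>" using mem True by simp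
  qed (use True left_size fern_N_nonneg yzw dents_odd in auto)
  then show ?thesis using True by simp
qed

lemma bottom_corner_mem:
  assumes mem: "(c, j) \<in> triangle (z \<le> y) (int p) (- (N + y + z)) \<bar>y - z\<bar>"
  shows "(c, j) \<in> (full_region k b p n N y z w f E0) \<longleftrightarrow> side_line (c, j) \<noteq> int p \<and> \<not> (z \<le> y \<and> j = 0)"
proof (cases "z \<le> y")
  case False
  have "(c, j) \<in> (full_region k b p n N y z w f E0) \<longleftrightarrow> side_line (c, j) \<noteq> int p"
  unfolding full_region_def
  proof (rule two_sided_right_lobe[OF corner_par(2)])
    show "j' \<in> (right_dents k b N y z w f E0)" if "\<bar>j' - - (N + y + z)\<bar> < \<bar>y - z\<bar>" "odd (j' - - (N + y + z) + \<bar>y - z\<bar>)" for j'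
      using that False unfolding right_dents_def right_corner_def corner_odd by auto
    show "(c, j) \<in> triangle False (int p) (- (N + y + z)) \<bar>y - z\<bar>" using mem False by simp
  qed (use False right_size fern_N_nonneg yzw dents_odd in auto)
  then show ?thesis using False by simp
next
  case True
  have "(c, j) \<in> (full_region k b p n N y z w f E0) \<longleftrightarrow> side_line (c, j) \<noteq> int p \<and> j \<noteq> 0"
  unfolding full_region_def
  proof (rule two_sided_left_lobe[OF corner_par(2)])
    show "j' \<in> (left_dents k b N y z w f)" if "\<bar>j' - - (N + y + z)\<bar> < \<bar>y - z\<bar>" "odd (j' - - (N + y + z) + \<bar>y - z\<bar>)" for j'
      using that True unfolding left_dents_def left_corner_def corner_odd by auto
    show "(c, j) \<in> triangle True (int p) (- (N + y + z)) \<bar>y - z\<bar>" using mem True by simp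
  qed (use True left_size fern_N_nonneg yzw dents_odd in auto)
  then show ?thesis using True by simp
qed

text \<open>All lobes and both corners are forced. The corners contribute a factor that depends on
  N, y, z, w only and so cancels between numerator and denominator.\<close>

lemma Mq_full_region:
  "Mq q (full_region k b p n N y z w f E0) = fern_weight q k b * (lobe_weight q (N + y + w) \<bar>y - w\<bar> * lobe_weight q (- (N + y + z)) \<bar>y - z\<bar>)
     * Mq q ((full_region k b p n N y z w f E0) - (fern_cells k b p f) - (top_cells p N y w) - (bottom_cells p N y z))"
proof -
  \<comment> \<open>The disjoint sum keeps the top corner (\<open>Inr True\<close>) and the bottom
    corner (\<open>Inr False\<close>) apart from each other and from the lobes, even when they have
    size 0.\<close>
  define I where "I = lobes k b <+> (UNIV :: bool set)"
  define lobe :: "(bool \<times> int \<times> int) + bool \<Rightarrow> bool \<times> int \<times> int" where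
    "lobe i = (case i of Inl (o', m, s) \<Rightarrow> (o' \<noteq> f, m, s)
       | Inr c \<Rightarrow> if c then (w \<le> y, N + y + w, \<bar>y - w\<bar>) else (z \<le> y, - (N + y + z), \<bar>y - z\<bar>))" for i
  define B M S where "B i = fst (lobe i)" and "M i = fst (snd (lobe i))" and "S i = snd (snd (lobe i))" for i
  have inl: "B (Inl (o', m, s)) = (o' \<noteq> f)" "M (Inl (o', m, s)) = m" "S (Inl (o', m, s)) = s" for o' m s
    unfolding B_def M_def S_def lobe_def by auto
  have inr: "B (Inr True) = (w \<le> y)" "M (Inr True) = N + y + w" "S (Inr True) = \<bar>y - w\<bar>"
     "B (Inr False) = (z \<le> y)" "M (Inr False) = - (N + y + z)" "S (Inr False) = \<bar>y - z\<bar>"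
    unfolding B_def M_def S_def lobe_def by auto
  have I_cases: "(\<exists>o' m s. i = Inl (o', m, s) \<and> (o', m, s) \<in> lobes k b) \<or> i = Inr True \<or> i = Inr False" if "i \<in> I" for i
  proof (cases i)
    case (Inl a)
    then have "a \<in> lobes k b" using that unfolding I_def by auto
    then show ?thesis using Inl by (cases a) auto
  next
    case (Inr c)
    then show ?thesis by (cases c) auto
  qed
  have par: "even (int p + S i + M i)" if "i \<in> I" for i
    using I_cases[OF that] fern_lobe_par corner_par by (elim disjE exE conjE) (simp_all add: inl inr)
  have sep: "S i + S i' \<le> \<bar>M i - M i'\<bar>" if ii: "i \<in> I" "i' \<in> I" "i \<noteq> i'" for i i'
  proof -
    have lc: "s + \<bar>y - w\<bar> \<le> \<bar>m - (N + y + w)\<bar>" "s + \<bar>y - z\<bar> \<le> \<bar>m - - (N + y + z)\<bar>" if "(o', m, s) \<in> lobes k b" for o' m s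
      using lobe_bounds(1,2)[OF b_nonneg that] edge(1) yzw by auto
    have tb: "\<bar>y - w\<bar> + \<bar>y - z\<bar> \<le> \<bar>N + y + w - - (N + y + z)\<bar>" using fern_N_nonneg yzw by auto
    consider (ll) o' m s o1 m1 s1 where "i = Inl (o', m, s)" "(o', m, s) \<in> lobes k b" "i' = Inl (o1, m1, s1)" "(o1, m1, s1) \<in> lobes k b"
      | (lc) o' m s where "i = Inl (o', m, s)" "(o', m, s) \<in> lobes k b" "i' = Inr True \<or> i' = Inr False"
      | (cl) o' m s where "i' = Inl (o', m, s)" "(o', m, s) \<in> lobes k b" "i = Inr True \<or> i = Inr False"
      | (cc) "i = Inr True \<and> i' = Inr False \<or> i = Inr False \<and> i' = Inr True"
      using I_cases[OF ii(1)] I_cases[OF ii(2)] ii(3) by blast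
    then show ?thesis
    proof cases
      case ll
      then show ?thesis using lobe_separated[OF b_nonneg ll(2,4)] ii(3) by (simp add: inl)
    next
      case lc': lc
      show ?thesis using lc'(3) lc[OF lc'(2)] unfolding lc'(1) by (elim disjE) (simp_all only: inl inr)
    next
      case cl
      show ?thesis using cl(3) lc[OF cl(2)] unfolding cl(1)
        by (elim disjE) (simp_all only: inl inr abs_minus_commute[of _ m] add.commute[of _ s])
    next
      case cc
      then show ?thesis using tb
        by (elim disjE conjE) (simp_all only: inr abs_minus_commute[of "- (N + y + z)"] add.commute[of "\<bar>y - z\<bar>"])
    qed
  qed
  have "Mq q (full_region k b p n N y z w f E0) = (\<Prod>i\<in>I. lobe_weight q (M i) (S i)) * Mq q ((full_region k b p n N y z w f E0) - (\<Union>i\<in>I. triangle (B i) (int p) (M i) (S i)))"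
  proof (rule Mq_remove_lobes[OF _ _ par])
    show "finite (full_region k b p n N y z w f E0)" unfolding full_region_def by simp
    show "finite I" unfolding I_def using finite_lobes[OF b_nonneg] by simp
    show "(c, j) \<in> (full_region k b p n N y z w f E0) \<longleftrightarrow> side_line (c, j) \<noteq> int p \<and> \<not> (B i \<and> j = 0)"
      if "i \<in> I" "(c, j) \<in> triangle (B i) (int p) (M i) (S i)" for i c j
      using I_cases[OF that(1)]
    proof (elim disjE exE conjE)
      fix o' m s assume i: "i = Inl (o', m, s)" "(o', m, s) \<in> lobes k b"
      show ?thesis using fern_lobe_mem[OF i(2)] that(2) unfolding i(1) inl by blast
    next
      assume i: "i = Inr True"
      show ?thesis using top_corner_mem that(2) unfolding i inr by blast
    next
      assume i: "i = Inr False"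
      show ?thesis using bottom_corner_mem that(2) unfolding i inr by blast
    qed
    show "triangle (B i) (int p) (M i) (S i) \<inter> triangle (B i') (int p) (M i') (S i') = {}" if "i \<in> I" "i' \<in> I" "i \<noteq> i'" for i i'
      by (rule triangle_disjoint[OF par[OF that(1)] par[OF that(2)] sep[OF that]])
  qed
  moreover have "(\<Union>i\<in>I. triangle (B i) (int p) (M i) (S i)) = (fern_cells k b p f) \<union> (top_cells p N y w) \<union> (bottom_cells p N y z)"
  proof -
    have "(\<Union>i\<in>I. triangle (B i) (int p) (M i) (S i)) = (\<Union>a\<in>lobes k b. triangle (B (Inl a)) (int p) (M (Inl a)) (S (Inl a)))
        \<union> (triangle (B (Inr True)) (int p) (M (Inr True)) (S (Inr True)) \<union> triangle (B (Inr False)) (int p) (M (Inr False)) (S (Inr False)))"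
      unfolding I_def Plus_def by (simp add: UNIV_bool Un_ac)
    also have "(\<Union>a\<in>lobes k b. triangle (B (Inl a)) (int p) (M (Inl a)) (S (Inl a))) = (fern_cells k b p f)"
      unfolding fern_cells_def by (rule SUP_cong) (auto simp: inl)
    finally show ?thesis unfolding inr top_cells_def bottom_cells_def by (simp only: Un_assoc)
  qed
  moreover have "(\<Prod>i\<in>I. lobe_weight q (M i) (S i)) = fern_weight q k b * (lobe_weight q (N + y + w) \<bar>y - w\<bar> * lobe_weight q (- (N + y + z)) \<bar>y - z\<bar>)"
  proof -
    have "(\<Prod>i\<in>I. lobe_weight q (M i) (S i)) = (\<Prod>a\<in>lobes k b. lobe_weight q (M (Inl a)) (S (Inl a))) * (\<Prod>c\<in>UNIV. lobe_weight q (M (Inr c)) (S (Inr c)))"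
      unfolding I_def using finite_lobes[OF b_nonneg] by (subst prod.Plus) auto
    also have "(\<Prod>a\<in>lobes k b. lobe_weight q (M (Inl a)) (S (Inl a))) = fern_weight q k b"
    proof -
      have fw: "fern_weight q k b = (\<Prod>(o', m, s)\<in>lobes k b. lobe_weight q m s)" by (rule fern_weight_eq[OF b_nonneg])
      show ?thesis unfolding fw by (intro prod.cong refl) (auto simp: inl)
    qed
    also have "(\<Prod>c\<in>UNIV. lobe_weight q (M (Inr c)) (S (Inr c))) = lobe_weight q (N + y + w) \<bar>y - w\<bar> * lobe_weight q (- (N + y + z)) \<bar>y - z\<bar>"
      by (simp add: UNIV_bool inr mult.commute)
    finally show ?thesis .
  qed
  moreover have "(full_region k b p n N y z w f E0) - ((fern_cells k b p f) \<union> (top_cells p N y w) \<union> (bottom_cells p N y z)) = (full_region k b p n N y z w f E0) - (fern_cells k b p f) - (top_cells p N y w) - (bottom_cells p N y z)"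
    by blast
  ultimately show ?thesis by (simp only:)
qed

text \<open>Deleting the corner triangles cuts the two trapezoids back to the hexagon. On row 0,
  intrusion and fern together must reach the axis, since \<open>left_trapezoid\<close> omits the
  whole row.\<close>

lemma full_region_minus_lobes:
  assumes Hex: "\<And>c j. (c, j) \<in> Hex \<longleftrightarrow> 0 \<le> c \<and> c < int p + int n \<and> j - c \<le> N + 2 * y - int p \<and> j + c < N + 2 * w + int p
      \<and> - (N + 2 * z) - int p < j - c \<and> - (N + 2 * y - int p) \<le> j + c"
    and Intr: "\<And>c j. (c, j) \<in> Intr \<Longrightarrow> j = 0 \<and> c < int p" "\<And>c. 0 \<le> c \<Longrightarrow> c < int p \<Longrightarrow> (c, 0) \<in> Intr \<union> (fern_cells k b p f)"
  shows "(full_region k b p n N y z w f E0) - (fern_cells k b p f) - (top_cells p N y w) - (bottom_cells p N y z) = Hex - Intr - (fern_cells k b p f) - {int p} \<times> E0"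
proof (rule Set.set_eqI)
  fix t :: cell
  obtain c j where t: "t = (c, j)" by (cases t)
  have N0: "0 \<le> N" by (rule fern_N_nonneg)
  have par_top: "even (int p - \<bar>y - w\<bar> + (N + y + w))" and par_bot: "even (int p - \<bar>y - z\<bar> + - (N + y + z))"
    using corner_par by presburger+
  have top: "(c, j) \<in> (top_cells p N y w) \<longleftrightarrow> (if w \<le> y then int p - (y - w) \<le> c \<and> c < int p \<and> \<bar>j - (N + y + w)\<bar> \<le> c - (int p - (y - w))
      else int p \<le> c \<and> c < int p + (w - y) \<and> \<bar>j - (N + y + w)\<bar> \<le> int p + (w - y) - 1 - c)"
    unfolding top_cells_def using triangle_left_iff[OF par_top] triangle_right_iff[OF corner_par(1)] by auto
  have bot: "(c, j) \<in> (bottom_cells p N y z) \<longleftrightarrow> (if z \<le> y then int p - (y - z) \<le> c \<and> c < int p \<and> \<bar>j + (N + y + z)\<bar> \<le> c - (int p - (y - z))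
      else int p \<le> c \<and> c < int p + (z - y) \<and> \<bar>j + (N + y + z)\<bar> \<le> int p + (z - y) - 1 - c)"
    unfolding bottom_cells_def using triangle_left_iff[OF par_bot] triangle_right_iff[OF corner_par(2)] by auto
  show "t \<in> (full_region k b p n N y z w f E0) - (fern_cells k b p f) - (top_cells p N y w) - (bottom_cells p N y z) \<longleftrightarrow> t \<in> Hex - Intr - (fern_cells k b p f) - {int p} \<times> E0"
  proof (cases "(c, j) \<in> (fern_cells k b p f)")
    case True
    then show ?thesis unfolding t by simp
  next
    case nf: False
    show ?thesis
    proof (cases "c < int p")
      case True
      have dent: "(c, j) \<in> (top_cells p N y w) \<union> (bottom_cells p N y z)" if "c = int p - 1" "j \<in> (left_dents k b N y z w f)"
      proof -
        have "j \<notin> axis_set (\<not> f) k b"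
        proof
          assume "j \<in> axis_set (\<not> f) k b"
          then obtain m s where l: "(\<not> f, m, s) \<in> lobes k b" "\<bar>j - m\<bar> < s" unfolding axis_set_def by blast
          have "even (int p - s + m)" using fern_lobe_par[OF l(1)] by presburger
          then have "(c, j) \<in> triangle True (int p) m s" using that(1) l(2) triangle_left_iff by auto
          then have "(c, j) \<in> (fern_cells k b p f)" unfolding fern_cells_def using l(1) by force
          then show False using nf by simp
        qed
        then have "j \<in> left_corner N y z w" using that(2) unfolding left_dents_def by blast
        then show ?thesis unfolding Un_iff top bot left_corner_def using that(1) N0 yzw by auto
      qed
      have intr: "j \<noteq> 0 \<longleftrightarrow> (c, j) \<notin> Intr" if "0 \<le> c"
        using Intr(1)[of c j] Intr(2)[OF that True] nf by auto
      have "t \<in> (full_region k b p n N y z w f E0) - (fern_cells k b p f) - (top_cells p N y w) - (bottom_cells p N y z) \<longleftrightarrow>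
          0 \<le> c \<and> \<bar>j\<bar> \<le> N + 2 * y - int p + c \<and> j \<noteq> 0 \<and> (c, j) \<notin> (top_cells p N y w) \<and> (c, j) \<notin> (bottom_cells p N y z)"
        unfolding t full_region_def using nf dent two_sided_left_iff[OF True] by auto
      also have "\<dots> \<longleftrightarrow> 0 \<le> c \<and> \<bar>j\<bar> \<le> N + 2 * y - int p + c \<and> j \<noteq> 0 \<and> j + c < N + 2 * w + int p \<and> - (N + 2 * z) - int p < j - c"
        unfolding top bot using True N0 yzw by auto
      also have "\<dots> \<longleftrightarrow> (c, j) \<in> Hex \<and> j \<noteq> 0" unfolding Hex using True by auto
      also have "\<dots> \<longleftrightarrow> t \<in> Hex - Intr - (fern_cells k b p f) - {int p} \<times> E0"
        unfolding t using intr nf True Hex[of c j] by auto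
      finally show ?thesis .
    next
      case False
      then have c: "int p \<le> c" by simp
      have dent: "(c, j) \<in> (top_cells p N y w) \<union> (bottom_cells p N y z)" if "c = int p" "j \<in> (right_dents k b N y z w f E0)" "j \<notin> E0"
      proof -
        have "j \<notin> axis_set f k b"
        proof
          assume "j \<in> axis_set f k b"
          then obtain m s where l: "(f, m, s) \<in> lobes k b" "\<bar>j - m\<bar> < s" unfolding axis_set_def by blast
          have "(c, j) \<in> triangle False (int p) m s" using that(1) l(2) triangle_right_iff[OF fern_lobe_par[OF l(1)]] by auto
          then have "(c, j) \<in> (fern_cells k b p f)" unfolding fern_cells_def using l(1) by force
          then show False using nf by simp
        qed
        then have "j \<in> right_corner N y z w" using that(2,3) unfolding right_dents_def by blast
        then show ?thesis unfolding Un_iff top bot right_corner_def using that(1) N0 yzw by auto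
      qed
      have E0_dent: "j \<in> (right_dents k b N y z w f E0)" if "j \<in> E0" using that unfolding right_dents_def by blast
      have "t \<in> (full_region k b p n N y z w f E0) - (fern_cells k b p f) - (top_cells p N y w) - (bottom_cells p N y z) \<longleftrightarrow>
          c < int p + int n \<and> - (N + 2 * z) + (c - int p) < j \<and> j < N + 2 * w - (c - int p) \<and> (c, j) \<notin> (top_cells p N y w) \<and> (c, j) \<notin> (bottom_cells p N y z) \<and> \<not> (c = int p \<and> j \<in> E0)"
        unfolding t full_region_def using nf dent E0_dent two_sided_right_iff[OF c] by auto
      also have "\<dots> \<longleftrightarrow> (c, j) \<in> Hex \<and> \<not> (c = int p \<and> j \<in> E0)"
        unfolding top bot Hex using c N0 yzw by auto
      also have "\<dots> \<longleftrightarrow> t \<in> Hex - Intr - (fern_cells k b p f) - {int p} \<times> E0"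
        unfolding t using nf c Intr(1)[of c j] by auto
      finally show ?thesis .
    qed
  qed
qed

end

text \<open>Here the axis passes through the top and bottom vertices, so both halves end at s + p
  and there are no corners. A left dent at 0 is dropped because the intrusion has already removed
  that cell.\<close>

lemma region_H_two_sided:
  fixes Li Ri :: "int set"
  assumes s: "even s" and L: "\<And>j. j \<in> Li \<Longrightarrow> odd (int p + j)" and R: "\<And>j. j \<in> Ri \<Longrightarrow> odd (int p + j)"
    and s4: "s4 = s + int p - int n"
  shows "hexagon s (int p) (int n) s4 (int n) (int p) - intrusion (int p)
      - dents True (int p) ((\<lambda>j. real_of_int j / 2) ` Li) - dents False (int p) ((\<lambda>j. real_of_int j / 2) ` Ri)
    = two_sided p n s (s + int p) (s + int p) (Li - {0}) Ri"
proof (rule Set.set_eqI)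
  fix t :: cell
  obtain c j where t: "t = (c, j)" by (cases t)
  have hex: "(c, j) \<in> hexagon s (int p) (int n) s4 (int n) (int p) \<longleftrightarrow> 0 \<le> c \<and> c < int p + int n \<and> j - c \<le> s \<and> j + c < s + 2 * int p
     \<and> s - 2 * int n - 2 * s4 < j - c \<and> - s \<le> j + c"
    by (rule hexagon_iff[OF s]) (use s4 in auto)
  have im: "real_of_int j / 2 \<in> (\<lambda>j. real_of_int j / 2) ` X \<longleftrightarrow> j \<in> X" for X by auto
  have dL: "(c, j) \<in> dents True (int p) ((\<lambda>j. real_of_int j / 2) ` Li) \<longleftrightarrow> c = int p - 1 \<and> j \<in> Li"
    unfolding dents_def mem_Collect_eq snd_conv im side_line_iff left_pointing_def fst_conv using L[of j] by auto
  have dR: "(c, j) \<in> dents False (int p) ((\<lambda>j. real_of_int j / 2) ` Ri) \<longleftrightarrow> c = int p \<and> j \<in> Ri"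
    unfolding dents_def mem_Collect_eq snd_conv im side_line_iff left_pointing_def fst_conv using R[of j] by auto
  have intr: "(c, j) \<in> intrusion (int p) \<longleftrightarrow> 0 \<le> c \<and> c < int p \<and> j = 0" unfolding intrusion_def by auto
  show "t \<in> hexagon s (int p) (int n) s4 (int n) (int p) - intrusion (int p)
      - dents True (int p) ((\<lambda>j. real_of_int j / 2) ` Li) - dents False (int p) ((\<lambda>j. real_of_int j / 2) ` Ri)
    \<longleftrightarrow> t \<in> two_sided p n s (s + int p) (s + int p) (Li - {0}) Ri"
  proof (cases "c < int p")
    case True
    then show ?thesis unfolding t Diff_iff hex dL dR intr two_sided_left_iff[OF True] using s4 by auto
  next
    case False
    then have c: "int p \<le> c" by simp
    then show ?thesis unfolding t Diff_iff hex dL dR intr two_sided_right_iff[OF c] using s4 by auto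
  qed
qed

section \<open>The ratio for a general fern\<close>

lemma lobe_size_le_card:
  assumes b_nonneg: "\<And>i. i \<in> {1..2 * k + 1} \<Longrightarrow> 0 \<le> b i" and l: "(o', m, s) \<in> lobes k b"
  shows "s \<le> int (card (axis_set o' k b))"
proof -
  have s: "0 \<le> s" using lobe_bounds(1)[OF b_nonneg l] .
  have sub: "{j. m - s < j \<and> j < m + s \<and> odd (j - (m - s))} \<subseteq> axis_set o' k b"
  proof
    fix j assume j: "j \<in> {j. m - s < j \<and> j < m + s \<and> odd (j - (m - s))}"
    then have "\<bar>j - m\<bar> < s" "odd (j - m + s)" by auto
    then show "j \<in> axis_set o' k b" unfolding axis_set_def using l by blast
  qed
  have "card {j. m - s < j \<and> j < m + s \<and> odd (j - (m - s))} = nat s"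
    using card_odd_gap[of "m - s" "m + s"] s by simp
  then show ?thesis using card_mono[OF finite_axis_set[OF b_nonneg] sub] s by simp
qed

lemma lobes_0: "lobes 0 b = {(True, 0, b 1)}"
  unfolding lobes_def lobe_midpoint_def by auto

lemma core_axis_sets:
  "axis_set True 0 b = {j. \<bar>j\<bar> < b 1 \<and> odd (j + b 1)}" "axis_set False 0 b = {}"
  unfolding axis_set_def lobes_0 by auto

lemma card_axis_sets_sum:
  assumes b_nonneg: "\<And>i. i \<in> {1..2 * k + 1} \<Longrightarrow> 0 \<le> b i"
  shows "int (card (axis_set True k b)) + int (card (axis_set False k b)) = lobe_edge b (2 * k + 1)"
proof -
  let ?e = "lobe_edge b (2 * k + 1)"
  have e0: "0 \<le> ?e" using lobe_edge_pos[of k b "2 * k + 1", OF b_nonneg] b_nonneg[of 1] by simp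
  have "card (axis_set True k b) + card (axis_set False k b) = card (axis_set True k b \<union> axis_set False k b)"
    using finite_axis_set[OF b_nonneg] axis_set_disjoint[OF b_nonneg] by (intro card_Un_disjoint[symmetric])
  also have "axis_set True k b \<union> axis_set False k b = {j. - ?e < j \<and> j < ?e \<and> odd (j - - ?e)}"
  proof -
    have "axis_set True k b \<union> axis_set False k b = {j. \<bar>j\<bar> < ?e \<and> odd (j + b 1)}"
      by (rule axis_set_Un[OF b_nonneg])
    then show ?thesis
    proof (rule trans)
      show "{j. \<bar>j\<bar> < ?e \<and> odd (j + b 1)} = {j. - ?e < j \<and> j < ?e \<and> odd (j - - ?e)}"
    proof (rule Collect_cong)
      fix j
      have "even (?e - b 1)" by (simp add: lobe_edge_def)
      then have "odd (j + b 1) \<longleftrightarrow> odd (j - - ?e)" by presburger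
      moreover have "\<bar>j\<bar> < ?e \<longleftrightarrow> - ?e < j \<and> j < ?e" by linarith
      ultimately show "\<bar>j\<bar> < ?e \<and> odd (j + b 1) \<longleftrightarrow> - ?e < j \<and> j < ?e \<and> odd (j - - ?e)" by blast
    qed
    qed
  qed
  also have "card \<dots> = nat ?e" using card_odd_gap[of "- ?e" ?e] e0 by simp
  finally show ?thesis using e0 by simp
qed

text \<open>All right dents of the fern except the height 0 are moved to the left, where they merge
  with the others into one core of size e. A dent at 0, removed separately or belonging to a flipped
  core of odd size, stays behind as E1. This is why region E is compared with the single-core region
  C rather than B.\<close>

lemma fern_ratio:
  fixes q :: "'a::linordered_field" and k :: nat and b b0 :: "nat \<Rightarrow> int" and p n n' :: nat and N y z w :: int and f :: bool
    and E0 :: "int set"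
  assumes q: "q > 0" and b_nonneg: "\<And>i. i \<in> {1..2 * k + 1} \<Longrightarrow> 0 \<le> b i"
    and yzw: "0 \<le> y" "0 \<le> z" "0 \<le> w" "w \<le> z"
    and e: "lobe_edge b (2 * k + 1) = e" "e \<le> N" "even (N + b 1)"
    and E0: "E0 \<subseteq> {0}" "E0 \<noteq> {} \<Longrightarrow> \<not> f \<and> odd (b 1)"
  defines "Q \<equiv> axis_set f k b - {0}" and "E1 \<equiv> E0 \<union> (axis_set f k b \<inter> {0})"
  assumes p: "int p + int (card Q) = e + 2 * y" and n: "n = n' + card Q" "int n' = w + z + int (card E1)"
    and b0: "b0 1 = e" and T: "T = N + 2 * max y z"
    and num: "RN = full_region k b p n N y z w f E0 - fern_cells k b p f - top_cells p N y w - bottom_cells p N y z"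
    and den: "RD = full_region 0 b0 (p + card Q) n' N y z w False E1 - fern_cells 0 b0 (p + card Q) False
       - top_cells (p + card Q) N y w - bottom_cells (p + card Q) N y z"
  shows "Mq q RN / Mq q RD * (fern_weight q k b / fern_weight q 0 b0)
    = Mq q (two_sided p n (T - int p) T T (left_dents k b N y z w f) (right_dents k b N y z w f E0))
     / Mq q (two_sided (p + card Q) n' (T - int (p + card Q)) T T (central e \<union> left_corner N y z w) (right_corner N y z w \<union> E1))"
proof -
  have e_par: "even (e - b 1)" unfolding e(1)[symmetric] lobe_edge_def by simp
  have e0: "0 \<le> e" using lobe_edge_pos[of k b "2 * k + 1", OF b_nonneg] b_nonneg[of 1] e(1) by simp
  have odd_eq: "odd (j + b 1) \<longleftrightarrow> odd (e + j)" for j using e_par by presburger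
  have ax_mem: "odd (e + j)" "\<bar>j\<bar> < e" if "j \<in> axis_set o' k b" for o' j
    using axis_set_bounds[OF b_nonneg that] e(1) odd_eq by auto
  have Q: "Q \<subseteq> {j. odd (e + j) \<and> \<bar>j\<bar> < e \<and> j \<noteq> 0}" unfolding Q_def using ax_mem by blast
  have Qsym: "uminus ` Q = Q"
  proof -
    have "uminus ` axis_set f k b = axis_set f k b" by (rule axis_set_minus[OF b_nonneg])
    then show ?thesis unfolding Q_def by (subst image_set_diff) simp_all
  qed
  have E1: "E1 \<subseteq> {0}" unfolding E1_def using E0 by blast
  have E1o: "odd e" if "E1 \<noteq> {}"
  proof (cases "E0 = {}")
    case True
    then have "0 \<in> axis_set f k b" using that unfolding E1_def by auto
    then show ?thesis using ax_mem(1)[of 0 f] by simp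
  next
    case False
    then show ?thesis using E0 e_par by auto
  qed
  have eN: "even (N - e)" using e(3) e_par by presburger
  have finQ: "finite Q" "finite (axis_set o' k b)" for o' unfolding Q_def using finite_axis_set[OF b_nonneg] by auto
  have cardQ: "even (card Q)" using card_symmetric[OF finQ(1) _ Qsym] unfolding Q_def by simp
  have tot: "int (card (axis_set (\<not> f) k b)) + int (card (axis_set f k b)) = e"
  proof -
    have "int (card (axis_set True k b)) + int (card (axis_set False k b)) = lobe_edge b (2 * k + 1)"
      by (rule card_axis_sets_sum[OF b_nonneg])
    then show ?thesis using e(1) by (cases f) simp_all
  qed
  have cQ: "int (card Q) \<le> int (card (axis_set f k b))" unfolding Q_def using finQ by (auto intro: card_mono)
  have cQ': "int (card (axis_set f k b)) \<le> int (card Q) + int (card E1)"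
  proof -
    have "axis_set f k b \<subseteq> Q \<union> E1" unfolding Q_def E1_def by auto
    then have "card (axis_set f k b) \<le> card (Q \<union> E1)" using finQ finite_subset[OF E1] by (intro card_mono) auto
    also have "\<dots> \<le> card Q + card E1" by (rule card_Un_le)
    finally show ?thesis by simp
  qed
  have ppar: "even (int p + b 1)" using p cardQ e_par by presburger
  have lsize: "s \<le> int p" if "(\<not> f, m, s) \<in> lobes k b" for m s
    using lobe_size_le_card[OF b_nonneg that] p tot cQ yzw by simp
  have rsize: "s \<le> int n" if "(f, m, s) \<in> lobes k b" for m s
    using lobe_size_le_card[OF b_nonneg that] n cQ' yzw by simp
  have pw: "y - w \<le> int p" "y - z \<le> int p" using p tot cQ yzw by auto
  have nw: "w - y \<le> int n" "z - y \<le> int n" using n yzw by auto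
  let ?cw = "lobe_weight q (N + y + w) \<bar>y - w\<bar> * lobe_weight q (- (N + y + z)) \<bar>y - z\<bar>"
  have cw: "?cw \<noteq> 0" using lobe_weight_pos[OF q, of "N + y + w" "\<bar>y - w\<bar>"] lobe_weight_pos[OF q, of "- (N + y + z)" "\<bar>y - z\<bar>"] by simp
  have N: "Mq q (full_region k b p n N y z w f E0) = fern_weight q k b * ?cw * Mq q RN"
    unfolding num
  proof (rule Mq_full_region)
    show "0 \<le> b i" if "i \<in> {1..2 * k + 1}" for i by (rule b_nonneg[OF that])
    show "lobe_edge b (2 * k + 1) \<le> N" using e by simp
    show "s \<le> int p" if "(\<not> f, m, s) \<in> lobes k b" for m s by (rule lsize[OF that])
    show "s \<le> int n" if "(f, m, s) \<in> lobes k b" for m s by (rule rsize[OF that])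
    show "\<not> f \<and> odd (b 1)" if "E0 \<noteq> {}" by (rule E0(2)[OF that])
  qed fact+
  have b0_nonneg: "0 \<le> b0 i" if "i \<in> {1..2 * 0 + 1}" for i using that b0 e0 by auto
  have edge0: "lobe_edge b0 (2 * 0 + 1) = e" using b0 lobe_edge_1[of b0] by simp
  have lobes0: "lobes 0 b0 = {(True, 0, e)}" unfolding lobes_0 b0 ..
  have D: "Mq q (full_region 0 b0 (p + card Q) n' N y z w False E1) = fern_weight q 0 b0 * ?cw * Mq q RD"
    unfolding den
  proof (rule Mq_full_region)
    show "0 \<le> b0 i" if "i \<in> {1..2 * 0 + 1}" for i by (rule b0_nonneg[OF that])
    show "lobe_edge b0 (2 * 0 + 1) \<le> N" unfolding edge0 by (rule e(2))
    show "even (N + b0 1)" using eN b0 by simp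
    show "even (int (p + card Q) + b0 1)" using p b0 by simp
    show "s \<le> int (p + card Q)" if "(\<not> False, m, s) \<in> lobes 0 b0" for m s using that p yzw unfolding lobes0 by auto
    show "s \<le> int n'" if "(False, m, s) \<in> lobes 0 b0" for m s using that unfolding lobes0 by auto
    show "\<not> False \<and> odd (b0 1)" if "E1 \<noteq> {}" using E1o[OF that] b0 by simp
  qed (use pw yzw n E1 in auto)
  have ld: "left_dents k b N y z w f = (central e - Q) \<union> left_corner N y z w"
  proof -
    have "axis_set (\<not> f) k b - {0} = central e - Q"
    proof -
      have u: "axis_set (\<not> f) k b \<union> axis_set f k b = {j. \<bar>j\<bar> < e \<and> odd (j + b 1)}"
      proof -
        have "axis_set True k b \<union> axis_set False k b = {j. \<bar>j\<bar> < lobe_edge b (2 * k + 1) \<and> odd (j + b 1)}"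
          by (rule axis_set_Un[OF b_nonneg])
        then show ?thesis unfolding e(1) by (cases f) (simp_all add: Un_commute)
      qed
      have d: "axis_set (\<not> f) k b \<inter> axis_set f k b = {}"
      proof -
        have "axis_set True k b \<inter> axis_set False k b = {}" by (rule axis_set_disjoint[OF b_nonneg])
        then show ?thesis by (cases f) (simp_all add: Int_commute)
      qed
      have "central e = (axis_set (\<not> f) k b \<union> axis_set f k b) - {0}"
        unfolding u central_def odd_eq by auto
      then show ?thesis unfolding Q_def using d by auto
    qed
    then show ?thesis unfolding left_dents_def by simp
  qed
  have rd: "right_dents k b N y z w f E0 = right_corner N y z w \<union> E1 \<union> Q"
    unfolding right_dents_def Q_def E1_def by blast
  have ld0: "left_dents 0 b0 N y z w False = central e \<union> left_corner N y z w"
  proof -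
    have "axis_set (\<not> False) 0 b0 - {0} = central e"
      using core_axis_sets(1)[of b0] unfolding b0 central_def by (auto simp: add.commute)
    then show ?thesis by (simp only: left_dents_def)
  qed
  have rd0: "right_dents 0 b0 N y z w False E1 = right_corner N y z w \<union> E1"
    unfolding right_dents_def core_axis_sets by simp
  have ratio: "Mq q (full_region k b p n N y z w f E0) / Mq q (full_region 0 b0 (p + card Q) n' N y z w False E1)
    = Mq q (two_sided p n (T - int p) T T (left_dents k b N y z w f) (right_dents k b N y z w f E0))
     / Mq q (two_sided (p + card Q) n' (T - int (p + card Q)) T T (central e \<union> left_corner N y z w) (right_corner N y z w \<union> E1))"
    unfolding full_region_def ld rd ld0 rd0 n(1)
  proof (rule two_sided_ratio)
    show "odd e" if "E1 \<noteq> {}" by (rule E1o[OF that])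
    show "int n' = w + z + int (card E1)" by (rule n(2))
  qed fact+
  have "Mq q RN / Mq q RD * (fern_weight q k b / fern_weight q 0 b0)
    = (fern_weight q k b * ?cw * Mq q RN) / (fern_weight q 0 b0 * ?cw * Mq q RD)"
    using cw by (simp add: mult_ac)
  then show ?thesis unfolding N[symmetric] D[symmetric] ratio .
qed

section \<open>The regions of the theorem\<close>

text \<open>Number the segments of a diagonal from its lower end - M upwards: the s-th one is
  centred at i-coordinate 2 s - M - 1.\<close>

lemma shift_down_axis:
  assumes "0 \<le> lo" "even (M - N)" "A = - M + 2 * lo" "B = - M + 2 * hi"
  shows "shift_down ({1..hi} - {1..lo}) ((real_of_int M + 1) / 2) = (\<lambda>j. real_of_int j / 2) ` {j. odd (N + j) \<and> A < j \<and> j < B}"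
proof (intro equalityI subsetI)
  fix h assume "h \<in> shift_down ({1..hi} - {1..lo}) ((real_of_int M + 1) / 2)"
  then obtain s where s: "h = real_of_int s - (real_of_int M + 1) / 2" "s \<in> {1..hi} - {1..lo}" unfolding shift_down_def by blast
  have "odd (N + (2 * s - M - 1))" using assms(2) by presburger
  then have "2 * s - M - 1 \<in> {j. odd (N + j) \<and> A < j \<and> j < B}" using s(2) assms by auto
  moreover have "h = real_of_int (2 * s - M - 1) / 2" using s(1) by (simp add: field_simps)
  ultimately show "h \<in> (\<lambda>j. real_of_int j / 2) ` {j. odd (N + j) \<and> A < j \<and> j < B}" by blast
next
  fix h assume "h \<in> (\<lambda>j. real_of_int j / 2) ` {j. odd (N + j) \<and> A < j \<and> j < B}"
  then obtain j where j: "h = real_of_int j / 2" "odd (N + j)" "A < j" "j < B" by blast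
  have "even (j + M + 1)" using j(2) assms(2) by presburger
  then obtain s where s: "j + M + 1 = 2 * s" by (rule evenE)
  then have "s \<in> {1..hi} - {1..lo}" using j assms by auto
  moreover have "h = real_of_int s - (real_of_int M + 1) / 2"
  proof -
    have "real_of_int j + real_of_int M + 1 = 2 * real_of_int s" using s by (metis of_int_1 of_int_add of_int_mult of_int_numeral)
    then show ?thesis unfolding j(1) by (simp add: field_simps)
  qed
  ultimately show "h \<in> shift_down ({1..hi} - {1..lo}) ((real_of_int M + 1) / 2)" unfolding shift_down_def by blast
qed

abbreviation half :: "int set \<Rightarrow> real set" where
  "half A \<equiv> (\<lambda>j. real_of_int j / 2) ` A"

text \<open>X describes the bottom corner and Y the top one, both numbered along the diagonal of H.
  For y < w both corners are right of the axis, for z < y both are left of it, and in between the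
  top one is left and the bottom one right.\<close>

lemma corner_sets:
  fixes X Y :: "real set"
  assumes N: "0 \<le> N" and yzw: "0 \<le> y" "0 \<le> z" "0 \<le> w" "w \<le> z"
    and X: "X = (if y \<le> z then shift_down {1..z - y} ((real_of_int (N + 2 * z) + 1) / 2)
                   else shift_down {1..y - z} ((real_of_int (N + 2 * y) + 1) / 2))"
    and Y: "Y = (if y < w then shift_down ({1..N + z + w} - {1..N + y + z}) ((real_of_int (N + 2 * z) + 1) / 2)
                 else if y \<le> z then shift_down ({1..N + y + z} - {1..N + z + w}) ((real_of_int (N + 2 * z) + 1) / 2)
                 else shift_down ({1..N + 2 * y} - {1..N + y + w}) ((real_of_int (N + 2 * y) + 1) / 2))"
  shows "y < w \<Longrightarrow> X \<union> Y = half (right_corner N y z w) \<and> left_corner N y z w = {}"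
    and "w \<le> y \<Longrightarrow> y \<le> z \<Longrightarrow> X = half (right_corner N y z w) \<and> Y = half (left_corner N y z w)"
    and "z < y \<Longrightarrow> X \<union> Y = half (left_corner N y z w) \<and> right_corner N y z w = {}"
proof -
  let ?J = "\<lambda>A B. {j. odd (N + j) \<and> A < j \<and> j < B}"
  have sh: "shift_down ({1..hi} - {1..lo}) ((real_of_int (N + 2 * u) + 1) / 2) = half (?J (- (N + 2 * u) + 2 * lo) (- (N + 2 * u) + 2 * hi))"
    if "0 \<le> lo" for lo hi u
    by (rule shift_down_axis) (use that in auto)
  have sh0: "shift_down {1..hi} ((real_of_int (N + 2 * u) + 1) / 2) = half (?J (- (N + 2 * u)) (- (N + 2 * u) + 2 * hi))" for hi u
    using sh[of 0 hi u] by simp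
  have XL: "X = half (?J (- (N + 2 * z)) (- (N + 2 * y)))" if "y \<le> z"
  proof -
    have e: "- (N + 2 * z) + 2 * (z - y) = - (N + 2 * y)" by simp
    show ?thesis using that unfolding X sh0 e by simp
  qed
  {
    assume c: "y < w"
    have e: "- (N + 2 * z) + 2 * (N + y + z) = N + 2 * y" "- (N + 2 * z) + 2 * (N + z + w) = N + 2 * w" by simp_all
    have "Y = half (?J (N + 2 * y) (N + 2 * w))" using c sh[of "N + y + z" "N + z + w" z] N yzw unfolding Y e by simp
    moreover have "right_corner N y z w = ?J (- (N + 2 * z)) (- (N + 2 * y)) \<union> ?J (N + 2 * y) (N + 2 * w)"
      unfolding right_corner_def by auto
    moreover have "left_corner N y z w = {}" unfolding left_corner_def using c yzw by auto
    ultimately show "X \<union> Y = half (right_corner N y z w) \<and> left_corner N y z w = {}"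
      using XL c yzw by (simp only: image_Un)
  }
  {
    assume c: "w \<le> y" "y \<le> z"
    have e: "- (N + 2 * z) + 2 * (N + z + w) = N + 2 * w" "- (N + 2 * z) + 2 * (N + y + z) = N + 2 * y" by simp_all
    have "Y = half (?J (N + 2 * w) (N + 2 * y))" using c sh[of "N + z + w" "N + y + z" z] N yzw unfolding Y e by simp
    moreover have "right_corner N y z w = ?J (- (N + 2 * z)) (- (N + 2 * y))"
      unfolding right_corner_def using c by auto
    moreover have "left_corner N y z w = ?J (N + 2 * w) (N + 2 * y)" unfolding left_corner_def using c yzw by auto
    ultimately show "X = half (right_corner N y z w) \<and> Y = half (left_corner N y z w)" using XL c by simp
  }
  {
    assume c: "z < y"
    have e: "- (N + 2 * y) + 2 * (N + y + w) = N + 2 * w" "- (N + 2 * y) + 2 * (N + 2 * y) = N + 2 * y"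
       "- (N + 2 * y) + 2 * (y - z) = - (N + 2 * z)" by simp_all
    have "Y = half (?J (N + 2 * w) (N + 2 * y))" using c sh[of "N + y + w" "N + 2 * y" y] N yzw unfolding Y e by simp
    moreover have "X = half (?J (- (N + 2 * y)) (- (N + 2 * z)))" using c unfolding X sh0 e by simp
    moreover have "left_corner N y z w = ?J (- (N + 2 * y)) (- (N + 2 * z)) \<union> ?J (N + 2 * w) (N + 2 * y)"
      unfolding left_corner_def by auto
    moreover have "right_corner N y z w = {}" unfolding right_corner_def using c yzw by auto
    ultimately show "X \<union> Y = half (left_corner N y z w) \<and> right_corner N y z w = {}"
      by (simp only: image_Un)
  }
qed

lemma odd_even_sum: "odd_sum k a + even_sum k a = a 1 + (\<Sum>j = 2..2 * k + 1. a j)"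
proof (induction k)
  case (Suc k)
  have o: "odd_sum (Suc k) a = odd_sum k a + a (2 * k + 3)" by (simp add: odd_sum_def numeral_3_eq_3)
  have e: "even_sum (Suc k) a = even_sum k a + a (2 * k + 2)" by (simp add: even_sum_def)
  have I: "{2..2 * Suc k + 1} = insert (2 * k + 3) (insert (2 * k + 2) {2..2 * k + 1})" by auto
  have "(\<Sum>j = 2..2 * Suc k + 1. a j) = a (2 * k + 3) + (a (2 * k + 2) + (\<Sum>j = 2..2 * k + 1. a j))"
    unfolding I by (subst sum.insert, simp, simp, subst sum.insert, simp, simp, rule refl)
  then show ?case using Suc o e by simp
qed (simp add: odd_sum_def even_sum_def)

lemma lobe_edge_upd: "lobe_edge (a(1 := c)) (2 * k + 1) = c + 2 * (odd_sum k a + even_sum k a - a 1)"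
  unfolding odd_even_sum lobe_edge_def by simp

lemma even_sum_upd: "(\<Sum>i = 1..k. (a(1 := c)) (2 * i)) = even_sum k a"
  unfolding even_sum_def by (rule sum.cong) auto

lemma fern_eq_fern_cells:
  "fern (int p) k b = fern_cells k b p False" "flipped_fern (int p) k b = fern_cells k b p True"
  unfolding fern_def flipped_fern_def fern_cells_def by (auto simp: case_prod_unfold)

lemma core_covers:
  assumes "\<And>i. i \<in> {1..2 * k + 1} \<Longrightarrow> 0 \<le> b i" "even (int p - b 1)" "int p - b 1 \<le> c" "c < int p"
  shows "(c, 0) \<in> fern_cells k b p False"
proof -
  have "(c, 0) \<in> triangle True (int p) 0 (b 1)" using assms triangle_left_iff[of "int p" "b 1" 0 c 0] by simp
  moreover have "(True, 0, b 1) \<in> lobes k b" by (rule core_lobe[OF assms(1)])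
  ultimately show ?thesis unfolding fern_cells_def by force
qed

lemma fern_weight_core: "b 1 = b' 1 \<Longrightarrow> fern_weight q 0 b = fern_weight q 0 b'"
  unfolding fern_weight_def lobes_0 by simp

text \<open>\<open>fern_ratio\<close> restated with integer side lengths, so that each of the five
  regions requires only arithmetic. The intrusion may end before the axis, provided that the core
  covers the rest of row 0 (A, B, C), or reach the axis (D, E).\<close>

lemma region_ratio:
  fixes q :: "'a::linordered_field"
  assumes q: "q > 0" and b_nonneg: "\<And>i. i \<in> {1..2 * k + 1} \<Longrightarrow> 0 \<le> b i"
    and yzw: "0 \<le> y" "0 \<le> z" "0 \<le> w" "w \<le> z"
    and e: "lobe_edge b (2 * k + 1) = e" "e \<le> N" "even (N + b 1)"
    and E0: "E0 \<subseteq> {0}" "E0 \<noteq> {} \<Longrightarrow> \<not> f \<and> odd (b 1)" and E1: "E1 = E0 \<union> (axis_set f k b \<inter> {0})"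
    and cQ: "int (card (axis_set f k b - {0})) = cQ"
    and P: "0 \<le> P" "P + cQ = e + 2 * y" "P' = e + 2 * y" and n: "n = n' + cQ" "n' = w + z + int (card E1)"
    and b0: "b0 1 = e" and T: "T = N + 2 * max y z"
    and hex: "even s1" "s2 + s3 = s5 + s6" "s1 + s2 = s4 + s5" "s2 + s3 = P + n" "s1 = N + 2 * y - P"
      "s1 + 2 * s2 = N + 2 * w + P" "s1 - 2 * s3 - 2 * s4 = - (N + 2 * z) - P"
    and i0: "i0 \<le> P" "\<And>c. 0 \<le> c \<Longrightarrow> i0 \<le> c \<Longrightarrow> c < P \<Longrightarrow> (c, 0) \<in> fern_cells k b (nat P) f"
    and hex': "even t1" "t2 + t3 = t5 + t6" "t1 + t2 = t4 + t5" "t2 + t3 = P' + n'" "t1 = N + 2 * y - P'"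
      "t1 + 2 * t2 = N + 2 * w + P'" "t1 - 2 * t3 - 2 * t4 = - (N + 2 * z) - P'"
    and i0': "i0' \<le> P'" "P' - e \<le> i0'"
  shows "Mq q (hexagon s1 s2 s3 s4 s5 s6 - intrusion i0 - fern_cells k b (nat P) f - {P} \<times> E0)
       / Mq q (hexagon t1 t2 t3 t4 t5 t6 - intrusion i0' - fern_cells 0 b0 (nat P') False - {P'} \<times> E1)
       * (fern_weight q k b / fern_weight q 0 b0)
    = Mq q (two_sided (nat P) (nat n) (T - P) T T (left_dents k b N y z w f) (right_dents k b N y z w f E0))
     / Mq q (two_sided (nat P') (nat n') (T - P') T T (central e \<union> left_corner N y z w) (right_corner N y z w \<union> E1))"
proof -
  define p nn nn' where "p = nat P" and "nn = nat n" and "nn' = nat n'"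
  let ?c = "card (axis_set f k b - {0})"
  have p: "int p = P" "int (p + ?c) = P'" and nn: "int nn' = n'" "int nn = n" "nn = nn' + ?c"
    using P n cQ yzw unfolding p_def nn_def nn'_def by (auto simp: nat_add_distrib)
  have p': "p + ?c = nat P'" using p by simp
  have e_par: "even (e - b 1)" unfolding e(1)[symmetric] lobe_edge_def by simp
  have e0: "0 \<le> e" using lobe_edge_pos[of k b "2 * k + 1", OF b_nonneg] b_nonneg[of 1] e(1) by simp
  have finA: "finite (axis_set o' k b)" for o' by (rule finite_axis_set[OF b_nonneg])
  have tot: "int (card (axis_set (\<not> f) k b)) + int (card (axis_set f k b)) = e"
  proof -
    have "int (card (axis_set True k b)) + int (card (axis_set False k b)) = lobe_edge b (2 * k + 1)"
      by (rule card_axis_sets_sum[OF b_nonneg])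
    then show ?thesis using e(1) by (cases f) simp_all
  qed
  have E1': "E1 \<subseteq> {0}" "finite E1" using E0(1) unfolding E1 by (auto intro: finite_subset)
  have c1: "int ?c \<le> int (card (axis_set f k b))" using finA by (auto intro: card_mono)
  have c2: "int (card (axis_set f k b)) \<le> int ?c + int (card E1)"
  proof -
    have "axis_set f k b \<subseteq> (axis_set f k b - {0}) \<union> E1" unfolding E1 by auto
    then have "card (axis_set f k b) \<le> card ((axis_set f k b - {0}) \<union> E1)" using finA E1'(2) by (intro card_mono) auto
    also have "\<dots> \<le> ?c + card E1" by (rule card_Un_le)
    finally show ?thesis by simp
  qed
  have ev: "even ?c"
  proof -
    have "uminus ` axis_set f k b = axis_set f k b" by (rule axis_set_minus[OF b_nonneg])
    then have "uminus ` (axis_set f k b - {0}) = axis_set f k b - {0}" by (subst image_set_diff) simp_all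
    then show ?thesis using card_symmetric[of "axis_set f k b - {0}"] finA by simp
  qed
  have ppar: "even (int p + b 1)"
  proof -
    have "int p + int ?c = e + 2 * y" using p P by simp
    then have "even (int p + int ?c + e)" by simp
    then have "even (int p + e)" using ev by simp
    then show ?thesis using e_par by presburger
  qed
  have hexN: "full_region k b p nn N y z w f E0 - fern_cells k b p f - top_cells p N y w - bottom_cells p N y z
    = hexagon s1 s2 s3 s4 s5 s6 - intrusion i0 - fern_cells k b p f - {int p} \<times> E0"
  proof (rule full_region_minus_lobes)
    show "0 \<le> b i" if "i \<in> {1..2 * k + 1}" for i by (rule b_nonneg[OF that])
    show "lobe_edge b (2 * k + 1) \<le> N" using e by simp
    show "s \<le> int p" if l: "(\<not> f, m, s) \<in> lobes k b" for m s
    proof -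
      have "s \<le> int (card (axis_set (\<not> f) k b))" by (rule lobe_size_le_card[OF b_nonneg l])
      then show ?thesis using p P tot c1 yzw by simp
    qed
    show "s \<le> int nn" if l: "(f, m, s) \<in> lobes k b" for m s
    proof -
      have "s \<le> int (card (axis_set f k b))" by (rule lobe_size_le_card[OF b_nonneg l])
      then show ?thesis using nn n c2 cQ yzw by simp
    qed
    show "y - w \<le> int p" "y - z \<le> int p" using p P tot c1 yzw by simp_all
    show "w - y \<le> int nn" "z - y \<le> int nn" using nn n cQ yzw by simp_all
    show "\<not> f \<and> odd (b 1)" if "E0 \<noteq> {}" by (rule E0(2)[OF that])
    show "(c, j) \<in> hexagon s1 s2 s3 s4 s5 s6 \<longleftrightarrow> 0 \<le> c \<and> c < int p + int nn \<and> j - c \<le> N + 2 * y - int p \<and> j + c < N + 2 * w + int p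
      \<and> - (N + 2 * z) - int p < j - c \<and> - (N + 2 * y - int p) \<le> j + c" for c j
      unfolding hexagon_iff[OF hex(1-3)] p(1) nn(2) hex(4,6,7) by (simp only: hex(5))
    show "j = 0 \<and> c < int p" if "(c, j) \<in> intrusion i0" for c j using that i0(1) p unfolding intrusion_def by auto
    show "(c, 0) \<in> intrusion i0 \<union> fern_cells k b p f" if "0 \<le> c" "c < int p" for c
      using that i0(2)[of c] p unfolding p_def intrusion_def by (cases "c < i0") auto
  qed fact+
  have hexD: "full_region 0 b0 (p + ?c) nn' N y z w False E1 - fern_cells 0 b0 (p + ?c) False - top_cells (p + ?c) N y w - bottom_cells (p + ?c) N y z
    = hexagon t1 t2 t3 t4 t5 t6 - intrusion i0' - fern_cells 0 b0 (p + ?c) False - {int (p + ?c)} \<times> E1"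
  proof (rule full_region_minus_lobes)
    have i1: "i = 1" if "i \<in> {1..2 * 0 + 1}" for i :: nat using that by simp
    show "0 \<le> b0 i" if "i \<in> {1..2 * 0 + 1}" for i using i1[OF that] b0 e0 by simp
    show "lobe_edge b0 (2 * 0 + 1) \<le> N" using b0 lobe_edge_1[of b0] e(2) by simp
    show "even (N + b0 1)" using e(3) e_par unfolding b0 by presburger
    show "even (int (p + ?c) + b0 1)" unfolding p(2) P(3) b0 by simp
    show "s \<le> int (p + ?c)" if "(\<not> False, m, s) \<in> lobes 0 b0" for m s using that yzw b0 unfolding lobes_0 p(2) P(3) by simp
    show "s \<le> int nn'" if "(False, m, s) \<in> lobes 0 b0" for m s using that unfolding lobes_0 by simp
    show "y - w \<le> int (p + ?c)" "y - z \<le> int (p + ?c)" using yzw e0 unfolding p(2) P(3) by simp_all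
    show "w - y \<le> int nn'" "z - y \<le> int nn'" using yzw unfolding nn n(2) by simp_all
    show "\<not> False \<and> odd (b0 1)" if "E1 \<noteq> {}"
    proof (cases "E0 = {}")
      case True
      then have "0 \<in> axis_set f k b" using that E0 unfolding E1 by auto
      then have "odd (0 + b 1)" using axis_set_bounds[of k b 0 f, OF b_nonneg] by blast
      then show ?thesis using e_par unfolding b0 by simp
    next
      case False
      then show ?thesis using E0(2) e_par unfolding b0 by simp
    qed
    show "(c, j) \<in> hexagon t1 t2 t3 t4 t5 t6 \<longleftrightarrow> 0 \<le> c \<and> c < int (p + ?c) + int nn' \<and> j - c \<le> N + 2 * y - int (p + ?c) \<and> j + c < N + 2 * w + int (p + ?c)
      \<and> - (N + 2 * z) - int (p + ?c) < j - c \<and> - (N + 2 * y - int (p + ?c)) \<le> j + c" for c j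
      unfolding hexagon_iff[OF hex'(1-3)] p(2) nn(1) hex'(4,6,7) by (simp only: hex'(5))
    show "j = 0 \<and> c < int (p + ?c)" if "(c, j) \<in> intrusion i0'" for c j using that i0'(1) p unfolding intrusion_def by auto
    show "(c, 0) \<in> intrusion i0' \<union> fern_cells 0 b0 (p + ?c) False" if c: "0 \<le> c" "c < int (p + ?c)" for c
    proof (cases "c < i0'")
      case True
      then show ?thesis using c unfolding intrusion_def by auto
    next
      case False
      have "(c, 0) \<in> fern_cells 0 b0 (p + ?c) False"
      proof (rule core_covers)
        show "0 \<le> b0 i" if "i \<in> {1..2 * 0 + 1}" for i using i1[OF that] b0 e0 by simp
        show "even (int (p + ?c) - b0 1)" unfolding p(2) P(3) b0 by simp
        show "int (p + ?c) - b0 1 \<le> c" using False i0'(2) unfolding p(2) b0 by simp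
      qed (rule c(2))
      then show ?thesis by blast
    qed
  qed fact+
  have "Mq q (hexagon s1 s2 s3 s4 s5 s6 - intrusion i0 - fern_cells k b p f - {int p} \<times> E0)
       / Mq q (hexagon t1 t2 t3 t4 t5 t6 - intrusion i0' - fern_cells 0 b0 (p + ?c) False - {int (p + ?c)} \<times> E1)
       * (fern_weight q k b / fern_weight q 0 b0)
    = Mq q (two_sided p nn (T - int p) T T (left_dents k b N y z w f) (right_dents k b N y z w f E0))
     / Mq q (two_sided (p + ?c) nn' (T - int (p + ?c)) T T (central e \<union> left_corner N y z w) (right_corner N y z w \<union> E1))"
    unfolding E1
  proof (rule fern_ratio)
    show "0 \<le> b i" if "i \<in> {1..2 * k + 1}" for i by (rule b_nonneg[OF that])
    show "\<not> f \<and> odd (b 1)" if "E0 \<noteq> {}" by (rule E0(2)[OF that])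
    show "int p + int ?c = e + 2 * y" using p P by simp
    show "int nn' = w + z + int (card (E0 \<union> axis_set f k b \<inter> {0}))" using nn n E1 by simp
    show "hexagon t1 t2 t3 t4 t5 t6 - intrusion i0' - fern_cells 0 b0 (p + ?c) False - {int (p + ?c)} \<times> (E0 \<union> axis_set f k b \<inter> {0})
      = full_region 0 b0 (p + ?c) nn' N y z w False (E0 \<union> axis_set f k b \<inter> {0}) - fern_cells 0 b0 (p + ?c) False
       - top_cells (p + ?c) N y w - bottom_cells (p + ?c) N y z" using hexD unfolding E1 by (rule sym)
    show "hexagon s1 s2 s3 s4 s5 s6 - intrusion i0 - fern_cells k b p f - {int p} \<times> E0
       = full_region k b p nn N y z w f E0 - fern_cells k b p f - top_cells p N y w - bottom_cells p N y z" by (rule hexN[symmetric])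
  qed fact+
  then show ?thesis unfolding p unfolding p' unfolding p_def nn_def nn'_def .
qed

section \<open>Matching the regions of the theorem with trapezoids\<close>

lemma region_H_eq:
  assumes "P = 2 * m + 2 * \<alpha> + 1" "0 \<le> P" "nn = 2 * n + \<beta>" "0 \<le> nn" "2 * n + 2 * \<gamma> = T - P"
    and L: "\<And>j. j \<in> Li \<Longrightarrow> odd (P + j)" and R: "\<And>j. j \<in> Ri \<Longrightarrow> odd (P + j)"
  shows "region_H m n \<alpha> \<beta> \<gamma> (half Li) (half Ri) = two_sided (nat P) (nat nn) (T - P) T T (Li - {0}) Ri"
proof -
  have ev: "even (T - P)" unfolding assms(5)[symmetric] by simp
  have "hexagon (T - P) (int (nat P)) (int (nat nn)) (2 * m + 2 * \<alpha> + 2 * \<gamma> - \<beta> + 1) (int (nat nn)) (int (nat P)) - intrusion (int (nat P))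
      - dents True (int (nat P)) (half Li) - dents False (int (nat P)) (half Ri)
    = two_sided (nat P) (nat nn) (T - P) (T - P + int (nat P)) (T - P + int (nat P)) (Li - {0}) Ri"
    by (rule region_H_two_sided[OF ev]) (use assms in auto)
  then show ?thesis unfolding region_H_def Let_def using assms(1-5) by simp
qed

lemma region_H'_eq:
  assumes "P = 2 * m + 2 * \<alpha> + 2" "0 \<le> P" "nn = 2 * n + \<beta>" "0 \<le> nn" "2 * n + 2 * \<gamma> = T - P"
    and L: "\<And>j. j \<in> Li \<Longrightarrow> odd (P + j)" and R: "\<And>j. j \<in> Ri \<Longrightarrow> odd (P + j)"
  shows "region_H' m n \<alpha> \<beta> \<gamma> (half Li) (half Ri) = two_sided (nat P) (nat nn) (T - P) T T (Li - {0}) Ri"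
proof -
  have ev: "even (T - P)" unfolding assms(5)[symmetric] by simp
  have "hexagon (T - P) (int (nat P)) (int (nat nn)) (2 * m + 2 * \<alpha> + 2 * \<gamma> - \<beta> + 2) (int (nat nn)) (int (nat P)) - intrusion (int (nat P))
      - dents True (int (nat P)) (half Li) - dents False (int (nat P)) (half Ri)
    = two_sided (nat P) (nat nn) (T - P) (T - P + int (nat P)) (T - P + int (nat P)) (Li - {0}) Ri"
    by (rule region_H_two_sided[OF ev]) (use assms in auto)
  then show ?thesis unfolding region_H'_def Let_def using assms(1-5) by simp
qed

text \<open>With the corner sets LC and RC inserted, the three displayed cases become a single
  formula; the parameter x - y + z or x is always x - y + max y z. Z and Z0 hold a possible extra
  dent at 0.\<close>

lemma three_cases:
  fixes F F0 :: "int \<Rightarrow> real set \<Rightarrow> real set \<Rightarrow> 'a::field"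
  assumes "y < w \<longrightarrow> X \<union> Y = RC \<and> LC = {}" "w \<le> y \<and> y \<le> z \<longrightarrow> X = RC \<and> Y = LC" "z < y \<longrightarrow> X \<union> Y = LC \<and> RC = {}"
    and "w \<le> (z :: int)"
  shows "(if y < w then F (x - y + z) L (R \<union> X \<union> Y \<union> Z) / F0 (x - y + z) L0 (X \<union> Y \<union> Z0)
     else if y \<le> z then F (x - y + z) (L \<union> Y) (R \<union> X \<union> Z) / F0 (x - y + z) (L0 \<union> Y) (X \<union> Z0)
     else F x (L \<union> X \<union> Y) (R \<union> Z) / F0 x (L0 \<union> X \<union> Y) Z0)
    = F (x - y + max y z) (L \<union> LC) (R \<union> RC \<union> Z) / F0 (x - y + max y z) (L0 \<union> LC) (RC \<union> Z0)"
proof -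
  consider "y < w" | "w \<le> y" "y \<le> z" | "z < y" by linarith
  then show ?thesis
  proof cases
    case 1
    then show ?thesis using assms(1,4) by (simp add: Un_assoc[of R X Y])
  next
    case 2
    then show ?thesis using assms(2) by simp
  next
    case 3
    then have "L \<union> X \<union> Y = L \<union> LC" "L0 \<union> X \<union> Y = L0 \<union> LC" using assms(3) by auto
    then show ?thesis using assms(3,4) 3 by simp
  qed
qed

text \<open>The empty set removed at the end gives all regions the common shape, with a slot for E0,
  that \<open>region_ratio\<close> expects.\<close>

lemma region_A_cells:
  assumes "ao = odd_sum k a" "ae = even_sum k a" "0 \<le> ao + y"
  shows "region_A k a x y z w = hexagon (2*ae + 2*x) (2*ao + y + w) (2*ae + y + z) (2*ao + 2*x) (2*ae + y + w) (2*ao + y + z)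
    - intrusion (2 * (ao - a 1) + 2 * y) - fern_cells k (a(1 := 2 * a 1)) (nat (2 * ao + 2 * y)) False - {2 * ao + 2 * y} \<times> {}"
proof -
  have p: "2 * (ao - a 1) + 2 * y + 2 * a 1 = int (nat (2 * ao + 2 * y))" using assms(3) by simp
  show ?thesis unfolding region_A_def Let_def assms(1,2)[symmetric] p fern_eq_fern_cells by simp
qed

lemma region_B_cells:
  assumes "ao = odd_sum k a" "ae = even_sum k a" "1 \<le> ao + y"
  shows "region_B k a x y z w = hexagon (2*ae + 2*x) (2*ao + y + w - 1) (2*ae + y + z) (2*ao + 2*x - 1) (2*ae + y + w) (2*ao + y + z - 1)
    - intrusion (2 * (ao - a 1) + 2 * y) - fern_cells k (a(1 := 2 * a 1 - 1)) (nat (2 * ao + 2 * y - 1)) False - {2 * ao + 2 * y - 1} \<times> {}"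
proof -
  have p: "2 * (ao - a 1) + 2 * y + (2 * a 1 - 1) = int (nat (2 * ao + 2 * y - 1))" using assms(3) by simp
  show ?thesis unfolding region_B_def Let_def assms(1,2)[symmetric] p fern_eq_fern_cells by simp
qed

lemma region_C_cells:
  assumes "ao = odd_sum k a" "ae = even_sum k a" "1 \<le> ao + y"
  shows "region_C k a x y z w = hexagon (2*ae + 2*x) (2*ao + y + w - 1) (2*ae + y + z + 1) (2*ao + 2*x - 2) (2*ae + y + w + 1) (2*ao + y + z - 1)
    - intrusion (2 * (ao - a 1) + 2 * y) - fern_cells k (a(1 := 2 * a 1 - 1)) (nat (2 * ao + 2 * y - 1)) False - {2 * ao + 2 * y - 1} \<times> {0}"
proof -
  have p: "2 * (ao - a 1) + 2 * y + (2 * a 1 - 1) = int (nat (2 * ao + 2 * y - 1))" using assms(3) by simp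
  have s: "{(int (nat (2 * ao + 2 * y - 1)), 0)} = {2 * ao + 2 * y - 1} \<times> {0 :: int}" using assms(3) by simp
  show ?thesis unfolding region_C_def Let_def assms(1,2)[symmetric] p s fern_eq_fern_cells ..
qed

lemma region_D_cells:
  assumes "ao = odd_sum k a" "ae = even_sum k a" "0 \<le> ae + y"
  shows "region_D k a x y z w = hexagon (2*ao + 2*x) (2*ae + y + w) (2*ao + y + z) (2*ae + 2*x) (2*ao + y + w) (2*ae + y + z)
    - intrusion (2 * ae + 2 * y) - fern_cells k (a(1 := 2 * a 1)) (nat (2 * ae + 2 * y)) True - {2 * ae + 2 * y} \<times> {}"
proof -
  have "flipped_fern (2 * ae + 2 * y) k (a(1 := 2 * a 1)) = fern_cells k (a(1 := 2 * a 1)) (nat (2 * ae + 2 * y)) True"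
    using fern_eq_fern_cells(2)[of "nat (2 * ae + 2 * y)" k] assms(3) by simp
  then show ?thesis unfolding region_D_def Let_def assms(1,2)[symmetric] by simp
qed

lemma region_E_cells:
  assumes "ao = odd_sum k a" "ae = even_sum k a" "0 \<le> ae + y"
  shows "region_E k a x y z w = hexagon (2*ao + 2*x - 2) (2*ae + y + w + 1) (2*ao + y + z - 1) (2*ae + 2*x) (2*ao + y + w - 1) (2*ae + y + z + 1)
    - intrusion (2 * ae + 2 * y + 1) - fern_cells k (a(1 := 2 * a 1 - 1)) (nat (2 * ae + 2 * y + 1)) True - {2 * ae + 2 * y + 1} \<times> {}"
proof -
  have "flipped_fern (2 * ae + 2 * y + 1) k (a(1 := 2 * a 1 - 1)) = fern_cells k (a(1 := 2 * a 1 - 1)) (nat (2 * ae + 2 * y + 1)) True"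
    using fern_eq_fern_cells(2)[of "nat (2 * ae + 2 * y + 1)" k] assms(3) by simp
  then show ?thesis unfolding region_E_def Let_def assms(1,2)[symmetric] by simp
qed

lemma half_diff_0: "half A - {0} = half (A - {0})"
  by auto

lemma odd_corner: "even (P - N) \<Longrightarrow> j \<in> left_corner N y z w \<union> right_corner N y z w \<Longrightarrow> odd (P + j)" for P :: int
proof -
  assume a: "even (P - N)" "j \<in> left_corner N y z w \<union> right_corner N y z w"
  then have "odd (N + j)" unfolding left_corner_def right_corner_def by blast
  then show "odd (P + j)" using a(1) by presburger
qed

text \<open>The premise \<open>a 1 \<ge> 1\<close> in the parts with an odd core excludes only k = 0
  with a_1 = 0, where the core would have size -1.\<close>

theorem theorem3p4:
  fixes q :: "'a::linordered_field"
    and x y z w ao ae as :: int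
    and k :: nat
    and a :: "nat \<Rightarrow> int"
    and X Y X' Y' Qo Qe Qo' Qe' :: "real set"
  assumes q: "q > 0"
    and nonneg: "x \<ge> 0" "y \<ge> 0" "z \<ge> 0" "w \<ge> 0" and zw: "z \<ge> w"
    and a_pos: "\<And>i. i \<in> {1..2 * k} \<Longrightarrow> a i > 0" and a_last: "a (2 * k + 1) \<ge> 0"
    and ao: "ao = odd_sum k a" and ae: "ae = even_sum k a" and as: "as = ao + ae"
    and Qo': "Qo' = Q_odd k (a(1 := 2 * a 1))" and Qe': "Qe' = Q_even k (a(1 := 2 * a 1))"
    and Qo: "Qo = Q_odd k (a(1 := 2 * a 1 - 1))" and Qe: "Qe = Q_even k (a(1 := 2 * a 1 - 1))"
    and X': "X' = (if y \<le> z then shift_down {1..z - y} ((2*as + 2*x + 2*z + 1) / 2)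
                   else shift_down {1..y - z} ((2*as + 2*x + 2*y + 1) / 2))"
    and Y': "Y' = (if y < w then
                     shift_down ({1..2*as + 2*x + z + w} - {1..2*as + 2*x + y + z})
                       ((2*as + 2*x + 2*z + 1) / 2)
                   else if y \<le> z then
                     shift_down ({1..2*as + 2*x + y + z} - {1..2*as + 2*x + z + w})
                       ((2*as + 2*x + 2*z + 1) / 2)
                   else
                     shift_down ({1..2*as + 2*x + 2*y} - {1..2*as + 2*x + y + w})
                       ((2*as + 2*x + 2*y + 1) / 2))"
    and X: "X = (if y \<le> z then shift_down {1..z - y} (as + x + z)
                 else shift_down {1..y - z} (as + x + y))"
    and Y: "Y = (if y < w then
                   shift_down ({1..2*as + 2*x + z + w - 1} - {1..2*as + 2*x + y + z - 1})
                     (as + x + z)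
                 else if y \<le> z then
                   shift_down ({1..2*as + 2*x + y + z - 1} - {1..2*as + 2*x + z + w - 1})
                     (as + x + z)
                 else
                   shift_down ({1..2*as + 2*x + 2*y - 1} - {1..2*as + 2*x + y + w - 1})
                     (as + x + y))"
  shows
    "(Mq q (region_A k a x y z w) / Mq q (region_A 0 (\<lambda>_. as) x y z w)
        * (fern_weight q k (a(1 := 2 * a 1)) / fern_weight q 0 (\<lambda>_. 2 * as))
      = (if y < w then
           Mq q (region_H' 0 ae (ao + y - 1) (z + w) (x - y + z) Qo' (Qe' \<union> X' \<union> Y'))
           / Mq q (region_H' ae 0 (ao + y - 1) (z + w) (x - y + z) (Qo' \<union> Qe') (X' \<union> Y'))
         else if y \<le> z then
           Mq q (region_H' 0 ae (ao + y - 1) (z + w) (x - y + z) (Qo' \<union> Y') (Qe' \<union> X'))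
           / Mq q (region_H' ae 0 (ao + y - 1) (z + w) (x - y + z) (Qo' \<union> Qe' \<union> Y') X')
         else
           Mq q (region_H' 0 ae (ao + y - 1) (z + w) x (Qo' \<union> X' \<union> Y') Qe')
           / Mq q (region_H' ae 0 (ao + y - 1) (z + w) x (Qo' \<union> Qe' \<union> X' \<union> Y') {})))
   \<and> (a 1 \<ge> 1 \<longrightarrow>
      Mq q (region_B k a x y z w) / Mq q (region_B 0 (\<lambda>_. as) x y z w)
        * (fern_weight q k (a(1 := 2 * a 1 - 1)) / fern_weight q 0 (\<lambda>_. 2 * as - 1))
      = (if y < w then
           Mq q (region_H 0 ae (ao + y - 1) (z + w) (x - y + z) Qo (Qe \<union> X \<union> Y))
           / Mq q (region_H ae 0 (ao + y - 1) (z + w) (x - y + z) (Qo \<union> Qe) (X \<union> Y))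
         else if y \<le> z then
           Mq q (region_H 0 ae (ao + y - 1) (z + w) (x - y + z) (Qo \<union> Y) (Qe \<union> X))
           / Mq q (region_H ae 0 (ao + y - 1) (z + w) (x - y + z) (Qo \<union> Qe \<union> Y) X)
         else
           Mq q (region_H 0 ae (ao + y - 1) (z + w) x (Qo \<union> X \<union> Y) Qe)
           / Mq q (region_H ae 0 (ao + y - 1) (z + w) x (Qo \<union> Qe \<union> X \<union> Y) {})))
   \<and> (a 1 \<ge> 1 \<longrightarrow>
      Mq q (region_C k a x y z w) / Mq q (region_C 0 (\<lambda>_. as) x y z w)
        * (fern_weight q k (a(1 := 2 * a 1 - 1)) / fern_weight q 0 (\<lambda>_. 2 * as - 1))
      = (if y < w then
           Mq q (region_H 0 ae (ao + y - 1) (z + w + 1) (x - y + z) Qo (Qe \<union> X \<union> Y \<union> {0}))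
           / Mq q (region_H ae 0 (ao + y - 1) (z + w + 1) (x - y + z) (Qo \<union> Qe) (X \<union> Y \<union> {0}))
         else if y \<le> z then
           Mq q (region_H 0 ae (ao + y - 1) (z + w + 1) (x - y + z) (Qo \<union> Y) (Qe \<union> X \<union> {0}))
           / Mq q (region_H ae 0 (ao + y - 1) (z + w + 1) (x - y + z) (Qo \<union> Qe \<union> Y) (X \<union> {0}))
         else
           Mq q (region_H 0 ae (ao + y - 1) (z + w + 1) x (Qo \<union> X \<union> Y) (Qe \<union> {0}))
           / Mq q (region_H ae 0 (ao + y - 1) (z + w + 1) x (Qo \<union> Qe \<union> X \<union> Y) {0})))
   \<and> (Mq q (region_D k a x y z w) / Mq q (region_A 0 (\<lambda>_. as) x y z w)
        * (fern_weight q k (a(1 := 2 * a 1)) / fern_weight q 0 (\<lambda>_. 2 * as))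
      = (if y < w then
           Mq q (region_H' 0 ao (ae + y - 1) (z + w) (x - y + z) Qe' (Qo' \<union> X' \<union> Y'))
           / Mq q (region_H' ao 0 (ae + y - 1) (z + w) (x - y + z) (Qo' \<union> Qe') (X' \<union> Y'))
         else if y \<le> z then
           Mq q (region_H' 0 ao (ae + y - 1) (z + w) (x - y + z) (Qe' \<union> Y') (Qo' \<union> X'))
           / Mq q (region_H' ao 0 (ae + y - 1) (z + w) (x - y + z) (Qo' \<union> Qe' \<union> Y') X')
         else
           Mq q (region_H' 0 ao (ae + y - 1) (z + w) x (Qe' \<union> X' \<union> Y') Qo')
           / Mq q (region_H' ao 0 (ae + y - 1) (z + w) x (Qo' \<union> Qe' \<union> X' \<union> Y') {})))
   \<and> (a 1 \<ge> 1 \<longrightarrow>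
      Mq q (region_E k a x y z w) / Mq q (region_C 0 (\<lambda>_. as) x y z w)
        * (fern_weight q k (a(1 := 2 * a 1 - 1)) / fern_weight q 0 (\<lambda>_. 2 * as - 1))
      = (if y < w then
           Mq q (region_H 0 (ao - 1) (ae + y) (z + w + 1) (x - y + z) Qe (Qo \<union> X \<union> Y))
           / Mq q (region_H (ao - 1) 0 (ae + y) (z + w + 1) (x - y + z) ((Qo - {0}) \<union> Qe) (X \<union> Y \<union> {0}))
         else if y \<le> z then
           Mq q (region_H 0 (ao - 1) (ae + y) (z + w + 1) (x - y + z) (Qe \<union> Y) (Qo \<union> X))
           / Mq q (region_H (ao - 1) 0 (ae + y) (z + w + 1) (x - y + z) ((Qo - {0}) \<union> Qe \<union> Y) (X \<union> {0}))
         else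
           Mq q (region_H 0 (ao - 1) (ae + y) (z + w + 1) x (Qe \<union> X \<union> Y) Qo)
           / Mq q (region_H (ao - 1) 0 (ae + y) (z + w + 1) x ((Qo - {0}) \<union> Qe \<union> X \<union> Y) {0})))"

proof -
  have a_nonneg: "0 \<le> a i" if "i \<in> {1..2 * k + 1}" for i
    using that a_pos[of i] a_last by (cases "i = 2 * k + 1") auto
  have a1: "0 \<le> a 1" using a_nonneg by simp
  have ae0: "0 \<le> ae" unfolding ae even_sum_def by (rule sum_nonneg) (auto intro!: a_nonneg)
  have a1ao: "a 1 \<le> ao"
    using member_le_sum[of 0 "{0..k}" "\<lambda>i. a (2 * i + 1)"] a_nonneg unfolding ao odd_sum_def by simp
  have ao0: "0 \<le> ao" using a1 a1ao by simp
  define bA where "bA = a(1 := 2 * a 1)"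
  define bB where "bB = a(1 := 2 * a 1 - 1)"
  \<comment> \<open>\<open>cA\<close> and \<open>cB\<close> are the sizes that occur inside the
    single-core regions; they agree with the constant functions of the statement at index 1, the
    only one that matters for k = 0.\<close>
  define cA where "cA = (\<lambda>_ :: nat. as)(1 := 2 * as)"
  define cB where "cB = (\<lambda>_ :: nat. as)(1 := 2 * as - 1)"
  have core_sums: "as = odd_sum 0 (\<lambda>_. as)" "0 = even_sum 0 (\<lambda>_. as)" by (simp_all add: odd_sum_def even_sum_def)
  have bA1: "bA 1 = 2 * a 1" and bB1: "bB 1 = 2 * a 1 - 1" and cA1: "cA 1 = 2 * as" and cB1: "cB 1 = 2 * as - 1"
    unfolding bA_def bB_def cA_def cB_def by simp_all
  have fwA: "fern_weight q 0 (\<lambda>_. 2 * as) = fern_weight q 0 cA" by (rule fern_weight_core, rule cA1[symmetric])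
  have fwB: "fern_weight q 0 (\<lambda>_. 2 * as - 1) = fern_weight q 0 cB" by (rule fern_weight_core, rule cB1[symmetric])

  \<comment> \<open>Cores of even size: regions A and D\<close>
  have bA_nonneg: "0 \<le> bA i" if "i \<in> {1..2 * k + 1}" for i using a_nonneg[OF that] a1 unfolding bA_def by simp
  have edgeA: "lobe_edge bA (2 * k + 1) = 2 * as"
    unfolding bA_def lobe_edge_upd ao[symmetric] ae[symmetric] as by simp
  have evA: "(\<Sum>i = 1..k. bA (2 * i)) = ae"
    unfolding bA_def even_sum_upd ae ..
  have cardA: "int (card (axis_set False k bA)) = 2 * ae" "int (card (axis_set True k bA - {0})) = 2 * ao"
    using card_axis_sets[of k bA, OF bA_nonneg] unfolding evA edgeA as by simp_all
  have zeroA: "0 \<notin> axis_set o' k bA" for o'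
  proof
    assume "0 \<in> axis_set o' k bA"
    then have "odd (0 + bA 1)" using axis_set_bounds[of k bA 0 o', OF bA_nonneg] by blast
    then show False unfolding bA1 by simp
  qed
  have oddA: "odd (2 * u + j)" if "j \<in> axis_set o' k bA" for o' j u
  proof -
    have "odd (j + bA 1)" using axis_set_bounds[of k bA j o', OF bA_nonneg] that by blast
    then show ?thesis unfolding bA1 by simp
  qed
  have unA: "axis_set True k bA \<union> axis_set False k bA = central (2 * as)"
  proof -
    have "axis_set True k bA \<union> axis_set False k bA = {j. \<bar>j\<bar> < lobe_edge bA (2 * k + 1) \<and> odd (j + bA 1)}"
      by (rule axis_set_Un[OF bA_nonneg])
    then show ?thesis unfolding edgeA bA1 central_def by auto
  qed
  \<comment> \<open>N is read off from the left half, which ends at \<open>N + 2 * y\<close>: half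
    the i-extent of the left side plus the number of columns before the axis. For A this is
    \<open>2 * ae + 2 * x\<close> plus \<open>2 * ao + 2 * y\<close>; an odd core makes the sum
    smaller by one.\<close>
  let ?NA = "2 * as + 2 * x" and ?NB = "2 * as + 2 * x - 1"
  let ?LA = "left_corner ?NA y z w" and ?RA = "right_corner ?NA y z w"
  let ?LB = "left_corner ?NB y z w" and ?RB = "right_corner ?NB y z w"
  let ?TA = "?NA + 2 * max y z" and ?TB = "?NB + 2 * max y z"
  let ?g = "x - y + max y z"
  have NA0: "0 \<le> ?NA" using ao0 ae0 as nonneg by simp
  have csA: "y < w \<longrightarrow> X' \<union> Y' = half ?RA \<and> half ?LA = {}" "w \<le> y \<and> y \<le> z \<longrightarrow> X' = half ?RA \<and> Y' = half ?LA"
    "z < y \<longrightarrow> X' \<union> Y' = half ?LA \<and> half ?RA = {}"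
  proof -
    have X2: "X' = (if y \<le> z then shift_down {1..z - y} ((real_of_int (?NA + 2 * z) + 1) / 2)
                   else shift_down {1..y - z} ((real_of_int (?NA + 2 * y) + 1) / 2))"
      unfolding X' by (simp add: algebra_simps)
    have Y2: "Y' = (if y < w then shift_down ({1..?NA + z + w} - {1..?NA + y + z}) ((real_of_int (?NA + 2 * z) + 1) / 2)
                 else if y \<le> z then shift_down ({1..?NA + y + z} - {1..?NA + z + w}) ((real_of_int (?NA + 2 * z) + 1) / 2)
                 else shift_down ({1..?NA + 2 * y} - {1..?NA + y + w}) ((real_of_int (?NA + 2 * y) + 1) / 2))"
      unfolding Y' by (simp add: algebra_simps)
    note cs = corner_sets[OF NA0 nonneg(2-4) zw X2 Y2]
    show "y < w \<longrightarrow> X' \<union> Y' = half ?RA \<and> half ?LA = {}" using cs(1) by auto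
    show "w \<le> y \<and> y \<le> z \<longrightarrow> X' = half ?RA \<and> Y' = half ?LA" using cs(2) by blast
    show "z < y \<longrightarrow> X' \<union> Y' = half ?LA \<and> half ?RA = {}" using cs(3) by auto
  qed
  have denA: "central (2 * as) \<union> ?LA = (axis_set True k bA \<union> axis_set False k bA \<union> ?LA) - {0}"
    unfolding unA using NA0 nonneg by (auto simp: central_def left_corner_def)
  have ldA: "left_dents k bA ?NA y z w f = (axis_set (\<not> f) k bA \<union> ?LA) - {0}" for f
    unfolding left_dents_def using NA0 nonneg by (auto simp: left_corner_def)
  have A0: "region_A 0 (\<lambda>_. as) x y z w = hexagon (2*0 + 2*x) (2*as + y + w) (2*0 + y + z) (2*as + 2*x) (2*0 + y + w) (2*as + y + z)
    - intrusion (2 * (as - as) + 2 * y) - fern_cells 0 cA (nat (2 * as + 2 * y)) False - {2 * as + 2 * y} \<times> {}"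
    unfolding cA_def by (rule region_A_cells[OF core_sums]) (use ao0 ae0 as nonneg in simp)
  have cornerA: "odd (2 * u + j)" if "j \<in> ?LA \<union> ?RA" for u j
    by (rule odd_corner[OF _ that]) simp
  have QA: "Qo' = half (axis_set True k bA)" "Qe' = half (axis_set False k bA)" unfolding Qo' Qe' axis_heights_eq bA_def by simp_all
  have QA: "Qo' = half (axis_set True k bA)" "Qe' = half (axis_set False k bA)" unfolding Qo' Qe' axis_heights_eq bA_def by simp_all
  have QA: "Qo' = half (axis_set True k bA)" "Qe' = half (axis_set False k bA)" unfolding Qo' Qe' axis_heights_eq bA_def by simp_all
  have QA: "Qo' = half (axis_set True k bA)" "Qe' = half (axis_set False k bA)" unfolding Qo' Qe' axis_heights_eq bA_def by simp_all
  have partA: "Mq q (region_A k a x y z w) / Mq q (region_A 0 (\<lambda>_. as) x y z w)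
        * (fern_weight q k (a(1 := 2 * a 1)) / fern_weight q 0 (\<lambda>_. 2 * as))
      = (if y < w then
           Mq q (region_H' 0 ae (ao + y - 1) (z + w) (x - y + z) Qo' (Qe' \<union> X' \<union> Y'))
           / Mq q (region_H' ae 0 (ao + y - 1) (z + w) (x - y + z) (Qo' \<union> Qe') (X' \<union> Y'))
         else if y \<le> z then
           Mq q (region_H' 0 ae (ao + y - 1) (z + w) (x - y + z) (Qo' \<union> Y') (Qe' \<union> X'))
           / Mq q (region_H' ae 0 (ao + y - 1) (z + w) (x - y + z) (Qo' \<union> Qe' \<union> Y') X')
         else
           Mq q (region_H' 0 ae (ao + y - 1) (z + w) x (Qo' \<union> X' \<union> Y') Qe')
           / Mq q (region_H' ae 0 (ao + y - 1) (z + w) x (Qo' \<union> Qe' \<union> X' \<union> Y') {}))"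
  proof -
    have R: "region_A k a x y z w = hexagon (2*ae + 2*x) (2*ao + y + w) (2*ae + y + z) (2*ao + 2*x) (2*ae + y + w) (2*ao + y + z)
      - intrusion (2 * (ao - a 1) + 2 * y) - fern_cells k bA (nat (2 * ao + 2 * y)) False - {2 * ao + 2 * y} \<times> {}"
      unfolding bA_def by (rule region_A_cells[OF ao ae]) (use ao0 ae0 nonneg in simp)
    have ratio: "Mq q (region_A k a x y z w) / Mq q (region_A 0 (\<lambda>_. as) x y z w) * (fern_weight q k bA / fern_weight q 0 cA)
      = Mq q (two_sided (nat (2 * ao + 2 * y)) (nat (2 * ae + (z + w))) (?TA - (2 * ao + 2 * y)) ?TA ?TA
            (left_dents k bA ?NA y z w False) (right_dents k bA ?NA y z w False {}))
        / Mq q (two_sided (nat (2 * as + 2 * y)) (nat (2 * 0 + (z + w))) (?TA - (2 * as + 2 * y)) ?TA ?TA (central (2 * as) \<union> ?LA) (?RA \<union> {}))"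
      unfolding R A0
    proof (rule region_ratio[where cQ = "2 * ae"])
      show "0 \<le> bA i" if "i \<in> {1..2 * k + 1}" for i by (rule bA_nonneg[OF that])
      show "{} = {} \<union> axis_set False k bA \<inter> {0}" using zeroA by auto
      show "int (card (axis_set False k bA - {0})) = 2 * ae" using cardA(1) zeroA by simp
      show "(c, 0) \<in> fern_cells k bA (nat (2 * ao + 2 * y)) False" if "0 \<le> c" "2 * (ao - a 1) + 2 * y \<le> c" "c < 2 * ao + 2 * y" for c
        by (rule core_covers[OF bA_nonneg]) (use that bA1 in auto)
    qed (use q nonneg zw edgeA bA1 cA1 as ao0 ae0 a1 in auto)
    have HN: "region_H' 0 ae (ao + y - 1) (z + w) ?g (half (axis_set True k bA \<union> ?LA)) (half (axis_set False k bA \<union> ?RA))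
      = two_sided (nat (2 * ao + 2 * y)) (nat (2 * ae + (z + w))) (?TA - (2 * ao + 2 * y)) ?TA ?TA
         (left_dents k bA ?NA y z w False) (right_dents k bA ?NA y z w False {})"
      unfolding ldA right_dents_def Un_empty_right not_False_eq_True
    proof (rule region_H'_eq)
      show "odd (2 * ao + 2 * y + j)" if "j \<in> axis_set True k bA \<union> ?LA" for j
        using that oddA[of j _ "ao + y"] cornerA[of j "ao + y"] by (auto simp only: Un_iff distrib_left)
      show "odd (2 * ao + 2 * y + j)" if "j \<in> axis_set False k bA \<union> ?RA" for j
        using that oddA[of j _ "ao + y"] cornerA[of j "ao + y"] by (auto simp only: Un_iff distrib_left)
    qed (use nonneg ao0 ae0 as in auto)
    have HD: "region_H' ae 0 (ao + y - 1) (z + w) ?g (half (axis_set True k bA \<union> axis_set False k bA \<union> ?LA)) (half (?RA))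
      = two_sided (nat (2 * as + 2 * y)) (nat (2 * 0 + (z + w))) (?TA - (2 * as + 2 * y)) ?TA ?TA (central (2 * as) \<union> ?LA) (?RA \<union> {})"
      unfolding denA Un_empty_right
    proof (rule region_H'_eq)
      show "odd (2 * as + 2 * y + j)" if "j \<in> axis_set True k bA \<union> axis_set False k bA \<union> ?LA" for j
        using that oddA[of j _ "as + y"] cornerA[of j "as + y"] by (auto simp only: Un_iff distrib_left)
      show "odd (2 * as + 2 * y + j)" if "j \<in> ?RA" for j
        using that oddA[of j _ "as + y"] cornerA[of j "as + y"] by (auto simp only: Un_iff distrib_left)
    qed (use nonneg ao0 ae0 as in auto)
    note tc = three_cases[where F = "\<lambda>g L R. Mq q (region_H' 0 ae (ao + y - 1) (z + w) g L R)"
      and ?F0.0 = "\<lambda>g L R. Mq q (region_H' ae 0 (ao + y - 1) (z + w) g L R)"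
      and L = "Qo'" and R = "Qe'" and ?L0.0 = "Qo' \<union> Qe'" and Z = "{}" and ?Z0.0 = "{}" and x = x, OF csA zw, unfolded Un_empty_right]
    have sets: "Qo' \<union> half ?LA = half (axis_set True k bA \<union> ?LA)" "Qe' \<union> half ?RA = half (axis_set False k bA \<union> ?RA)"
      "Qo' \<union> Qe' \<union> half ?LA = half (axis_set True k bA \<union> axis_set False k bA \<union> ?LA)"
      unfolding QA by (simp_all only: image_Un)
    show ?thesis unfolding tc sets fwA bA_def[symmetric] ratio HN HD ..
  qed
  have partD: "Mq q (region_D k a x y z w) / Mq q (region_A 0 (\<lambda>_. as) x y z w)
        * (fern_weight q k (a(1 := 2 * a 1)) / fern_weight q 0 (\<lambda>_. 2 * as))
      = (if y < w then
           Mq q (region_H' 0 ao (ae + y - 1) (z + w) (x - y + z) Qe' (Qo' \<union> X' \<union> Y'))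
           / Mq q (region_H' ao 0 (ae + y - 1) (z + w) (x - y + z) (Qo' \<union> Qe') (X' \<union> Y'))
         else if y \<le> z then
           Mq q (region_H' 0 ao (ae + y - 1) (z + w) (x - y + z) (Qe' \<union> Y') (Qo' \<union> X'))
           / Mq q (region_H' ao 0 (ae + y - 1) (z + w) (x - y + z) (Qo' \<union> Qe' \<union> Y') X')
         else
           Mq q (region_H' 0 ao (ae + y - 1) (z + w) x (Qe' \<union> X' \<union> Y') Qo')
           / Mq q (region_H' ao 0 (ae + y - 1) (z + w) x (Qo' \<union> Qe' \<union> X' \<union> Y') {}))"
  proof -
    have R: "region_D k a x y z w = hexagon (2*ao + 2*x) (2*ae + y + w) (2*ao + y + z) (2*ae + 2*x) (2*ao + y + w) (2*ae + y + z)
      - intrusion (2 * ae + 2 * y) - fern_cells k bA (nat (2 * ae + 2 * y)) True - {2 * ae + 2 * y} \<times> {}"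
      unfolding bA_def by (rule region_D_cells[OF ao ae]) (use ao0 ae0 nonneg in simp)
    have ratio: "Mq q (region_D k a x y z w) / Mq q (region_A 0 (\<lambda>_. as) x y z w) * (fern_weight q k bA / fern_weight q 0 cA)
      = Mq q (two_sided (nat (2 * ae + 2 * y)) (nat (2 * ao + (z + w))) (?TA - (2 * ae + 2 * y)) ?TA ?TA
            (left_dents k bA ?NA y z w True) (right_dents k bA ?NA y z w True {}))
        / Mq q (two_sided (nat (2 * as + 2 * y)) (nat (2 * 0 + (z + w))) (?TA - (2 * as + 2 * y)) ?TA ?TA (central (2 * as) \<union> ?LA) (?RA \<union> {}))"
      unfolding R A0
    \<comment> \<open>In the flipped fern the odd-indexed triangles lie right of the axis, so their
      \<open>2 * ao\<close> dents are the ones that move.\<close>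
    proof (rule region_ratio[where cQ = "2 * ao"])
      show "0 \<le> bA i" if "i \<in> {1..2 * k + 1}" for i by (rule bA_nonneg[OF that])
      show "{} = {} \<union> axis_set True k bA \<inter> {0}" using zeroA by auto
      show "int (card (axis_set True k bA - {0})) = 2 * ao" using cardA(2) .
    qed (use q nonneg zw edgeA bA1 cA1 as ao0 ae0 a1 in auto)
    have HN: "region_H' 0 ao (ae + y - 1) (z + w) ?g (half (axis_set False k bA \<union> ?LA)) (half (axis_set True k bA \<union> ?RA))
      = two_sided (nat (2 * ae + 2 * y)) (nat (2 * ao + (z + w))) (?TA - (2 * ae + 2 * y)) ?TA ?TA
         (left_dents k bA ?NA y z w True) (right_dents k bA ?NA y z w True {})"
      unfolding ldA right_dents_def Un_empty_right not_True_eq_False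
    proof (rule region_H'_eq)
      show "odd (2 * ae + 2 * y + j)" if "j \<in> axis_set False k bA \<union> ?LA" for j
        using that oddA[of j _ "ae + y"] cornerA[of j "ae + y"] by (auto simp only: Un_iff distrib_left)
      show "odd (2 * ae + 2 * y + j)" if "j \<in> axis_set True k bA \<union> ?RA" for j
        using that oddA[of j _ "ae + y"] cornerA[of j "ae + y"] by (auto simp only: Un_iff distrib_left)
    qed (use nonneg ao0 ae0 as in auto)
    have HD: "region_H' ao 0 (ae + y - 1) (z + w) ?g (half (axis_set True k bA \<union> axis_set False k bA \<union> ?LA)) (half (?RA))
      = two_sided (nat (2 * as + 2 * y)) (nat (2 * 0 + (z + w))) (?TA - (2 * as + 2 * y)) ?TA ?TA (central (2 * as) \<union> ?LA) (?RA \<union> {})"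
      unfolding denA Un_empty_right
    proof (rule region_H'_eq)
      show "odd (2 * as + 2 * y + j)" if "j \<in> axis_set True k bA \<union> axis_set False k bA \<union> ?LA" for j
        using that oddA[of j _ "as + y"] cornerA[of j "as + y"] by (auto simp only: Un_iff distrib_left)
      show "odd (2 * as + 2 * y + j)" if "j \<in> ?RA" for j
        using that oddA[of j _ "as + y"] cornerA[of j "as + y"] by (auto simp only: Un_iff distrib_left)
    qed (use nonneg ao0 ae0 as in auto)
    note tc = three_cases[where F = "\<lambda>g L R. Mq q (region_H' 0 ao (ae + y - 1) (z + w) g L R)"
      and ?F0.0 = "\<lambda>g L R. Mq q (region_H' ao 0 (ae + y - 1) (z + w) g L R)"
      and L = "Qe'" and R = "Qo'" and ?L0.0 = "Qo' \<union> Qe'" and Z = "{}" and ?Z0.0 = "{}" and x = x, OF csA zw, unfolded Un_empty_right]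
    have sets: "Qe' \<union> half ?LA = half (axis_set False k bA \<union> ?LA)" "Qo' \<union> half ?RA = half (axis_set True k bA \<union> ?RA)"
      "Qo' \<union> Qe' \<union> half ?LA = half (axis_set True k bA \<union> axis_set False k bA \<union> ?LA)"
      unfolding QA by (simp_all only: image_Un)
    show ?thesis unfolding tc sets fwA bA_def[symmetric] ratio HN HD ..
  qed

  \<comment> \<open>Cores of odd size: regions B, C and E\<close>
  have edgeB: "lobe_edge bB (2 * k + 1) = 2 * as - 1"
    unfolding bB_def lobe_edge_upd ao[symmetric] ae[symmetric] as by simp
  have evB: "(\<Sum>i = 1..k. bB (2 * i)) = ae" unfolding bB_def even_sum_upd ae ..
  {
    assume a11: "1 \<le> a 1"
    have ao1: "1 \<le> ao" using a11 a1ao by simp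
    have NB0: "0 \<le> ?NB" using ao1 ae0 as nonneg by simp
    have bB_nonneg: "0 \<le> bB i" if "i \<in> {1..2 * k + 1}" for i using a_nonneg[OF that] a11 unfolding bB_def by simp
    have cardB: "int (card (axis_set False k bB)) = 2 * ae" "int (card (axis_set True k bB - {0})) = 2 * (ao - 1)"
    proof -
      have "(2 * as - 1) div 2 = as - 1" by presburger
      then show "int (card (axis_set False k bB)) = 2 * ae" "int (card (axis_set True k bB - {0})) = 2 * (ao - 1)"
        using card_axis_sets[of k bB, OF bB_nonneg] unfolding evB edgeB as by simp_all
    qed
    have zeroF: "0 \<notin> axis_set False k bB" by (rule zero_notin_axis_set[OF bB_nonneg])
    have zeroT: "0 \<in> axis_set True k bB"
      by (rule zero_axis_set[OF bB_nonneg]) (use a11 in \<open>simp_all add: bB1[unfolded One_nat_def] bB1\<close>)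
    have evenB: "even j" if "j \<in> axis_set o' k bB" for o' j
    proof -
      have "odd (j + bB 1)" using axis_set_bounds[of k bB j o', OF bB_nonneg] that by blast
      then show ?thesis unfolding bB1 by simp
    qed
    have evenC: "even j" if "j \<in> ?LB \<union> ?RB" for j
    proof -
      have "odd (?NB + j)" by (rule odd_corner[OF _ that]) simp
      then show ?thesis by simp
    qed
    have unB: "axis_set True k bB \<union> axis_set False k bB - {0} = central (2 * as - 1)"
    proof -
      have "axis_set True k bB \<union> axis_set False k bB = {j. \<bar>j\<bar> < lobe_edge bB (2 * k + 1) \<and> odd (j + bB 1)}"
        by (rule axis_set_Un[OF bB_nonneg])
      then show ?thesis unfolding edgeB bB1 central_def by auto
    qed
    have csB: "y < w \<longrightarrow> X \<union> Y = half ?RB \<and> half ?LB = {}" "w \<le> y \<and> y \<le> z \<longrightarrow> X = half ?RB \<and> Y = half ?LB"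
      "z < y \<longrightarrow> X \<union> Y = half ?LB \<and> half ?RB = {}"
    proof -
      have h: "(real_of_int (?NB + 2 * u) + 1) / 2 = real_of_int as + real_of_int x + real_of_int u" for u by (simp add: field_simps)
      have X2: "X = (if y \<le> z then shift_down {1..z - y} ((real_of_int (?NB + 2 * z) + 1) / 2)
                     else shift_down {1..y - z} ((real_of_int (?NB + 2 * y) + 1) / 2))"
        unfolding X h by (simp add: algebra_simps)
      have Y2: "Y = (if y < w then shift_down ({1..?NB + z + w} - {1..?NB + y + z}) ((real_of_int (?NB + 2 * z) + 1) / 2)
                   else if y \<le> z then shift_down ({1..?NB + y + z} - {1..?NB + z + w}) ((real_of_int (?NB + 2 * z) + 1) / 2)
                   else shift_down ({1..?NB + 2 * y} - {1..?NB + y + w}) ((real_of_int (?NB + 2 * y) + 1) / 2))"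
        unfolding Y h by (simp add: algebra_simps)
      note cs = corner_sets[OF NB0 nonneg(2-4) zw X2 Y2]
      show "y < w \<longrightarrow> X \<union> Y = half ?RB \<and> half ?LB = {}" using cs(1) by auto
      show "w \<le> y \<and> y \<le> z \<longrightarrow> X = half ?RB \<and> Y = half ?LB" using cs(2) by blast
      show "z < y \<longrightarrow> X \<union> Y = half ?LB \<and> half ?RB = {}" using cs(3) by auto
    qed
    have zeroL: "0 \<notin> ?LB" using NB0 nonneg by (auto simp: left_corner_def)
    have denB: "central (2 * as - 1) \<union> ?LB = (axis_set True k bB \<union> axis_set False k bB \<union> ?LB) - {0}"
      unfolding unB[symmetric] using zeroL by blast
    have denE: "central (2 * as - 1) \<union> ?LB = ((axis_set True k bB - {0}) \<union> axis_set False k bB \<union> ?LB) - {0}"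
      unfolding denB by blast
    have ldB: "left_dents k bB ?NB y z w f = (axis_set (\<not> f) k bB \<union> ?LB) - {0}" for f
      unfolding left_dents_def using zeroL by blast
    have QB: "Qo = half (axis_set True k bB)" "Qe = half (axis_set False k bB)" unfolding Qo Qe axis_heights_eq bB_def by simp_all
    have zero: "{0} = half {0}" by simp
    have B0: "region_B 0 (\<lambda>_. as) x y z w = hexagon (2*0 + 2*x) (2*as + y + w - 1) (2*0 + y + z) (2*as + 2*x - 1) (2*0 + y + w) (2*as + y + z - 1)
      - intrusion (2 * (as - as) + 2 * y) - fern_cells 0 cB (nat (2 * as + 2 * y - 1)) False - {2 * as + 2 * y - 1} \<times> {}"
      unfolding cB_def by (rule region_B_cells[OF core_sums]) (use ao1 ae0 as nonneg in simp)
    have C0: "region_C 0 (\<lambda>_. as) x y z w = hexagon (2*0 + 2*x) (2*as + y + w - 1) (2*0 + y + z + 1) (2*as + 2*x - 2) (2*0 + y + w + 1) (2*as + y + z - 1)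
      - intrusion (2 * (as - as) + 2 * y) - fern_cells 0 cB (nat (2 * as + 2 * y - 1)) False - {2 * as + 2 * y - 1} \<times> {0}"
      unfolding cB_def by (rule region_C_cells[OF core_sums]) (use ao1 ae0 as nonneg in simp)
    have partB: "Mq q (region_B k a x y z w) / Mq q (region_B 0 (\<lambda>_. as) x y z w)
          * (fern_weight q k (a(1 := 2 * a 1 - 1)) / fern_weight q 0 (\<lambda>_. 2 * as - 1))
        = (if y < w then
             Mq q (region_H 0 ae (ao + y - 1) (z + w) (x - y + z) Qo (Qe \<union> X \<union> Y))
             / Mq q (region_H ae 0 (ao + y - 1) (z + w) (x - y + z) (Qo \<union> Qe) (X \<union> Y))
           else if y \<le> z then
             Mq q (region_H 0 ae (ao + y - 1) (z + w) (x - y + z) (Qo \<union> Y) (Qe \<union> X))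
             / Mq q (region_H ae 0 (ao + y - 1) (z + w) (x - y + z) (Qo \<union> Qe \<union> Y) X)
           else
             Mq q (region_H 0 ae (ao + y - 1) (z + w) x (Qo \<union> X \<union> Y) Qe)
             / Mq q (region_H ae 0 (ao + y - 1) (z + w) x (Qo \<union> Qe \<union> X \<union> Y) {}))"
    proof -
      have R: "region_B k a x y z w = hexagon (2*ae + 2*x) (2*ao + y + w - 1) (2*ae + y + z) (2*ao + 2*x - 1) (2*ae + y + w) (2*ao + y + z - 1)
        - intrusion (2 * (ao - a 1) + 2 * y) - fern_cells k bB (nat (2 * ao + 2 * y - 1)) False - {2 * ao + 2 * y - 1} \<times> {}"
        unfolding bB_def by (rule region_B_cells[OF ao ae]) (use ao1 ae0 nonneg in simp)
      have ratio: "Mq q (region_B k a x y z w) / Mq q (region_B 0 (\<lambda>_. as) x y z w) * (fern_weight q k bB / fern_weight q 0 cB)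
        = Mq q (two_sided (nat (2 * ao + 2 * y - 1)) (nat (2 * ae + (z + w))) (?TB - (2 * ao + 2 * y - 1)) ?TB ?TB
              (left_dents k bB ?NB y z w False) (right_dents k bB ?NB y z w False {}))
          / Mq q (two_sided (nat (2 * as + 2 * y - 1)) (nat (2 * 0 + (z + w))) (?TB - (2 * as + 2 * y - 1)) ?TB ?TB (central (2 * as - 1) \<union> ?LB) (?RB \<union> {}))"
        unfolding R B0
      proof (rule region_ratio[where cQ = "2 * ae"])
        show "0 \<le> bB i" if "i \<in> {1..2 * k + 1}" for i by (rule bB_nonneg[OF that])
        show "{} = {} \<union> axis_set False k bB \<inter> {0}" using zeroF by auto
        show "int (card (axis_set False k bB - {0})) = 2 * ae" using cardB(1) zeroF by simp
        show "(c, 0) \<in> fern_cells k bB (nat (2 * ao + 2 * y - 1)) False" if "0 \<le> c" "2 * (ao - a 1) + 2 * y \<le> c" "c < 2 * ao + 2 * y - 1" for c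
          by (rule core_covers[OF bB_nonneg]) (use that bB1 in auto)
      qed (use q nonneg zw edgeB bB1 cB1 as ao1 ae0 a11 in auto)
      have HN: "region_H 0 ae (ao + y - 1) (z + w) ?g (half (axis_set True k bB \<union> ?LB)) (half (axis_set False k bB \<union> ?RB))
        = two_sided (nat (2 * ao + 2 * y - 1)) (nat (2 * ae + (z + w))) (?TB - (2 * ao + 2 * y - 1)) ?TB ?TB
           (left_dents k bB ?NB y z w False) (right_dents k bB ?NB y z w False {})"
        unfolding ldB right_dents_def Un_empty_right not_False_eq_True
      proof (rule region_H_eq)
        show "odd (2 * ao + 2 * y - 1 + j)" if "j \<in> axis_set True k bB \<union> ?LB" for j
        proof -
          have "even j" using that evenB evenC by blast
          then show ?thesis by simp
        qed
        show "odd (2 * ao + 2 * y - 1 + j)" if "j \<in> axis_set False k bB \<union> ?RB" for j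
        proof -
          have "even j" using that evenB evenC by blast
          then show ?thesis by simp
        qed
      qed (use nonneg ao1 ae0 as in auto)
      have HD: "region_H ae 0 (ao + y - 1) (z + w) ?g (half (axis_set True k bB \<union> axis_set False k bB \<union> ?LB)) (half (?RB))
        = two_sided (nat (2 * as + 2 * y - 1)) (nat (2 * 0 + (z + w))) (?TB - (2 * as + 2 * y - 1)) ?TB ?TB (central (2 * as - 1) \<union> ?LB) (?RB \<union> {})"
        unfolding denB Un_empty_right
      proof (rule region_H_eq)
        show "odd (2 * as + 2 * y - 1 + j)" if "j \<in> axis_set True k bB \<union> axis_set False k bB \<union> ?LB" for j
        proof -
          have "even j" using that evenB evenC by blast
          then show ?thesis by simp
        qed
        show "odd (2 * as + 2 * y - 1 + j)" if "j \<in> ?RB" for j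
        proof -
          have "even j" using that evenB evenC by blast
          then show ?thesis by simp
        qed
      qed (use nonneg ao1 ae0 as in auto)
      note tc = three_cases[where F = "\<lambda>g L R. Mq q (region_H 0 ae (ao + y - 1) (z + w) g L R)"
        and ?F0.0 = "\<lambda>g L R. Mq q (region_H ae 0 (ao + y - 1) (z + w) g L R)"
        and L = "Qo" and R = "Qe" and ?L0.0 = "Qo \<union> Qe" and Z = "{}" and ?Z0.0 = "{}" and x = x, OF csB zw, unfolded Un_empty_right]
      have sets: "Qo \<union> half ?LB = half (axis_set True k bB \<union> ?LB)" "Qe \<union> half ?RB = half (axis_set False k bB \<union> ?RB)"
        "Qo \<union> Qe \<union> half ?LB = half (axis_set True k bB \<union> axis_set False k bB \<union> ?LB)"
        unfolding QB by (simp_all only: image_Un)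
      show ?thesis unfolding tc sets fwB bB_def[symmetric] ratio HN HD ..
    qed
    have partC: "Mq q (region_C k a x y z w) / Mq q (region_C 0 (\<lambda>_. as) x y z w)
          * (fern_weight q k (a(1 := 2 * a 1 - 1)) / fern_weight q 0 (\<lambda>_. 2 * as - 1))
        = (if y < w then
             Mq q (region_H 0 ae (ao + y - 1) (z + w + 1) (x - y + z) Qo (Qe \<union> X \<union> Y \<union> {0}))
             / Mq q (region_H ae 0 (ao + y - 1) (z + w + 1) (x - y + z) (Qo \<union> Qe) (X \<union> Y \<union> {0}))
           else if y \<le> z then
             Mq q (region_H 0 ae (ao + y - 1) (z + w + 1) (x - y + z) (Qo \<union> Y) (Qe \<union> X \<union> {0}))
             / Mq q (region_H ae 0 (ao + y - 1) (z + w + 1) (x - y + z) (Qo \<union> Qe \<union> Y) (X \<union> {0}))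
           else
             Mq q (region_H 0 ae (ao + y - 1) (z + w + 1) x (Qo \<union> X \<union> Y) (Qe \<union> {0}))
             / Mq q (region_H ae 0 (ao + y - 1) (z + w + 1) x (Qo \<union> Qe \<union> X \<union> Y) {0}))"
    proof -
      have R: "region_C k a x y z w = hexagon (2*ae + 2*x) (2*ao + y + w - 1) (2*ae + y + z + 1) (2*ao + 2*x - 2) (2*ae + y + w + 1) (2*ao + y + z - 1)
        - intrusion (2 * (ao - a 1) + 2 * y) - fern_cells k bB (nat (2 * ao + 2 * y - 1)) False - {2 * ao + 2 * y - 1} \<times> {0}"
        unfolding bB_def by (rule region_C_cells[OF ao ae]) (use ao1 ae0 nonneg in simp)
      have ratio: "Mq q (region_C k a x y z w) / Mq q (region_C 0 (\<lambda>_. as) x y z w) * (fern_weight q k bB / fern_weight q 0 cB)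
        = Mq q (two_sided (nat (2 * ao + 2 * y - 1)) (nat (2 * ae + (z + w + 1))) (?TB - (2 * ao + 2 * y - 1)) ?TB ?TB
              (left_dents k bB ?NB y z w False) (right_dents k bB ?NB y z w False {0}))
          / Mq q (two_sided (nat (2 * as + 2 * y - 1)) (nat (2 * 0 + (z + w + 1))) (?TB - (2 * as + 2 * y - 1)) ?TB ?TB (central (2 * as - 1) \<union> ?LB) (?RB \<union> {0}))"
        unfolding R C0
      \<comment> \<open>E0 is {0}, the removed unit triangle to the right of the core; it occurs
        unchanged in the denominator.\<close>
      proof (rule region_ratio[where cQ = "2 * ae"])
        show "0 \<le> bB i" if "i \<in> {1..2 * k + 1}" for i by (rule bB_nonneg[OF that])
        show "{0} = {0} \<union> axis_set False k bB \<inter> {0}" using zeroF by auto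
        show "int (card (axis_set False k bB - {0})) = 2 * ae" using cardB(1) zeroF by simp
        show "(c, 0) \<in> fern_cells k bB (nat (2 * ao + 2 * y - 1)) False" if "0 \<le> c" "2 * (ao - a 1) + 2 * y \<le> c" "c < 2 * ao + 2 * y - 1" for c
          by (rule core_covers[OF bB_nonneg]) (use that bB1 in auto)
      qed (use q nonneg zw edgeB bB1 cB1 as ao1 ae0 a11 in auto)
      have HN: "region_H 0 ae (ao + y - 1) (z + w + 1) ?g (half (axis_set True k bB \<union> ?LB)) (half (axis_set False k bB \<union> ?RB \<union> {0}))
        = two_sided (nat (2 * ao + 2 * y - 1)) (nat (2 * ae + (z + w + 1))) (?TB - (2 * ao + 2 * y - 1)) ?TB ?TB
           (left_dents k bB ?NB y z w False) (right_dents k bB ?NB y z w False {0})"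
        unfolding ldB right_dents_def Un_empty_right not_False_eq_True
      proof (rule region_H_eq)
        show "odd (2 * ao + 2 * y - 1 + j)" if "j \<in> axis_set True k bB \<union> ?LB" for j
        proof -
          have "even j" using that evenB evenC by blast
          then show ?thesis by simp
        qed
        show "odd (2 * ao + 2 * y - 1 + j)" if "j \<in> axis_set False k bB \<union> ?RB \<union> {0}" for j
        proof -
          have "even j" using that evenB evenC even_zero by blast
          then show ?thesis by simp
        qed
      qed (use nonneg ao1 ae0 as in auto)
      have HD: "region_H ae 0 (ao + y - 1) (z + w + 1) ?g (half (axis_set True k bB \<union> axis_set False k bB \<union> ?LB)) (half (?RB \<union> {0}))
        = two_sided (nat (2 * as + 2 * y - 1)) (nat (2 * 0 + (z + w + 1))) (?TB - (2 * as + 2 * y - 1)) ?TB ?TB (central (2 * as - 1) \<union> ?LB) (?RB \<union> {0})"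
        unfolding denB Un_empty_right
      proof (rule region_H_eq)
        show "odd (2 * as + 2 * y - 1 + j)" if "j \<in> axis_set True k bB \<union> axis_set False k bB \<union> ?LB" for j
        proof -
          have "even j" using that evenB evenC by blast
          then show ?thesis by simp
        qed
        show "odd (2 * as + 2 * y - 1 + j)" if "j \<in> ?RB \<union> {0}" for j
        proof -
          have "even j" using that evenB evenC even_zero by blast
          then show ?thesis by simp
        qed
      qed (use nonneg ao1 ae0 as in auto)
      note tc = three_cases[where F = "\<lambda>g L R. Mq q (region_H 0 ae (ao + y - 1) (z + w + 1) g L R)"
        and ?F0.0 = "\<lambda>g L R. Mq q (region_H ae 0 (ao + y - 1) (z + w + 1) g L R)"
        and L = "Qo" and R = "Qe" and ?L0.0 = "Qo \<union> Qe" and Z = "{0}" and ?Z0.0 = "{0}" and x = x, OF csB zw, unfolded Un_empty_right]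
      have sets: "Qo \<union> half ?LB = half (axis_set True k bB \<union> ?LB)" "Qe \<union> half ?RB \<union> {0} = half (axis_set False k bB \<union> ?RB \<union> {0})"
        "Qo \<union> Qe \<union> half ?LB = half (axis_set True k bB \<union> axis_set False k bB \<union> ?LB)" "half ?RB \<union> {0} = half (?RB \<union> {0})"
        unfolding QB by (simp_all only: image_Un zero[symmetric])
      show ?thesis unfolding tc sets fwB bB_def[symmetric] ratio HN HD ..
    qed
    have partE: "Mq q (region_E k a x y z w) / Mq q (region_C 0 (\<lambda>_. as) x y z w)
          * (fern_weight q k (a(1 := 2 * a 1 - 1)) / fern_weight q 0 (\<lambda>_. 2 * as - 1))
        = (if y < w then
             Mq q (region_H 0 (ao - 1) (ae + y) (z + w + 1) (x - y + z) Qe (Qo \<union> X \<union> Y))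
             / Mq q (region_H (ao - 1) 0 (ae + y) (z + w + 1) (x - y + z) ((Qo - {0}) \<union> Qe) (X \<union> Y \<union> {0}))
           else if y \<le> z then
             Mq q (region_H 0 (ao - 1) (ae + y) (z + w + 1) (x - y + z) (Qe \<union> Y) (Qo \<union> X))
             / Mq q (region_H (ao - 1) 0 (ae + y) (z + w + 1) (x - y + z) ((Qo - {0}) \<union> Qe \<union> Y) (X \<union> {0}))
           else
             Mq q (region_H 0 (ao - 1) (ae + y) (z + w + 1) x (Qe \<union> X \<union> Y) Qo)
             / Mq q (region_H (ao - 1) 0 (ae + y) (z + w + 1) x ((Qo - {0}) \<union> Qe \<union> X \<union> Y) {0}))"
    proof -
      have R: "region_E k a x y z w = hexagon (2*ao + 2*x - 2) (2*ae + y + w + 1) (2*ao + y + z - 1) (2*ae + 2*x) (2*ao + y + w - 1) (2*ae + y + z + 1)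
        - intrusion (2 * ae + 2 * y + 1) - fern_cells k bB (nat (2 * ae + 2 * y + 1)) True - {2 * ae + 2 * y + 1} \<times> {}"
        unfolding bB_def by (rule region_E_cells[OF ao ae]) (use ao1 ae0 nonneg in simp)
      have ratio: "Mq q (region_E k a x y z w) / Mq q (region_C 0 (\<lambda>_. as) x y z w) * (fern_weight q k bB / fern_weight q 0 cB)
        = Mq q (two_sided (nat (2 * ae + 2 * y + 1)) (nat (2 * (ao - 1) + (z + w + 1))) (?TB - (2 * ae + 2 * y + 1)) ?TB ?TB
              (left_dents k bB ?NB y z w True) (right_dents k bB ?NB y z w True {}))
          / Mq q (two_sided (nat (2 * as + 2 * y - 1)) (nat (2 * 0 + (z + w + 1))) (?TB - (2 * as + 2 * y - 1)) ?TB ?TB (central (2 * as - 1) \<union> ?LB) (?RB \<union> {0}))"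
        unfolding R C0
      \<comment> \<open>The flipped core has a dent at height 0 right of the axis. It stays there
        and plays the part of the removed unit triangle of C, so only \<open>2 * (ao - 1)\<close>
        dents move.\<close>
      proof (rule region_ratio[where cQ = "2 * (ao - 1)"])
        show "0 \<le> bB i" if "i \<in> {1..2 * k + 1}" for i by (rule bB_nonneg[OF that])
        show "{0} = {} \<union> axis_set True k bB \<inter> {0}" using zeroT by auto
        show "int (card (axis_set True k bB - {0})) = 2 * (ao - 1)" using cardB(2) .
      qed (use q nonneg zw edgeB bB1 cB1 as ao1 ae0 a11 in auto)
      have HN: "region_H 0 (ao - 1) (ae + y) (z + w + 1) ?g (half (axis_set False k bB \<union> ?LB)) (half (axis_set True k bB \<union> ?RB))
        = two_sided (nat (2 * ae + 2 * y + 1)) (nat (2 * (ao - 1) + (z + w + 1))) (?TB - (2 * ae + 2 * y + 1)) ?TB ?TB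
           (left_dents k bB ?NB y z w True) (right_dents k bB ?NB y z w True {})"
        unfolding ldB right_dents_def Un_empty_right not_True_eq_False
      proof (rule region_H_eq)
        show "odd (2 * ae + 2 * y + 1 + j)" if "j \<in> axis_set False k bB \<union> ?LB" for j
        proof -
          have "even j" using that evenB evenC by blast
          then show ?thesis by simp
        qed
        show "odd (2 * ae + 2 * y + 1 + j)" if "j \<in> axis_set True k bB \<union> ?RB" for j
        proof -
          have "even j" using that evenB evenC by blast
          then show ?thesis by simp
        qed
      qed (use nonneg ao1 ae0 as in auto)
      have HD: "region_H (ao - 1) 0 (ae + y) (z + w + 1) ?g (half ((axis_set True k bB - {0}) \<union> axis_set False k bB \<union> ?LB)) (half (?RB \<union> {0}))
        = two_sided (nat (2 * as + 2 * y - 1)) (nat (2 * 0 + (z + w + 1))) (?TB - (2 * as + 2 * y - 1)) ?TB ?TB (central (2 * as - 1) \<union> ?LB) (?RB \<union> {0})"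
        unfolding denE Un_empty_right
      proof (rule region_H_eq)
        show "odd (2 * as + 2 * y - 1 + j)" if "j \<in> (axis_set True k bB - {0}) \<union> axis_set False k bB \<union> ?LB" for j
        proof -
          have "even j" using that evenB evenC by blast
          then show ?thesis by simp
        qed
        show "odd (2 * as + 2 * y - 1 + j)" if "j \<in> ?RB \<union> {0}" for j
        proof -
          have "even j" using that evenB evenC even_zero by blast
          then show ?thesis by simp
        qed
      qed (use nonneg ao1 ae0 as in auto)
      note tc = three_cases[where F = "\<lambda>g L R. Mq q (region_H 0 (ao - 1) (ae + y) (z + w + 1) g L R)"
        and ?F0.0 = "\<lambda>g L R. Mq q (region_H (ao - 1) 0 (ae + y) (z + w + 1) g L R)"
        and L = "Qe" and R = "Qo" and ?L0.0 = "(Qo - {0}) \<union> Qe" and Z = "{}" and ?Z0.0 = "{0}" and x = x, OF csB zw, unfolded Un_empty_right]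
      have sets: "Qe \<union> half ?LB = half (axis_set False k bB \<union> ?LB)" "Qo \<union> half ?RB = half (axis_set True k bB \<union> ?RB)"
        "(Qo - {0}) \<union> Qe \<union> half ?LB = half ((axis_set True k bB - {0}) \<union> axis_set False k bB \<union> ?LB)" "half ?RB \<union> {0} = half (?RB \<union> {0})"
        unfolding QB half_diff_0 by (simp_all only: image_Un zero[symmetric])
      show ?thesis unfolding tc sets fwB bB_def[symmetric] ratio HN HD ..
    qed
    note partB partC partE
  }
  note partsBCE = this
  show ?thesis by (intro conjI impI partA partD partsBCE)
qed

end
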